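(* Let $R$ be a commutative ring with identity. Then the class $w\text{-}\mathcal{F}_{sr}$ of all semi-regular $w$-flat $R$-modules is closed under direct limits, pure submodules and pure quotients. Consequently, $w\text{-}\mathcal{F}_{sr}$ is a covering class.
   Context: An ideal $I$ of $R$ is dense if $(0:_R I)=\{r\in R\mid Ir=0\}=0$, and semi-regular if it contains a finitely generated dense sub-ideal. $\mathcal{Q}$ denotes the set of all finitely generated semi-regular ideals of $R$. A finitely generated ideal $J$ of $R$ is a GV-ideal if the natural homomorphism $R\to \mathrm{Hom}_R(J,R)$, $r\mapsto (x\mapsto rx)$, is an isomorphism; $\mathrm{GV}(R)$ is the set of all GV-ideals. For an $R$-module $M$, $\mathrm{tor}_{\mathrm{GV}}(M)=\{x\in M\mid Jx=0 \text{ for some } J\in \mathrm{GV}(R)\}$, and $M$ is GV-torsion if $\mathrm{tor}_{\mathrm{GV}}(M)=M$. An $R$-module $M$ is semi-regular $w$-flat if $\mathrm{Tor}_1^R(R/I,M)$ is GV-torsion for every $I\in\mathcal{Q}$. A class $\mathcal{F}$ of $R$-modules is precovering if for every $R$-module $M$ there is a homomorphism $f:F\to M$ with $F\in\mathcal{F}$ such that $\mathrm{Hom}_R(F',F)\to\mathrm{Hom}_R(F',M)$ is an epimorphism for every $F'\in\mathcal{F}$. If, moreover, $f$ can be chosen such that any homomorphism $h:F\to F$ with $f=f\circ h$ is an isomorphism, then $\mathcal{F}$ is covering. *)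

theory Defs
  imports "HOL-Algebra.Module" "HOL-Algebra.Ideal"
begin

section \<open>Modules and homomorphisms\<close>

text \<open>
  An R-module is a record \<open>M\<close> with \<open>module R M\<close>; the (irrelevant) ring multiplication and unit
  that the record type also carries are left \<open>undefined\<close> in the constructions below.
  Homomorphisms are extensional functions, so that equal homomorphisms are equal as HOL functions.
\<close>

definition mod_hom ::
    "('a,'r) ring_scheme \<Rightarrow> ('a,'b) module \<Rightarrow> ('a,'c) module \<Rightarrow> ('b \<Rightarrow> 'c) set" where
  "mod_hom R M N = {f \<in> carrier M \<rightarrow>\<^sub>E carrier N.
     (\<forall>x\<in>carrier M. \<forall>y\<in>carrier M. f (x \<oplus>\<^bsub>M\<^esub> y) = f x \<oplus>\<^bsub>N\<^esub> f y) \<and>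
     (\<forall>r\<in>carrier R. \<forall>x\<in>carrier M. f (r \<odot>\<^bsub>M\<^esub> x) = r \<odot>\<^bsub>N\<^esub> f x)}"

definition mod_iso ::
    "('a,'r) ring_scheme \<Rightarrow> ('a,'b) module \<Rightarrow> ('a,'c) module \<Rightarrow> ('b \<Rightarrow> 'c) set" where
  "mod_iso R M N = {f \<in> mod_hom R M N. bij_betw f (carrier M) (carrier N)}"

definition hom_module ::
    "('a,'r) ring_scheme \<Rightarrow> ('a,'b) module \<Rightarrow> ('a,'c) module \<Rightarrow> ('a, 'b \<Rightarrow> 'c) module" where
  "hom_module R M N =
    \<lparr> carrier = mod_hom R M N, mult = (\<lambda>_ _. undefined), one = undefined,
      zero = (\<lambda>x\<in>carrier M. \<zero>\<^bsub>N\<^esub>),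
      add = (\<lambda>f g. \<lambda>x\<in>carrier M. f x \<oplus>\<^bsub>N\<^esub> g x),
      smult = (\<lambda>r f. \<lambda>x\<in>carrier M. r \<odot>\<^bsub>N\<^esub> f x) \<rparr>"

definition regular_module :: "('a,'r) ring_scheme \<Rightarrow> ('a,'a) module" where
  "regular_module R =
    \<lparr> carrier = carrier R, mult = mult R, one = one R, zero = zero R, add = add R,
      smult = mult R \<rparr>"

definition sub_module :: "('a,'b) module \<Rightarrow> 'b set \<Rightarrow> ('a,'b) module" where
  "sub_module M N = M\<lparr>carrier := N\<rparr>"

definition quot_module :: "('a,'b) module \<Rightarrow> 'b set \<Rightarrow> ('a, 'b set) module" where
  "quot_module M N =
    \<lparr> carrier = a_rcosets\<^bsub>M\<^esub> N, mult = (\<lambda>_ _. undefined), one = undefined,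
      zero = N,
      add = set_add M,
      smult = (\<lambda>r X. \<Union>x\<in>X. N +>\<^bsub>M\<^esub> (r \<odot>\<^bsub>M\<^esub> x)) \<rparr>"

definition module_span ::
    "('a,'r) ring_scheme \<Rightarrow> ('a,'b) module \<Rightarrow> 'b set \<Rightarrow> 'b set" where
  "module_span R M S = \<Inter>{H. submodule H R M \<and> S \<subseteq> H}"

definition free_module :: "('a,'r) ring_scheme \<Rightarrow> 's set \<Rightarrow> ('a, 's \<Rightarrow> 'a) module" where
  "free_module R S =
    \<lparr> carrier = {\<phi>. (\<forall>s. \<phi> s \<in> carrier R) \<and> finite {s. \<phi> s \<noteq> \<zero>\<^bsub>R\<^esub>} \<and> {s. \<phi> s \<noteq> \<zero>\<^bsub>R\<^esub>} \<subseteq> S},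
      mult = (\<lambda>_ _. undefined), one = undefined,
      zero = (\<lambda>_. \<zero>\<^bsub>R\<^esub>),
      add = (\<lambda>\<phi> \<psi> s. \<phi> s \<oplus>\<^bsub>R\<^esub> \<psi> s),
      smult = (\<lambda>r \<phi> s. r \<otimes>\<^bsub>R\<^esub> \<phi> s) \<rparr>"

definition free_gen :: "('a,'r) ring_scheme \<Rightarrow> 's \<Rightarrow> 's \<Rightarrow> 'a" where
  "free_gen R s = (\<lambda>t. if t = s then \<one>\<^bsub>R\<^esub> else \<zero>\<^bsub>R\<^esub>)"

text \<open>For \<open>S \<subseteq> carrier M\<close>: the homomorphism from the free module on \<open>S\<close> to \<open>M\<close> with \<open>s \<mapsto> s\<close>.\<close>

definition free_eval ::
    "('a,'r) ring_scheme \<Rightarrow> ('a,'b) module \<Rightarrow> 'b set \<Rightarrow> ('b \<Rightarrow> 'a) \<Rightarrow> 'b" where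
  "free_eval R M S = (\<lambda>\<phi>\<in>carrier (free_module R S).
     \<Oplus>\<^bsub>M\<^esub>s\<in>{s. \<phi> s \<noteq> \<zero>\<^bsub>R\<^esub>}. \<phi> s \<odot>\<^bsub>M\<^esub> s)"


section \<open>Tensor products and Tor\<close>

definition tensor_rels ::
    "('a,'r) ring_scheme \<Rightarrow> ('a,'b) module \<Rightarrow> ('a,'c) module \<Rightarrow> ('b \<times> 'c \<Rightarrow> 'a) set" where
  "tensor_rels R M N = (let F = free_module R (carrier M \<times> carrier N); e = free_gen R in
     {e (x \<oplus>\<^bsub>M\<^esub> x', y) \<ominus>\<^bsub>F\<^esub> (e (x, y) \<oplus>\<^bsub>F\<^esub> e (x', y)) | x x' y.
        x \<in> carrier M \<and> x' \<in> carrier M \<and> y \<in> carrier N} \<union>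
     {e (x, y \<oplus>\<^bsub>N\<^esub> y') \<ominus>\<^bsub>F\<^esub> (e (x, y) \<oplus>\<^bsub>F\<^esub> e (x, y')) | x y y'.
        x \<in> carrier M \<and> y \<in> carrier N \<and> y' \<in> carrier N} \<union>
     {e (r \<odot>\<^bsub>M\<^esub> x, y) \<ominus>\<^bsub>F\<^esub> (r \<odot>\<^bsub>F\<^esub> e (x, y)) | r x y.
        r \<in> carrier R \<and> x \<in> carrier M \<and> y \<in> carrier N} \<union>
     {e (x, r \<odot>\<^bsub>N\<^esub> y) \<ominus>\<^bsub>F\<^esub> (r \<odot>\<^bsub>F\<^esub> e (x, y)) | r x y.
        r \<in> carrier R \<and> x \<in> carrier M \<and> y \<in> carrier N})"

definition tensor_kernel ::
    "('a,'r) ring_scheme \<Rightarrow> ('a,'b) module \<Rightarrow> ('a,'c) module \<Rightarrow> ('b \<times> 'c \<Rightarrow> 'a) set" where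
  "tensor_kernel R M N =
     module_span R (free_module R (carrier M \<times> carrier N)) (tensor_rels R M N)"

definition tensor ::
    "('a,'r) ring_scheme \<Rightarrow> ('a,'b) module \<Rightarrow> ('a,'c) module \<Rightarrow> ('a, ('b \<times> 'c \<Rightarrow> 'a) set) module" where
  "tensor R M N = quot_module (free_module R (carrier M \<times> carrier N)) (tensor_kernel R M N)"

definition pure_tensor ::
    "('a,'r) ring_scheme \<Rightarrow> ('a,'b) module \<Rightarrow> ('a,'c) module \<Rightarrow> 'b \<Rightarrow> 'c \<Rightarrow> ('b \<times> 'c \<Rightarrow> 'a) set" where
  "pure_tensor R M N x y =
     tensor_kernel R M N +>\<^bsub>free_module R (carrier M \<times> carrier N)\<^esub> free_gen R (x, y)"

text \<open>The homomorphism \<open>f \<otimes> N\<close>, for a homomorphism \<open>f\<close> from \<open>M\<close> to \<open>M'\<close>.\<close>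

definition tensor_map ::
    "('a,'r) ring_scheme \<Rightarrow> ('a,'b) module \<Rightarrow> ('a,'c) module \<Rightarrow> ('a,'d) module \<Rightarrow> ('b \<Rightarrow> 'c) \<Rightarrow>
     ('b \<times> 'd \<Rightarrow> 'a) set \<Rightarrow> ('c \<times> 'd \<Rightarrow> 'a) set" where
  "tensor_map R M M' N f = (THE h. h \<in> mod_hom R (tensor R M N) (tensor R M' N) \<and>
     (\<forall>x\<in>carrier M. \<forall>y\<in>carrier N. h (pure_tensor R M N x y) = pure_tensor R M' N (f x) y))"

text \<open>
  \<open>Tor\<^sub>1(A,B)\<close> is the homology at \<open>F\<^sub>1 \<otimes> B\<close> of the complex obtained by tensoring with \<open>B\<close> the
  canonical free resolution \<open>F\<^sub>2 \<rightarrow> F\<^sub>1 \<rightarrow> F\<^sub>0 \<rightarrow> A \<rightarrow> 0\<close>, in which \<open>F\<^sub>0\<close> is free on the underlying set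
  of \<open>A\<close> and each \<open>F\<^sub>n\<^sub>+\<^sub>1\<close> is free on the underlying set of the kernel of the preceding map.
\<close>

definition Tor1 ::
    "('a,'r) ring_scheme \<Rightarrow> ('a,'b) module \<Rightarrow> ('a,'c) module \<Rightarrow>
     ('a, (((('b \<Rightarrow> 'a) \<Rightarrow> 'a) \<times> 'c) \<Rightarrow> 'a) set set) module" where
  "Tor1 R A B = (let
     F0 = free_module R (carrier A);
     d0 = free_eval R A (carrier A);
     K0 = a_kernel F0 A d0;
     F1 = free_module R K0;
     d1 = free_eval R F0 K0;
     K1 = a_kernel F1 F0 d1;
     F2 = free_module R K1;
     d2 = free_eval R F1 K1;
     Z = a_kernel (tensor R F1 B) (tensor R F0 B) (tensor_map R F1 F0 B d1);
     Im = tensor_map R F2 F1 B d2 ` carrier (tensor R F2 B)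
   in quot_module (sub_module (tensor R F1 B) Z) Im)"


section \<open>Semi-regular ideals, GV-ideals and semi-regular w-flat modules\<close>

definition fg_ideal :: "('a,'r) ring_scheme \<Rightarrow> 'a set \<Rightarrow> bool" where
  "fg_ideal R I \<longleftrightarrow> (\<exists>S. finite S \<and> S \<subseteq> carrier R \<and> I = Idl\<^bsub>R\<^esub> S)"

definition dense_ideal :: "('a,'r) ring_scheme \<Rightarrow> 'a set \<Rightarrow> bool" where
  "dense_ideal R I \<longleftrightarrow>
     ideal I R \<and> {r \<in> carrier R. \<forall>x\<in>I. x \<otimes>\<^bsub>R\<^esub> r = \<zero>\<^bsub>R\<^esub>} = {\<zero>\<^bsub>R\<^esub>}"

definition semi_regular_ideal :: "('a,'r) ring_scheme \<Rightarrow> 'a set \<Rightarrow> bool" where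
  "semi_regular_ideal R I \<longleftrightarrow>
     ideal I R \<and> (\<exists>J. J \<subseteq> I \<and> fg_ideal R J \<and> dense_ideal R J)"

definition fg_semi_regular_ideals :: "('a,'r) ring_scheme \<Rightarrow> 'a set set" where
  "fg_semi_regular_ideals R = {I. fg_ideal R I \<and> semi_regular_ideal R I}"

definition GV_ideals :: "('a,'r) ring_scheme \<Rightarrow> 'a set set" where
  "GV_ideals R = {J. fg_ideal R J \<and>
     (\<lambda>r\<in>carrier R. \<lambda>x\<in>J. r \<otimes>\<^bsub>R\<^esub> x) \<in>
       mod_iso R (regular_module R) (hom_module R (sub_module (regular_module R) J) (regular_module R))}"

definition tor_GV :: "('a,'r) ring_scheme \<Rightarrow> ('a,'b) module \<Rightarrow> 'b set" where
  "tor_GV R M = {x \<in> carrier M. \<exists>J\<in>GV_ideals R. \<forall>r\<in>J. r \<odot>\<^bsub>M\<^esub> x = \<zero>\<^bsub>M\<^esub>}"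

definition GV_torsion :: "('a,'r) ring_scheme \<Rightarrow> ('a,'b) module \<Rightarrow> bool" where
  "GV_torsion R M \<longleftrightarrow> tor_GV R M = carrier M"

definition semi_regular_w_flat :: "('a,'r) ring_scheme \<Rightarrow> ('a,'b) module set" where
  "semi_regular_w_flat R = {M. module R M \<and>
     (\<forall>I\<in>fg_semi_regular_ideals R. GV_torsion R (Tor1 R (quot_module (regular_module R) I) M))}"


section \<open>Direct limits and purity\<close>

definition direct_system ::
    "('a,'r) ring_scheme \<Rightarrow> 'i set \<Rightarrow> ('i \<Rightarrow> 'i \<Rightarrow> bool) \<Rightarrow> ('i \<Rightarrow> ('a,'b) module) \<Rightarrow>
     ('i \<Rightarrow> 'i \<Rightarrow> 'b \<Rightarrow> 'b) \<Rightarrow> bool" where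
  "direct_system R I rel M \<phi> \<longleftrightarrow>
     I \<noteq> {} \<and> (\<forall>i\<in>I. rel i i) \<and>
     (\<forall>i\<in>I. \<forall>j\<in>I. \<forall>k\<in>I. rel i j \<longrightarrow> rel j k \<longrightarrow> rel i k) \<and>
     (\<forall>i\<in>I. \<forall>j\<in>I. \<exists>k\<in>I. rel i k \<and> rel j k) \<and>
     (\<forall>i\<in>I. module R (M i)) \<and>
     (\<forall>i\<in>I. \<forall>j\<in>I. rel i j \<longrightarrow> \<phi> i j \<in> mod_hom R (M i) (M j)) \<and>
     (\<forall>i\<in>I. \<forall>x\<in>carrier (M i). \<phi> i i x = x) \<and>
     (\<forall>i\<in>I. \<forall>j\<in>I. \<forall>k\<in>I. rel i j \<longrightarrow> rel j k \<longrightarrow>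
        (\<forall>x\<in>carrier (M i). \<phi> j k (\<phi> i j x) = \<phi> i k x))"

definition direct_sum :: "'i set \<Rightarrow> ('i \<Rightarrow> ('a,'b) module) \<Rightarrow> ('a, 'i \<Rightarrow> 'b) module" where
  "direct_sum I M =
    \<lparr> carrier = {x \<in> \<Pi>\<^sub>E i\<in>I. carrier (M i). finite {i\<in>I. x i \<noteq> \<zero>\<^bsub>M i\<^esub>}},
      mult = (\<lambda>_ _. undefined), one = undefined,
      zero = (\<lambda>i\<in>I. \<zero>\<^bsub>M i\<^esub>),
      add = (\<lambda>x y. \<lambda>i\<in>I. x i \<oplus>\<^bsub>M i\<^esub> y i),
      smult = (\<lambda>r x. \<lambda>i\<in>I. r \<odot>\<^bsub>M i\<^esub> x i) \<rparr>"

definition sum_inj :: "'i set \<Rightarrow> ('i \<Rightarrow> ('a,'b) module) \<Rightarrow> 'i \<Rightarrow> 'b \<Rightarrow> 'i \<Rightarrow> 'b" where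
  "sum_inj I M j x = (\<lambda>i\<in>I. if i = j then x else \<zero>\<^bsub>M i\<^esub>)"

definition direct_limit ::
    "('a,'r) ring_scheme \<Rightarrow> 'i set \<Rightarrow> ('i \<Rightarrow> 'i \<Rightarrow> bool) \<Rightarrow> ('i \<Rightarrow> ('a,'b) module) \<Rightarrow>
     ('i \<Rightarrow> 'i \<Rightarrow> 'b \<Rightarrow> 'b) \<Rightarrow> ('a, ('i \<Rightarrow> 'b) set) module" where
  "direct_limit R I rel M \<phi> = (let S = direct_sum I M in
     quot_module S (module_span R S
       {sum_inj I M j (\<phi> i j x) \<ominus>\<^bsub>S\<^esub> sum_inj I M i x | i j x.
          i \<in> I \<and> j \<in> I \<and> rel i j \<and> x \<in> carrier (M i)}))"

text \<open>
  \<open>N\<close> is pure in \<open>M\<close> if \<open>N \<otimes> X \<rightarrow> M \<otimes> X\<close> is injective for every R-module \<open>X\<close>.  The modules \<open>X\<close>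
  range over those with elements in the type \<open>(nat \<Rightarrow> 'a) set\<close>.  Up to isomorphism these include
  all finitely presented modules (quotients of the free module on \<open>{..<n}\<close>), hence, as tensor
  products commute with direct limits, injectivity for these \<open>X\<close> gives it for all modules \<open>X\<close>.
\<close>

definition pure_submodule :: "('a,'r) ring_scheme \<Rightarrow> 'b set \<Rightarrow> ('a,'b) module \<Rightarrow> bool" where
  "pure_submodule R N M \<longleftrightarrow> submodule N R M \<and>
     (\<forall>X :: ('a, (nat \<Rightarrow> 'a) set) module. module R X \<longrightarrow>
        inj_on (tensor_map R (sub_module M N) M X (\<lambda>x\<in>N. x))
               (carrier (tensor R (sub_module M N) X)))"


section \<open>Covers\<close>

text \<open>
  A class of modules cannot be a single HOL object ranging over all carrier types.  Hence a precover
  takes the class twice: \<open>C\<close> is its incarnation on the type that carries \<open>F\<close>, and \<open>C'\<close> its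
  incarnation on the type that carries the test modules \<open>F'\<close>.
\<close>

definition precover ::
    "('a,'r) ring_scheme \<Rightarrow> ('a,'f) module set \<Rightarrow> ('a,'g) module set \<Rightarrow>
     ('a,'m) module \<Rightarrow> ('a,'f) module \<Rightarrow> ('f \<Rightarrow> 'm) \<Rightarrow> bool" where
  "precover R C C' M F f \<longleftrightarrow> F \<in> C \<and> f \<in> mod_hom R F M \<and>
     (\<forall>F'\<in>C'. (\<lambda>h. compose (carrier F') f h) ` mod_hom R F' F = mod_hom R F' M)"

definition cover ::
    "('a,'r) ring_scheme \<Rightarrow> ('a,'f) module set \<Rightarrow> ('a,'g) module set \<Rightarrow>
     ('a,'m) module \<Rightarrow> ('a,'f) module \<Rightarrow> ('f \<Rightarrow> 'm) \<Rightarrow> bool" where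
  "cover R C C' M F f \<longleftrightarrow> precover R C C' M F f \<and>
     (\<forall>h\<in>mod_hom R F F. f = compose (carrier F) f h \<longrightarrow> h \<in> mod_iso R F F)"

text \<open>
  For a module with elements in \<open>'m\<close> over a ring with elements in \<open>'a\<close>, this type has cardinality
  \<open>2\<^sup>\<lambda>\<close> with \<open>\<lambda> = max(|'a|, |'m|, \<aleph>\<^sub>0)\<close>.  This is enough room for covers by a class closed under pure
  quotients: the kernel of such a cover contains no nonzero pure submodule of its domain, which
  bounds the cardinality of the domain by \<open>2\<^sup>\<lambda>\<close>.
\<close>

type_synonym ('a, 'm) cover_type = "('a + 'm + nat) set"

end

theory Submission
  imports Defs
begin

text \<open>
  A module \<open>M\<close> is semi-regular w-flat if a condition on \<open>Tor\<^sub>1(R/I,M)\<close> holds for certain ideals \<open>I\<close>.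
  Since the free resolution of \<open>R/I\<close> does not involve \<open>M\<close>, this condition is about finite linear
  systems over \<open>R\<close> with solutions in \<open>M\<close>: every solution in \<open>M\<close> of one system is multiplied, by the
  elements of some GV-ideal, into the solvable right-hand sides of another one
  (\<open>tor_cond\<close>, \<open>Tor1_GV_torsion_iff\<close>).  Purity, too, means that finite systems can be solved
  (\<open>pure_submodule_sys_pure\<close>), and finite systems commute with direct limits.  Hence the closure
  properties \<open>w_flat_pure_sub\<close>, \<open>w_flat_pure_quot\<close> and \<open>w_flat_colim\<close>.  Direct sums
  (\<open>w_flat_direct_sum\<close>) need, in addition, that finitely many GV-ideals contain a common one.

  For precovers one needs a set of modules that suffices to test the lifting property.  Let
  \<open>g : G \<rightarrow> M\<close> be a homomorphism from a w-flat module.  If \<open>G\<close> is large compared with the ring and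
  \<open>M\<close>, the kernel of \<open>g\<close> contains a nonzero pure submodule of \<open>G\<close>
  (\<open>small_if_no_pure_submodule_in_kernel\<close>); dividing by a maximal one, \<open>g\<close> factors through a w-flat
  module of bounded size (\<open>w_flat_reduce\<close>).  So the sum of all homomorphisms from w-flat modules of
  bounded size to \<open>M\<close> is a precover, and reducing it gives a precover \<open>W \<rightarrow> M\<close> of bounded size
  (\<open>ex_small_precover\<close>, \<open>small_precover_lift\<close>).

  A precover is turned into a cover by means of closure under direct limits, as in Enochs' theorem.
  A well-ordered system of endomorphisms of \<open>W\<close> over \<open>M\<close> always extends, because its direct limit
  is w-flat and maps back to \<open>W\<close> over \<open>M\<close> (\<open>over_end_cocone\<close>).  A long system that kills as many
  elements as possible has a limit whose endomorphisms over \<open>M\<close> are injective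
  (\<open>ex_precover_injective_endomorphisms\<close>).  For such a precover they are also surjective: otherwise
  a long system of injective, non-surjective maps would produce more elements than there are in
  the precover (\<open>over_end_surjective\<close>).
\<close>

section \<open>Modules, free modules and tensor products\<close>

definition lcomb :: "('a,'b) module \<Rightarrow> 'k set \<Rightarrow> ('k \<Rightarrow> 'a) \<Rightarrow> ('k \<Rightarrow> 'b) \<Rightarrow> 'b" where
  "lcomb M T c m = (\<Oplus>\<^bsub>M\<^esub>k\<in>T. c k \<odot>\<^bsub>M\<^esub> m k)"

context cring
begin

lemma mod_agrp: "module R M \<Longrightarrow> abelian_group M"
  by (simp add: module_def)

lemma mod_amon: "module R M \<Longrightarrow> abelian_monoid M"
  by (simp add: module_def abelian_group_def)

lemma mod_zero_closed [simp]: "module R M \<Longrightarrow> \<zero>\<^bsub>M\<^esub> \<in> carrier M"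
  by (meson abelian_monoid.zero_closed mod_amon)

lemma mod_add_closed [simp]:
  "\<lbrakk>module R M; x \<in> carrier M; y \<in> carrier M\<rbrakk> \<Longrightarrow> x \<oplus>\<^bsub>M\<^esub> y \<in> carrier M"
  by (meson abelian_monoid.a_closed mod_amon)

lemma mod_inv_closed [simp]: "\<lbrakk>module R M; x \<in> carrier M\<rbrakk> \<Longrightarrow> \<ominus>\<^bsub>M\<^esub> x \<in> carrier M"
  by (meson abelian_group.a_inv_closed mod_agrp)

lemma mod_diff_closed [simp]:
  "\<lbrakk>module R M; x \<in> carrier M; y \<in> carrier M\<rbrakk> \<Longrightarrow> x \<ominus>\<^bsub>M\<^esub> y \<in> carrier M"
  by (meson abelian_group.minus_closed mod_agrp)

lemma mod_smult_closed [simp]: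
  "\<lbrakk>module R M; r \<in> carrier R; x \<in> carrier M\<rbrakk> \<Longrightarrow> r \<odot>\<^bsub>M\<^esub> x \<in> carrier M"
  by (meson module.smult_closed)

lemma mod_assoc:
  "\<lbrakk>module R M; x \<in> carrier M; y \<in> carrier M; z \<in> carrier M\<rbrakk> \<Longrightarrow>
   (x \<oplus>\<^bsub>M\<^esub> y) \<oplus>\<^bsub>M\<^esub> z = x \<oplus>\<^bsub>M\<^esub> (y \<oplus>\<^bsub>M\<^esub> z)"
  by (meson abelian_monoid.a_assoc mod_amon)

lemma mod_comm:
  "\<lbrakk>module R M; x \<in> carrier M; y \<in> carrier M\<rbrakk> \<Longrightarrow> x \<oplus>\<^bsub>M\<^esub> y = y \<oplus>\<^bsub>M\<^esub> x"
  by (meson abelian_monoid.a_comm mod_amon)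

lemma mod_lcomm:
  "\<lbrakk>module R M; x \<in> carrier M; y \<in> carrier M; z \<in> carrier M\<rbrakk> \<Longrightarrow>
   x \<oplus>\<^bsub>M\<^esub> (y \<oplus>\<^bsub>M\<^esub> z) = y \<oplus>\<^bsub>M\<^esub> (x \<oplus>\<^bsub>M\<^esub> z)"
  by (metis mod_assoc mod_comm)

lemmas mod_ac = mod_assoc mod_comm mod_lcomm

lemma mod_zero_add [simp]:
  "\<lbrakk>module R M; x \<in> carrier M\<rbrakk> \<Longrightarrow> \<zero>\<^bsub>M\<^esub> \<oplus>\<^bsub>M\<^esub> x = x"
  "\<lbrakk>module R M; x \<in> carrier M\<rbrakk> \<Longrightarrow> x \<oplus>\<^bsub>M\<^esub> \<zero>\<^bsub>M\<^esub> = x"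
  by (meson abelian_monoid.l_zero abelian_monoid.r_zero mod_amon)+

lemma mod_neg_add [simp]:
  "\<lbrakk>module R M; x \<in> carrier M\<rbrakk> \<Longrightarrow> \<ominus>\<^bsub>M\<^esub> x \<oplus>\<^bsub>M\<^esub> x = \<zero>\<^bsub>M\<^esub>"
  "\<lbrakk>module R M; x \<in> carrier M\<rbrakk> \<Longrightarrow> x \<oplus>\<^bsub>M\<^esub> \<ominus>\<^bsub>M\<^esub> x = \<zero>\<^bsub>M\<^esub>"
  by (meson abelian_group.l_neg abelian_group.r_neg mod_agrp)+

lemma mod_neg_add2 [simp]:
  "\<lbrakk>module R M; x \<in> carrier M; y \<in> carrier M\<rbrakk> \<Longrightarrow> \<ominus>\<^bsub>M\<^esub> x \<oplus>\<^bsub>M\<^esub> (x \<oplus>\<^bsub>M\<^esub> y) = y"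
  "\<lbrakk>module R M; x \<in> carrier M; y \<in> carrier M\<rbrakk> \<Longrightarrow> x \<oplus>\<^bsub>M\<^esub> (\<ominus>\<^bsub>M\<^esub> x \<oplus>\<^bsub>M\<^esub> y) = y"
  by (metis mod_assoc mod_neg_add mod_inv_closed mod_zero_add)+

lemma mod_minus_minus [simp]: "\<lbrakk>module R M; x \<in> carrier M\<rbrakk> \<Longrightarrow> \<ominus>\<^bsub>M\<^esub> (\<ominus>\<^bsub>M\<^esub> x) = x"
  by (meson abelian_group.minus_minus mod_agrp)

lemma mod_minus_zero [simp]: "module R M \<Longrightarrow> \<ominus>\<^bsub>M\<^esub> \<zero>\<^bsub>M\<^esub> = \<zero>\<^bsub>M\<^esub>"
  by (metis mod_inv_closed mod_neg_add(2) mod_zero_add(1) mod_zero_closed)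

lemma mod_minus_add:
  "\<lbrakk>module R M; x \<in> carrier M; y \<in> carrier M\<rbrakk> \<Longrightarrow>
    \<ominus>\<^bsub>M\<^esub> (x \<oplus>\<^bsub>M\<^esub> y) = \<ominus>\<^bsub>M\<^esub> x \<oplus>\<^bsub>M\<^esub> \<ominus>\<^bsub>M\<^esub> y"
  by (meson abelian_group.minus_add mod_agrp)

lemma mod_diff: "x \<ominus>\<^bsub>M\<^esub> y = x \<oplus>\<^bsub>M\<^esub> \<ominus>\<^bsub>M\<^esub> y"
  by (simp add: a_minus_def)

lemma mod_diff_eq_zero:
  "\<lbrakk>module R M; x \<in> carrier M; y \<in> carrier M\<rbrakk> \<Longrightarrow> x \<ominus>\<^bsub>M\<^esub> y = \<zero>\<^bsub>M\<^esub> \<longleftrightarrow> x = y"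
  by (metis mod_diff mod_inv_closed mod_neg_add(2) mod_assoc mod_neg_add(1) mod_zero_add)

lemma mod_add_diff_cancel [simp]:
  "\<lbrakk>module R M; x \<in> carrier M; y \<in> carrier M\<rbrakk> \<Longrightarrow> (x \<oplus>\<^bsub>M\<^esub> y) \<ominus>\<^bsub>M\<^esub> y = x"
  "\<lbrakk>module R M; x \<in> carrier M; y \<in> carrier M\<rbrakk> \<Longrightarrow> (x \<ominus>\<^bsub>M\<^esub> y) \<oplus>\<^bsub>M\<^esub> y = x"
  by (auto simp: mod_diff mod_ac)

lemma mod_diff_add:
  "\<lbrakk>module R M; x \<in> carrier M; y \<in> carrier M; x' \<in> carrier M; y' \<in> carrier M\<rbrakk> \<Longrightarrow>
    (x \<oplus>\<^bsub>M\<^esub> x') \<ominus>\<^bsub>M\<^esub> (y \<oplus>\<^bsub>M\<^esub> y') = (x \<ominus>\<^bsub>M\<^esub> y) \<oplus>\<^bsub>M\<^esub> (x' \<ominus>\<^bsub>M\<^esub> y')"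
  by (auto simp: mod_diff mod_minus_add mod_ac)

lemma mod_diff_diff:
  "\<lbrakk>module R M; x \<in> carrier M; y \<in> carrier M; x' \<in> carrier M; y' \<in> carrier M\<rbrakk> \<Longrightarrow>
    (x \<ominus>\<^bsub>M\<^esub> x') \<ominus>\<^bsub>M\<^esub> (y \<ominus>\<^bsub>M\<^esub> y') = (x \<ominus>\<^bsub>M\<^esub> y) \<ominus>\<^bsub>M\<^esub> (x' \<ominus>\<^bsub>M\<^esub> y')"
  by (auto simp: mod_diff mod_minus_add mod_ac)

lemma mod_smult_zero [simp]:
  "\<lbrakk>module R M; x \<in> carrier M\<rbrakk> \<Longrightarrow> \<zero> \<odot>\<^bsub>M\<^esub> x = \<zero>\<^bsub>M\<^esub>"
  "\<lbrakk>module R M; r \<in> carrier R\<rbrakk> \<Longrightarrow> r \<odot>\<^bsub>M\<^esub> \<zero>\<^bsub>M\<^esub> = \<zero>\<^bsub>M\<^esub>"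
  by (meson module.smult_l_null module.smult_r_null)+

lemma mod_smult_one [simp]: "\<lbrakk>module R M; x \<in> carrier M\<rbrakk> \<Longrightarrow> \<one> \<odot>\<^bsub>M\<^esub> x = x"
  by (meson module.smult_one)

lemma mod_smult_r_distr:
  "\<lbrakk>module R M; r \<in> carrier R; x \<in> carrier M; y \<in> carrier M\<rbrakk> \<Longrightarrow>
    r \<odot>\<^bsub>M\<^esub> (x \<oplus>\<^bsub>M\<^esub> y) = r \<odot>\<^bsub>M\<^esub> x \<oplus>\<^bsub>M\<^esub> r \<odot>\<^bsub>M\<^esub> y"
  by (meson module.smult_r_distr)

lemma mod_smult_l_distr:
  "\<lbrakk>module R M; r \<in> carrier R; s \<in> carrier R; x \<in> carrier M\<rbrakk> \<Longrightarrow>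
    (r \<oplus> s) \<odot>\<^bsub>M\<^esub> x = r \<odot>\<^bsub>M\<^esub> x \<oplus>\<^bsub>M\<^esub> s \<odot>\<^bsub>M\<^esub> x"
  by (meson module.smult_l_distr)

lemma mod_smult_assoc:
  "\<lbrakk>module R M; r \<in> carrier R; s \<in> carrier R; x \<in> carrier M\<rbrakk> \<Longrightarrow>
    (r \<otimes> s) \<odot>\<^bsub>M\<^esub> x = r \<odot>\<^bsub>M\<^esub> (s \<odot>\<^bsub>M\<^esub> x)"
  by (meson module.smult_assoc1)

lemma mod_smult_lcomm:
  "\<lbrakk>module R M; r \<in> carrier R; s \<in> carrier R; x \<in> carrier M\<rbrakk> \<Longrightarrow>
    r \<odot>\<^bsub>M\<^esub> (s \<odot>\<^bsub>M\<^esub> x) = s \<odot>\<^bsub>M\<^esub> (r \<odot>\<^bsub>M\<^esub> x)"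
  by (metis mod_smult_assoc m_comm)

lemma mod_smult_minus:
  "\<lbrakk>module R M; r \<in> carrier R; x \<in> carrier M\<rbrakk> \<Longrightarrow> r \<odot>\<^bsub>M\<^esub> (\<ominus>\<^bsub>M\<^esub> x) = \<ominus>\<^bsub>M\<^esub> (r \<odot>\<^bsub>M\<^esub> x)"
  by (meson module.smult_r_minus)

lemma mod_smult_neg_one:
  "\<lbrakk>module R M; x \<in> carrier M\<rbrakk> \<Longrightarrow> (\<ominus> \<one>) \<odot>\<^bsub>M\<^esub> x = \<ominus>\<^bsub>M\<^esub> x"
  by (metis mod_smult_one module.smult_l_minus one_closed)

lemma mod_smult_diff:
  "\<lbrakk>module R M; r \<in> carrier R; x \<in> carrier M; y \<in> carrier M\<rbrakk> \<Longrightarrow>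
    r \<odot>\<^bsub>M\<^esub> (x \<ominus>\<^bsub>M\<^esub> y) = r \<odot>\<^bsub>M\<^esub> x \<ominus>\<^bsub>M\<^esub> r \<odot>\<^bsub>M\<^esub> y"
  by (simp add: mod_diff mod_smult_r_distr mod_smult_minus)

lemma submoduleI':
  assumes "module R M" "H \<subseteq> carrier M" "\<zero>\<^bsub>M\<^esub> \<in> H"
    and "\<And>x y. \<lbrakk>x \<in> H; y \<in> H\<rbrakk> \<Longrightarrow> x \<oplus>\<^bsub>M\<^esub> y \<in> H"
    and "\<And>r x. \<lbrakk>r \<in> carrier R; x \<in> H\<rbrakk> \<Longrightarrow> r \<odot>\<^bsub>M\<^esub> x \<in> H"
  shows "submodule H R M"
proof (rule module.submoduleI)
  show "\<ominus>\<^bsub>M\<^esub> x \<in> H" if "x \<in> H" for x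
    using assms(5)[of "\<ominus> \<one>" x] that assms(1,2) by (auto simp: mod_smult_neg_one subset_iff)
qed (use assms in auto)

lemma submoduleD:
  assumes "module R M" "submodule H R M"
  shows "H \<subseteq> carrier M" "\<zero>\<^bsub>M\<^esub> \<in> H" "x \<in> H \<Longrightarrow> x \<in> carrier M"
    "\<lbrakk>x \<in> H; y \<in> H\<rbrakk> \<Longrightarrow> x \<oplus>\<^bsub>M\<^esub> y \<in> H" "\<lbrakk>x \<in> H; y \<in> H\<rbrakk> \<Longrightarrow> x \<ominus>\<^bsub>M\<^esub> y \<in> H"
    "\<lbrakk>r \<in> carrier R; x \<in> H\<rbrakk> \<Longrightarrow> r \<odot>\<^bsub>M\<^esub> x \<in> H"
    "x \<in> H \<Longrightarrow> \<ominus>\<^bsub>M\<^esub> x \<in> H"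
proof -
  note E = module.submoduleE[OF assms]
  show 1: "H \<subseteq> carrier M" by (rule E(1))
  then show "x \<in> H \<Longrightarrow> x \<in> carrier M" by auto
  show "\<lbrakk>x \<in> H; y \<in> H\<rbrakk> \<Longrightarrow> x \<oplus>\<^bsub>M\<^esub> y \<in> H" by (rule E(5))
  show "\<lbrakk>r \<in> carrier R; x \<in> H\<rbrakk> \<Longrightarrow> r \<odot>\<^bsub>M\<^esub> x \<in> H" by (rule E(4))
  show "\<lbrakk>x \<in> H; y \<in> H\<rbrakk> \<Longrightarrow> x \<ominus>\<^bsub>M\<^esub> y \<in> H" by (simp add: mod_diff E(3,5))
  show "x \<in> H \<Longrightarrow> \<ominus>\<^bsub>M\<^esub> x \<in> H" by (rule E(3))
  obtain h where "h \<in> H" using E(2) by auto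
  then show "\<zero>\<^bsub>M\<^esub> \<in> H" using E(3)[of h] E(5)[of h "\<ominus>\<^bsub>M\<^esub> h"] 1 assms(1) by auto
qed

lemma sub_module_simps [simp]:
  "carrier (sub_module M N) = N" "zero (sub_module M N) = zero M"
  "add (sub_module M N) = add M" "smult (sub_module M N) = smult M"
  by (auto simp: sub_module_def)

lemma module_sub_module:
  assumes "module R M" "submodule N R M"
  shows "module R (sub_module M N)"
  unfolding sub_module_def by (rule submodule.submodule_is_module[OF assms(2,1)])

lemma module_span_submodule:
  assumes M: "module R M" and S: "S \<subseteq> carrier M"
  shows "submodule (module_span R M S) R M"
proof -
  have c: "submodule (carrier M) R M" using M by (rule module.carrier_is_submodule)
  show ?thesis unfolding module_span_def
  proof (rule submoduleI'[OF M])
    show "\<Inter>{H. submodule H R M \<and> S \<subseteq> H} \<subseteq> carrier M" using c S by blast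
  qed (auto intro: submoduleD(2,4,6)[OF M])
qed

lemma module_span_superset: "S \<subseteq> module_span R M S"
  by (auto simp: module_span_def)

lemma module_span_min: "\<lbrakk>submodule H R M; S \<subseteq> H\<rbrakk> \<Longrightarrow> module_span R M S \<subseteq> H"
  by (auto simp: module_span_def)


subsection \<open>Homomorphisms\<close>

lemma hom_closed: "\<lbrakk>f \<in> mod_hom R M N; x \<in> carrier M\<rbrakk> \<Longrightarrow> f x \<in> carrier N"
  by (auto simp: mod_hom_def)

lemma hom_add:
  "\<lbrakk>f \<in> mod_hom R M N; x \<in> carrier M; y \<in> carrier M\<rbrakk> \<Longrightarrow> f (x \<oplus>\<^bsub>M\<^esub> y) = f x \<oplus>\<^bsub>N\<^esub> f y"
  by (auto simp: mod_hom_def)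

lemma hom_smult:
  "\<lbrakk>f \<in> mod_hom R M N; r \<in> carrier R; x \<in> carrier M\<rbrakk> \<Longrightarrow> f (r \<odot>\<^bsub>M\<^esub> x) = r \<odot>\<^bsub>N\<^esub> f x"
  by (auto simp: mod_hom_def)

lemma hom_zero:
  "\<lbrakk>f \<in> mod_hom R M N; module R M; module R N\<rbrakk> \<Longrightarrow> f \<zero>\<^bsub>M\<^esub> = \<zero>\<^bsub>N\<^esub>"
  by (metis hom_closed hom_smult mod_smult_zero(1) mod_zero_closed zero_closed)

lemma hom_minus:
  "\<lbrakk>f \<in> mod_hom R M N; module R M; module R N; x \<in> carrier M\<rbrakk> \<Longrightarrow> f (\<ominus>\<^bsub>M\<^esub> x) = \<ominus>\<^bsub>N\<^esub> f x"
  by (metis a_inv_closed hom_closed hom_smult mod_smult_neg_one one_closed)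

lemma hom_diff:
  "\<lbrakk>f \<in> mod_hom R M N; module R M; module R N; x \<in> carrier M; y \<in> carrier M\<rbrakk> \<Longrightarrow>
    f (x \<ominus>\<^bsub>M\<^esub> y) = f x \<ominus>\<^bsub>N\<^esub> f y"
  by (simp add: mod_diff hom_add hom_minus)

lemma hom_eqI:
  "\<lbrakk>f \<in> mod_hom R M N; g \<in> mod_hom R M N'; \<And>x. x \<in> carrier M \<Longrightarrow> f x = g x\<rbrakk> \<Longrightarrow> f = g"
  by (rule extensionalityI[of _ "carrier M"]) (auto simp: mod_hom_def PiE_def)

lemma mod_homI:
  assumes "module R M" "\<And>x. x \<in> carrier M \<Longrightarrow> f x \<in> carrier N"
    "\<And>x y. \<lbrakk>x \<in> carrier M; y \<in> carrier M\<rbrakk> \<Longrightarrow> f (x \<oplus>\<^bsub>M\<^esub> y) = f x \<oplus>\<^bsub>N\<^esub> f y"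
    "\<And>r x. \<lbrakk>r \<in> carrier R; x \<in> carrier M\<rbrakk> \<Longrightarrow> f (r \<odot>\<^bsub>M\<^esub> x) = r \<odot>\<^bsub>N\<^esub> f x"
  shows "restrict f (carrier M) \<in> mod_hom R M N"
  using assms by (auto simp: mod_hom_def)

lemma hom_compose:
  assumes "module R M" "f \<in> mod_hom R M N" "g \<in> mod_hom R N P"
  shows "compose (carrier M) g f \<in> mod_hom R M P"
  unfolding compose_def
  by (rule mod_homI) (use assms in \<open>auto simp: hom_closed hom_add hom_smult\<close>)

lemma hom_id: "module R M \<Longrightarrow> (\<lambda>x\<in>carrier M. x) \<in> mod_hom R M M"
  by (rule mod_homI) auto

lemma hom_restrict:
  assumes "module R M" "f \<in> mod_hom R M N" "submodule H R M"
  shows "restrict f H \<in> mod_hom R (sub_module M H) N"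
  using mod_homI[OF module_sub_module[OF assms(1,3)], of f N]
    submoduleD(3)[OF assms(1,3)] assms(2) by (auto simp: hom_closed hom_add hom_smult)

lemma kernel_submodule:
  assumes "module R M" "module R N" "f \<in> mod_hom R M N"
  shows "submodule {x \<in> carrier M. f x = \<zero>\<^bsub>N\<^esub>} R M"
  by (rule submoduleI') (use assms in \<open>auto simp: hom_zero hom_add hom_smult\<close>)

lemma image_submodule:
  assumes "module R M" "module R N" "f \<in> mod_hom R M N"
  shows "submodule (f ` carrier M) R N"
proof (rule submoduleI'[OF assms(2)])
  show "\<zero>\<^bsub>N\<^esub> \<in> f ` carrier M"
    by (metis assms hom_zero imageI mod_zero_closed)
  show "x \<oplus>\<^bsub>N\<^esub> y \<in> f ` carrier M" if "x \<in> f ` carrier M" "y \<in> f ` carrier M" for x y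
    using that assms by (auto simp flip: hom_add)
  show "r \<odot>\<^bsub>N\<^esub> x \<in> f ` carrier M" if "r \<in> carrier R" "x \<in> f ` carrier M" for r x
    using that assms by (auto simp flip: hom_smult)
qed (use assms in \<open>auto simp: hom_closed\<close>)

text \<open>The module laws are equations, so they pass along a surjection that respects the operations.
  Quotients and copies of a module on another type inherit their laws in this way.\<close>

lemma module_surj_image:
  assumes M: "module R M" and surj: "p ` carrier M = carrier Q"
    and add: "\<And>x y. \<lbrakk>x \<in> carrier M; y \<in> carrier M\<rbrakk> \<Longrightarrow> p (x \<oplus>\<^bsub>M\<^esub> y) = p x \<oplus>\<^bsub>Q\<^esub> p y"
    and smult: "\<And>r x. \<lbrakk>r \<in> carrier R; x \<in> carrier M\<rbrakk> \<Longrightarrow> p (r \<odot>\<^bsub>M\<^esub> x) = r \<odot>\<^bsub>Q\<^esub> p x"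
    and zero: "p \<zero>\<^bsub>M\<^esub> = \<zero>\<^bsub>Q\<^esub>"
  shows "module R Q"
proof -
  have ex: "\<exists>y \<in> carrier M. x = p y" if "x \<in> carrier Q" for x using that surj by auto
  have cl: "p x \<in> carrier Q" if "x \<in> carrier M" for x using that surj by auto
  note S = add[symmetric] smult[symmetric] zero[symmetric]
  show ?thesis
  proof (rule moduleI)
    show "cring R" by (rule is_cring)
    show "abelian_group Q"
    proof (rule abelian_groupI)
      fix x assume "x \<in> carrier Q"
      then obtain a where a: "a \<in> carrier M" "x = p a" using ex by blast
      show "\<exists>y\<in>carrier Q. y \<oplus>\<^bsub>Q\<^esub> x = \<zero>\<^bsub>Q\<^esub>"
        by (rule bexI[of _ "p (\<ominus>\<^bsub>M\<^esub> a)"]) (use a M in \<open>auto simp: S cl\<close>)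
      show "\<zero>\<^bsub>Q\<^esub> \<oplus>\<^bsub>Q\<^esub> x = x" using a M by (simp add: S)
      fix y assume "y \<in> carrier Q"
      then obtain b where b: "b \<in> carrier M" "y = p b" using ex by blast
      show "x \<oplus>\<^bsub>Q\<^esub> y \<in> carrier Q" using a b M by (simp add: S cl)
      show "x \<oplus>\<^bsub>Q\<^esub> y = y \<oplus>\<^bsub>Q\<^esub> x" using a b M by (simp add: S mod_comm)
      fix z assume "z \<in> carrier Q"
      then obtain c where c: "c \<in> carrier M" "z = p c" using ex by blast
      show "x \<oplus>\<^bsub>Q\<^esub> y \<oplus>\<^bsub>Q\<^esub> z = x \<oplus>\<^bsub>Q\<^esub> (y \<oplus>\<^bsub>Q\<^esub> z)"
        using a b c M by (simp add: S mod_assoc)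
    qed (use M in \<open>auto simp: S cl\<close>)
  next
    fix r s x y assume rs: "r \<in> carrier R" "s \<in> carrier R" and "x \<in> carrier Q" "y \<in> carrier Q"
    then obtain a b where ab: "a \<in> carrier M" "x = p a" "b \<in> carrier M" "y = p b" using ex by blast
    show "r \<odot>\<^bsub>Q\<^esub> x \<in> carrier Q" using M ab rs by (simp add: S cl)
    show "(r \<oplus> s) \<odot>\<^bsub>Q\<^esub> x = r \<odot>\<^bsub>Q\<^esub> x \<oplus>\<^bsub>Q\<^esub> s \<odot>\<^bsub>Q\<^esub> x"
      using M ab rs by (simp add: S mod_smult_l_distr)
    show "r \<odot>\<^bsub>Q\<^esub> (x \<oplus>\<^bsub>Q\<^esub> y) = r \<odot>\<^bsub>Q\<^esub> x \<oplus>\<^bsub>Q\<^esub> r \<odot>\<^bsub>Q\<^esub> y"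
      using M ab rs by (simp add: S mod_smult_r_distr)
    show "r \<otimes> s \<odot>\<^bsub>Q\<^esub> x = r \<odot>\<^bsub>Q\<^esub> (s \<odot>\<^bsub>Q\<^esub> x)"
      using M ab rs by (simp add: S mod_smult_assoc)
  next
    fix x assume "x \<in> carrier Q"
    then show "\<one> \<odot>\<^bsub>Q\<^esub> x = x" using M ex[of x] by (auto simp: S)
  qed
qed

lemma hom_factor_surj:
  assumes M: "module R M" and Q: "module R Q" and P: "module R P"
    and p: "p \<in> mod_hom R M Q" and surj: "p ` carrier M = carrier Q" and f: "f \<in> mod_hom R M P"
    and ker: "\<And>x. \<lbrakk>x \<in> carrier M; p x = \<zero>\<^bsub>Q\<^esub>\<rbrakk> \<Longrightarrow> f x = \<zero>\<^bsub>P\<^esub>"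
  obtains g where "g \<in> mod_hom R Q P" "\<And>x. x \<in> carrier M \<Longrightarrow> g (p x) = f x"
proof -
  define g where "g = (\<lambda>y. f (SOME x. x \<in> carrier M \<and> p x = y))"
  have g: "g (p x) = f x" if x: "x \<in> carrier M" for x
  proof -
    have "\<exists>z. z \<in> carrier M \<and> p z = p x" using x by auto
    then obtain z where z: "z \<in> carrier M" "p z = p x" "g (p x) = f z"
      unfolding g_def by (metis (mono_tags, lifting) someI_ex)
    have "p (z \<ominus>\<^bsub>M\<^esub> x) = \<zero>\<^bsub>Q\<^esub>"
      using z x M Q p by (simp add: hom_diff hom_closed mod_diff_eq_zero)
    then have "f (z \<ominus>\<^bsub>M\<^esub> x) = \<zero>\<^bsub>P\<^esub>" using ker x z M by simp
    then show ?thesis using z x M P f by (simp add: hom_diff hom_closed mod_diff_eq_zero)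
  qed
  have ex: "\<exists>x \<in> carrier M. y = p x" if "y \<in> carrier Q" for y using that surj by auto
  have "restrict g (carrier Q) \<in> mod_hom R Q P"
  proof (rule mod_homI[OF Q])
    fix x assume "x \<in> carrier Q"
    then obtain a where a: "a \<in> carrier M" "x = p a" using ex by blast
    show "g x \<in> carrier P" using a g f by (simp add: hom_closed)
    show "g (r \<odot>\<^bsub>Q\<^esub> x) = r \<odot>\<^bsub>P\<^esub> g x" if "r \<in> carrier R" for r
      using a g f p that M by (simp add: hom_smult[symmetric])
    fix y assume "y \<in> carrier Q"
    then obtain b where b: "b \<in> carrier M" "y = p b" using ex by blast
    show "g (x \<oplus>\<^bsub>Q\<^esub> y) = g x \<oplus>\<^bsub>P\<^esub> g y"
      using a b g f p M by (simp add: hom_add[symmetric])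
  qed
  then show ?thesis using that g p by (simp add: hom_closed)
qed

lemma iso_inverse:
  assumes "module R M" "module R N" "f \<in> mod_hom R M N" "bij_betw f (carrier M) (carrier N)"
  obtains g where "g \<in> mod_hom R N M" "\<And>x. x \<in> carrier M \<Longrightarrow> g (f x) = x"
    "\<And>y. y \<in> carrier N \<Longrightarrow> f (g y) = y"
proof -
  have inj: "inj_on f (carrier M)" and im: "f ` carrier M = carrier N"
    using assms(4) by (auto simp: bij_betw_def)
  have "(\<lambda>x\<in>carrier M. x) x = \<zero>\<^bsub>M\<^esub>" if "x \<in> carrier M" "f x = \<zero>\<^bsub>N\<^esub>" for x
    using that inj_onD[OF inj, of x "\<zero>\<^bsub>M\<^esub>"] hom_zero[OF assms(3,1,2)] assms(1) by auto
  from hom_factor_surj[OF assms(1,2,1,3) im hom_id[OF assms(1)] this]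
  obtain g where g: "g \<in> mod_hom R N M" "\<And>x. x \<in> carrier M \<Longrightarrow> g (f x) = x" by auto
  moreover have "f (g y) = y" if "y \<in> carrier N" for y
    using that g im by (metis imageE)
  ultimately show ?thesis using that by blast
qed


subsection \<open>Linear combinations\<close>

lemma mod_finsum_closed:
  "\<lbrakk>module R M; \<And>k. k \<in> T \<Longrightarrow> f k \<in> carrier M\<rbrakk> \<Longrightarrow> finsum M f T \<in> carrier M"
  by (rule abelian_monoid.finsum_closed[OF mod_amon]) auto

lemma mod_finsum_empty [simp]: "module R M \<Longrightarrow> finsum M f {} = \<zero>\<^bsub>M\<^esub>"
  by (rule abelian_monoid.finsum_empty[OF mod_amon])

lemma mod_finsum_insert:
  "\<lbrakk>module R M; finite T; x \<notin> T; \<And>k. k \<in> insert x T \<Longrightarrow> f k \<in> carrier M\<rbrakk> \<Longrightarrow>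
    finsum M f (insert x T) = f x \<oplus>\<^bsub>M\<^esub> finsum M f T"
  by (rule abelian_monoid.finsum_insert[OF mod_amon]) auto

lemma mod_finsum_cong:
  "\<lbrakk>module R M; \<And>k. k \<in> T \<Longrightarrow> f k = g k; \<And>k. k \<in> T \<Longrightarrow> g k \<in> carrier M\<rbrakk> \<Longrightarrow>
    finsum M f T = finsum M g T"
  by (rule abelian_monoid.finsum_cong'[OF mod_amon]) auto

lemma mod_finsum_zero: "\<lbrakk>module R M; \<And>k. k \<in> T \<Longrightarrow> f k = \<zero>\<^bsub>M\<^esub>\<rbrakk> \<Longrightarrow> finsum M f T = \<zero>\<^bsub>M\<^esub>"
  using mod_finsum_cong[of M T f "\<lambda>_. \<zero>\<^bsub>M\<^esub>"] abelian_monoid.finsum_zero[OF mod_amon, of M T] by simp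

lemma mod_finsum_add:
  "\<lbrakk>module R M; \<And>k. k \<in> T \<Longrightarrow> f k \<in> carrier M; \<And>k. k \<in> T \<Longrightarrow> g k \<in> carrier M\<rbrakk> \<Longrightarrow>
    finsum M (\<lambda>k. f k \<oplus>\<^bsub>M\<^esub> g k) T = finsum M f T \<oplus>\<^bsub>M\<^esub> finsum M g T"
  by (rule abelian_monoid.finsum_addf[OF mod_amon]) auto

lemma mod_finsum_smult:
  "\<lbrakk>module R M; r \<in> carrier R; finite T; \<And>k. k \<in> T \<Longrightarrow> f k \<in> carrier M\<rbrakk> \<Longrightarrow>
    r \<odot>\<^bsub>M\<^esub> finsum M f T = finsum M (\<lambda>k. r \<odot>\<^bsub>M\<^esub> f k) T"
  by (rule module.finsum_smult_ldistr) auto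

lemma mod_finsum_mono:
  assumes M: "module R M" and "finite T'" "T \<subseteq> T'" "\<And>k. k \<in> T \<Longrightarrow> f k \<in> carrier M"
    "\<And>k. k \<in> T' - T \<Longrightarrow> f k = \<zero>\<^bsub>M\<^esub>"
  shows "finsum M f T' = finsum M f T"
proof -
  have "finite T" using assms by (meson finite_subset)
  have "finsum M f (T \<union> (T' - T)) = finsum M f T \<oplus>\<^bsub>M\<^esub> finsum M f (T' - T)"
    by (rule abelian_monoid.finsum_Un_disjoint[OF mod_amon[OF M]]) (use assms \<open>finite T\<close> in auto)
  also have "finsum M f (T' - T) = \<zero>\<^bsub>M\<^esub>" by (rule mod_finsum_zero[OF M assms(5)])
  also have "T \<union> (T' - T) = T'" using assms by auto
  finally show ?thesis using assms by (simp add: mod_finsum_closed)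
qed

lemma mod_finsum_swap:
  assumes M: "module R M" and "finite A" "finite B"
    "\<And>i j. \<lbrakk>i \<in> A; j \<in> B\<rbrakk> \<Longrightarrow> f i j \<in> carrier M"
  shows "finsum M (\<lambda>i. finsum M (f i) B) A = finsum M (\<lambda>j. finsum M (\<lambda>i. f i j) A) B"
  using assms(2,4)
proof (induction A)
  case empty
  then show ?case using M by (simp add: mod_finsum_zero)
next
  case (insert x A)
  then have IH: "finsum M (\<lambda>i. finsum M (f i) B) A = finsum M (\<lambda>j. finsum M (\<lambda>i. f i j) A) B"
    by auto
  have cl: "f i j \<in> carrier M" if "i = x \<or> i \<in> A" "j \<in> B" for i j using insert that by auto
  have "finsum M (\<lambda>i. finsum M (f i) B) (insert x A) =
    finsum M (f x) B \<oplus>\<^bsub>M\<^esub> finsum M (\<lambda>j. finsum M (\<lambda>i. f i j) A) B"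
    using insert M cl IH by (subst mod_finsum_insert) (auto simp: mod_finsum_closed)
  also have "\<dots> = finsum M (\<lambda>j. f x j \<oplus>\<^bsub>M\<^esub> finsum M (\<lambda>i. f i j) A) B"
    by (subst mod_finsum_add) (use M cl in \<open>auto simp: mod_finsum_closed\<close>)
  also have "\<dots> = finsum M (\<lambda>j. finsum M (\<lambda>i. f i j) (insert x A)) B"
    by (rule mod_finsum_cong[OF M])
      (use M cl insert in \<open>auto intro!: mod_add_closed mod_finsum_closed mod_finsum_insert[symmetric]\<close>)
  finally show ?case .
qed

lemma hom_finsum:
  assumes "module R M" "module R N" "f \<in> mod_hom R M N" "finite T"
    "\<And>k. k \<in> T \<Longrightarrow> g k \<in> carrier M"
  shows "f (finsum M g T) = finsum N (\<lambda>k. f (g k)) T"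
  using assms(4,5)
proof (induction T)
  case (insert x T)
  then show ?case using assms(1-3)
    by (subst (1 2) mod_finsum_insert) (auto intro: hom_closed simp: hom_add mod_finsum_closed)
qed (use assms(1-3) in \<open>auto simp: hom_zero\<close>)

lemma finsum_submodule:
  assumes "module R M" "submodule H R M" "finite T" "\<And>k. k \<in> T \<Longrightarrow> g k \<in> H"
  shows "finsum M g T \<in> H"
  using assms(3,4)
proof (induction T)
  case (insert x T)
  then show ?case
    by (subst mod_finsum_insert) (auto intro: assms(1) submoduleD[OF assms(1,2)])
qed (use submoduleD(2)[OF assms(1,2)] assms(1) in auto)

lemma lcomb_closed:
  "\<lbrakk>module R M; \<And>k. k \<in> T \<Longrightarrow> c k \<in> carrier R; \<And>k. k \<in> T \<Longrightarrow> m k \<in> carrier M\<rbrakk> \<Longrightarrow>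
    lcomb M T c m \<in> carrier M"
  unfolding lcomb_def by (rule mod_finsum_closed) auto

lemma lcomb_cong:
  assumes "module R M" "\<And>k. k \<in> T \<Longrightarrow> c k = c' k" "\<And>k. k \<in> T \<Longrightarrow> m k = m' k"
    "\<And>k. k \<in> T \<Longrightarrow> c' k \<in> carrier R" "\<And>k. k \<in> T \<Longrightarrow> m' k \<in> carrier M"
  shows "lcomb M T c m = lcomb M T c' m'"
  unfolding lcomb_def by (rule mod_finsum_cong) (use assms in auto)

lemma lcomb_mono:
  assumes "module R M" "finite T'" "T \<subseteq> T'" "\<And>k. k \<in> T' \<Longrightarrow> c k \<in> carrier R"
    "\<And>k. k \<in> T' \<Longrightarrow> m k \<in> carrier M"
    "\<And>k. k \<in> T' - T \<Longrightarrow> c k = \<zero> \<or> m k = \<zero>\<^bsub>M\<^esub>"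
  shows "lcomb M T' c m = lcomb M T c m"
  unfolding lcomb_def
proof (rule mod_finsum_mono[OF assms(1-3)])
  show "c k \<odot>\<^bsub>M\<^esub> m k = \<zero>\<^bsub>M\<^esub>" if "k \<in> T' - T" for k
    using assms(4-6)[of k] assms(1,3) that by auto
qed (use assms in auto)

lemma lcomb_zero:
  assumes "module R M" "\<And>k. k \<in> T \<Longrightarrow> c k \<in> carrier R" "\<And>k. k \<in> T \<Longrightarrow> m k \<in> carrier M"
    "\<And>k. k \<in> T \<Longrightarrow> c k = \<zero> \<or> m k = \<zero>\<^bsub>M\<^esub>"
  shows "lcomb M T c m = \<zero>\<^bsub>M\<^esub>"
  unfolding lcomb_def
proof (rule mod_finsum_zero[OF assms(1)])
  show "c k \<odot>\<^bsub>M\<^esub> m k = \<zero>\<^bsub>M\<^esub>" if "k \<in> T" for k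
    using assms that by (metis mod_smult_zero)
qed

lemma lcomb_single:
  assumes "module R M" "finite T" "j \<in> T" "\<And>k. k \<in> T \<Longrightarrow> c k \<in> carrier R"
    "\<And>k. k \<in> T \<Longrightarrow> m k \<in> carrier M" "\<And>k. \<lbrakk>k \<in> T; k \<noteq> j\<rbrakk> \<Longrightarrow> c k = \<zero> \<or> m k = \<zero>\<^bsub>M\<^esub>"
  shows "lcomb M T c m = c j \<odot>\<^bsub>M\<^esub> m j"
proof -
  have "lcomb M T c m = lcomb M {j} c m"
    by (rule lcomb_mono) (use assms in auto)
  also have "\<dots> = c j \<odot>\<^bsub>M\<^esub> m j"
    unfolding lcomb_def by (subst mod_finsum_insert) (use assms in auto)
  finally show ?thesis .
qed

lemma lcomb_add:
  assumes "module R M" "\<And>k. k \<in> T \<Longrightarrow> c k \<in> carrier R" "\<And>k. k \<in> T \<Longrightarrow> m k \<in> carrier M"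
    "\<And>k. k \<in> T \<Longrightarrow> m' k \<in> carrier M"
  shows "lcomb M T c (\<lambda>k. m k \<oplus>\<^bsub>M\<^esub> m' k) = lcomb M T c m \<oplus>\<^bsub>M\<^esub> lcomb M T c m'"
  using assms unfolding lcomb_def
  by (subst mod_finsum_add[symmetric]) (auto intro!: mod_finsum_cong simp: mod_smult_r_distr)

lemma lcomb_add_coeff:
  assumes "module R M" "\<And>k. k \<in> T \<Longrightarrow> c k \<in> carrier R" "\<And>k. k \<in> T \<Longrightarrow> c' k \<in> carrier R"
    "\<And>k. k \<in> T \<Longrightarrow> m k \<in> carrier M"
  shows "lcomb M T (\<lambda>k. c k \<oplus> c' k) m = lcomb M T c m \<oplus>\<^bsub>M\<^esub> lcomb M T c' m"
  using assms unfolding lcomb_def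
  by (subst mod_finsum_add[symmetric]) (auto intro!: mod_finsum_cong simp: mod_smult_l_distr)

lemma lcomb_smult:
  assumes "module R M" "finite T" "r \<in> carrier R" "\<And>k. k \<in> T \<Longrightarrow> c k \<in> carrier R"
    "\<And>k. k \<in> T \<Longrightarrow> m k \<in> carrier M"
  shows "lcomb M T c (\<lambda>k. r \<odot>\<^bsub>M\<^esub> m k) = r \<odot>\<^bsub>M\<^esub> lcomb M T c m"
  using assms unfolding lcomb_def
  by (subst mod_finsum_smult) (auto intro!: mod_finsum_cong simp: mod_smult_lcomm)

lemma lcomb_smult_coeff:
  assumes "module R M" "finite T" "r \<in> carrier R" "\<And>k. k \<in> T \<Longrightarrow> c k \<in> carrier R"
    "\<And>k. k \<in> T \<Longrightarrow> m k \<in> carrier M"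
  shows "lcomb M T (\<lambda>k. r \<otimes> c k) m = r \<odot>\<^bsub>M\<^esub> lcomb M T c m"
  using assms unfolding lcomb_def
  by (subst mod_finsum_smult) (auto intro!: mod_finsum_cong simp: mod_smult_assoc)

lemma lcomb_diff:
  assumes M: "module R M" and "finite T" and c: "\<And>k. k \<in> T \<Longrightarrow> c k \<in> carrier R"
    and m: "\<And>k. k \<in> T \<Longrightarrow> m k \<in> carrier M" "\<And>k. k \<in> T \<Longrightarrow> m' k \<in> carrier M"
  shows "lcomb M T c (\<lambda>k. m k \<ominus>\<^bsub>M\<^esub> m' k) = lcomb M T c m \<ominus>\<^bsub>M\<^esub> lcomb M T c m'"
proof -
  have "lcomb M T c (\<lambda>k. m k \<ominus>\<^bsub>M\<^esub> m' k) \<oplus>\<^bsub>M\<^esub> lcomb M T c m' = lcomb M T c m"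
    using assms
    by (subst lcomb_add[symmetric]) (auto intro!: lcomb_cong)
  moreover have "lcomb M T c m \<in> carrier M" "lcomb M T c m' \<in> carrier M"
    "lcomb M T c (\<lambda>k. m k \<ominus>\<^bsub>M\<^esub> m' k) \<in> carrier M"
    using assms by (auto intro!: lcomb_closed)
  ultimately show ?thesis using M by (metis mod_add_diff_cancel(1))
qed

lemma hom_lcomb:
  assumes "module R M" "module R N" "f \<in> mod_hom R M N" "finite T"
    "\<And>k. k \<in> T \<Longrightarrow> c k \<in> carrier R" "\<And>k. k \<in> T \<Longrightarrow> m k \<in> carrier M"
  shows "f (lcomb M T c m) = lcomb N T c (\<lambda>k. f (m k))"
  using assms unfolding lcomb_def
  by (subst hom_finsum[OF assms(1-4)]) (auto intro!: mod_finsum_cong simp: hom_smult hom_closed)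

lemma lcomb_reindex:
  assumes "module R M" "inj_on h T" "\<And>k. k \<in> T \<Longrightarrow> c (h k) \<in> carrier R"
    "\<And>k. k \<in> T \<Longrightarrow> m (h k) \<in> carrier M"
  shows "lcomb M (h ` T) c m = lcomb M T (\<lambda>k. c (h k)) (\<lambda>k. m (h k))"
  unfolding lcomb_def
  by (rule abelian_monoid.finsum_reindex[OF mod_amon[OF assms(1)]]) (use assms in auto)

lemma lcomb_sub_module:
  assumes M: "module R M" and N: "submodule N R M" and "finite T"
    "\<And>k. k \<in> T \<Longrightarrow> c k \<in> carrier R" "\<And>k. k \<in> T \<Longrightarrow> m k \<in> N"
  shows "lcomb (sub_module M N) T c m = lcomb M T c m"
proof -
  have h: "(\<lambda>x\<in>N. x) \<in> mod_hom R (sub_module M N) M"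
    using hom_restrict[OF M hom_id[OF M] N] submoduleD(1)[OF M N]
    by (simp add: restrict_restrict Int_absorb1)
  have "(\<lambda>x\<in>N. x) (lcomb (sub_module M N) T c m) = lcomb M T c (\<lambda>k. (\<lambda>x\<in>N. x) (m k))"
    by (rule hom_lcomb[OF module_sub_module[OF M N] M h]) (use assms in auto)
  moreover have "lcomb (sub_module M N) T c m \<in> N"
    using lcomb_closed[OF module_sub_module[OF M N]] assms by auto
  moreover have "lcomb M T c (\<lambda>k. (\<lambda>x\<in>N. x) (m k)) = lcomb M T c m"
    by (rule lcomb_cong) (use assms submoduleD(3)[OF M N] in auto)
  ultimately show ?thesis by simp
qed

end

context cring
begin

subsection \<open>Quotients\<close>

lemma submodule_abelian_subgroup:
  assumes "module R M" "submodule N R M"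
  shows "abelian_subgroup N M"
  by (rule abelian_subgroupI3[OF additive_subgroupI mod_agrp])
    (use assms in \<open>auto simp: submodule_def\<close>)

lemma quot_carrier: "carrier (quot_module M N) = (\<lambda>x. N +>\<^bsub>M\<^esub> x) ` carrier M"
  by (auto simp: quot_module_def A_RCOSETS_def' )

lemma coset_eq_iff:
  assumes M: "module R M" and N: "submodule N R M" and x: "x \<in> carrier M" "y \<in> carrier M"
  shows "N +>\<^bsub>M\<^esub> x = N +>\<^bsub>M\<^esub> y \<longleftrightarrow> x \<ominus>\<^bsub>M\<^esub> y \<in> N"
proof -
  interpret abelian_subgroup N M by (rule submodule_abelian_subgroup[OF M N])
  have "N +>\<^bsub>M\<^esub> x = N +>\<^bsub>M\<^esub> y \<longleftrightarrow> x \<in> N +>\<^bsub>M\<^esub> y"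
    using x a_rcos_self a_repr_independence' by metis
  then show ?thesis using x a_rcos_module by (simp add: mod_diff)
qed

lemma coset_eq_zero_iff:
  assumes M: "module R M" and N: "submodule N R M" and x: "x \<in> carrier M"
  shows "N +>\<^bsub>M\<^esub> x = \<zero>\<^bsub>quot_module M N\<^esub> \<longleftrightarrow> x \<in> N"
proof -
  interpret abelian_subgroup N M by (rule submodule_abelian_subgroup[OF M N])
  have "N +>\<^bsub>M\<^esub> \<zero>\<^bsub>M\<^esub> = N" using a_coset_add_zero a_subset by blast
  moreover have "N +>\<^bsub>M\<^esub> x = N +>\<^bsub>M\<^esub> \<zero>\<^bsub>M\<^esub> \<longleftrightarrow> x \<in> N"
    using M x by (subst coset_eq_iff[OF M N x]) (auto simp: mod_diff)
  ultimately show ?thesis by (auto simp: quot_module_def)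
qed

lemma quot_add:
  assumes M: "module R M" and N: "submodule N R M" and x: "x \<in> carrier M" "y \<in> carrier M"
  shows "(N +>\<^bsub>M\<^esub> x) \<oplus>\<^bsub>quot_module M N\<^esub> (N +>\<^bsub>M\<^esub> y) = N +>\<^bsub>M\<^esub> (x \<oplus>\<^bsub>M\<^esub> y)"
proof -
  interpret abelian_subgroup N M by (rule submodule_abelian_subgroup[OF M N])
  show ?thesis using a_rcos_sum x by (simp add: quot_module_def)
qed

lemma quot_smult:
  assumes M: "module R M" and N: "submodule N R M" and x: "x \<in> carrier M" and r: "r \<in> carrier R"
  shows "r \<odot>\<^bsub>quot_module M N\<^esub> (N +>\<^bsub>M\<^esub> x) = N +>\<^bsub>M\<^esub> (r \<odot>\<^bsub>M\<^esub> x)"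
proof -
  interpret abelian_subgroup N M by (rule submodule_abelian_subgroup[OF M N])
  have "N +>\<^bsub>M\<^esub> (r \<odot>\<^bsub>M\<^esub> y) = N +>\<^bsub>M\<^esub> (r \<odot>\<^bsub>M\<^esub> x)" if "y \<in> N +>\<^bsub>M\<^esub> x" for y
  proof -
    have y: "y \<in> carrier M" using that x a_elemrcos_carrier by blast
    then have "y \<ominus>\<^bsub>M\<^esub> x \<in> N" using that x a_rcos_module by (simp add: mod_diff)
    then have "r \<odot>\<^bsub>M\<^esub> y \<ominus>\<^bsub>M\<^esub> r \<odot>\<^bsub>M\<^esub> x \<in> N"
      using submoduleD(6)[OF M N r] mod_smult_diff[OF M r y x] by metis
    then show ?thesis using M N x y r by (simp add: coset_eq_iff)
  qed
  moreover have "x \<in> N +>\<^bsub>M\<^esub> x" using x a_rcos_self by simp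
  ultimately have "(\<Union>y\<in>N +>\<^bsub>M\<^esub> x. N +>\<^bsub>M\<^esub> (r \<odot>\<^bsub>M\<^esub> y)) = N +>\<^bsub>M\<^esub> (r \<odot>\<^bsub>M\<^esub> x)" by blast
  then show ?thesis by (simp add: quot_module_def)
qed

lemma coset_zero:
  assumes M: "module R M" and N: "submodule N R M"
  shows "N +>\<^bsub>M\<^esub> \<zero>\<^bsub>M\<^esub> = \<zero>\<^bsub>quot_module M N\<^esub>"
  using coset_eq_zero_iff[OF M N, of "\<zero>\<^bsub>M\<^esub>"] M N submoduleD(2) by simp

lemma module_quot:
  assumes M: "module R M" and N: "submodule N R M"
  shows "module R (quot_module M N)"
  by (rule module_surj_image[OF M, of "\<lambda>x. N +>\<^bsub>M\<^esub> x"])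
    (use assms in \<open>auto simp: quot_carrier quot_add quot_smult coset_zero\<close>)

lemma quot_proj_hom:
  assumes M: "module R M" and N: "submodule N R M"
  shows "(\<lambda>x\<in>carrier M. N +>\<^bsub>M\<^esub> x) \<in> mod_hom R M (quot_module M N)"
  by (rule mod_homI) (use assms in \<open>auto simp: quot_carrier quot_add quot_smult\<close>)

lemma quot_factor:
  assumes M: "module R M" and N: "submodule N R M" and P: "module R P"
    and f: "f \<in> mod_hom R M P" and z: "\<And>x. x \<in> N \<Longrightarrow> f x = \<zero>\<^bsub>P\<^esub>"
  obtains g where "g \<in> mod_hom R (quot_module M N) P"
    "\<And>x. x \<in> carrier M \<Longrightarrow> g (N +>\<^bsub>M\<^esub> x) = f x"
proof (rule hom_factor_surj[OF M module_quot[OF M N] P quot_proj_hom[OF M N] _ f])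
  show "(\<lambda>x\<in>carrier M. N +>\<^bsub>M\<^esub> x) ` carrier M = carrier (quot_module M N)"
    by (auto simp: quot_carrier)
qed (use z coset_eq_zero_iff[OF M N] that in auto)


subsection \<open>Free modules\<close>

lemma module_regular: "module R (regular_module R)"
proof (rule moduleI)
  show "abelian_group (regular_module R)"
  proof (rule abelian_groupI)
    show "\<exists>y\<in>carrier (regular_module R). y \<oplus>\<^bsub>regular_module R\<^esub> x = \<zero>\<^bsub>regular_module R\<^esub>"
      if "x \<in> carrier (regular_module R)" for x
      using that l_neg[of x] by (intro bexI[of _ "\<ominus> x"]) (simp_all add: regular_module_def)
  qed (simp_all only: regular_module_def a_ac zero_closed l_zero r_zero a_closed partial_object.simps ring.simps)
qed (simp_all only: regular_module_def is_cring l_distr r_distr m_assoc l_one m_closed partial_object.simps monoid.simps ring.simps module.simps)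

lemma regular_simps [simp]:
  "carrier (regular_module R) = carrier R" "zero (regular_module R) = \<zero>"
  "add (regular_module R) = add R" "smult (regular_module R) = mult R"
  by (auto simp: regular_module_def)

lemma free_simps [simp]:
  "zero (free_module R S) = (\<lambda>_. \<zero>)" "add (free_module R S) \<phi> \<psi> = (\<lambda>s. \<phi> s \<oplus> \<psi> s)"
  "smult (free_module R S) r \<phi> = (\<lambda>s. r \<otimes> \<phi> s)"
  by (auto simp: free_module_def)

lemma free_carrier:
  "\<phi> \<in> carrier (free_module R S) \<longleftrightarrow>
    (\<forall>s. \<phi> s \<in> carrier R) \<and> finite {s. \<phi> s \<noteq> \<zero>} \<and> {s. \<phi> s \<noteq> \<zero>} \<subseteq> S"
  by (auto simp: free_module_def)

lemma free_carrierI: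
  "\<lbrakk>\<And>s. \<phi> s \<in> carrier R; finite T; \<And>s. \<phi> s \<noteq> \<zero> \<Longrightarrow> s \<in> T \<and> s \<in> S\<rbrakk> \<Longrightarrow>
    \<phi> \<in> carrier (free_module R S)"
  unfolding free_carrier by (auto intro: finite_subset[of _ T])

lemma free_carrierD:
  assumes "\<phi> \<in> carrier (free_module R S)"
  shows "\<phi> s \<in> carrier R" "finite {s. \<phi> s \<noteq> \<zero>}" "\<phi> s \<noteq> \<zero> \<Longrightarrow> s \<in> S"
  using assms by (auto simp: free_carrier)

lemma module_free: "module R (free_module R S)"
proof (rule moduleI)
  have add: "(\<lambda>s. \<phi> s \<oplus> \<psi> s) \<in> carrier (free_module R S)"
    if "\<phi> \<in> carrier (free_module R S)" "\<psi> \<in> carrier (free_module R S)" for \<phi> \<psi>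
  proof (rule free_carrierI)
    show "finite ({s. \<phi> s \<noteq> \<zero>} \<union> {s. \<psi> s \<noteq> \<zero>})" using that by (simp add: free_carrierD)
    show "s \<in> {s. \<phi> s \<noteq> \<zero>} \<union> {s. \<psi> s \<noteq> \<zero>} \<and> s \<in> S" if "\<phi> s \<oplus> \<psi> s \<noteq> \<zero>" for s
      using that free_carrierD(3)[OF \<open>\<phi> \<in> _\<close>, of s] free_carrierD(3)[OF \<open>\<psi> \<in> _\<close>, of s]
      using \<open>\<psi> \<in> _\<close> by (cases "\<phi> s = \<zero>") (auto simp: free_carrierD)
  qed (use that in \<open>simp add: free_carrierD\<close>)
  have smult: "(\<lambda>s. r \<otimes> \<phi> s) \<in> carrier (free_module R S)"
    if "\<phi> \<in> carrier (free_module R S)" "r \<in> carrier R" for r \<phi>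
  proof (rule free_carrierI)
    show "finite {s. \<phi> s \<noteq> \<zero>}" using that by (simp add: free_carrierD)
    show "s \<in> {s. \<phi> s \<noteq> \<zero>} \<and> s \<in> S" if "r \<otimes> \<phi> s \<noteq> \<zero>" for s
      using that free_carrierD(3)[OF \<open>\<phi> \<in> _\<close>, of s] \<open>r \<in> _\<close> by (cases "\<phi> s = \<zero>") auto
  qed (use that in \<open>simp add: free_carrierD\<close>)
  show "r \<odot>\<^bsub>free_module R S\<^esub> \<phi> \<in> carrier (free_module R S)"
    if "r \<in> carrier R" "\<phi> \<in> carrier (free_module R S)" for r \<phi>
    using smult that by simp
  show "abelian_group (free_module R S)"
  proof (rule abelian_groupI)
    fix \<phi> assume p: "\<phi> \<in> carrier (free_module R S)"
    show "\<exists>\<psi>\<in>carrier (free_module R S). \<psi> \<oplus>\<^bsub>free_module R S\<^esub> \<phi> = \<zero>\<^bsub>free_module R S\<^esub>"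
      by (rule bexI[OF _ smult[OF p, of "\<ominus> \<one>"]])
        (use p in \<open>auto simp: free_carrier l_minus l_neg\<close>)
    fix \<psi> assume q: "\<psi> \<in> carrier (free_module R S)"
    show "\<phi> \<oplus>\<^bsub>free_module R S\<^esub> \<psi> = \<psi> \<oplus>\<^bsub>free_module R S\<^esub> \<phi>"
      using p q by (auto simp: free_carrier a_comm)
    show "\<phi> \<oplus>\<^bsub>free_module R S\<^esub> \<psi> \<in> carrier (free_module R S)" using add[OF p q] by simp
  qed (auto simp: free_carrier a_assoc)
qed (auto simp: free_carrier is_cring l_distr r_distr m_assoc)

lemma free_gen_closed [simp]: "s \<in> S \<Longrightarrow> free_gen R s \<in> carrier (free_module R S)"
proof -
  show "s \<in> S \<Longrightarrow> ?thesis"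
    by (rule free_carrierI[of _ "{s}"]) (auto simp: free_gen_def split: if_splits)
qed

lemma free_coord_hom:
  "(\<lambda>\<phi>\<in>carrier (free_module R S). \<phi> t) \<in> mod_hom R (free_module R S) (regular_module R)"
  by (rule mod_homI[OF module_free]) (auto simp: free_carrier)

lemma lcomb_free_apply:
  assumes "finite T" "\<And>k. k \<in> T \<Longrightarrow> c k \<in> carrier R"
    "\<And>k. k \<in> T \<Longrightarrow> m k \<in> carrier (free_module R S)"
  shows "lcomb (free_module R S) T c m t = lcomb (regular_module R) T c (\<lambda>k. m k t)"
proof -
  have h: "(\<lambda>\<phi>\<in>carrier (free_module R S). \<phi> t) \<in> mod_hom R (free_module R S) (regular_module R)"
    by (rule free_coord_hom)
  have "lcomb (free_module R S) T c m \<in> carrier (free_module R S)"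
    using assms by (auto intro: lcomb_closed module_free)
  then have "lcomb (free_module R S) T c m t =
      lcomb (regular_module R) T c (\<lambda>k. (\<lambda>\<phi>\<in>carrier (free_module R S). \<phi> t) (m k))"
    using hom_lcomb[OF module_free module_regular h, of T c m] assms by simp
  also have "\<dots> = lcomb (regular_module R) T c (\<lambda>k. m k t)"
    by (rule lcomb_cong[OF module_regular]) (use assms in \<open>auto simp: free_carrier\<close>)
  finally show ?thesis .
qed

lemma free_expand:
  assumes p: "\<phi> \<in> carrier (free_module R S)" and T: "finite T" "{s. \<phi> s \<noteq> \<zero>} \<subseteq> T" "T \<subseteq> S"
  shows "lcomb (free_module R S) T \<phi> (free_gen R) = \<phi>"
proof
  fix t
  have pc: "\<phi> s \<in> carrier R" for s using p by (auto simp: free_carrier)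
  have "lcomb (free_module R S) T \<phi> (free_gen R) t =
      lcomb (regular_module R) T \<phi> (\<lambda>k. free_gen R k t)"
    by (rule lcomb_free_apply) (use T pc in auto)
  also have "\<dots> = \<phi> t"
  proof (cases "t \<in> T")
    case True
    then show ?thesis
      by (subst lcomb_single[OF module_regular, of _ t])
        (use T pc in \<open>auto simp: free_gen_def\<close>)
  next
    case False
    then have "\<phi> t = \<zero>" using T by auto
    with False show ?thesis
      by (subst lcomb_zero[OF module_regular]) (use pc in \<open>auto simp: free_gen_def\<close>)
  qed
  finally show "lcomb (free_module R S) T \<phi> (free_gen R) t = \<phi> t" .
qed

definition free_lift :: "('a,'c) module \<Rightarrow> 's set \<Rightarrow> ('s \<Rightarrow> 'c) \<Rightarrow> ('s \<Rightarrow> 'a) \<Rightarrow> 'c" where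
  "free_lift P S g = (\<lambda>\<phi>\<in>carrier (free_module R S). lcomb P {s. \<phi> s \<noteq> \<zero>} \<phi> g)"

lemma free_lift_eq:
  assumes P: "module R P" and g: "\<And>s. s \<in> S \<Longrightarrow> g s \<in> carrier P"
    and p: "\<phi> \<in> carrier (free_module R S)" and T: "finite T" "{s. \<phi> s \<noteq> \<zero>} \<subseteq> T" "T \<subseteq> S"
  shows "free_lift P S g \<phi> = lcomb P T \<phi> g"
proof -
  have "lcomb P T \<phi> g = lcomb P {s. \<phi> s \<noteq> \<zero>} \<phi> g"
    by (rule lcomb_mono[OF P T(1,2)]) (use p g T in \<open>auto simp: free_carrier\<close>)
  then show ?thesis using p by (simp add: free_lift_def)
qed

lemma free_lift_hom:
  assumes P: "module R P" and g: "\<And>s. s \<in> S \<Longrightarrow> g s \<in> carrier P"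
  shows "free_lift P S g \<in> mod_hom R (free_module R S) P"
proof -
  let ?F = "free_module R S" and ?h = "\<lambda>\<phi>. lcomb P {s. \<phi> s \<noteq> \<zero>} \<phi> g"
  have r: "free_lift P S g = restrict (free_lift P S g) (carrier ?F)"
    by (simp add: free_lift_def restrict_restrict)
  show ?thesis
  proof (subst r, rule mod_homI[OF module_free])
    fix \<phi> assume p: "\<phi> \<in> carrier ?F"
    let ?T = "{s. \<phi> s \<noteq> \<zero>}"
    have pT: "finite ?T" "?T \<subseteq> S" "\<And>s. \<phi> s \<in> carrier R" using p by (auto simp: free_carrier)
    show "free_lift P S g \<phi> \<in> carrier P" 
      using p pT g P by (auto simp: free_lift_def intro!: lcomb_closed)
    show "free_lift P S g (r \<odot>\<^bsub>?F\<^esub> \<phi>) = r \<odot>\<^bsub>P\<^esub> free_lift P S g \<phi>" if r: "r \<in> carrier R" for r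
    proof -
      have c: "r \<odot>\<^bsub>?F\<^esub> \<phi> \<in> carrier ?F" by (rule mod_smult_closed[OF module_free r p])
      have "free_lift P S g (r \<odot>\<^bsub>?F\<^esub> \<phi>) = lcomb P ?T (r \<odot>\<^bsub>?F\<^esub> \<phi>) g"
        by (rule free_lift_eq[OF P g c]) (use pT r in auto)
      also have "\<dots> = r \<odot>\<^bsub>P\<^esub> lcomb P ?T \<phi> g"
        using lcomb_smult_coeff[OF P pT(1) r, of \<phi> g] pT g by auto
      finally show ?thesis using p by (simp add: free_lift_def)
    qed
    fix \<psi> assume q: "\<psi> \<in> carrier ?F"
    let ?U = "{s. \<psi> s \<noteq> \<zero>}"
    have qT: "finite ?U" "?U \<subseteq> S" "\<And>s. \<psi> s \<in> carrier R" using q by (auto simp: free_carrier)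
    have c: "\<phi> \<oplus>\<^bsub>?F\<^esub> \<psi> \<in> carrier ?F" by (rule mod_add_closed[OF module_free p q])
    have "free_lift P S g (\<phi> \<oplus>\<^bsub>?F\<^esub> \<psi>) = lcomb P (?T \<union> ?U) (\<phi> \<oplus>\<^bsub>?F\<^esub> \<psi>) g"
      by (rule free_lift_eq[OF P g c]) (use pT qT in auto)
    also have "\<dots> = lcomb P (?T \<union> ?U) \<phi> g \<oplus>\<^bsub>P\<^esub> lcomb P (?T \<union> ?U) \<psi> g"
      unfolding free_simps by (rule lcomb_add_coeff[OF P]) (use pT qT g in auto)
    also have "lcomb P (?T \<union> ?U) \<phi> g = free_lift P S g \<phi>"
      by (rule free_lift_eq[OF P g p, symmetric]) (use pT qT in auto)
    also have "lcomb P (?T \<union> ?U) \<psi> g = free_lift P S g \<psi>"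
      by (rule free_lift_eq[OF P g q, symmetric]) (use pT qT in auto)
    finally show "free_lift P S g (\<phi> \<oplus>\<^bsub>?F\<^esub> \<psi>) = free_lift P S g \<phi> \<oplus>\<^bsub>P\<^esub> free_lift P S g \<psi>" .
  qed
qed

lemma free_lift_gen:
  assumes P: "module R P" and g: "\<And>s. s \<in> S \<Longrightarrow> g s \<in> carrier P" and s: "s \<in> S"
  shows "free_lift P S g (free_gen R s) = g s"
proof -
  have "free_lift P S g (free_gen R s) = lcomb P {s} (free_gen R s) g"
    by (rule free_lift_eq[OF P g free_gen_closed[OF s]]) (use s in \<open>auto simp: free_gen_def\<close>)
  also have "\<dots> = g s"
    by (subst lcomb_single[OF P, of _ s]) (use g s P in \<open>auto simp: free_gen_def\<close>)
  finally show ?thesis .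
qed

lemma free_eval_eq: "free_eval R M S = free_lift M S (\<lambda>s. s)"
  by (auto simp: free_eval_def free_lift_def lcomb_def)


subsection \<open>Tensor products\<close>

lemma tensor_rels_cases:
  assumes "u \<in> tensor_rels R M N"
  defines "F \<equiv> free_module R (carrier M \<times> carrier N)"
  obtains
    (addl) x x' y where "x \<in> carrier M" "x' \<in> carrier M" "y \<in> carrier N"
      "u = free_gen R (x \<oplus>\<^bsub>M\<^esub> x', y) \<ominus>\<^bsub>F\<^esub> (free_gen R (x, y) \<oplus>\<^bsub>F\<^esub> free_gen R (x', y))"
  | (addr) x y y' where "x \<in> carrier M" "y \<in> carrier N" "y' \<in> carrier N"
      "u = free_gen R (x, y \<oplus>\<^bsub>N\<^esub> y') \<ominus>\<^bsub>F\<^esub> (free_gen R (x, y) \<oplus>\<^bsub>F\<^esub> free_gen R (x, y'))"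
  | (sml) r x y where "r \<in> carrier R" "x \<in> carrier M" "y \<in> carrier N"
      "u = free_gen R (r \<odot>\<^bsub>M\<^esub> x, y) \<ominus>\<^bsub>F\<^esub> (r \<odot>\<^bsub>F\<^esub> free_gen R (x, y))"
  | (smr) r x y where "r \<in> carrier R" "x \<in> carrier M" "y \<in> carrier N"
      "u = free_gen R (x, r \<odot>\<^bsub>N\<^esub> y) \<ominus>\<^bsub>F\<^esub> (r \<odot>\<^bsub>F\<^esub> free_gen R (x, y))"
  using assms(1) unfolding tensor_rels_def Let_def F_def[symmetric] by blast

lemma free_gen_pair_closed [simp]:
  "\<lbrakk>x \<in> carrier M; y \<in> carrier N\<rbrakk> \<Longrightarrow>
    free_gen R (x, y) \<in> carrier (free_module R (carrier M \<times> carrier N))"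
  by simp

lemma tensor_rels_subset:
  assumes M: "module R M" and N: "module R N"
  shows "tensor_rels R M N \<subseteq> carrier (free_module R (carrier M \<times> carrier N))"
proof
  let ?F = "free_module R (carrier M \<times> carrier N)"
  note F = module_free[of "carrier M \<times> carrier N"]
  fix u assume "u \<in> tensor_rels R M N"
  then show "u \<in> carrier ?F"
    by (cases rule: tensor_rels_cases)
      (auto intro!: mod_diff_closed[OF F] mod_add_closed[OF F] mod_smult_closed[OF F]
        free_gen_pair_closed simp: M N simp del: free_simps)
qed

lemma tensor_kernel_submodule:
  assumes M: "module R M" and N: "module R N"
  shows "submodule (tensor_kernel R M N) R (free_module R (carrier M \<times> carrier N))"
  unfolding tensor_kernel_def
  by (rule module_span_submodule[OF module_free tensor_rels_subset[OF M N]])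

lemma module_tensor: "\<lbrakk>module R M; module R N\<rbrakk> \<Longrightarrow> module R (tensor R M N)"
  unfolding tensor_def by (intro module_quot module_free tensor_kernel_submodule)

lemma pure_tensor_closed [simp]:
  "\<lbrakk>x \<in> carrier M; y \<in> carrier N\<rbrakk> \<Longrightarrow> pure_tensor R M N x y \<in> carrier (tensor R M N)"
  by (auto simp: tensor_def pure_tensor_def quot_carrier)

lemma tensor_rels_intros:
  fixes M :: "('a,'x) module" and N :: "('a,'y) module"
  defines "F \<equiv> free_module R (carrier M \<times> carrier N)"
  shows "\<lbrakk>x \<in> carrier M; x' \<in> carrier M; y \<in> carrier N\<rbrakk> \<Longrightarrow>
      free_gen R (x \<oplus>\<^bsub>M\<^esub> x', y) \<ominus>\<^bsub>F\<^esub> (free_gen R (x, y) \<oplus>\<^bsub>F\<^esub> free_gen R (x', y))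
        \<in> tensor_rels R M N"
    and "\<lbrakk>x \<in> carrier M; y \<in> carrier N; y' \<in> carrier N\<rbrakk> \<Longrightarrow>
      free_gen R (x, y \<oplus>\<^bsub>N\<^esub> y') \<ominus>\<^bsub>F\<^esub> (free_gen R (x, y) \<oplus>\<^bsub>F\<^esub> free_gen R (x, y'))
        \<in> tensor_rels R M N"
    and "\<lbrakk>r \<in> carrier R; x \<in> carrier M; y \<in> carrier N\<rbrakk> \<Longrightarrow>
      free_gen R (r \<odot>\<^bsub>M\<^esub> x, y) \<ominus>\<^bsub>F\<^esub> (r \<odot>\<^bsub>F\<^esub> free_gen R (x, y)) \<in> tensor_rels R M N"
    and "\<lbrakk>r \<in> carrier R; x \<in> carrier M; y \<in> carrier N\<rbrakk> \<Longrightarrow>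
      free_gen R (x, r \<odot>\<^bsub>N\<^esub> y) \<ominus>\<^bsub>F\<^esub> (r \<odot>\<^bsub>F\<^esub> free_gen R (x, y)) \<in> tensor_rels R M N"
  unfolding tensor_rels_def Let_def F_def[symmetric] by blast+

lemma pure_tensor_bilinear:
  assumes M: "module R M" and N: "module R N"
  shows "\<lbrakk>x \<in> carrier M; x' \<in> carrier M; y \<in> carrier N\<rbrakk> \<Longrightarrow>
      pure_tensor R M N (x \<oplus>\<^bsub>M\<^esub> x') y =
        pure_tensor R M N x y \<oplus>\<^bsub>tensor R M N\<^esub> pure_tensor R M N x' y"
    and "\<lbrakk>x \<in> carrier M; y \<in> carrier N; y' \<in> carrier N\<rbrakk> \<Longrightarrow>
      pure_tensor R M N x (y \<oplus>\<^bsub>N\<^esub> y') =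
        pure_tensor R M N x y \<oplus>\<^bsub>tensor R M N\<^esub> pure_tensor R M N x y'"
    and "\<lbrakk>r \<in> carrier R; x \<in> carrier M; y \<in> carrier N\<rbrakk> \<Longrightarrow>
      pure_tensor R M N (r \<odot>\<^bsub>M\<^esub> x) y = r \<odot>\<^bsub>tensor R M N\<^esub> pure_tensor R M N x y"
    and "\<lbrakk>r \<in> carrier R; x \<in> carrier M; y \<in> carrier N\<rbrakk> \<Longrightarrow>
      pure_tensor R M N x (r \<odot>\<^bsub>N\<^esub> y) = r \<odot>\<^bsub>tensor R M N\<^esub> pure_tensor R M N x y"
proof -
  let ?F = "free_module R (carrier M \<times> carrier N)" and ?K = "tensor_kernel R M N"
  note K = tensor_kernel_submodule[OF M N]
  note F = module_free[of "carrier M \<times> carrier N"]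
  note gc = free_gen_pair_closed[of _ M _ N]
  have *: "pure_tensor R M N a b = v"
    if "v = ?K +>\<^bsub>?F\<^esub> w" "free_gen R (a,b) \<ominus>\<^bsub>?F\<^esub> w \<in> tensor_rels R M N"
      "a \<in> carrier M" "b \<in> carrier N" "w \<in> carrier ?F" for a b v w
  proof -
    have "free_gen R (a,b) \<ominus>\<^bsub>?F\<^esub> w \<in> ?K"
      using that(2) module_span_superset unfolding tensor_kernel_def by (rule subsetD[rotated])
    then show ?thesis
      unfolding pure_tensor_def that(1) by (subst coset_eq_iff[OF F K gc]) (use that in auto)
  qed
  have A: "pure_tensor R M N a b \<oplus>\<^bsub>tensor R M N\<^esub> pure_tensor R M N a' b' =
      ?K +>\<^bsub>?F\<^esub> (free_gen R (a,b) \<oplus>\<^bsub>?F\<^esub> free_gen R (a',b'))"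
    if "a \<in> carrier M" "b \<in> carrier N" "a' \<in> carrier M" "b' \<in> carrier N" for a b a' b'
    unfolding pure_tensor_def tensor_def using that by (intro quot_add[OF F K] gc)
  have S: "r \<odot>\<^bsub>tensor R M N\<^esub> pure_tensor R M N a b = ?K +>\<^bsub>?F\<^esub> (r \<odot>\<^bsub>?F\<^esub> free_gen R (a,b))"
    if "r \<in> carrier R" "a \<in> carrier M" "b \<in> carrier N" for r a b
    unfolding pure_tensor_def tensor_def using that by (intro quot_smult[OF F K] gc)
  note c = gc mod_add_closed[OF M] mod_add_closed[OF N] mod_smult_closed[OF M]
    mod_smult_closed[OF N] mod_add_closed[OF F] mod_smult_closed[OF F]
  show "pure_tensor R M N (x \<oplus>\<^bsub>M\<^esub> x') y =
      pure_tensor R M N x y \<oplus>\<^bsub>tensor R M N\<^esub> pure_tensor R M N x' y"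
    if "x \<in> carrier M" "x' \<in> carrier M" "y \<in> carrier N"
    by (rule *[OF A[OF that(1,3) that(2,3)] tensor_rels_intros(1)[OF that]]; intro c that)
  show "pure_tensor R M N x (y \<oplus>\<^bsub>N\<^esub> y') =
      pure_tensor R M N x y \<oplus>\<^bsub>tensor R M N\<^esub> pure_tensor R M N x y'"
    if "x \<in> carrier M" "y \<in> carrier N" "y' \<in> carrier N"
    by (rule *[OF A[OF that(1,2) that(1,3)] tensor_rels_intros(2)[OF that]]; intro c that)
  show "pure_tensor R M N (r \<odot>\<^bsub>M\<^esub> x) y = r \<odot>\<^bsub>tensor R M N\<^esub> pure_tensor R M N x y"
    if "r \<in> carrier R" "x \<in> carrier M" "y \<in> carrier N"
    by (rule *[OF S[OF that] tensor_rels_intros(3)[OF that]]; intro c that)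
  show "pure_tensor R M N x (r \<odot>\<^bsub>N\<^esub> y) = r \<odot>\<^bsub>tensor R M N\<^esub> pure_tensor R M N x y"
    if "r \<in> carrier R" "x \<in> carrier M" "y \<in> carrier N"
    by (rule *[OF S[OF that] tensor_rels_intros(4)[OF that]]; intro c that)
qed

lemma pure_tensor_homs:
  assumes M: "module R M" and N: "module R N"
  shows "y \<in> carrier N \<Longrightarrow> (\<lambda>x\<in>carrier M. pure_tensor R M N x y) \<in> mod_hom R M (tensor R M N)"
    and "x \<in> carrier M \<Longrightarrow> (\<lambda>y\<in>carrier N. pure_tensor R M N x y) \<in> mod_hom R N (tensor R M N)"
  by (rule mod_homI; simp add: pure_tensor_bilinear M N)+

lemma tensor_induct [consumes 3, case_names pure add smult]:
  assumes M: "module R M" and N: "module R N" and z: "z \<in> carrier (tensor R M N)"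
    and pure: "\<And>x y. \<lbrakk>x \<in> carrier M; y \<in> carrier N\<rbrakk> \<Longrightarrow> Q (pure_tensor R M N x y)"
    and add: "\<And>u v. \<lbrakk>u \<in> carrier (tensor R M N); v \<in> carrier (tensor R M N); Q u; Q v\<rbrakk> \<Longrightarrow>
      Q (u \<oplus>\<^bsub>tensor R M N\<^esub> v)"
    and smult: "\<And>r u. \<lbrakk>r \<in> carrier R; u \<in> carrier (tensor R M N); Q u\<rbrakk> \<Longrightarrow>
      Q (r \<odot>\<^bsub>tensor R M N\<^esub> u)"
  shows "Q z"
proof -
  let ?F = "free_module R (carrier M \<times> carrier N)" and ?K = "tensor_kernel R M N"
    and ?T = "tensor R M N"
  let ?p = "\<lambda>\<phi>\<in>carrier ?F. ?K +>\<^bsub>?F\<^esub> \<phi>"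
  note F = module_free[of "carrier M \<times> carrier N"] and T = module_tensor[OF M N]
  have p: "?p \<in> mod_hom R ?F ?T"
    unfolding tensor_def by (rule quot_proj_hom[OF F tensor_kernel_submodule[OF M N]])
  have Q0: "Q \<zero>\<^bsub>?T\<^esub>"
    using smult[OF _ _ pure, of \<zero> "\<zero>\<^bsub>M\<^esub>" "\<zero>\<^bsub>N\<^esub>"] M N T by simp
  have sub: "submodule {z \<in> carrier ?T. Q z} R ?T"
    by (rule submoduleI'[OF T]) (use T Q0 add smult in auto)
  obtain \<phi> where phi: "\<phi> \<in> carrier ?F" "z = ?p \<phi>"
    using z by (auto simp: tensor_def quot_carrier)
  let ?S = "{s. \<phi> s \<noteq> \<zero>}"
  have S: "finite ?S" "?S \<subseteq> carrier M \<times> carrier N" "\<And>s. \<phi> s \<in> carrier R"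
    using phi by (auto simp: free_carrier)
  have "z = ?p (lcomb ?F ?S \<phi> (free_gen R))"
    using phi S by (subst free_expand[OF phi(1)]) auto
  also have "\<dots> = lcomb ?T ?S \<phi> (\<lambda>s. ?p (free_gen R s))"
    by (rule hom_lcomb[OF F T p]) (use S in auto)
  also have "\<dots> \<in> {z \<in> carrier ?T. Q z}" unfolding lcomb_def
  proof (rule finsum_submodule[OF T sub S(1)])
    fix s assume s: "s \<in> ?S"
    obtain x y where xy: "s = (x,y)" "x \<in> carrier M" "y \<in> carrier N" using s S(2) by auto
    have "?p (free_gen R s) = pure_tensor R M N x y"
      using xy by (simp add: pure_tensor_def)
    then show "\<phi> s \<odot>\<^bsub>?T\<^esub> ?p (free_gen R s) \<in> {z \<in> carrier ?T. Q z}"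
      using xy pure S(3) by (intro submoduleD(6)[OF T sub]) auto
  qed
  finally show ?thesis by simp
qed

lemma tensor_hom_eq:
  assumes M: "module R M" and N: "module R N"
    and f: "f \<in> mod_hom R (tensor R M N) P" and g: "g \<in> mod_hom R (tensor R M N) P"
    and eq: "\<And>x y. \<lbrakk>x \<in> carrier M; y \<in> carrier N\<rbrakk> \<Longrightarrow>
      f (pure_tensor R M N x y) = g (pure_tensor R M N x y)"
    and z: "z \<in> carrier (tensor R M N)"
  shows "f z = g z"
  using M N z by (induction z rule: tensor_induct) (use eq f g in \<open>auto simp: hom_add hom_smult\<close>)

lemma tensor_lift:
  assumes M: "module R M" and N: "module R N" and P: "module R P"
    and closed: "\<And>x y. \<lbrakk>x \<in> carrier M; y \<in> carrier N\<rbrakk> \<Longrightarrow> \<beta> x y \<in> carrier P"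
    and addl: "\<And>x x' y. \<lbrakk>x \<in> carrier M; x' \<in> carrier M; y \<in> carrier N\<rbrakk> \<Longrightarrow>
      \<beta> (x \<oplus>\<^bsub>M\<^esub> x') y = \<beta> x y \<oplus>\<^bsub>P\<^esub> \<beta> x' y"
    and addr: "\<And>x y y'. \<lbrakk>x \<in> carrier M; y \<in> carrier N; y' \<in> carrier N\<rbrakk> \<Longrightarrow>
      \<beta> x (y \<oplus>\<^bsub>N\<^esub> y') = \<beta> x y \<oplus>\<^bsub>P\<^esub> \<beta> x y'"
    and sml: "\<And>r x y. \<lbrakk>r \<in> carrier R; x \<in> carrier M; y \<in> carrier N\<rbrakk> \<Longrightarrow>
      \<beta> (r \<odot>\<^bsub>M\<^esub> x) y = r \<odot>\<^bsub>P\<^esub> \<beta> x y"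
    and smr: "\<And>r x y. \<lbrakk>r \<in> carrier R; x \<in> carrier M; y \<in> carrier N\<rbrakk> \<Longrightarrow>
      \<beta> x (r \<odot>\<^bsub>N\<^esub> y) = r \<odot>\<^bsub>P\<^esub> \<beta> x y"
  obtains h where "h \<in> mod_hom R (tensor R M N) P"
    "\<And>x y. \<lbrakk>x \<in> carrier M; y \<in> carrier N\<rbrakk> \<Longrightarrow> h (pure_tensor R M N x y) = \<beta> x y"
proof -
  let ?C = "carrier M \<times> carrier N"
  let ?F = "free_module R ?C" and ?K = "tensor_kernel R M N"
  note F = module_free[of ?C]
  have cl: "case_prod \<beta> s \<in> carrier P" if "s \<in> ?C" for s using that closed by auto
  let ?h = "free_lift P ?C (case_prod \<beta>)"
  have h: "?h \<in> mod_hom R ?F P" by (rule free_lift_hom[OF P cl])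
  have hg: "?h (free_gen R (x,y)) = \<beta> x y" if "x \<in> carrier M" "y \<in> carrier N" for x y
    using free_lift_gen[OF P cl, where s="(x,y)"] that by simp
  let ?Z = "{u \<in> carrier ?F. ?h u = \<zero>\<^bsub>P\<^esub>}"
  have Z: "submodule ?Z R ?F" by (rule kernel_submodule[OF F P h])
  have gc: "free_gen R (x,y) \<in> carrier ?F" if "x \<in> carrier M" "y \<in> carrier N" for x y
    using that by simp
  have dz: "?h (u \<ominus>\<^bsub>?F\<^esub> v) = \<zero>\<^bsub>P\<^esub>"
    if "u \<in> carrier ?F" "v \<in> carrier ?F" "?h u = ?h v" for u v
    using that F P h by (simp add: hom_diff hom_closed mod_diff_eq_zero)
  have "tensor_rels R M N \<subseteq> ?Z"
  proof
    fix u assume u: "u \<in> tensor_rels R M N"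
    have ha: "?h (free_gen R (a,b) \<oplus>\<^bsub>?F\<^esub> free_gen R (a',b')) = \<beta> a b \<oplus>\<^bsub>P\<^esub> \<beta> a' b'"
      if "a \<in> carrier M" "b \<in> carrier N" "a' \<in> carrier M" "b' \<in> carrier N" for a b a' b'
      using that by (simp only: hom_add[OF h] gc hg)
    have hs: "?h (r \<odot>\<^bsub>?F\<^esub> free_gen R (a,b)) = r \<odot>\<^bsub>P\<^esub> \<beta> a b"
      if "r \<in> carrier R" "a \<in> carrier M" "b \<in> carrier N" for r a b
      using that by (simp only: hom_smult[OF h] gc hg)
    have "?h u = \<zero>\<^bsub>P\<^esub>"
      using u
    proof (cases rule: tensor_rels_cases)
      case (addl x x' y)
      show ?thesis unfolding addl(4)
        by (rule dz) (use addl(1-3) M N in \<open>simp_all only: gc mod_add_closed[OF F] mod_add_closed ha hg\<close>, simp add: assms(5))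
    next
      case (addr x y y')
      show ?thesis unfolding addr(4)
        by (rule dz) (use addr(1-3) M N in \<open>simp_all only: gc mod_add_closed[OF F] mod_add_closed ha hg\<close>, simp add: assms(6))
    next
      case (sml r x y)
      show ?thesis unfolding sml(4)
        by (rule dz) (use sml(1-3) M N in \<open>simp_all only: gc mod_smult_closed[OF F] mod_smult_closed hs hg\<close>, simp add: assms(7))
    next
      case (smr r x y)
      show ?thesis unfolding smr(4)
        by (rule dz) (use smr(1-3) M N in \<open>simp_all only: gc mod_smult_closed[OF F] mod_smult_closed hs hg\<close>, simp add: assms(8))
    qed
    then show "u \<in> ?Z" using u tensor_rels_subset[OF M N] by auto
  qed
  then have "?K \<subseteq> ?Z" unfolding tensor_kernel_def by (rule module_span_min[OF Z])
  then have z: "?h u = \<zero>\<^bsub>P\<^esub>" if "u \<in> ?K" for u using that by auto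
  obtain g where g: "g \<in> mod_hom R (quot_module ?F ?K) P"
    "\<And>x. x \<in> carrier ?F \<Longrightarrow> g (?K +>\<^bsub>?F\<^esub> x) = ?h x"
    using quot_factor[OF F tensor_kernel_submodule[OF M N] P h z] by blast
  show ?thesis
  proof
    show "g \<in> mod_hom R (tensor R M N) P" using g by (simp add: tensor_def)
    show "g (pure_tensor R M N x y) = \<beta> x y" if "x \<in> carrier M" "y \<in> carrier N" for x y
      using that g(2)[OF gc] hg by (simp add: pure_tensor_def)
  qed
qed

text \<open>Elementary tensors generate the tensor product, so that at most one homomorphism has the prescribed
  values on them; the universal property provides one.\<close>

lemma tensor_map:
  assumes M: "module R M" and M': "module R M'" and N: "module R N" and f: "f \<in> mod_hom R M M'"
  shows "tensor_map R M M' N f \<in> mod_hom R (tensor R M N) (tensor R M' N)"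
    and "\<lbrakk>x \<in> carrier M; y \<in> carrier N\<rbrakk> \<Longrightarrow>
      tensor_map R M M' N f (pure_tensor R M N x y) = pure_tensor R M' N (f x) y"
proof -
  let ?P = "\<lambda>h. h \<in> mod_hom R (tensor R M N) (tensor R M' N) \<and>
     (\<forall>x\<in>carrier M. \<forall>y\<in>carrier N. h (pure_tensor R M N x y) = pure_tensor R M' N (f x) y)"
  obtain h where "h \<in> mod_hom R (tensor R M N) (tensor R M' N)"
    "\<And>x y. \<lbrakk>x \<in> carrier M; y \<in> carrier N\<rbrakk> \<Longrightarrow>
      h (pure_tensor R M N x y) = pure_tensor R M' N (f x) y"
    using tensor_lift[OF M N module_tensor[OF M' N], of "\<lambda>x y. pure_tensor R M' N (f x) y"]
    by (auto simp: M M' N pure_tensor_bilinear hom_closed[OF f] hom_add[OF f] hom_smult[OF f])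
  then have h: "?P h" by auto
  have "?P (THE h. ?P h)"
  proof (rule theI[of ?P, OF h])
    show "k = h" if "?P k" for k
      using tensor_hom_eq[OF M N, of k "tensor R M' N" h] that h by (intro hom_eqI[of k _ _ h]) auto
  qed
  then have *: "?P (tensor_map R M M' N f)" by (simp add: tensor_map_def)
  show "tensor_map R M M' N f \<in> mod_hom R (tensor R M N) (tensor R M' N)" using * by blast
  show "\<lbrakk>x \<in> carrier M; y \<in> carrier N\<rbrakk> \<Longrightarrow>
      tensor_map R M M' N f (pure_tensor R M N x y) = pure_tensor R M' N (f x) y"
    using * by blast
qed

end

section \<open>GV-ideals\<close>

context cring
begin

lemma minus_eq_zeroD: "\<lbrakk>r \<ominus> s = \<zero>; r \<in> carrier R; s \<in> carrier R\<rbrakk> \<Longrightarrow> r = s"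
  by (metis a_minus_def minus_equality minus_minus a_inv_closed)

lemma fg_ideal_ideal: "fg_ideal R J \<Longrightarrow> ideal J R"
  unfolding fg_ideal_def by (auto intro: genideal_ideal)

lemma GV_idealD:
  assumes "J \<in> GV_ideals R"
  shows "fg_ideal R J" "J \<subseteq> carrier R"
proof -
  show "fg_ideal R J" using assms by (simp add: GV_ideals_def)
  from ideal.Icarr[OF fg_ideal_ideal[OF this]] show "J \<subseteq> carrier R" by (rule subsetI)
qed

lemma ideal_submodule:
  assumes I: "ideal J R"
  shows "submodule J R (regular_module R)"
proof (rule submoduleI'[OF module_regular])
  show "J \<subseteq> carrier (regular_module R)" using ideal.Icarr[OF I] by (simp add: subset_iff)
  show "\<zero>\<^bsub>regular_module R\<^esub> \<in> J"
    using additive_subgroup.zero_closed[OF ideal.axioms(1)[OF I]] by simp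
  show "x \<oplus>\<^bsub>regular_module R\<^esub> y \<in> J" if "x \<in> J" "y \<in> J" for x y
    using additive_subgroup.a_closed[OF ideal.axioms(1)[OF I] that] by simp
  show "r \<odot>\<^bsub>regular_module R\<^esub> x \<in> J" if "r \<in> carrier R" "x \<in> J" for r x
    using ideal.I_l_closed[OF I that(2,1)] by simp
qed

text \<open>The natural homomorphism \<open>R \<rightarrow> Hom(J,R)\<close> is injective if nothing but \<open>0\<close> annihilates \<open>J\<close>, and
  surjective if every homomorphism from \<open>J\<close> to \<open>R\<close> is a multiplication.\<close>

lemma GV_ideal_iff:
  "J \<in> GV_ideals R \<longleftrightarrow> fg_ideal R J \<and>
    (\<forall>r\<in>carrier R. (\<forall>x\<in>J. r \<otimes> x = \<zero>) \<longrightarrow> r = \<zero>) \<and>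
    (\<forall>f\<in>mod_hom R (sub_module (regular_module R) J) (regular_module R).
      \<exists>r\<in>carrier R. \<forall>x\<in>J. f x = r \<otimes> x)"
  (is "_ \<longleftrightarrow> _ \<and> ?inj \<and> ?surj")
proof (cases "fg_ideal R J")
  case True
  let ?N = "sub_module (regular_module R) J" and ?m = "\<lambda>r\<in>carrier R. \<lambda>x\<in>J. r \<otimes> x"
  let ?H = "hom_module R ?N (regular_module R)"
  have I: "ideal J R" using True by (rule fg_ideal_ideal)
  have Jc: "x \<in> carrier R" if "x \<in> J" for x using ideal.Icarr[OF I] that .
  have Jm: "r \<otimes> x \<in> J" if "r \<in> carrier R" "x \<in> J" for r x using ideal.I_l_closed[OF I] that by simp
  have Ja: "x \<oplus> y \<in> J" if "x \<in> J" "y \<in> J" for x y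
    using additive_subgroup.a_closed[OF ideal.axioms(1)[OF I]] that by simp
  have m1: "(\<lambda>x\<in>J. r \<otimes> x) \<in> mod_hom R ?N (regular_module R)" if "r \<in> carrier R" for r
    using mod_homI[of ?N "\<lambda>x. r \<otimes> x" "regular_module R"] that
      module_sub_module[OF module_regular ideal_submodule[OF I]]
    by (simp add: Jc r_distr m_lcomm)
  have hom: "?m \<in> mod_hom R (regular_module R) ?H"
  proof -
    have "restrict (\<lambda>r. \<lambda>x\<in>J. r \<otimes> x) (carrier (regular_module R)) \<in> mod_hom R (regular_module R) ?H"
    proof (rule mod_homI[OF module_regular])
      show "(\<lambda>x\<in>J. r \<otimes> x) \<in> carrier ?H" if "r \<in> carrier (regular_module R)" for r
        using m1 that by (simp add: hom_module_def)
    qed (auto simp: hom_module_def l_distr m_assoc Jc)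
    then show ?thesis by simp
  qed
  have inj: "inj_on ?m (carrier R) \<longleftrightarrow> ?inj"
  proof
    assume i: "inj_on ?m (carrier R)"
    show ?inj
    proof (intro ballI impI)
      fix r assume r: "r \<in> carrier R" "\<forall>x\<in>J. r \<otimes> x = \<zero>"
      then have "?m r = ?m \<zero>" using Jc by auto
      then show "r = \<zero>" using inj_onD[OF i] r by blast
    qed
  next
    assume i: ?inj
    show "inj_on ?m (carrier R)"
    proof (rule inj_onI)
      fix r s assume rs: "r \<in> carrier R" "s \<in> carrier R" "?m r = ?m s"
      have "(r \<ominus> s) \<otimes> x = \<zero>" if x: "x \<in> J" for x
      proof -
        have "?m r x = ?m s x" by (simp only: rs(3))
        then have "r \<otimes> x = s \<otimes> x" using rs(1,2) x by simp
        then show ?thesis using rs Jc[OF x] by (simp add: a_minus_def l_distr l_minus r_neg)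
      qed
      then have "r \<ominus> s = \<zero>" using i rs by simp
      then show "r = s" by (rule minus_eq_zeroD[OF _ rs(1,2)])
    qed
  qed
  have surj: "?m ` carrier R = mod_hom R ?N (regular_module R) \<longleftrightarrow> ?surj"
  proof
    assume s: "?m ` carrier R = mod_hom R ?N (regular_module R)"
    show ?surj unfolding s[symmetric] by auto
  next
    assume s: ?surj
    show "?m ` carrier R = mod_hom R ?N (regular_module R)"
    proof
      show "?m ` carrier R \<subseteq> mod_hom R ?N (regular_module R)" using m1 by auto
      show "mod_hom R ?N (regular_module R) \<subseteq> ?m ` carrier R"
      proof
        fix f assume f: "f \<in> mod_hom R ?N (regular_module R)"
        then obtain r where r: "r \<in> carrier R" "\<forall>x\<in>J. f x = r \<otimes> x" using s by blast
        have "f = ?m r"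
          by (rule hom_eqI[OF f, of _ "regular_module R"]) (use m1 r in auto)
        then show "f \<in> ?m ` carrier R" using r by blast
      qed
    qed
  qed
  have "?m \<in> mod_iso R (regular_module R) ?H \<longleftrightarrow> ?inj \<and> ?surj"
    unfolding mod_iso_def bij_betw_def mem_Collect_eq inj[symmetric] surj[symmetric]
    using hom by (simp add: hom_module_def)
  then show ?thesis using True by (simp add: GV_ideals_def)
qed (simp add: GV_ideals_def)

lemma GV_carrier: "carrier R \<in> GV_ideals R"
  unfolding GV_ideal_iff
proof (intro conjI ballI impI)
  have "carrier R = Idl {\<one>}" using genideal_one by simp
  then show "fg_ideal R (carrier R)" unfolding fg_ideal_def by (intro exI[of _ "{\<one>}"]) auto
  show "r = \<zero>" if "r \<in> carrier R" "\<forall>x\<in>carrier R. r \<otimes> x = \<zero>" for r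
    using that by (metis one_closed r_one)
  fix f assume f: "f \<in> mod_hom R (sub_module (regular_module R) (carrier R)) (regular_module R)"
  have "f x = f \<one> \<otimes> x" if "x \<in> carrier R" for x
    using hom_smult[OF f, of x \<one>] hom_closed[OF f, of \<one>] that by (simp add: m_comm)
  moreover have "f \<one> \<in> carrier R" using hom_closed[OF f, of \<one>] by simp
  ultimately show "\<exists>r\<in>carrier R. \<forall>x\<in>carrier R. f x = r \<otimes> x" by blast
qed

text \<open>The product of two GV-ideals is a GV-ideal: a homomorphism \<open>f\<close> on the product gives, for
  fixed \<open>a\<close> in the first factor, a homomorphism \<open>b \<mapsto> f (a b)\<close> on the second one, which is
  multiplication by some \<open>g a\<close>, and \<open>g\<close> is in turn a homomorphism on the first factor.\<close>

lemma GV_product: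
  assumes J1: "J1 \<in> GV_ideals R" and J2: "J2 \<in> GV_ideals R"
  shows "\<exists>J\<in>GV_ideals R. J \<subseteq> J1 \<inter> J2"
proof -
  note G1 = J1[unfolded GV_ideal_iff] and G2 = J2[unfolded GV_ideal_iff]
  obtain S1 S2 where S: "finite S1" "S1 \<subseteq> carrier R" "J1 = Idl S1"
    "finite S2" "S2 \<subseteq> carrier R" "J2 = Idl S2"
    using G1 G2 unfolding fg_ideal_def by blast
  define S where "S = (\<lambda>(a,b). a \<otimes> b) ` (S1 \<times> S2)"
  define J where "J = Idl S"
  have Sc: "S \<subseteq> carrier R" using S unfolding S_def by auto
  have I1: "ideal J1 R" and I2: "ideal J2 R" using G1 G2 fg_ideal_ideal by auto
  have I: "ideal J R" unfolding J_def by (rule genideal_ideal[OF Sc])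
  have SJ: "S \<subseteq> J" unfolding J_def by (rule genideal_self[OF Sc])
  have fg: "fg_ideal R J"
    unfolding fg_ideal_def J_def using Sc S by (intro exI[of _ S]) (auto simp: S_def)
  have min: "Idl X \<subseteq> H" if "ideal H R" "X \<subseteq> H" for X H
    by (rule genideal_minimal[OF that])
  have sub: "J \<subseteq> J1 \<inter> J2" unfolding J_def
  proof (rule min[OF i_intersect[OF I1 I2]])
    have SJ: "S1 \<subseteq> J1" "S2 \<subseteq> J2" using S(3,6) genideal_self[OF S(2)] genideal_self[OF S(5)] by simp_all
    show "S \<subseteq> J1 \<inter> J2"
    proof
      fix x assume "x \<in> S"
      then obtain a b where ab: "a \<in> S1" "b \<in> S2" "x = a \<otimes> b" unfolding S_def by auto
      then have "a \<in> carrier R" "b \<in> carrier R" "a \<in> J1" "b \<in> J2" using S(2,5) SJ by auto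
      then show "x \<in> J1 \<inter> J2"
        using ideal.I_l_closed[OF I2, of b a] ideal.I_r_closed[OF I1, of a b] ab(3) by simp
    qed
  qed
  have Jc: "x \<in> carrier R" if "x \<in> J1 \<or> x \<in> J2 \<or> x \<in> J" for x
    using that ideal.Icarr[OF I1] ideal.Icarr[OF I2] ideal.Icarr[OF I] by metis
  \<comment> \<open>ideal quotients extend \<open>a b \<in> J\<close> from the generators \<open>a\<close>, \<open>b\<close> to all of \<open>J1\<close> and \<open>J2\<close>\<close>
  have idl: "ideal {x \<in> carrier R. \<forall>y\<in>Y. x \<otimes> y \<in> J} R" if Y: "Y \<subseteq> carrier R" for Y
  proof (rule idealI[OF ring_axioms])
    show "subgroup {x \<in> carrier R. \<forall>y\<in>Y. x \<otimes> y \<in> J} (add_monoid R)"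
    proof (rule subgroup.intro)
      show "inv\<^bsub>add_monoid R\<^esub> x \<in> {x \<in> carrier R. \<forall>y\<in>Y. x \<otimes> y \<in> J}"
        if x: "x \<in> {x \<in> carrier R. \<forall>y\<in>Y. x \<otimes> y \<in> J}" for x
      proof -
        have "\<ominus> x \<otimes> y \<in> J" if "y \<in> Y" for y
          using x that Y additive_subgroup.a_inv_closed[OF ideal.axioms(1)[OF I]]
          by (auto simp: l_minus)
        then show ?thesis using x by (auto simp flip: a_inv_def)
      qed
    qed (use Y additive_subgroup.zero_closed[OF ideal.axioms(1)[OF I]]
        additive_subgroup.a_closed[OF ideal.axioms(1)[OF I]] in \<open>auto simp: l_distr subset_iff\<close>)
  next
    fix a x assume ax: "a \<in> {x \<in> carrier R. \<forall>y\<in>Y. x \<otimes> y \<in> J}" "x \<in> carrier R"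
    have "x \<otimes> a \<otimes> y \<in> J" if "y \<in> Y" for y
      using ax that Y ideal.I_l_closed[OF I, of "a \<otimes> y" x] by (auto simp: m_assoc subset_iff)
    then show "x \<otimes> a \<in> {x \<in> carrier R. \<forall>y\<in>Y. x \<otimes> y \<in> J}" using ax by auto
    then show "a \<otimes> x \<in> {x \<in> carrier R. \<forall>y\<in>Y. x \<otimes> y \<in> J}" using ax by (auto simp: m_comm)
  qed
  have S1: "x \<otimes> y \<in> J" if "x \<in> S1" "y \<in> S2" for x y
    using that SJ by (auto simp: S_def)
  have J1S: "J1 \<subseteq> {x \<in> carrier R. \<forall>y\<in>S2. x \<otimes> y \<in> J}"
    unfolding \<open>J1 = Idl S1\<close> by (rule min[OF idl]) (use S S1 in auto)
  have J1c: "J1 \<subseteq> carrier R" using Jc by blast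
  have "y \<otimes> x \<in> J" if "y \<in> S2" "x \<in> J1" for x y
  proof -
    have "x \<in> carrier R" "y \<in> carrier R" "x \<otimes> y \<in> J" using that J1S S(5) by auto
    then show ?thesis by (simp add: m_comm)
  qed
  then have "S2 \<subseteq> {x \<in> carrier R. \<forall>y\<in>J1. x \<otimes> y \<in> J}" using S(5) by blast
  then have J2S: "J2 \<subseteq> {x \<in> carrier R. \<forall>y\<in>J1. x \<otimes> y \<in> J}"
    unfolding \<open>J2 = Idl S2\<close> by (rule min[OF idl[OF J1c]])
  have prod: "x \<otimes> y \<in> J" if "x \<in> J1" "y \<in> J2" for x y
  proof -
    have "x \<in> carrier R" "y \<in> carrier R" "y \<otimes> x \<in> J" using that J2S J1c by auto
    then show ?thesis by (simp add: m_comm)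
  qed
  let ?N = "\<lambda>J. sub_module (regular_module R) J"
  have N: "module R (?N J1)" "module R (?N J2)" "module R (?N J)"
    using module_sub_module[OF module_regular ideal_submodule] I1 I2 I by auto
  have "J \<in> GV_ideals R" unfolding GV_ideal_iff
  proof (intro conjI ballI impI)
    show "fg_ideal R J" by (rule fg)
    fix r assume r: "r \<in> carrier R" "\<forall>x\<in>J. r \<otimes> x = \<zero>"
    have "r \<otimes> a = \<zero>" if a: "a \<in> J1" for a
    proof -
      have "r \<otimes> a \<otimes> b = \<zero>" if b: "b \<in> J2" for b
        using r prod[OF a b] Jc a b by (simp add: m_assoc)
      then show ?thesis using G2 r Jc a by auto
    qed
    then show "r = \<zero>" using G1 r by blast
  next
    fix f assume f: "f \<in> mod_hom R (?N J) (regular_module R)"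
    have "\<exists>r\<in>carrier R. \<forall>b\<in>J2. f (a \<otimes> b) = r \<otimes> b" if a: "a \<in> J1" for a
    proof -
      have "restrict (\<lambda>b. f (a \<otimes> b)) (carrier (?N J2)) \<in> mod_hom R (?N J2) (regular_module R)"
      proof (rule mod_homI[OF N(2)])
        fix x assume x: "x \<in> carrier (?N J2)"
        show "f (a \<otimes> x) \<in> carrier (regular_module R)" using x a prod hom_closed[OF f, of "a \<otimes> x"] by simp
        show "f (a \<otimes> (r \<odot>\<^bsub>?N J2\<^esub> x)) = r \<odot>\<^bsub>regular_module R\<^esub> f (a \<otimes> x)" if "r \<in> carrier R" for r
          using hom_smult[OF f that, of "a \<otimes> x"] x a prod that Jc by (simp add: m_lcomm)
        fix y assume y: "y \<in> carrier (?N J2)"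
        show "f (a \<otimes> (x \<oplus>\<^bsub>?N J2\<^esub> y)) = f (a \<otimes> x) \<oplus>\<^bsub>regular_module R\<^esub> f (a \<otimes> y)"
          using hom_add[OF f, of "a \<otimes> x" "a \<otimes> y"] x y a prod Jc by (simp add: r_distr)
      qed
      then obtain r where "r \<in> carrier R" "\<forall>x\<in>J2. restrict (\<lambda>b. f (a \<otimes> b)) (carrier (?N J2)) x = r \<otimes> x"
        using G2 by blast
      then show ?thesis by auto
    qed
    then obtain g where g: "\<And>a. a \<in> J1 \<Longrightarrow> g a \<in> carrier R"
      "\<And>a b. \<lbrakk>a \<in> J1; b \<in> J2\<rbrakk> \<Longrightarrow> f (a \<otimes> b) = g a \<otimes> b"
      by metis
    \<comment> \<open>elements of \<open>R\<close> are determined by their products with \<open>J2\<close>; so \<open>g\<close> inherits linearity from \<open>f\<close>\<close>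
    have eq: "r = s" if "r \<in> carrier R" "s \<in> carrier R" "\<And>b. b \<in> J2 \<Longrightarrow> r \<otimes> b = s \<otimes> b" for r s
    proof -
      have "(r \<ominus> s) \<otimes> b = \<zero>" if b: "b \<in> J2" for b
      proof -
        have "r \<otimes> b = s \<otimes> b" using \<open>\<And>b. b \<in> J2 \<Longrightarrow> r \<otimes> b = s \<otimes> b\<close> b .
        then show ?thesis using \<open>r \<in> _\<close> \<open>s \<in> _\<close> Jc[of b] b
          by (simp add: a_minus_def l_distr l_minus r_neg)
      qed
      then have "r \<ominus> s = \<zero>" using G2 that(1,2) by simp
      then show ?thesis by (rule minus_eq_zeroD[OF _ that(1,2)])
    qed
    have J1a: "x \<oplus> y \<in> J1" if "x \<in> J1" "y \<in> J1" for x y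
      using additive_subgroup.a_closed[OF ideal.axioms(1)[OF I1]] that by simp
    have J1m: "r \<otimes> x \<in> J1" if "r \<in> carrier R" "x \<in> J1" for r x
      using ideal.I_l_closed[OF I1] that by simp
    have "restrict g (carrier (?N J1)) \<in> mod_hom R (?N J1) (regular_module R)"
    proof (rule mod_homI[OF N(1)])
      fix x assume "x \<in> carrier (?N J1)"
      then have x: "x \<in> J1" by simp
      show "g x \<in> carrier (regular_module R)" using x g by simp
      show "g (r \<odot>\<^bsub>?N J1\<^esub> x) = r \<odot>\<^bsub>regular_module R\<^esub> g x" if r: "r \<in> carrier R" for r
      proof -
        have "g (r \<otimes> x) \<otimes> b = r \<otimes> g x \<otimes> b" if b: "b \<in> J2" for b
        proof -
          have "g (r \<otimes> x) \<otimes> b = f (r \<otimes> x \<otimes> b)" using g(2)[OF J1m[OF r x] b] by simp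
          also have "\<dots> = r \<otimes> f (x \<otimes> b)"
            using hom_smult[OF f r, of "x \<otimes> b"] prod[OF x b] r x b Jc by (simp add: m_assoc)
          also have "\<dots> = r \<otimes> g x \<otimes> b" using g x b r Jc by (simp add: m_assoc)
          finally show ?thesis .
        qed
        then have "g (r \<otimes> x) = r \<otimes> g x" using eq g J1m r x by simp
        then show ?thesis by simp
      qed
      fix y assume "y \<in> carrier (?N J1)"
      then have y: "y \<in> J1" by simp
      have "g (x \<oplus> y) \<otimes> b = (g x \<oplus> g y) \<otimes> b" if b: "b \<in> J2" for b
      proof -
        have "g (x \<oplus> y) \<otimes> b = f ((x \<oplus> y) \<otimes> b)" using g(2)[OF J1a[OF x y] b] by simp
        also have "\<dots> = f (x \<otimes> b) \<oplus> f (y \<otimes> b)"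
          using hom_add[OF f, of "x \<otimes> b" "y \<otimes> b"] prod x y b Jc by (simp add: l_distr)
        also have "\<dots> = (g x \<oplus> g y) \<otimes> b" using g x y b Jc by (simp add: l_distr)
        finally show ?thesis .
      qed
      then have "g (x \<oplus> y) = g x \<oplus> g y" using eq g J1a x y by simp
      then show "g (x \<oplus>\<^bsub>?N J1\<^esub> y) = g x \<oplus>\<^bsub>regular_module R\<^esub> g y" by simp
    qed
    then obtain r where r: "r \<in> carrier R" "\<forall>x\<in>J1. g x = r \<otimes> x" using G1 by auto
    let ?m = "restrict (\<lambda>x. r \<otimes> x) (carrier (?N J))"
    have m: "?m \<in> mod_hom R (?N J) (regular_module R)"
      by (rule mod_homI[OF N(3)]) (use r Jc in \<open>auto simp: r_distr m_lcomm\<close>)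
    \<comment> \<open>\<open>f\<close> agrees with a multiplication on an ideal that contains the generators of \<open>J\<close>\<close>
    let ?E = "{x \<in> J. f x = r \<otimes> x}"
    have "ideal ?E R"
    proof (rule idealI[OF ring_axioms])
      show "subgroup ?E (add_monoid R)"
      proof (rule subgroup.intro)
        have z: "\<zero> \<in> J" using additive_subgroup.zero_closed[OF ideal.axioms(1)[OF I]] .
        then show "\<one>\<^bsub>add_monoid R\<^esub> \<in> ?E" using hom_zero[OF f N(3) module_regular] r by simp
        show "inv\<^bsub>add_monoid R\<^esub> x \<in> ?E" if "x \<in> ?E" for x
        proof -
          have x: "x \<in> J" "f x = r \<otimes> x" using that by auto
          have "\<ominus> x = (\<ominus> \<one>) \<otimes> x" using x Jc by (simp add: l_minus)
          moreover have "f ((\<ominus> \<one>) \<otimes> x) = (\<ominus> \<one>) \<otimes> f x" using hom_smult[OF f, of "\<ominus> \<one>" x] x by simp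
          moreover have "(\<ominus> \<one>) \<otimes> x \<in> J" using ideal.I_l_closed[OF I] x by simp
          ultimately have "\<ominus> x \<in> ?E" using x r Jc[of x] by (simp add: l_minus r_minus)
          then show ?thesis by (simp add: a_inv_def)
        qed
      next
        fix x y assume xy: "x \<in> ?E" "y \<in> ?E"
        then have "x \<oplus> y \<in> J" using additive_subgroup.a_closed[OF ideal.axioms(1)[OF I]] by simp
        then show "x \<otimes>\<^bsub>add_monoid R\<^esub> y \<in> ?E"
          using xy hom_add[OF f, of x y] r Jc by (simp add: r_distr)
      qed (use Jc in auto)
    next
      fix a x assume ax: "a \<in> ?E" "x \<in> carrier R"
      then have "x \<otimes> a \<in> J" using ideal.I_l_closed[OF I] by simp
      then show "x \<otimes> a \<in> ?E" using ax hom_smult[OF f, of x a] r Jc by (simp add: m_lcomm)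
      then show "a \<otimes> x \<in> ?E" using ax Jc by (simp add: m_comm)
    qed
    moreover have "S \<subseteq> ?E"
    proof
      fix x assume "x \<in> S"
      then obtain a b where ab: "a \<in> S1" "b \<in> S2" "x = a \<otimes> b" unfolding S_def by auto
      then have ab': "a \<in> J1" "b \<in> J2" using S genideal_self by auto
      then have "f x = r \<otimes> x" using g r Jc ab(3) by (simp add: m_assoc)
      then show "x \<in> ?E" using \<open>x \<in> S\<close> SJ by auto
    qed
    ultimately have "J \<subseteq> ?E" unfolding J_def by (rule min)
    then show "\<exists>r\<in>carrier R. \<forall>x\<in>J. f x = r \<otimes> x" using r by blast
  qed
  then show ?thesis using sub by blast
qed

end

section \<open>An elementwise description of the Tor condition\<close>

text \<open>In the canonical resolution \<open>F\<^sub>2 \<rightarrow> F\<^sub>1 \<rightarrow> F\<^sub>0 \<rightarrow> A\<close> that defines \<open>Tor\<^sub>1(A,M)\<close>, the modules \<open>F\<^sub>1\<close> and \<open>F\<^sub>2\<close> are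
  free on the sets \<open>tor_K0\<close> and \<open>tor_K1\<close>.\<close>

definition tor_K0 :: "('a,'r) ring_scheme \<Rightarrow> ('a,'b) module \<Rightarrow> ('b \<Rightarrow> 'a) set" where
  "tor_K0 R A = a_kernel (free_module R (carrier A)) A (free_eval R A (carrier A))"

definition tor_K1 :: "('a,'r) ring_scheme \<Rightarrow> ('a,'b) module \<Rightarrow> (('b \<Rightarrow> 'a) \<Rightarrow> 'a) set" where
  "tor_K1 R A = a_kernel (free_module R (tor_K0 R A)) (free_module R (carrier A))
    (free_eval R (free_module R (carrier A)) (tor_K0 R A))"

text \<open>The elements of \<open>F\<^sub>1 \<otimes> M\<close> are families \<open>z\<close> of elements of \<open>M\<close>, indexed by the basis of \<open>F\<^sub>1\<close>, with finite
  support.  The boundaries among them are the sums of families \<open>k \<mapsto> \<kappa> k n\<close> with \<open>\<kappa> \<in> K1\<close> and \<open>n \<in> M\<close>.\<close>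

definition tor_null :: "(('s \<Rightarrow> 'a) \<Rightarrow> 'a) set \<Rightarrow> ('a,'b) module \<Rightarrow> (('s \<Rightarrow> 'a) \<Rightarrow> 'b) \<Rightarrow> bool"
  where
  "tor_null K1 M z \<longleftrightarrow> (\<exists>U n. finite U \<and> U \<subseteq> K1 \<and> (\<forall>\<kappa>\<in>U. n \<kappa> \<in> carrier M) \<and>
     (\<forall>k. lcomb M U (\<lambda>\<kappa>. \<kappa> k) n = z k))"

text \<open>A family \<open>m\<close> with support in \<open>T\<close> is a cycle if \<open>\<Sum>\<^sub>k k(s) m\<^sub>k = 0\<close> for every \<open>s\<close>.  Cycles and boundaries are
  thus the solutions, and the solvable right-hand sides, of linear systems with coefficients in \<open>R\<close>
  that do not depend on \<open>M\<close>.  Only finitely many equations and unknowns are involved at a time,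
  since the elements of \<open>K0\<close> and \<open>K1\<close> have finite support.\<close>

definition tor_cond ::
    "('a,'r) ring_scheme \<Rightarrow> ('s \<Rightarrow> 'a) set \<Rightarrow> (('s \<Rightarrow> 'a) \<Rightarrow> 'a) set \<Rightarrow> ('a,'b) module \<Rightarrow> bool" where
  "tor_cond R K0 K1 M \<longleftrightarrow> (\<forall>T m. finite T \<and> T \<subseteq> K0 \<and> (\<forall>k\<in>T. m k \<in> carrier M) \<and>
     (\<forall>s. lcomb M T (\<lambda>k. k s) m = \<zero>\<^bsub>M\<^esub>) \<longrightarrow>
     (\<exists>J\<in>GV_ideals R. \<forall>r\<in>J. tor_null K1 M (\<lambda>k. if k \<in> T then r \<odot>\<^bsub>M\<^esub> m k else \<zero>\<^bsub>M\<^esub>)))"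

context cring
begin

lemma tensor_map_finsum:
  assumes M: "module R M" and M': "module R M'" and N: "module R N" and f: "f \<in> mod_hom R M M'"
    and U: "finite U" "\<And>k. k \<in> U \<Longrightarrow> x k \<in> carrier M" "\<And>k. k \<in> U \<Longrightarrow> y k \<in> carrier N"
  shows "tensor_map R M M' N f (finsum (tensor R M N) (\<lambda>k. pure_tensor R M N (x k) (y k)) U) =
    finsum (tensor R M' N) (\<lambda>k. pure_tensor R M' N (f (x k)) (y k)) U"
proof -
  note t = tensor_map[OF M M' N f]
  have "tensor_map R M M' N f (finsum (tensor R M N) (\<lambda>k. pure_tensor R M N (x k) (y k)) U) =
      finsum (tensor R M' N) (\<lambda>k. tensor_map R M M' N f (pure_tensor R M N (x k) (y k))) U"
    by (rule hom_finsum[OF module_tensor[OF M N] module_tensor[OF M' N] t(1) U(1)]) (use U in auto)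
  also have "\<dots> = finsum (tensor R M' N) (\<lambda>k. pure_tensor R M' N (f (x k)) (y k)) U"
    by (rule mod_finsum_cong[OF module_tensor[OF M' N]]) (use U t(2) hom_closed[OF f] in auto)
  finally show ?thesis .
qed

text \<open>\<open>F \<otimes> B\<close> is a direct sum of copies of \<open>B\<close> if \<open>F\<close> is free on \<open>K\<close>.  The homomorphisms \<open>\<epsilon> k\<close> are the
  coordinates; the last condition says that an element is recovered from finitely many of them.\<close>

definition tensor_coords ::
    "'k set \<Rightarrow> ('a,'x) module \<Rightarrow> ('k \<Rightarrow> (('k \<Rightarrow> 'a) \<times> 'x \<Rightarrow> 'a) set \<Rightarrow> 'x) \<Rightarrow> bool" where
  "tensor_coords K B \<epsilon> \<longleftrightarrow> (\<forall>k. \<epsilon> k \<in> mod_hom R (tensor R (free_module R K) B) B) \<and>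
     (\<forall>k. \<forall>\<phi>\<in>carrier (free_module R K). \<forall>b\<in>carrier B.
       \<epsilon> k (pure_tensor R (free_module R K) B \<phi> b) = \<phi> k \<odot>\<^bsub>B\<^esub> b) \<and>
     (\<forall>z\<in>carrier (tensor R (free_module R K) B). \<exists>U. finite U \<and> U \<subseteq> K \<and>
       z = finsum (tensor R (free_module R K) B)
         (\<lambda>k. pure_tensor R (free_module R K) B (free_gen R k) (\<epsilon> k z)) U)"

lemma ex_tensor_coords:
  fixes K :: "'k set" and B :: "('a,'x) module"
  assumes B: "module R B"
  shows "\<exists>\<epsilon>. tensor_coords K B \<epsilon>"
proof -
  define F where "F = free_module R K"
  let ?T = "tensor R F B" and ?pt = "pure_tensor R F B"
  have F: "module R F" unfolding F_def by (rule module_free)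
  note T = module_tensor[OF F B]
  have Fc: "\<phi> k \<in> carrier R" if "\<phi> \<in> carrier F" for \<phi> k
    using that unfolding F_def by (rule free_carrierD)
  have gen: "free_gen R k \<in> carrier F" if "k \<in> K" for k
    using that unfolding F_def by simp
  have "\<exists>h. h \<in> mod_hom R ?T B \<and>
      (\<forall>\<phi>\<in>carrier F. \<forall>b\<in>carrier B. h (?pt \<phi> b) = \<phi> k \<odot>\<^bsub>B\<^esub> b)" for k
    by (rule tensor_lift[OF F B B, of "\<lambda>\<phi> b. \<phi> k \<odot>\<^bsub>B\<^esub> b"])
      (use B in \<open>auto simp: Fc mod_smult_l_distr mod_smult_r_distr mod_smult_assoc
        mod_smult_lcomm F_def\<close>)
  then obtain \<epsilon> where e: "\<epsilon> k \<in> mod_hom R ?T B"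
    "\<And>\<phi> b. \<lbrakk>\<phi> \<in> carrier F; b \<in> carrier B\<rbrakk> \<Longrightarrow> \<epsilon> k (?pt \<phi> b) = \<phi> k \<odot>\<^bsub>B\<^esub> b" for k
    by metis
  let ?s = "\<lambda>U z. finsum ?T (\<lambda>k. ?pt (free_gen R k) (\<epsilon> k z)) U"
  have ptc: "?pt (free_gen R k) (\<epsilon> j z) \<in> carrier ?T" if "k \<in> K" "z \<in> carrier ?T" for k j z
    using that gen hom_closed[OF e(1)] by simp
  \<comment> \<open>with all finite supersets of \<open>U\<close> admitted, the sets for two summands have a common choice\<close>
  have "\<exists>U. finite U \<and> U \<subseteq> K \<and> (\<forall>U'. finite U' \<and> U \<subseteq> U' \<and> U' \<subseteq> K \<longrightarrow> z = ?s U' z)"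
    if z: "z \<in> carrier ?T" for z
    using F B z
  proof (induction z rule: tensor_induct)
    case (pure \<phi> b)
    let ?U = "{k. \<phi> k \<noteq> \<zero>}"
    have U: "finite ?U" "?U \<subseteq> K" using pure(1) unfolding F_def by (auto simp: free_carrier)
    have "?pt \<phi> b = ?s U' (?pt \<phi> b)" if U': "finite U'" "?U \<subseteq> U'" "U' \<subseteq> K" for U'
    proof -
      have gU: "free_gen R k \<in> carrier F" if "k \<in> U'" for k using that U' gen by auto
      let ?h = "\<lambda>x\<in>carrier F. ?pt x b"
      have h: "?h \<in> mod_hom R F ?T" by (rule pure_tensor_homs(1)[OF F B pure(2)])
      have "?pt \<phi> b = ?h (lcomb F U' \<phi> (free_gen R))"
        using free_expand[OF pure(1)[unfolded F_def] U'] pure(1) by (simp add: F_def)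
      also have "\<dots> = lcomb ?T U' \<phi> (\<lambda>k. ?h (free_gen R k))"
        by (rule hom_lcomb[OF F T h U'(1)]) (use gU Fc[OF pure(1)] in auto)
      also have "\<dots> = ?s U' (?pt \<phi> b)"
        unfolding lcomb_def
      proof (rule mod_finsum_cong[OF T])
        fix k assume k: "k \<in> U'"
        show "\<phi> k \<odot>\<^bsub>?T\<^esub> ?h (free_gen R k) = ?pt (free_gen R k) (\<epsilon> k (?pt \<phi> b))"
          using gU[OF k] Fc[OF pure(1)] pure e by (simp add: pure_tensor_bilinear(4)[OF F B])
        show "?pt (free_gen R k) (\<epsilon> k (?pt \<phi> b)) \<in> carrier ?T"
          using k U' pure by (intro ptc) auto
      qed
      finally show ?thesis .
    qed
    then show ?case using U by (intro exI[of _ ?U]) simp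
  next
    case (add u v)
    obtain U where U: "finite U" "U \<subseteq> K" "\<forall>U'. finite U' \<and> U \<subseteq> U' \<and> U' \<subseteq> K \<longrightarrow> u = ?s U' u"
      using add(3) by blast
    obtain V where V: "finite V" "V \<subseteq> K" "\<forall>U'. finite U' \<and> V \<subseteq> U' \<and> U' \<subseteq> K \<longrightarrow> v = ?s U' v"
      using add(4) by blast
    have "u \<oplus>\<^bsub>?T\<^esub> v = ?s U' (u \<oplus>\<^bsub>?T\<^esub> v)" if U': "finite U'" "U \<union> V \<subseteq> U'" "U' \<subseteq> K" for U'
    proof -
      have "u \<oplus>\<^bsub>?T\<^esub> v = ?s U' u \<oplus>\<^bsub>?T\<^esub> ?s U' v" using U(3)[rule_format, of U'] V(3)[rule_format, of U'] U' by simp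
      also have "\<dots> = finsum ?T (\<lambda>k. ?pt (free_gen R k) (\<epsilon> k u) \<oplus>\<^bsub>?T\<^esub> ?pt (free_gen R k) (\<epsilon> k v)) U'"
        by (rule mod_finsum_add[OF T, symmetric]) (use add U' in \<open>auto intro!: ptc\<close>)
      also have "\<dots> = ?s U' (u \<oplus>\<^bsub>?T\<^esub> v)"
      proof (rule mod_finsum_cong[OF T])
        fix k assume k: "k \<in> U'"
        show "?pt (free_gen R k) (\<epsilon> k u) \<oplus>\<^bsub>?T\<^esub> ?pt (free_gen R k) (\<epsilon> k v) =
            ?pt (free_gen R k) (\<epsilon> k (u \<oplus>\<^bsub>?T\<^esub> v))"
          using k U' add gen hom_closed[OF e(1)]
          by (simp add: hom_add[OF e(1)] pure_tensor_bilinear(2)[OF F B] subset_iff)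
        show "?pt (free_gen R k) (\<epsilon> k (u \<oplus>\<^bsub>?T\<^esub> v)) \<in> carrier ?T"
          using k U' add T by (intro ptc) auto
      qed
      finally show ?thesis .
    qed
    then show ?case using U V by (intro exI[of _ "U \<union> V"]) auto
  next
    case (smult r u)
    obtain U where U: "finite U" "U \<subseteq> K" "\<forall>U'. finite U' \<and> U \<subseteq> U' \<and> U' \<subseteq> K \<longrightarrow> u = ?s U' u"
      using smult(3) by blast
    have "r \<odot>\<^bsub>?T\<^esub> u = ?s U' (r \<odot>\<^bsub>?T\<^esub> u)" if U': "finite U'" "U \<subseteq> U'" "U' \<subseteq> K" for U'
    proof -
      have "r \<odot>\<^bsub>?T\<^esub> u = r \<odot>\<^bsub>?T\<^esub> ?s U' u" using U(3)[rule_format, of U'] U' by simp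
      also have "\<dots> = finsum ?T (\<lambda>k. r \<odot>\<^bsub>?T\<^esub> ?pt (free_gen R k) (\<epsilon> k u)) U'"
        by (rule mod_finsum_smult[OF T]) (use smult U' in \<open>auto intro!: ptc\<close>)
      also have "\<dots> = ?s U' (r \<odot>\<^bsub>?T\<^esub> u)"
      proof (rule mod_finsum_cong[OF T])
        fix k assume k: "k \<in> U'"
        show "r \<odot>\<^bsub>?T\<^esub> ?pt (free_gen R k) (\<epsilon> k u) = ?pt (free_gen R k) (\<epsilon> k (r \<odot>\<^bsub>?T\<^esub> u))"
          using k U' smult gen hom_closed[OF e(1)]
          by (simp add: hom_smult[OF e(1)] pure_tensor_bilinear(4)[OF F B] subset_iff)
        show "?pt (free_gen R k) (\<epsilon> k (r \<odot>\<^bsub>?T\<^esub> u)) \<in> carrier ?T"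
          using k U' smult T by (intro ptc) auto
      qed
      finally show ?thesis .
    qed
    then show ?case using U by (intro exI[of _ U]) auto
  qed
  note ex = this
  have "\<exists>U. finite U \<and> U \<subseteq> K \<and> z = ?s U z" if z: "z \<in> carrier ?T" for z
  proof -
    obtain U where "finite U" "U \<subseteq> K" "\<forall>U'. finite U' \<and> U \<subseteq> U' \<and> U' \<subseteq> K \<longrightarrow> z = ?s U' z"
      using ex[OF z] by blast
    then show ?thesis by (intro exI[of _ U]) simp
  qed
  with e show ?thesis
    unfolding tensor_coords_def F_def[symmetric] by (intro exI[of _ \<epsilon>] conjI allI ballI)
qed

lemma tensor_coords_finsum:
  fixes K :: "'k set" and B :: "('a,'x) module"
  assumes B: "module R B" and e: "tensor_coords K B \<epsilon>" and U: "finite U"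
    and x: "\<And>i. i \<in> U \<Longrightarrow> x i \<in> carrier (free_module R K)" and m: "\<And>i. i \<in> U \<Longrightarrow> m i \<in> carrier B"
  shows "\<epsilon> k (finsum (tensor R (free_module R K) B) (\<lambda>i. pure_tensor R (free_module R K) B (x i) (m i)) U) =
    lcomb B U (\<lambda>i. x i k) m"
proof -
  let ?F = "free_module R K"
  have e1: "\<epsilon> k \<in> mod_hom R (tensor R ?F B) B" using e by (simp add: tensor_coords_def)
  have "\<epsilon> k (finsum (tensor R ?F B) (\<lambda>i. pure_tensor R ?F B (x i) (m i)) U) =
      finsum B (\<lambda>i. \<epsilon> k (pure_tensor R ?F B (x i) (m i))) U"
    by (rule hom_finsum[OF module_tensor[OF module_free B] B e1 U]) (use x m in auto)
  also have "\<dots> = lcomb B U (\<lambda>i. x i k) m"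
    unfolding lcomb_def
  proof (rule mod_finsum_cong[OF B])
    fix i assume i: "i \<in> U"
    show "\<epsilon> k (pure_tensor R ?F B (x i) (m i)) = x i k \<odot>\<^bsub>B\<^esub> m i"
      using e x[OF i] m[OF i] by (simp add: tensor_coords_def)
    show "x i k \<odot>\<^bsub>B\<^esub> m i \<in> carrier B" using B free_carrierD(1)[OF x[OF i]] m[OF i] by simp
  qed
  finally show ?thesis .
qed

lemma tensor_coords_zero:
  fixes K :: "'k set" and B :: "('a,'x) module"
  assumes B: "module R B" and e: "tensor_coords K B \<epsilon>" and z: "z \<in> carrier (tensor R (free_module R K) B)"
    and 0: "\<And>k. \<epsilon> k z = \<zero>\<^bsub>B\<^esub>"
  shows "z = \<zero>\<^bsub>tensor R (free_module R K) B\<^esub>"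
proof -
  let ?F = "free_module R K"
  have T: "module R (tensor R ?F B)" by (rule module_tensor[OF module_free B])
  have gz: "pure_tensor R ?F B x \<zero>\<^bsub>B\<^esub> = \<zero>\<^bsub>tensor R ?F B\<^esub>" if "x \<in> carrier ?F" for x
    using hom_zero[OF pure_tensor_homs(2)[OF module_free B that] B T] B by simp
  have "\<forall>z\<in>carrier (tensor R ?F B). \<exists>U. finite U \<and> U \<subseteq> K \<and>
      z = finsum (tensor R ?F B) (\<lambda>k. pure_tensor R ?F B (free_gen R k) (\<epsilon> k z)) U"
    using e by (simp add: tensor_coords_def)
  then obtain U where U: "U \<subseteq> K"
    "z = finsum (tensor R ?F B) (\<lambda>k. pure_tensor R ?F B (free_gen R k) (\<epsilon> k z)) U" using z by blast
  have "finsum (tensor R ?F B) (\<lambda>k. pure_tensor R ?F B (free_gen R k) (\<epsilon> k z)) U = \<zero>\<^bsub>tensor R ?F B\<^esub>"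
    by (rule mod_finsum_zero[OF T]) (use U(1) gz 0 in auto)
  with U(2) show ?thesis by simp
qed

lemma a_kernel_mem: "x \<in> a_kernel M N f \<longleftrightarrow> x \<in> carrier M \<and> f x = \<zero>\<^bsub>N\<^esub>"
  by (auto simp: a_kernel_def')

lemma quot_sub_module_smult:
  "smult (quot_module (sub_module M Z) N) = smult (quot_module M N)"
  by (simp add: quot_module_def a_r_coset_def')

lemma GV_torsion_iff:
  "GV_torsion R M \<longleftrightarrow> (\<forall>x\<in>carrier M. \<exists>J\<in>GV_ideals R. \<forall>r\<in>J. r \<odot>\<^bsub>M\<^esub> x = \<zero>\<^bsub>M\<^esub>)"
  by (auto simp: GV_torsion_def tor_GV_def)

text \<open>\<open>Tor\<^sub>1\<close> is the quotient of the module of cycles.  The multiples of a coset in it may be computed in the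
  quotient of the whole chain module, as addition and scalar multiplication are the same.\<close>

lemma GV_torsion_subquotient:
  assumes M: "module R M" and N: "submodule N R M" and Z: "Z \<subseteq> carrier M"
  shows "GV_torsion R (quot_module (sub_module M Z) N) \<longleftrightarrow>
    (\<forall>z\<in>Z. \<exists>J\<in>GV_ideals R. \<forall>r\<in>J. r \<odot>\<^bsub>M\<^esub> z \<in> N)"
proof -
  have c: "carrier (quot_module (sub_module M Z) N) = (\<lambda>z. N +>\<^bsub>M\<^esub> z) ` Z"
    by (simp add: quot_carrier a_r_coset_def')
  have "r \<odot>\<^bsub>quot_module (sub_module M Z) N\<^esub> (N +>\<^bsub>M\<^esub> z) = \<zero>\<^bsub>quot_module (sub_module M Z) N\<^esub> \<longleftrightarrow>
      r \<odot>\<^bsub>M\<^esub> z \<in> N" if "z \<in> Z" "r \<in> carrier R" for r z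
  proof -
    have "\<zero>\<^bsub>quot_module (sub_module M Z) N\<^esub> = \<zero>\<^bsub>quot_module M N\<^esub>" by (simp add: quot_module_def)
    then show ?thesis
      using quot_smult[OF M N, of z r] coset_eq_zero_iff[OF M N, of "r \<odot>\<^bsub>M\<^esub> z"] that Z M
      by (auto simp: quot_sub_module_smult)
  qed
  then show ?thesis unfolding GV_torsion_iff c using GV_idealD(2) by (auto simp: subset_iff)
qed

text \<open>In coordinates, the maps of \<open>F\<^sub>2 \<otimes> B \<rightarrow> F\<^sub>1 \<otimes> B \<rightarrow> F\<^sub>0 \<otimes> B\<close> are the matrices whose columns are the elements of
  \<open>tor_K1\<close> and \<open>tor_K0\<close>.\<close>

lemma Tor1_GV_torsion_iff:
  fixes A :: "('a,'s) module" and B :: "('a,'x) module"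
  assumes A: "module R A" and B: "module R B"
  shows "GV_torsion R (Tor1 R A B) \<longleftrightarrow> tor_cond R (tor_K0 R A) (tor_K1 R A) B"
proof -
  define F0 where "F0 = free_module R (carrier A)"
  define K0 where "K0 = tor_K0 R A"
  define F1 where "F1 = free_module R K0"
  define d1 where "d1 = free_eval R F0 K0"
  define K1 where "K1 = tor_K1 R A"
  define F2 where "F2 = free_module R K1"
  define d2 where "d2 = free_eval R F1 K1"
  define T0 where "T0 = tensor R F0 B"
  define T1 where "T1 = tensor R F1 B"
  define T2 where "T2 = tensor R F2 B"
  have F: "module R F0" "module R F1" "module R F2"
    unfolding F0_def F1_def F2_def by (rule module_free)+
  have T: "module R T0" "module R T1" "module R T2"
    unfolding T0_def T1_def T2_def by (intro module_tensor F B)+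
  have K0: "K0 \<subseteq> carrier F0" unfolding K0_def tor_K0_def F0_def by (auto simp: a_kernel_mem)
  have K1: "K1 \<subseteq> carrier F1" unfolding K1_def tor_K1_def F1_def K0_def by (auto simp: a_kernel_mem)
  have d1: "d1 \<in> mod_hom R F1 F0" and d1g: "\<And>k. k \<in> K0 \<Longrightarrow> d1 (free_gen R k) = k"
    unfolding d1_def F1_def free_eval_eq
    using free_lift_hom[OF F(1), of K0 "\<lambda>s. s"] free_lift_gen[OF F(1), of K0 "\<lambda>s. s"] K0 by auto
  have d2: "d2 \<in> mod_hom R F2 F1" and d2g: "\<And>k. k \<in> K1 \<Longrightarrow> d2 (free_gen R k) = k"
    unfolding d2_def F2_def free_eval_eq
    using free_lift_hom[OF F(2), of K1 "\<lambda>s. s"] free_lift_gen[OF F(2), of K1 "\<lambda>s. s"] K1 by auto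
  define D1 where "D1 = tensor_map R F1 F0 B d1"
  define D2 where "D2 = tensor_map R F2 F1 B d2"
  have D1: "D1 \<in> mod_hom R T1 T0"
    unfolding D1_def T1_def T0_def by (rule tensor_map(1)[OF F(2) F(1) B d1])
  have D2: "D2 \<in> mod_hom R T2 T1"
    unfolding D2_def T1_def T2_def by (rule tensor_map(1)[OF F(3) F(2) B d2])
  obtain e0 where e0: "tensor_coords (carrier A) B e0" using ex_tensor_coords[OF B] ..
  obtain e1 where e1: "tensor_coords K0 B e1" using ex_tensor_coords[OF B] ..
  obtain e2 where e2: "tensor_coords K1 B e2" using ex_tensor_coords[OF B] ..
  have eh: "e0 i \<in> mod_hom R T0 B" "e1 j \<in> mod_hom R T1 B" "e2 k \<in> mod_hom R T2 B" for i j k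
    using e0 e1 e2 by (simp_all add: tensor_coords_def T0_def T1_def T2_def F0_def F1_def F2_def)
  note zero0 = tensor_coords_zero[OF B e0, folded F0_def, folded T0_def]
  note zero1 = tensor_coords_zero[OF B e1, folded F1_def, folded T1_def]
  have gen1: "free_gen R k \<in> carrier F1" if "k \<in> K0" for k using that unfolding F1_def by simp
  have gen2: "free_gen R k \<in> carrier F2" if "k \<in> K1" for k using that unfolding F2_def by simp
  let ?s1 = "\<lambda>m U. finsum T1 (\<lambda>k. pure_tensor R F1 B (free_gen R k) (m k)) U"
  let ?s2 = "\<lambda>m U. finsum T2 (\<lambda>k. pure_tensor R F2 B (free_gen R k) (m k)) U"
  have s1c: "?s1 m U \<in> carrier T1" if "U \<subseteq> K0" "\<And>k. k \<in> U \<Longrightarrow> m k \<in> carrier B" for m U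
    by (rule mod_finsum_closed[OF T(2)]) (use that gen1 in \<open>auto simp: T1_def\<close>)
  have s2c: "?s2 m U \<in> carrier T2" if "U \<subseteq> K1" "\<And>k. k \<in> U \<Longrightarrow> m k \<in> carrier B" for m U
    by (rule mod_finsum_closed[OF T(3)]) (use that gen2 in \<open>auto simp: T2_def\<close>)
  have exp1: "\<exists>U. finite U \<and> U \<subseteq> K0 \<and> z = ?s1 (\<lambda>k. e1 k z) U" if "z \<in> carrier T1" for z
    using e1 that by (simp add: tensor_coords_def T1_def F1_def)
  have exp2: "\<exists>U. finite U \<and> U \<subseteq> K1 \<and> z = ?s2 (\<lambda>k. e2 k z) U" if "z \<in> carrier T2" for z
    using e2 that by (simp add: tensor_coords_def T2_def F2_def)
  \<comment> \<open>the coordinates of the images under \<open>D1\<close> and \<open>D2\<close> of a sum of elementary tensors\<close>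
  have c1: "e0 s (D1 (?s1 m U)) = lcomb B U (\<lambda>k. k s) m"
    if U: "finite U" "U \<subseteq> K0" "\<And>k. k \<in> U \<Longrightarrow> m k \<in> carrier B" for U m s
  proof -
    have "D1 (?s1 m U) = finsum T0 (\<lambda>k. pure_tensor R F0 B (d1 (free_gen R k)) (m k)) U"
      unfolding D1_def T1_def T0_def by (rule tensor_map_finsum[OF F(2,1) B d1]) (use U gen1 in auto)
    also have "\<dots> = finsum T0 (\<lambda>k. pure_tensor R F0 B k (m k)) U"
      by (rule mod_finsum_cong[OF T(1)]) (use U d1g K0 in \<open>auto simp: T0_def\<close>)
    finally show ?thesis
      using tensor_coords_finsum[OF B e0 U(1), of "\<lambda>k. k" m s] U K0 by (simp add: T0_def F0_def subset_iff)
  qed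
  have c2: "e1 s (D2 (?s2 m U)) = lcomb B U (\<lambda>k. k s) m"
    if U: "finite U" "U \<subseteq> K1" "\<And>k. k \<in> U \<Longrightarrow> m k \<in> carrier B" for U m s
  proof -
    have "D2 (?s2 m U) = finsum T1 (\<lambda>k. pure_tensor R F1 B (d2 (free_gen R k)) (m k)) U"
      unfolding D2_def T2_def T1_def by (rule tensor_map_finsum[OF F(3,2) B d2]) (use U gen2 in auto)
    also have "\<dots> = finsum T1 (\<lambda>k. pure_tensor R F1 B k (m k)) U"
      by (rule mod_finsum_cong[OF T(2)]) (use U d2g K1 in \<open>auto simp: T1_def\<close>)
    finally show ?thesis
      using tensor_coords_finsum[OF B e1 U(1), of "\<lambda>k. k" m s] U K1 by (simp add: T1_def F1_def subset_iff)
  qed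
  have coord: "e1 k (?s1 m U) = (if k \<in> U then m k else \<zero>\<^bsub>B\<^esub>)"
    if U: "finite U" "U \<subseteq> K0" "\<And>k. k \<in> U \<Longrightarrow> m k \<in> carrier B" for U m k
  proof -
    have "e1 k (?s1 m U) = lcomb B U (\<lambda>j. free_gen R j k) m"
      using tensor_coords_finsum[OF B e1 U(1), of "free_gen R" m k] U gen1
      by (simp add: T1_def F1_def subset_iff)
    also have "\<dots> = (if k \<in> U then m k else \<zero>\<^bsub>B\<^esub>)"
    proof (cases "k \<in> U")
      case True
      then show ?thesis
        by (subst lcomb_single[OF B U(1) True]) (use U B in \<open>auto simp: free_gen_def\<close>)
    next
      case False
      then show ?thesis
        by (subst lcomb_zero[OF B]) (use U in \<open>auto simp: free_gen_def\<close>)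
    qed
    finally show ?thesis .
  qed
  define Z where "Z = a_kernel T1 T0 D1"
  define Im where "Im = D2 ` carrier T2"
  have Tor: "Tor1 R A B = quot_module (sub_module T1 Z) Im"
    unfolding Tor1_def Let_def Z_def Im_def T0_def T1_def T2_def D1_def D2_def d1_def d2_def
      F0_def F1_def F2_def K0_def K1_def tor_K0_def tor_K1_def by simp
  have Imsub: "submodule Im R T1" unfolding Im_def by (rule image_submodule[OF T(3,2) D2])
  have ImI: "z \<in> Im \<longleftrightarrow> tor_null K1 B (\<lambda>k. e1 k z)" if z: "z \<in> carrier T1" for z
  proof
    assume "z \<in> Im"
    then obtain w where w: "w \<in> carrier T2" "z = D2 w" unfolding Im_def by auto
    obtain U where U: "finite U" "U \<subseteq> K1"
      "w = finsum T2 (\<lambda>k. pure_tensor R F2 B (free_gen R k) (e2 k w)) U" using exp2[OF w(1)] by blast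
    have ec: "e2 k w \<in> carrier B" for k using hom_closed[OF eh(3) w(1)] .
    have "lcomb B U (\<lambda>\<kappa>. \<kappa> k) (\<lambda>\<kappa>. e2 \<kappa> w) = e1 k z" for k
      using c2[of U "\<lambda>\<kappa>. e2 \<kappa> w" k, OF U(1,2) ec, folded U(3) w(2)] by simp
    then show "tor_null K1 B (\<lambda>k. e1 k z)" unfolding tor_null_def
      by (intro exI[of _ U] exI[of _ "\<lambda>\<kappa>. e2 \<kappa> w"]) (simp add: U(1,2) ec)
  next
    assume "tor_null K1 B (\<lambda>k. e1 k z)"
    then obtain U n where U: "finite U" "U \<subseteq> K1" "\<And>\<kappa>. \<kappa> \<in> U \<Longrightarrow> n \<kappa> \<in> carrier B"
      and eq: "\<And>k. lcomb B U (\<lambda>\<kappa>. \<kappa> k) n = e1 k z" unfolding tor_null_def by blast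
    let ?w = "finsum T2 (\<lambda>k. pure_tensor R F2 B (free_gen R k) (n k)) U"
    have w: "?w \<in> carrier T2" by (rule s2c[OF U(2,3)])
    have Dw: "D2 ?w \<in> carrier T1" using hom_closed[OF D2 w] .
    have "z \<ominus>\<^bsub>T1\<^esub> D2 ?w = \<zero>\<^bsub>T1\<^esub>"
    proof (rule zero1)
      show "e1 k (z \<ominus>\<^bsub>T1\<^esub> D2 ?w) = \<zero>\<^bsub>B\<^esub>" for k
        using hom_diff[OF eh(2) T(2) B z Dw, of k] c2[of U n k, OF U] eq[of k]
          hom_closed[OF eh(2) z, of k] B by (simp add: mod_diff_eq_zero)
    qed (use T z Dw in simp)
    then have "z = D2 ?w" using T z Dw by (simp add: mod_diff_eq_zero)
    then show "z \<in> Im" using w unfolding Im_def by blast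
  qed
  have "GV_torsion R (Tor1 R A B) \<longleftrightarrow> (\<forall>z\<in>Z. \<exists>J\<in>GV_ideals R. \<forall>r\<in>J. r \<odot>\<^bsub>T1\<^esub> z \<in> Im)"
    unfolding Tor by (rule GV_torsion_subquotient[OF T(2) Imsub]) (auto simp: Z_def a_kernel_mem)
  also have "\<dots> \<longleftrightarrow> tor_cond R K0 K1 B"
  proof
    assume *: "\<forall>z\<in>Z. \<exists>J\<in>GV_ideals R. \<forall>r\<in>J. r \<odot>\<^bsub>T1\<^esub> z \<in> Im"
    show "tor_cond R K0 K1 B" unfolding tor_cond_def
    proof (intro allI impI; elim conjE)
      fix U m assume U: "finite U" "U \<subseteq> K0" and m0: "\<forall>k\<in>U. m k \<in> carrier B"
        and eq: "\<forall>s. lcomb B U (\<lambda>k. k s) m = \<zero>\<^bsub>B\<^esub>"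
      have m: "\<And>k. k \<in> U \<Longrightarrow> m k \<in> carrier B" using m0 by blast
      let ?z = "finsum T1 (\<lambda>k. pure_tensor R F1 B (free_gen R k) (m k)) U"
      have z: "?z \<in> carrier T1" by (rule s1c[OF U(2) m])
      have "D1 ?z = \<zero>\<^bsub>T0\<^esub>"
        by (rule zero0) (use hom_closed[OF D1 z] c1[of U m, OF U m] eq in auto)
      then have "?z \<in> Z" using z by (simp add: Z_def a_kernel_mem)
      then obtain J where J: "J \<in> GV_ideals R" "\<forall>r\<in>J. r \<odot>\<^bsub>T1\<^esub> ?z \<in> Im" using * by blast
      have "tor_null K1 B (\<lambda>k. if k \<in> U then r \<odot>\<^bsub>B\<^esub> m k else \<zero>\<^bsub>B\<^esub>)" if r: "r \<in> J" for r
      proof -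
        have rc: "r \<in> carrier R" using r GV_idealD(2)[OF J(1)] by auto
        have "e1 k (r \<odot>\<^bsub>T1\<^esub> ?z) = (if k \<in> U then r \<odot>\<^bsub>B\<^esub> m k else \<zero>\<^bsub>B\<^esub>)" for k
          using hom_smult[OF eh(2) rc z, of k] coord[of U m k, OF U m] B rc by simp
        then show ?thesis using ImI[of "r \<odot>\<^bsub>T1\<^esub> ?z"] J r rc z T by simp
      qed
      then show "\<exists>J\<in>GV_ideals R. \<forall>r\<in>J. tor_null K1 B (\<lambda>k. if k \<in> U then r \<odot>\<^bsub>B\<^esub> m k else \<zero>\<^bsub>B\<^esub>)"
        using J(1) by blast
    qed
  next
    assume *: "tor_cond R K0 K1 B"
    show "\<forall>z\<in>Z. \<exists>J\<in>GV_ideals R. \<forall>r\<in>J. r \<odot>\<^bsub>T1\<^esub> z \<in> Im"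
    proof
      fix z assume "z \<in> Z"
      then have z: "z \<in> carrier T1" "D1 z = \<zero>\<^bsub>T0\<^esub>" by (auto simp: Z_def a_kernel_mem)
      let ?m = "\<lambda>k. e1 k z"
      have ec: "?m k \<in> carrier B" for k using hom_closed[OF eh(2) z(1)] .
      obtain U where U: "finite U" "U \<subseteq> K0"
        and zU: "z = finsum T1 (\<lambda>k. pure_tensor R F1 B (free_gen R k) (?m k)) U"
        using exp1[OF z(1)] by blast
      have "lcomb B U (\<lambda>k. k s) ?m = \<zero>\<^bsub>B\<^esub>" for s
        using c1[of U ?m s, OF U ec, folded zU] z(2) hom_zero[OF eh(1) T(1) B] by simp
      then obtain J where J: "J \<in> GV_ideals R"
        "\<forall>r\<in>J. tor_null K1 B (\<lambda>k. if k \<in> U then r \<odot>\<^bsub>B\<^esub> ?m k else \<zero>\<^bsub>B\<^esub>)"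
        using *[unfolded tor_cond_def, rule_format, of U ?m] U ec by blast
      have "r \<odot>\<^bsub>T1\<^esub> z \<in> Im" if r: "r \<in> J" for r
      proof -
        have rc: "r \<in> carrier R" using r GV_idealD(2)[OF J(1)] by auto
        have "e1 k (r \<odot>\<^bsub>T1\<^esub> z) = (if k \<in> U then r \<odot>\<^bsub>B\<^esub> ?m k else \<zero>\<^bsub>B\<^esub>)" for k
          using hom_smult[OF eh(2) rc z(1), of k] coord[of U ?m k, OF U ec, folded zU] B rc by (cases "k \<in> U") auto
        then show ?thesis using ImI[of "r \<odot>\<^bsub>T1\<^esub> z"] J r rc z T by simp
      qed
      then show "\<exists>J\<in>GV_ideals R. \<forall>r\<in>J. r \<odot>\<^bsub>T1\<^esub> z \<in> Im" using J(1) by blast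
    qed
  qed
  finally show ?thesis unfolding K0_def K1_def .
qed

lemma tor_K0_subset: "tor_K0 R A \<subseteq> carrier (free_module R UNIV)"
  unfolding tor_K0_def by (auto simp: a_kernel_mem free_carrier)

lemma tor_K1_subset: "tor_K1 R A \<subseteq> carrier (free_module R UNIV)"
  unfolding tor_K1_def by (auto simp: a_kernel_mem free_carrier)

lemma semi_regular_w_flat_iff:
  "M \<in> semi_regular_w_flat R \<longleftrightarrow> module R M \<and> (\<forall>I\<in>fg_semi_regular_ideals R.
    tor_cond R (tor_K0 R (quot_module (regular_module R) I)) (tor_K1 R (quot_module (regular_module R) I)) M)"
proof -
  have "module R (quot_module (regular_module R) I)" if "I \<in> fg_semi_regular_ideals R" for I
    using that fg_ideal_ideal ideal_submodule module_quot[OF module_regular]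
    by (auto simp: fg_semi_regular_ideals_def)
  then show ?thesis by (auto simp: semi_regular_w_flat_def Tor1_GV_torsion_iff)
qed

end

section \<open>Purity and solvability of linear systems\<close>

text \<open>Cohn's description of purity: a finite linear system with right-hand sides in \<open>N\<close> that has a
  solution in \<open>M\<close> has one in \<open>N\<close>.\<close>

definition sys_pure :: "('a,'r) ring_scheme \<Rightarrow> 'b set \<Rightarrow> ('a,'b) module \<Rightarrow> bool" where
  "sys_pure R N M \<longleftrightarrow> submodule N R M \<and> (\<forall>(n::nat) (m::nat) a b y.
     (\<forall>i<n. \<forall>j<m. a i j \<in> carrier R) \<longrightarrow> (\<forall>i<n. b i \<in> N) \<longrightarrow> (\<forall>j<m. y j \<in> carrier M) \<longrightarrow>
     (\<forall>i<n. lcomb M {..<m} (a i) y = b i) \<longrightarrow>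
     (\<exists>y'. (\<forall>j<m. y' j \<in> N) \<and> (\<forall>i<n. lcomb M {..<m} (a i) y' = b i)))"

context cring
begin

lemma sys_pure_submodule: "sys_pure R N M \<Longrightarrow> submodule N R M"
  by (simp add: sys_pure_def)

lemma sys_pure_solve:
  fixes m n :: nat
  assumes "sys_pure R N M" "\<And>i j. \<lbrakk>i < n; j < m\<rbrakk> \<Longrightarrow> a i j \<in> carrier R"
    "\<And>i. i < n \<Longrightarrow> b i \<in> N" "\<And>j. j < m \<Longrightarrow> y j \<in> carrier M"
    "\<And>i. i < n \<Longrightarrow> lcomb M {..<m} (a i) y = b i"
  shows "\<exists>y'. (\<forall>j<m. y' j \<in> N) \<and> (\<forall>i<n. lcomb M {..<m} (a i) y' = b i)"
  using assms(1)[unfolded sys_pure_def, THEN conjunct2, rule_format, of n m a b y] assms(2-5) by blast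

lemma sys_pure_finite:
  assumes M: "module R M" and pure: "sys_pure R N M" and E: "finite E" and V: "finite V"
    and a: "\<And>e v. \<lbrakk>e \<in> E; v \<in> V\<rbrakk> \<Longrightarrow> a e v \<in> carrier R" and b: "\<And>e. e \<in> E \<Longrightarrow> b e \<in> N"
    and y: "\<And>v. v \<in> V \<Longrightarrow> y v \<in> carrier M"
    and eq: "\<And>e. e \<in> E \<Longrightarrow> lcomb M V (a e) y = b e"
  shows "\<exists>y'. (\<forall>v\<in>V. y' v \<in> N) \<and> (\<forall>e\<in>E. lcomb M V (a e) y' = b e)"
proof -
  let ?n = "card E" and ?m = "card V"
  obtain f where f: "bij_betw f {..<?n} E" using ex_bij_betw_nat_finite[OF E] by (auto simp: lessThan_atLeast0)
  obtain g where g: "bij_betw g {..<?m} V" using ex_bij_betw_nat_finite[OF V] by (auto simp: lessThan_atLeast0)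
  have fE: "f i \<in> E" if "i < ?n" for i using f that by (auto simp: bij_betw_def)
  have gV: "g j \<in> V" if "j < ?m" for j using g that by (auto simp: bij_betw_def)
  have gi: "inj_on g {..<?m}" "V = g ` {..<?m}" using g by (auto simp: bij_betw_def)
  have re: "lcomb M V (a e) z = lcomb M {..<?m} (\<lambda>j. a e (g j)) (\<lambda>j. z (g j))"
    if "e \<in> E" "\<And>v. v \<in> V \<Longrightarrow> z v \<in> carrier M" for e z
    using lcomb_reindex[OF M gi(1), of "a e" z] that a gV gi(2) by simp
  have "\<exists>y'. (\<forall>j<?m. y' j \<in> N) \<and>
      (\<forall>i<?n. lcomb M {..<?m} (\<lambda>j. a (f i) (g j)) y' = b (f i))"
    by (rule sys_pure_solve[OF pure, where y="\<lambda>j. y (g j)"])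
      (use fE gV a b y eq re[OF _ y] in auto)
  then obtain y' where y': "\<And>j. j < ?m \<Longrightarrow> y' j \<in> N"
    "\<And>i. i < ?n \<Longrightarrow> lcomb M {..<?m} (\<lambda>j. a (f i) (g j)) y' = b (f i)" by blast
  define z where "z v = y' (inv_into {..<?m} g v)" for v
  have zg: "z (g j) = y' j" if "j < ?m" for j using that gi(1) by (simp add: z_def)
  have zN: "z v \<in> N" if v: "v \<in> V" for v
  proof -
    obtain j where "j < ?m" "v = g j" using v gi(2) by blast
    then show ?thesis using y'(1) zg by simp
  qed
  have zM: "z v \<in> carrier M" if "v \<in> V" for v
    using zN[OF that] submoduleD(3)[OF M sys_pure_submodule[OF pure]] by simp
  have "lcomb M V (a e) z = b e" if e: "e \<in> E" for e
  proof -
    obtain i where i: "i < ?n" "e = f i" using e f by (auto simp: bij_betw_def)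
    have "lcomb M V (a e) z = lcomb M {..<?m} (\<lambda>j. a e (g j)) (\<lambda>j. z (g j))"
      by (rule re[OF e zM])
    also have "\<dots> = lcomb M {..<?m} (\<lambda>j. a e (g j)) y'"
      by (rule lcomb_cong[OF M]) (use e gV a zg zM[OF gV] in auto)
    also have "\<dots> = b e" using y'(2)[OF i(1)] i(2) by simp
    finally show ?thesis .
  qed
  then show ?thesis using zN by blast
qed

lemma sys_pure_zero:
  assumes M: "module R M"
  shows "sys_pure R {\<zero>\<^bsub>M\<^esub>} M"
  unfolding sys_pure_def
proof (intro conjI allI impI)
  show "submodule {\<zero>\<^bsub>M\<^esub>} R M" by (rule submoduleI'[OF M]) (use M in auto)
  fix n m a b y
  assume "\<forall>i<n. \<forall>j<m. a i j \<in> carrier R" "\<forall>i<n. b i \<in> {\<zero>\<^bsub>M\<^esub>}"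
  then show "\<exists>y'. (\<forall>j<m. y' j \<in> {\<zero>\<^bsub>M\<^esub>}) \<and> (\<forall>i<n. lcomb M {..<m} (a i) y' = b i)"
    by (intro exI[of _ "\<lambda>_. \<zero>\<^bsub>M\<^esub>"]) (auto intro!: lcomb_zero[OF M] simp: M)
qed

end

section \<open>Direct sums\<close>

context cring
begin

lemma direct_sum_simps [simp]:
  "zero (direct_sum I M) = (\<lambda>i\<in>I. \<zero>\<^bsub>M i\<^esub>)"
  "add (direct_sum I M) x y = (\<lambda>i\<in>I. x i \<oplus>\<^bsub>M i\<^esub> y i)"
  "smult (direct_sum I M) r x = (\<lambda>i\<in>I. r \<odot>\<^bsub>M i\<^esub> x i)"
  by (auto simp: direct_sum_def)

lemma direct_sum_carrierI:
  assumes "\<And>i. i \<in> I \<Longrightarrow> x i \<in> carrier (M i)" "x \<in> extensional I" "finite T"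
    "\<And>i. \<lbrakk>i \<in> I; x i \<noteq> \<zero>\<^bsub>M i\<^esub>\<rbrakk> \<Longrightarrow> i \<in> T"
  shows "x \<in> carrier (direct_sum I M)"
proof -
  have "{i \<in> I. x i \<noteq> \<zero>\<^bsub>M i\<^esub>} \<subseteq> T" using assms(4) by auto
  then have "finite {i \<in> I. x i \<noteq> \<zero>\<^bsub>M i\<^esub>}" using assms(3) finite_subset by auto
  then show ?thesis using assms(1,2) by (auto simp: direct_sum_def PiE_def)
qed

lemma direct_sum_carrierD:
  assumes "x \<in> carrier (direct_sum I M)"
  shows "i \<in> I \<Longrightarrow> x i \<in> carrier (M i)" "x \<in> extensional I" "finite {i \<in> I. x i \<noteq> \<zero>\<^bsub>M i\<^esub>}"
  using assms by (auto simp: direct_sum_def PiE_def)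

lemma direct_sum_eqI:
  assumes "x \<in> carrier (direct_sum I M)" "y \<in> carrier (direct_sum I M)" "\<And>i. i \<in> I \<Longrightarrow> x i = y i"
  shows "x = y"
  using extensionalityI[OF direct_sum_carrierD(2)[OF assms(1)] direct_sum_carrierD(2)[OF assms(2)]]
    assms(3) by blast

lemma module_direct_sum:
  assumes M: "\<And>i. i \<in> I \<Longrightarrow> module R (M i)"
  shows "module R (direct_sum I M)"
proof -
  let ?D = "direct_sum I M"
  have add: "x \<oplus>\<^bsub>?D\<^esub> y \<in> carrier ?D" if x: "x \<in> carrier ?D" and y: "y \<in> carrier ?D" for x y
  proof (rule direct_sum_carrierI)
    show "finite ({i \<in> I. x i \<noteq> \<zero>\<^bsub>M i\<^esub>} \<union> {i \<in> I. y i \<noteq> \<zero>\<^bsub>M i\<^esub>})"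
      using direct_sum_carrierD(3)[OF x] direct_sum_carrierD(3)[OF y] by simp
  qed (use M direct_sum_carrierD(1)[OF x] direct_sum_carrierD(1)[OF y] in auto)
  have smult: "r \<odot>\<^bsub>?D\<^esub> x \<in> carrier ?D" if x: "x \<in> carrier ?D" and r: "r \<in> carrier R" for r x
    by (rule direct_sum_carrierI[OF _ _ direct_sum_carrierD(3)[OF x]])
      (use r M direct_sum_carrierD(1)[OF x] in auto)
  have zero: "\<zero>\<^bsub>?D\<^esub> \<in> carrier ?D"
    by (rule direct_sum_carrierI[of _ _ _ "{}"]) (use M in auto)
  note D = direct_sum_carrierD
  show ?thesis
  proof (rule moduleI)
    show "abelian_group ?D"
    proof (rule abelian_groupI)
      fix x assume x: "x \<in> carrier ?D"
      show "\<exists>y\<in>carrier ?D. y \<oplus>\<^bsub>?D\<^esub> x = \<zero>\<^bsub>?D\<^esub>"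
      proof
        show "(\<ominus> \<one>) \<odot>\<^bsub>?D\<^esub> x \<in> carrier ?D" using smult x by blast
        then show "(\<ominus> \<one>) \<odot>\<^bsub>?D\<^esub> x \<oplus>\<^bsub>?D\<^esub> x = \<zero>\<^bsub>?D\<^esub>"
          by (intro direct_sum_eqI[OF add[OF _ x] zero])
            (use M D(1)[OF x] in \<open>auto simp: mod_smult_neg_one\<close>)
      qed
      show "\<zero>\<^bsub>?D\<^esub> \<oplus>\<^bsub>?D\<^esub> x = x"
        by (rule direct_sum_eqI[OF add[OF zero x] x]) (use M D(1)[OF x] in auto)
      fix y assume y: "y \<in> carrier ?D"
      show "x \<oplus>\<^bsub>?D\<^esub> y = y \<oplus>\<^bsub>?D\<^esub> x"
        by (rule direct_sum_eqI[OF add[OF x y] add[OF y x]])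
          (use M D(1)[OF x] D(1)[OF y] in \<open>auto intro: mod_comm\<close>)
      fix z assume z: "z \<in> carrier ?D"
      show "x \<oplus>\<^bsub>?D\<^esub> y \<oplus>\<^bsub>?D\<^esub> z = x \<oplus>\<^bsub>?D\<^esub> (y \<oplus>\<^bsub>?D\<^esub> z)"
        by (rule direct_sum_eqI[OF add[OF add[OF x y] z] add[OF x add[OF y z]]])
          (use M D(1)[OF x] D(1)[OF y] D(1)[OF z] in \<open>auto intro: mod_assoc\<close>)
    qed (use add zero in auto)
    show "cring R" by (rule is_cring)
    show "r \<odot>\<^bsub>?D\<^esub> x \<in> carrier ?D" if "r \<in> carrier R" "x \<in> carrier ?D" for r x
      using smult that by blast
    show "(r \<oplus> s) \<odot>\<^bsub>?D\<^esub> x = r \<odot>\<^bsub>?D\<^esub> x \<oplus>\<^bsub>?D\<^esub> s \<odot>\<^bsub>?D\<^esub> x"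
      if "r \<in> carrier R" "s \<in> carrier R" "x \<in> carrier ?D" for r s x
      by (rule direct_sum_eqI[OF smult add[OF smult smult]])
        (use that M D(1)[OF that(3)] in \<open>auto simp: mod_smult_l_distr\<close>)
    show "r \<odot>\<^bsub>?D\<^esub> (x \<oplus>\<^bsub>?D\<^esub> y) = r \<odot>\<^bsub>?D\<^esub> x \<oplus>\<^bsub>?D\<^esub> r \<odot>\<^bsub>?D\<^esub> y"
      if "r \<in> carrier R" "x \<in> carrier ?D" "y \<in> carrier ?D" for r x y
      by (rule direct_sum_eqI[OF smult[OF add] add[OF smult smult]])
        (use that M D(1)[OF that(2)] D(1)[OF that(3)] in \<open>auto simp: mod_smult_r_distr\<close>)
    show "r \<otimes> s \<odot>\<^bsub>?D\<^esub> x = r \<odot>\<^bsub>?D\<^esub> (s \<odot>\<^bsub>?D\<^esub> x)"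
      if "r \<in> carrier R" "s \<in> carrier R" "x \<in> carrier ?D" for r s x
      by (rule direct_sum_eqI[OF smult smult[OF smult]])
        (use that M D(1)[OF that(3)] in \<open>auto simp: mod_smult_assoc\<close>)
    show "\<one> \<odot>\<^bsub>?D\<^esub> x = x" if "x \<in> carrier ?D" for x
      by (rule direct_sum_eqI[OF smult]) (use that M D(1)[OF that] in auto)
  qed
qed

lemma sum_inj_hom:
  assumes M: "\<And>i. i \<in> I \<Longrightarrow> module R (M i)" and j: "j \<in> I"
  shows "restrict (sum_inj I M j) (carrier (M j)) \<in> mod_hom R (M j) (direct_sum I M)"
proof -
  have c: "sum_inj I M j x \<in> carrier (direct_sum I M)" if "x \<in> carrier (M j)" for x
    by (rule direct_sum_carrierI[of _ _ _ "{j}"]) (use that M in \<open>auto simp: sum_inj_def split: if_splits\<close>)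
  show ?thesis
    by (rule mod_homI[OF M[OF j] c]) (use M in \<open>auto simp: sum_inj_def intro!: restrict_ext\<close>)
qed

lemma sum_inj_closed:
  "\<lbrakk>\<And>i. i \<in> I \<Longrightarrow> module R (M i); j \<in> I; x \<in> carrier (M j)\<rbrakk> \<Longrightarrow>
    sum_inj I M j x \<in> carrier (direct_sum I M)"
  using hom_closed[OF sum_inj_hom, of I M j x] by simp

lemma direct_sum_coord_hom:
  assumes M: "\<And>i. i \<in> I \<Longrightarrow> module R (M i)" and j: "j \<in> I"
  shows "(\<lambda>x\<in>carrier (direct_sum I M). x j) \<in> mod_hom R (direct_sum I M) (M j)"
  by (rule mod_homI[OF module_direct_sum[OF M]]) (use j direct_sum_carrierD(1) in fastforce)+

lemma direct_sum_expand:
  assumes M: "\<And>i. i \<in> I \<Longrightarrow> module R (M i)" and x: "x \<in> carrier (direct_sum I M)"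
    and S: "finite S" "S \<subseteq> I" "\<And>i. \<lbrakk>i \<in> I; x i \<noteq> \<zero>\<^bsub>M i\<^esub>\<rbrakk> \<Longrightarrow> i \<in> S"
  shows "finsum (direct_sum I M) (\<lambda>i. sum_inj I M i (x i)) S = x"
proof -
  let ?D = "direct_sum I M"
  have D: "module R ?D" by (rule module_direct_sum[OF M])
  have cl: "sum_inj I M i (x i) \<in> carrier ?D" if "i \<in> S" for i
    by (rule sum_inj_closed[where M=M, OF M]) (use that S(2) direct_sum_carrierD(1)[OF x] in auto)
  then have c: "finsum ?D (\<lambda>i. sum_inj I M i (x i)) S \<in> carrier ?D"
    using D by (intro mod_finsum_closed) auto
  show ?thesis
  proof (rule direct_sum_eqI[OF c x])
    fix j assume j: "j \<in> I"
    let ?p = "\<lambda>x\<in>carrier ?D. x j"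
    have xj: "x j \<in> carrier (M j)" by (rule direct_sum_carrierD(1)[OF x j])
    have "finsum ?D (\<lambda>i. sum_inj I M i (x i)) S j = ?p (finsum ?D (\<lambda>i. sum_inj I M i (x i)) S)"
      using c by simp
    also have "\<dots> = finsum (M j) (\<lambda>i. ?p (sum_inj I M i (x i))) S"
      by (rule hom_finsum[OF D M[OF j] direct_sum_coord_hom[OF M j] S(1)]) (use cl in auto)
    also have "\<dots> = finsum (M j) (\<lambda>i. ?p (sum_inj I M i (x i))) (S \<inter> {j})"
      by (rule mod_finsum_mono[OF M[OF j] S(1)])
        (use cl j xj in \<open>auto simp: sum_inj_def\<close>)
    also have "\<dots> = x j"
    proof (cases "j \<in> S")
      case True
      then have "S \<inter> {j} = {j}" by auto
      have xj: "x j \<in> carrier (M j)" by (rule direct_sum_carrierD(1)[OF x j])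
      show ?thesis unfolding \<open>S \<inter> {j} = {j}\<close> using cl[OF True] j M[OF j] xj
        by (subst mod_finsum_insert) (auto simp: sum_inj_def)
    next
      case False
      then have "x j = \<zero>\<^bsub>M j\<^esub>" using S(3) j by blast
      then show ?thesis using False M[OF j] by simp
    qed
    finally show "finsum ?D (\<lambda>i. sum_inj I M i (x i)) S j = x j" .
  qed
qed

lemma direct_sum_lift:
  assumes M: "\<And>i. i \<in> I \<Longrightarrow> module R (M i)" and P: "module R P"
    and g: "\<And>i. i \<in> I \<Longrightarrow> g i \<in> mod_hom R (M i) P"
  obtains h where "h \<in> mod_hom R (direct_sum I M) P"
    "\<And>i x. \<lbrakk>i \<in> I; x \<in> carrier (M i)\<rbrakk> \<Longrightarrow> h (sum_inj I M i x) = g i x"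
proof -
  let ?D = "direct_sum I M"
  have D: "module R ?D" by (rule module_direct_sum[OF M])
  let ?s = "\<lambda>x. {i \<in> I. x i \<noteq> \<zero>\<^bsub>M i\<^esub>}"
  let ?h = "\<lambda>x. finsum P (\<lambda>i. g i (x i)) (?s x)"
  have gc: "g i (x i) \<in> carrier P" if "i \<in> I" "x \<in> carrier ?D" for i x
    using that hom_closed[OF g] direct_sum_carrierD(1) by metis
  have ext: "?h x = finsum P (\<lambda>i. g i (x i)) T"
    if "x \<in> carrier ?D" "finite T" "T \<subseteq> I" "?s x \<subseteq> T" for x T
    by (rule mod_finsum_mono[OF P that(2,4), symmetric])
      (use that gc hom_zero[OF g M P] in auto)
  have "restrict ?h (carrier ?D) \<in> mod_hom R ?D P"
  proof (rule mod_homI[OF D])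
    fix x assume x: "x \<in> carrier ?D"
    note xs = direct_sum_carrierD(3)[OF x]
    show "?h x \<in> carrier P" by (rule mod_finsum_closed[OF P]) (use gc x in auto)
    show "?h (r \<odot>\<^bsub>?D\<^esub> x) = r \<odot>\<^bsub>P\<^esub> ?h x" if r: "r \<in> carrier R" for r
    proof -
      have "?h (r \<odot>\<^bsub>?D\<^esub> x) = finsum P (\<lambda>i. g i ((r \<odot>\<^bsub>?D\<^esub> x) i)) (?s x)"
        by (rule ext[OF mod_smult_closed[OF D r x]]) (use xs r M in auto)
      also have "\<dots> = finsum P (\<lambda>i. r \<odot>\<^bsub>P\<^esub> g i (x i)) (?s x)"
        by (rule mod_finsum_cong[OF P])
          (use r x gc P direct_sum_carrierD(1)[OF x] in \<open>auto simp: hom_smult[OF g]\<close>)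
      also have "\<dots> = r \<odot>\<^bsub>P\<^esub> ?h x"
        by (rule mod_finsum_smult[OF P r xs, symmetric]) (use gc x in auto)
      finally show ?thesis .
    qed
    fix y assume y: "y \<in> carrier ?D"
    note ys = direct_sum_carrierD(3)[OF y]
    let ?T = "?s x \<union> ?s y"
    have "?h (x \<oplus>\<^bsub>?D\<^esub> y) = finsum P (\<lambda>i. g i ((x \<oplus>\<^bsub>?D\<^esub> y) i)) ?T"
      by (rule ext[OF mod_add_closed[OF D x y]]) (use xs ys M in auto)
    also have "\<dots> = finsum P (\<lambda>i. g i (x i) \<oplus>\<^bsub>P\<^esub> g i (y i)) ?T"
      by (rule mod_finsum_cong[OF P])
        (use x y gc P direct_sum_carrierD(1)[OF x] direct_sum_carrierD(1)[OF y] in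
          \<open>auto simp: hom_add[OF g]\<close>)
    also have "\<dots> = finsum P (\<lambda>i. g i (x i)) ?T \<oplus>\<^bsub>P\<^esub> finsum P (\<lambda>i. g i (y i)) ?T"
      by (rule mod_finsum_add[OF P]) (use x y gc in auto)
    also have "finsum P (\<lambda>i. g i (x i)) ?T = ?h x" by (rule ext[symmetric]) (use xs ys x in auto)
    also have "finsum P (\<lambda>i. g i (y i)) ?T = ?h y" by (rule ext[symmetric]) (use xs ys y in auto)
    finally show "?h (x \<oplus>\<^bsub>?D\<^esub> y) = ?h x \<oplus>\<^bsub>P\<^esub> ?h y" .
  qed
  moreover have "restrict ?h (carrier ?D) (sum_inj I M i x) = g i x"
    if i: "i \<in> I" and x: "x \<in> carrier (M i)" for i x
  proof -
    have c: "sum_inj I M i x \<in> carrier ?D" by (rule sum_inj_closed[where M=M, OF M i x])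
    have "?h (sum_inj I M i x) = finsum P (\<lambda>j. g j (sum_inj I M i x j)) {i}"
      by (rule ext[OF c]) (use i in \<open>auto simp: sum_inj_def\<close>)
    also have "\<dots> = g i x" using i x P hom_closed[OF g[OF i] x]
      by (subst mod_finsum_insert) (auto simp: sum_inj_def)
    finally show ?thesis using c by simp
  qed
  ultimately show ?thesis by (rule that)
qed

section \<open>From tensor products to linear systems\<close>

text \<open>Let \<open>X\<close> be the module with generators \<open>e\<^sub>i\<close> and relations \<open>\<Sum>\<^sub>i a\<^sub>i\<^sub>j e\<^sub>i = 0\<close>.  If the system
  \<open>\<Sum>\<^sub>j a\<^sub>i\<^sub>j y\<^sub>j = b\<^sub>i\<close> has a solution in \<open>M\<close>, then \<open>\<Sum>\<^sub>i b\<^sub>i \<otimes> e\<^sub>i\<close> vanishes in \<open>M \<otimes> X\<close>, hence also in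
  \<open>N \<otimes> X\<close>.  The latter maps to the quotient of \<open>N\<^sup>n\<close> by the image of the matrix, and the sum is sent to
  the class of \<open>b\<close>; so the system has a solution in \<open>N\<close>.\<close>

lemma pure_submodule_sys_pure:
  fixes M :: "('a,'x) module"
  assumes M: "module R M" and pure: "pure_submodule R N M"
  shows "sys_pure R N M"
  unfolding sys_pure_def
proof (intro conjI allI impI)
  show N: "submodule N R M" using pure by (simp add: pure_submodule_def)
  fix n m :: nat and a b y
  assume a: "\<forall>i<n. \<forall>j<m. a i j \<in> carrier R" and b: "\<forall>i<n. b i \<in> N"
    and y: "\<forall>j<m. y j \<in> carrier M" and eq: "\<forall>i<n. lcomb M {..<m} (a i) y = b i"
  let ?N = "sub_module M N"
  note Nm = module_sub_module[OF M N]
  define F where "F = free_module R {..<n}"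
  have F: "module R F" unfolding F_def by (rule module_free)
  define c where "c j = (\<lambda>i. if i < n then a i j else \<zero>)" for j
  have c: "c j \<in> carrier F" if "j < m" for j
    unfolding F_def by (rule free_carrierI[of _ "{..<n}"]) (use a that in \<open>auto simp: c_def split: if_splits\<close>)
  have Fc: "\<phi> i \<in> carrier R" if "\<phi> \<in> carrier F" for \<phi> i
    using that unfolding F_def by (rule free_carrierD)
  define S where "S = module_span R F (c ` {..<m})"
  have S: "submodule S R F" unfolding S_def by (rule module_span_submodule[OF F]) (use c in auto)
  define X where "X = quot_module F S"
  have X: "module R X" unfolding X_def by (rule module_quot[OF F S])
  define g where "g i = S +>\<^bsub>F\<^esub> free_gen R i" for i
  have gF: "free_gen R i \<in> carrier F" if "i < n" for i using that unfolding F_def by simp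
  have gX: "g i \<in> carrier X" if "i < n" for i
    using gF[OF that] by (auto simp: X_def g_def quot_carrier)
  let ?p = "\<lambda>\<phi>\<in>carrier F. S +>\<^bsub>F\<^esub> \<phi>"
  have p: "?p \<in> mod_hom R F X" unfolding X_def by (rule quot_proj_hom[OF F S])
  \<comment> \<open>the columns of the matrix vanish in its cokernel\<close>
  have col: "lcomb X {..<n} (\<lambda>i. a i j) g = \<zero>\<^bsub>X\<^esub>" if j: "j < m" for j
  proof -
    have "lcomb F {..<n} (c j) (free_gen R) = c j"
      unfolding F_def by (rule free_expand) (use c[OF j] in \<open>auto simp: F_def c_def split: if_splits\<close>)
    moreover have "c j \<in> S" unfolding S_def using module_span_superset j by fast
    ultimately have "?p (lcomb F {..<n} (c j) (free_gen R)) = \<zero>\<^bsub>X\<^esub>"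
      using coset_eq_zero_iff[OF F S c[OF j]] c[OF j] by (simp add: X_def)
    also have "?p (lcomb F {..<n} (c j) (free_gen R)) = lcomb X {..<n} (c j) (\<lambda>i. ?p (free_gen R i))"
      by (rule hom_lcomb[OF F X p]) (use Fc[OF c[OF j]] gF in auto)
    also have "\<dots> = lcomb X {..<n} (\<lambda>i. a i j) g"
      by (rule lcomb_cong[OF X]) (use a j gF gX in \<open>auto simp: c_def g_def\<close>)
    finally show ?thesis .
  qed
  let ?TN = "tensor R ?N X" and ?TM = "tensor R M X"
  note TN = module_tensor[OF Nm X] and TM = module_tensor[OF M X]
  let ?inc = "\<lambda>x\<in>N. x"
  have inc: "?inc \<in> mod_hom R ?N M"
    using hom_restrict[OF M hom_id[OF M] N] submoduleD(1)[OF M N]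
    by (simp add: restrict_restrict Int_absorb1)
  note tm = tensor_map[OF Nm M X inc]
  have bN: "b i \<in> N" "b i \<in> carrier M" if "i < n" for i
    using b that submoduleD(3)[OF M N] by auto
  define t where "t = finsum ?TN (\<lambda>i. pure_tensor R ?N X (b i) (g i)) {..<n}"
  have t: "t \<in> carrier ?TN" unfolding t_def by (rule mod_finsum_closed[OF TN]) (use bN gX in auto)
  have "tensor_map R ?N M X ?inc t =
      finsum ?TM (\<lambda>i. tensor_map R ?N M X ?inc (pure_tensor R ?N X (b i) (g i))) {..<n}"
    unfolding t_def by (rule hom_finsum[OF TN TM tm(1)]) (use bN gX in auto)
  also have "\<dots> = finsum ?TM (\<lambda>i. finsum ?TM (\<lambda>j. a i j \<odot>\<^bsub>?TM\<^esub> pure_tensor R M X (y j) (g i)) {..<m}) {..<n}"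
  proof (rule mod_finsum_cong[OF TM])
    fix i assume "i \<in> {..<n}"
    then have i: "i < n" by simp
    have "tensor_map R ?N M X ?inc (pure_tensor R ?N X (b i) (g i)) = pure_tensor R M X (b i) (g i)"
      using tm(2) bN[OF i] gX[OF i] by simp
    also have "\<dots> = (\<lambda>x\<in>carrier M. pure_tensor R M X x (g i)) (lcomb M {..<m} (a i) y)"
      using eq i bN by simp
    also have "\<dots> = lcomb ?TM {..<m} (a i) (\<lambda>j. (\<lambda>x\<in>carrier M. pure_tensor R M X x (g i)) (y j))"
      by (rule hom_lcomb[OF M TM pure_tensor_homs(1)[OF M X gX[OF i]]]) (use a y i in auto)
    also have "\<dots> = finsum ?TM (\<lambda>j. a i j \<odot>\<^bsub>?TM\<^esub> pure_tensor R M X (y j) (g i)) {..<m}"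
      unfolding lcomb_def by (rule mod_finsum_cong[OF TM]) (use a y i gX TM in auto)
    finally show "tensor_map R ?N M X ?inc (pure_tensor R ?N X (b i) (g i)) =
      finsum ?TM (\<lambda>j. a i j \<odot>\<^bsub>?TM\<^esub> pure_tensor R M X (y j) (g i)) {..<m}" .
    show "finsum ?TM (\<lambda>j. a i j \<odot>\<^bsub>?TM\<^esub> pure_tensor R M X (y j) (g i)) {..<m} \<in> carrier ?TM"
      by (rule mod_finsum_closed[OF TM]) (use a y i gX TM in auto)
  qed
  also have "\<dots> = finsum ?TM (\<lambda>j. finsum ?TM (\<lambda>i. a i j \<odot>\<^bsub>?TM\<^esub> pure_tensor R M X (y j) (g i)) {..<n}) {..<m}"
    by (rule mod_finsum_swap[OF TM]) (use a y gX TM in auto)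
  also have "\<dots> = \<zero>\<^bsub>?TM\<^esub>"
  proof (rule mod_finsum_zero[OF TM])
    fix j assume "j \<in> {..<m}"
    then have j: "j < m" by simp
    then have yj: "y j \<in> carrier M" using y by simp
    let ?h = "\<lambda>x\<in>carrier X. pure_tensor R M X (y j) x"
    have h: "?h \<in> mod_hom R X ?TM" by (rule pure_tensor_homs(2)[OF M X yj])
    have "finsum ?TM (\<lambda>i. a i j \<odot>\<^bsub>?TM\<^esub> pure_tensor R M X (y j) (g i)) {..<n} =
        lcomb ?TM {..<n} (\<lambda>i. a i j) (\<lambda>i. ?h (g i))"
      unfolding lcomb_def by (rule mod_finsum_cong[OF TM]) (use a j yj gX TM in auto)
    also have "\<dots> = ?h (lcomb X {..<n} (\<lambda>i. a i j) g)"
      by (rule hom_lcomb[OF X TM h, symmetric]) (use a j gX in auto)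
    also have "\<dots> = \<zero>\<^bsub>?TM\<^esub>" using col[OF j] hom_zero[OF h X TM] by simp
    finally show "finsum ?TM (\<lambda>i. a i j \<odot>\<^bsub>?TM\<^esub> pure_tensor R M X (y j) (g i)) {..<n} = \<zero>\<^bsub>?TM\<^esub>" .
  qed
  finally have "tensor_map R ?N M X ?inc t = tensor_map R ?N M X ?inc \<zero>\<^bsub>?TN\<^esub>"
    using hom_zero[OF tm(1) TN TM] by simp
  moreover have "inj_on (tensor_map R ?N M X ?inc) (carrier ?TN)"
    using pure X by (simp add: pure_submodule_def)
  ultimately have t0: "t = \<zero>\<^bsub>?TN\<^esub>" using t TN by (auto dest: inj_onD)
  \<comment> \<open>\<open>N \<otimes> X\<close> maps to the quotient of \<open>N\<^sup>n\<close> by the image of the matrix\<close>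
  define D where "D = direct_sum {..<n} (\<lambda>_. ?N)"
  have D: "module R D" unfolding D_def by (rule module_direct_sum) (rule Nm)
  have DI: "(\<lambda>i\<in>{..<n}. f i) \<in> carrier D" if "\<And>i. i < n \<Longrightarrow> f i \<in> N" for f
    unfolding D_def by (rule direct_sum_carrierI[of _ _ _ "{..<n}"]) (use that in auto)
  have DN: "w i \<in> N" if "w \<in> carrier D" "i < n" for w i
    using direct_sum_carrierD(1)[OF that(1)[unfolded D_def]] that(2) by auto
  have Dadd: "(u \<oplus>\<^bsub>D\<^esub> v) i = u i \<oplus>\<^bsub>M\<^esub> v i" "(r \<odot>\<^bsub>D\<^esub> u) i = r \<odot>\<^bsub>M\<^esub> u i"
    "\<zero>\<^bsub>D\<^esub> i = \<zero>\<^bsub>M\<^esub>" if "i < n" for u v r i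
    using that by (auto simp: D_def)
  have NM: "x \<in> carrier M" if "x \<in> N" for x using submoduleD(3)[OF M N that] .
  define W where "W = {w \<in> carrier D. \<exists>z. (\<forall>j<m. z j \<in> N) \<and> (\<forall>i<n. w i = lcomb M {..<m} (a i) z)}"
  have W: "submodule W R D"
  proof (rule submoduleI'[OF D])
    show "\<zero>\<^bsub>D\<^esub> \<in> W" unfolding W_def
      using D submoduleD(2)[OF M N] a
      by (auto intro!: exI[of _ "\<lambda>_. \<zero>\<^bsub>M\<^esub>"] lcomb_zero[OF M, symmetric] simp: Dadd M)
    fix u assume "u \<in> W"
    then obtain zu where u: "u \<in> carrier D" "\<forall>j<m. zu j \<in> N" "\<forall>i<n. u i = lcomb M {..<m} (a i) zu"
      unfolding W_def by blast
    show "r \<odot>\<^bsub>D\<^esub> u \<in> W" if r: "r \<in> carrier R" for r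
      unfolding W_def
    proof (intro CollectI conjI exI[of _ "\<lambda>j. r \<odot>\<^bsub>M\<^esub> zu j"] allI impI)
      show "r \<odot>\<^bsub>D\<^esub> u \<in> carrier D" using D r u by simp
      show "r \<odot>\<^bsub>M\<^esub> zu j \<in> N" if "j < m" for j using submoduleD(6)[OF M N r] u that by simp
      show "(r \<odot>\<^bsub>D\<^esub> u) i = lcomb M {..<m} (a i) (\<lambda>j. r \<odot>\<^bsub>M\<^esub> zu j)" if "i < n" for i
        using lcomb_smult[OF M _ r, of "{..<m}" "a i" zu] u a that NM by (simp add: Dadd)
    qed
    fix v assume "v \<in> W"
    then obtain zv where v: "v \<in> carrier D" "\<forall>j<m. zv j \<in> N" "\<forall>i<n. v i = lcomb M {..<m} (a i) zv"
      unfolding W_def by blast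
    show "u \<oplus>\<^bsub>D\<^esub> v \<in> W"
      unfolding W_def
    proof (intro CollectI conjI exI[of _ "\<lambda>j. zu j \<oplus>\<^bsub>M\<^esub> zv j"] allI impI)
      show "u \<oplus>\<^bsub>D\<^esub> v \<in> carrier D" using D u v by simp
      show "zu j \<oplus>\<^bsub>M\<^esub> zv j \<in> N" if "j < m" for j using submoduleD(4)[OF M N] u v that by simp
      show "(u \<oplus>\<^bsub>D\<^esub> v) i = lcomb M {..<m} (a i) (\<lambda>j. zu j \<oplus>\<^bsub>M\<^esub> zv j)" if "i < n" for i
        using lcomb_add[OF M, of "{..<m}" "a i" zu zv] u v a that NM by (simp add: Dadd)
    qed
  qed (auto simp: W_def)
  define Q where "Q = quot_module D W"
  have Q: "module R Q" unfolding Q_def by (rule module_quot[OF D W])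
  define v where "v x \<phi> = (\<lambda>i\<in>{..<n}. \<phi> i \<odot>\<^bsub>M\<^esub> x)" for x and \<phi> :: "nat \<Rightarrow> 'a"
  have vD: "v x \<phi> \<in> carrier D" if "x \<in> N" "\<phi> \<in> carrier F" for x \<phi>
    unfolding v_def by (rule DI) (use that Fc submoduleD(6)[OF M N] in auto)
  have Deq: "u = w" if "u \<in> carrier D" "w \<in> carrier D" "\<And>i. i < n \<Longrightarrow> u i = w i" for u w
    by (rule direct_sum_eqI[OF that(1,2)[unfolded D_def]]) (use that(3) in auto)
  have v_bilin:
    "v x (\<phi> \<oplus>\<^bsub>F\<^esub> \<psi>) = v x \<phi> \<oplus>\<^bsub>D\<^esub> v x \<psi>" "v x (r \<odot>\<^bsub>F\<^esub> \<phi>) = r \<odot>\<^bsub>D\<^esub> v x \<phi>"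
    "v (x \<oplus>\<^bsub>M\<^esub> x') \<phi> = v x \<phi> \<oplus>\<^bsub>D\<^esub> v x' \<phi>" "v (r \<odot>\<^bsub>M\<^esub> x) \<phi> = r \<odot>\<^bsub>D\<^esub> v x \<phi>"
    if "x \<in> N" "x' \<in> N" "\<phi> \<in> carrier F" "\<psi> \<in> carrier F" "r \<in> carrier R" for x x' \<phi> \<psi> r
    using that NM submoduleD(4,6)[OF M N] F D vD Fc M
    by (intro Deq vD mod_add_closed mod_smult_closed; simp add: Dadd;
        simp add: v_def F_def mod_smult_l_distr mod_smult_r_distr mod_smult_assoc mod_smult_lcomm)+
  have "\<exists>\<beta>. \<beta> \<in> mod_hom R X Q \<and> (\<forall>\<phi>\<in>carrier F. \<beta> (S +>\<^bsub>F\<^esub> \<phi>) = W +>\<^bsub>D\<^esub> v x \<phi>)" if x: "x \<in> N" for x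
  proof -
    let ?f = "\<lambda>\<phi>\<in>carrier F. W +>\<^bsub>D\<^esub> v x \<phi>"
    have f: "?f \<in> mod_hom R F Q"
    proof (rule mod_homI[OF F])
      fix \<phi> assume p: "\<phi> \<in> carrier F"
      show "W +>\<^bsub>D\<^esub> v x \<phi> \<in> carrier Q" using vD[OF x p] by (auto simp: Q_def quot_carrier)
      show "W +>\<^bsub>D\<^esub> v x (r \<odot>\<^bsub>F\<^esub> \<phi>) = r \<odot>\<^bsub>Q\<^esub> (W +>\<^bsub>D\<^esub> v x \<phi>)" if "r \<in> carrier R" for r
        using quot_smult[OF D W vD[OF x p] that] v_bilin(2)[OF x x p p that] by (simp add: Q_def)
      fix \<psi> assume q: "\<psi> \<in> carrier F"
      show "W +>\<^bsub>D\<^esub> v x (\<phi> \<oplus>\<^bsub>F\<^esub> \<psi>) = (W +>\<^bsub>D\<^esub> v x \<phi>) \<oplus>\<^bsub>Q\<^esub> (W +>\<^bsub>D\<^esub> v x \<psi>)"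
        using quot_add[OF D W vD[OF x p] vD[OF x q]] v_bilin(1)[OF x x p q zero_closed]
        by (simp add: Q_def)
    qed
    have "v x (c j) \<in> W" if j: "j < m" for j
      unfolding W_def
    proof (intro CollectI conjI exI[of _ "\<lambda>k. if k = j then x else \<zero>\<^bsub>M\<^esub>"] allI impI)
      show "v x (c j) \<in> carrier D" by (rule vD[OF x c[OF j]])
      show "v x (c j) i = lcomb M {..<m} (a i) (\<lambda>k. if k = j then x else \<zero>\<^bsub>M\<^esub>)" if "i < n" for i
        using that j a x NM M
        by (subst lcomb_single[OF M, of _ j]) (auto simp: v_def c_def)
    qed (use x submoduleD(2)[OF M N] in auto)
    then have "c ` {..<m} \<subseteq> {\<phi> \<in> carrier F. ?f \<phi> = \<zero>\<^bsub>Q\<^esub>}"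
      using c coset_eq_zero_iff[OF D W vD[OF x c]] by (auto simp: Q_def)
    then have "S \<subseteq> {\<phi> \<in> carrier F. ?f \<phi> = \<zero>\<^bsub>Q\<^esub>}"
      unfolding S_def by (rule module_span_min[OF kernel_submodule[OF F Q f]])
    then have "\<And>\<phi>. \<phi> \<in> S \<Longrightarrow> ?f \<phi> = \<zero>\<^bsub>Q\<^esub>" by blast
    from quot_factor[OF F S Q f this] obtain \<beta> where "\<beta> \<in> mod_hom R X Q"
      "\<And>\<phi>. \<phi> \<in> carrier F \<Longrightarrow> \<beta> (S +>\<^bsub>F\<^esub> \<phi>) = ?f \<phi>" unfolding X_def by blast
    then show ?thesis by (intro exI[of _ \<beta>]) auto
  qed
  then obtain \<beta> where \<beta>: "\<And>x. x \<in> N \<Longrightarrow> \<beta> x \<in> mod_hom R X Q"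
    "\<And>x \<phi>. \<lbrakk>x \<in> N; \<phi> \<in> carrier F\<rbrakk> \<Longrightarrow> \<beta> x (S +>\<^bsub>F\<^esub> \<phi>) = W +>\<^bsub>D\<^esub> v x \<phi>" by metis
  have Xs: "\<exists>\<phi>\<in>carrier F. \<xi> = S +>\<^bsub>F\<^esub> \<phi>" if "\<xi> \<in> carrier X" for \<xi>
    using that by (auto simp: X_def quot_carrier)
  obtain h where h: "h \<in> mod_hom R ?TN Q"
    "\<And>x \<xi>. \<lbrakk>x \<in> N; \<xi> \<in> carrier X\<rbrakk> \<Longrightarrow> h (pure_tensor R ?N X x \<xi>) = \<beta> x \<xi>"
  proof (rule tensor_lift[OF Nm X Q, of \<beta>])
    show "\<beta> x \<xi> \<in> carrier Q" if "x \<in> carrier ?N" "\<xi> \<in> carrier X" for x \<xi>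
      using that hom_closed[OF \<beta>(1)] by simp
    show "\<beta> (x \<oplus>\<^bsub>?N\<^esub> x') \<xi> = \<beta> x \<xi> \<oplus>\<^bsub>Q\<^esub> \<beta> x' \<xi>"
      if "x \<in> carrier ?N" "x' \<in> carrier ?N" and xi: "\<xi> \<in> carrier X" for x x' \<xi>
    proof -
      obtain \<phi> where p: "\<phi> \<in> carrier F" "\<xi> = S +>\<^bsub>F\<^esub> \<phi>" using Xs xi by blast
      have x: "x \<in> N" "x' \<in> N" using that by auto
      show ?thesis unfolding p(2)
        using quot_add[OF D W vD[OF x(1) p(1)] vD[OF x(2) p(1)]] submoduleD(4)[OF M N x]
          v_bilin(3)[OF x p(1) p(1) zero_closed] x p(1)
        by (simp add: \<beta>(2) Q_def)
    qed
    show "\<beta> (r \<odot>\<^bsub>?N\<^esub> x) \<xi> = r \<odot>\<^bsub>Q\<^esub> \<beta> x \<xi>"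
      if "r \<in> carrier R" "x \<in> carrier ?N" and xi: "\<xi> \<in> carrier X" for r x \<xi>
    proof -
      obtain \<phi> where p: "\<phi> \<in> carrier F" "\<xi> = S +>\<^bsub>F\<^esub> \<phi>" using Xs xi by blast
      have x: "x \<in> N" using that by auto
      show ?thesis unfolding p(2)
        using quot_smult[OF D W vD[OF x p(1)] that(1)] submoduleD(6)[OF M N that(1) x]
          v_bilin(4)[OF x x p(1) p(1) that(1)] x p(1)
        by (simp add: \<beta>(2) Q_def)
    qed
  qed (use \<beta>(1) in \<open>auto simp: hom_add hom_smult intro: that\<close>)
  have "h t = finsum Q (\<lambda>i. h (pure_tensor R ?N X (b i) (g i))) {..<n}"
    unfolding t_def by (rule hom_finsum[OF TN Q h(1)]) (use bN gX in auto)
  also have "\<dots> = finsum Q (\<lambda>i. (\<lambda>w\<in>carrier D. W +>\<^bsub>D\<^esub> w) (v (b i) (free_gen R i))) {..<n}"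
  proof (rule mod_finsum_cong[OF Q])
    fix i assume "i \<in> {..<n}"
    then have i: "i < n" by simp
    have c: "v (b i) (free_gen R i) \<in> carrier D" by (rule vD[OF bN(1)[OF i] gF[OF i]])
    then show "h (pure_tensor R ?N X (b i) (g i)) =
        (\<lambda>w\<in>carrier D. W +>\<^bsub>D\<^esub> w) (v (b i) (free_gen R i))"
      using h(2)[OF bN(1)[OF i] gX[OF i]] \<beta>(2)[OF bN(1)[OF i] gF[OF i]] by (simp add: g_def)
    show "(\<lambda>w\<in>carrier D. W +>\<^bsub>D\<^esub> w) (v (b i) (free_gen R i)) \<in> carrier Q"
      using c by (auto simp: Q_def quot_carrier)
  qed
  also have "\<dots> = (\<lambda>w\<in>carrier D. W +>\<^bsub>D\<^esub> w) (finsum D (\<lambda>i. v (b i) (free_gen R i)) {..<n})"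
    by (rule hom_finsum[OF D Q quot_proj_hom[OF D W, folded Q_def], symmetric]) (use vD bN gF in auto)
  also have "finsum D (\<lambda>i. v (b i) (free_gen R i)) {..<n} =
      finsum D (\<lambda>i. sum_inj {..<n} (\<lambda>_. ?N) i (restrict b {..<n} i)) {..<n}"
  proof (rule mod_finsum_cong[OF D])
    fix i assume i: "i \<in> {..<n}"
    show "v (b i) (free_gen R i) = sum_inj {..<n} (\<lambda>_. ?N) i (restrict b {..<n} i)"
      using i bN M by (auto simp: v_def sum_inj_def free_gen_def)
    then show "sum_inj {..<n} (\<lambda>_. ?N) i (restrict b {..<n} i) \<in> carrier D"
      using vD[OF bN(1) gF, of i i] i by simp
  qed
  also have "\<dots> = restrict b {..<n}"
    unfolding D_def by (rule direct_sum_expand[OF Nm DI[unfolded D_def]]) (use bN in auto)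
  finally have ht: "h t = (\<lambda>w\<in>carrier D. W +>\<^bsub>D\<^esub> w) (restrict b {..<n})" .
  have bD: "restrict b {..<n} \<in> carrier D" by (rule DI[OF bN(1)])
  have "W +>\<^bsub>D\<^esub> restrict b {..<n} = \<zero>\<^bsub>Q\<^esub>"
    using ht unfolding t0 hom_zero[OF h(1) TN Q] restrict_apply'[OF bD] by (rule sym)
  then have "restrict b {..<n} \<in> W"
    using coset_eq_zero_iff[OF D W bD] unfolding Q_def by blast
  then obtain z where "\<forall>j<m. z j \<in> N" "\<forall>i<n. restrict b {..<n} i = lcomb M {..<m} (a i) z"
    unfolding W_def by blast
  then show "\<exists>y'. (\<forall>j<m. y' j \<in> N) \<and> (\<forall>i<n. lcomb M {..<m} (a i) y' = b i)"
    by (intro exI[of _ z]) auto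
qed

end

section \<open>Direct limits\<close>

text \<open>The elementwise characterization of a direct limit: every element of \<open>L\<close> comes from some \<open>M i\<close>, and
  what becomes zero in \<open>L\<close> becomes zero at some later index.  Besides the constructed limit it covers
  isomorphic copies and unions of images.\<close>

definition colim_cone ::
    "('a,'r) ring_scheme \<Rightarrow> 'i set \<Rightarrow> ('i \<Rightarrow> 'i \<Rightarrow> bool) \<Rightarrow> ('i \<Rightarrow> ('a,'b) module) \<Rightarrow>
     ('i \<Rightarrow> 'i \<Rightarrow> 'b \<Rightarrow> 'b) \<Rightarrow> ('a,'c) module \<Rightarrow> ('i \<Rightarrow> 'b \<Rightarrow> 'c) \<Rightarrow> bool" where
  "colim_cone R I rel M \<phi> L \<psi> \<longleftrightarrow>
     (\<forall>i\<in>I. \<psi> i \<in> mod_hom R (M i) L) \<and>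
     (\<forall>i\<in>I. \<forall>j\<in>I. rel i j \<longrightarrow> (\<forall>x\<in>carrier (M i). \<psi> j (\<phi> i j x) = \<psi> i x)) \<and>
     (\<forall>y\<in>carrier L. \<exists>i\<in>I. \<exists>x\<in>carrier (M i). \<psi> i x = y) \<and>
     (\<forall>i\<in>I. \<forall>x\<in>carrier (M i). \<psi> i x = \<zero>\<^bsub>L\<^esub> \<longrightarrow> (\<exists>j\<in>I. rel i j \<and> \<phi> i j x = \<zero>\<^bsub>M j\<^esub>))"

context cring
begin

lemma direct_systemD:
  assumes "direct_system R I rel M \<phi>"
  shows "I \<noteq> {}" "i \<in> I \<Longrightarrow> rel i i"
    "\<lbrakk>i \<in> I; j \<in> I; k \<in> I; rel i j; rel j k\<rbrakk> \<Longrightarrow> rel i k"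
    "\<lbrakk>i \<in> I; j \<in> I\<rbrakk> \<Longrightarrow> \<exists>k\<in>I. rel i k \<and> rel j k"
    "i \<in> I \<Longrightarrow> module R (M i)"
    "\<lbrakk>i \<in> I; j \<in> I; rel i j\<rbrakk> \<Longrightarrow> \<phi> i j \<in> mod_hom R (M i) (M j)"
    "\<lbrakk>i \<in> I; x \<in> carrier (M i)\<rbrakk> \<Longrightarrow> \<phi> i i x = x"
    "\<lbrakk>i \<in> I; j \<in> I; k \<in> I; rel i j; rel j k; x \<in> carrier (M i)\<rbrakk> \<Longrightarrow> \<phi> j k (\<phi> i j x) = \<phi> i k x"
proof -
  note A = assms[unfolded direct_system_def]
  show "I \<noteq> {}" using A by (elim conjE)
  show "i \<in> I \<Longrightarrow> rel i i" using A by (elim conjE) blast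
  show "\<lbrakk>i \<in> I; j \<in> I; k \<in> I; rel i j; rel j k\<rbrakk> \<Longrightarrow> rel i k" using A by (elim conjE) blast
  show "\<lbrakk>i \<in> I; j \<in> I\<rbrakk> \<Longrightarrow> \<exists>k\<in>I. rel i k \<and> rel j k" using A by (elim conjE) blast
  show "i \<in> I \<Longrightarrow> module R (M i)" using A by (elim conjE) blast
  show "\<lbrakk>i \<in> I; j \<in> I; rel i j\<rbrakk> \<Longrightarrow> \<phi> i j \<in> mod_hom R (M i) (M j)" using A by (elim conjE) blast
  show "\<lbrakk>i \<in> I; x \<in> carrier (M i)\<rbrakk> \<Longrightarrow> \<phi> i i x = x" using A by (elim conjE) blast
  show "\<lbrakk>i \<in> I; j \<in> I; k \<in> I; rel i j; rel j k; x \<in> carrier (M i)\<rbrakk> \<Longrightarrow> \<phi> j k (\<phi> i j x) = \<phi> i k x"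
    using A by (elim conjE) blast
qed

lemma colim_coneD:
  assumes "colim_cone R I rel M \<phi> L \<psi>"
  shows "i \<in> I \<Longrightarrow> \<psi> i \<in> mod_hom R (M i) L"
    "\<lbrakk>i \<in> I; j \<in> I; rel i j; x \<in> carrier (M i)\<rbrakk> \<Longrightarrow> \<psi> j (\<phi> i j x) = \<psi> i x"
    "y \<in> carrier L \<Longrightarrow> \<exists>i\<in>I. \<exists>x\<in>carrier (M i). \<psi> i x = y"
    "\<lbrakk>i \<in> I; x \<in> carrier (M i); \<psi> i x = \<zero>\<^bsub>L\<^esub>\<rbrakk> \<Longrightarrow> \<exists>j\<in>I. rel i j \<and> \<phi> i j x = \<zero>\<^bsub>M j\<^esub>"
  using assms unfolding colim_cone_def by blast+

lemma colim_lift_finite: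
  assumes S: "direct_system R I rel M \<phi>" and C: "colim_cone R I rel M \<phi> L \<psi>"
    and T: "finite T" "\<And>k. k \<in> T \<Longrightarrow> m k \<in> carrier L"
  shows "\<exists>i\<in>I. \<exists>m'. \<forall>k\<in>T. m' k \<in> carrier (M i) \<and> \<psi> i (m' k) = m k"
  using T
proof (induction T)
  case empty
  then show ?case using direct_systemD(1)[OF S] by auto
next
  case (insert t T)
  then obtain i m' where i: "i \<in> I" "\<forall>k\<in>T. m' k \<in> carrier (M i) \<and> \<psi> i (m' k) = m k" by auto
  obtain j x where j: "j \<in> I" "x \<in> carrier (M j)" "\<psi> j x = m t"
    using colim_coneD(3)[OF C, of "m t"] insert by auto
  obtain k where k: "k \<in> I" "rel i k" "rel j k" using direct_systemD(4)[OF S i(1) j(1)] by blast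
  show ?case
  proof (rule bexI[OF _ k(1)], rule exI[of _ "\<lambda>s. if s = t then \<phi> j k x else \<phi> i k (m' s)"], rule ballI)
    fix s assume s: "s \<in> insert t T"
    show "(if s = t then \<phi> j k x else \<phi> i k (m' s)) \<in> carrier (M k) \<and>
        \<psi> k (if s = t then \<phi> j k x else \<phi> i k (m' s)) = m s"
      using s i j hom_closed[OF direct_systemD(6)[OF S j(1) k(1,3)] j(2)]
        hom_closed[OF direct_systemD(6)[OF S i(1) k(1,2)], of "m' s"]
        colim_coneD(2)[OF C j(1) k(1,3) j(2)] colim_coneD(2)[OF C i(1) k(1,2), of "m' s"]
      by auto
  qed
qed

lemma colim_kill_finite:
  assumes S: "direct_system R I rel M \<phi>" and C: "colim_cone R I rel M \<phi> L \<psi>" and i: "i \<in> I"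
    and T: "finite T" "\<And>s. s \<in> T \<Longrightarrow> x s \<in> carrier (M i)" "\<And>s. s \<in> T \<Longrightarrow> \<psi> i (x s) = \<zero>\<^bsub>L\<^esub>"
  shows "\<exists>j\<in>I. rel i j \<and> (\<forall>s\<in>T. \<phi> i j (x s) = \<zero>\<^bsub>M j\<^esub>)"
  using T
proof (induction T)
  case empty
  then show ?case using direct_systemD(2)[OF S i] i by auto
next
  case (insert t T)
  then obtain j where j: "j \<in> I" "rel i j" "\<forall>s\<in>T. \<phi> i j (x s) = \<zero>\<^bsub>M j\<^esub>" by auto
  obtain j' where j': "j' \<in> I" "rel i j'" "\<phi> i j' (x t) = \<zero>\<^bsub>M j'\<^esub>"
    using colim_coneD(4)[OF C i, of "x t"] insert by auto
  obtain k where k: "k \<in> I" "rel j k" "rel j' k" using direct_systemD(4)[OF S j(1) j'(1)] by blast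
  have "\<phi> i k (x s) = \<zero>\<^bsub>M k\<^esub>" if s: "s \<in> insert t T" for s
  proof (cases "s = t")
    case True
    have "\<phi> i k (x t) = \<phi> j' k (\<phi> i j' (x t))"
      using direct_systemD(8)[OF S i j'(1) k(1) j'(2) k(3)] insert by simp
    then show ?thesis unfolding True j'(3)
      using hom_zero[OF direct_systemD(6)[OF S j'(1) k(1,3)] direct_systemD(5)[OF S j'(1)]
          direct_systemD(5)[OF S k(1)]] by simp
  next
    case False
    then have sT: "s \<in> T" using s by simp
    have "\<phi> i k (x s) = \<phi> j k (\<phi> i j (x s))"
      using direct_systemD(8)[OF S i j(1) k(1) j(2) k(2)] insert s by simp
    then show ?thesis unfolding j(3)[rule_format, OF sT]
      using hom_zero[OF direct_systemD(6)[OF S j(1) k(1,2)] direct_systemD(5)[OF S j(1)]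
          direct_systemD(5)[OF S k(1)]] by simp
  qed
  moreover have "rel i k" using direct_systemD(3)[OF S i j(1) k(1) j(2) k(2)] .
  ultimately show ?case using k(1) by blast
qed

definition limit_rels ::
    "'i set \<Rightarrow> ('i \<Rightarrow> 'i \<Rightarrow> bool) \<Rightarrow> ('i \<Rightarrow> ('a,'x) module) \<Rightarrow> ('i \<Rightarrow> 'i \<Rightarrow> 'x \<Rightarrow> 'x) \<Rightarrow> ('i \<Rightarrow> 'x) set" where
  "limit_rels I rel M \<phi> =
    {sum_inj I M j (\<phi> i j x) \<ominus>\<^bsub>direct_sum I M\<^esub> sum_inj I M i x | i j x.
          i \<in> I \<and> j \<in> I \<and> rel i j \<and> x \<in> carrier (M i)}"

definition limit_inj ::
    "'i set \<Rightarrow> ('i \<Rightarrow> 'i \<Rightarrow> bool) \<Rightarrow> ('i \<Rightarrow> ('a,'x) module) \<Rightarrow> ('i \<Rightarrow> 'i \<Rightarrow> 'x \<Rightarrow> 'x) \<Rightarrow> 'i \<Rightarrow> 'x \<Rightarrow> ('i \<Rightarrow> 'x) set"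
  where
  "limit_inj I rel M \<phi> i = (\<lambda>x\<in>carrier (M i).
     module_span R (direct_sum I M) (limit_rels I rel M \<phi>) +>\<^bsub>direct_sum I M\<^esub> sum_inj I M i x)"

lemma direct_limit_eq:
  "direct_limit R I rel M \<phi> =
    quot_module (direct_sum I M) (module_span R (direct_sum I M) (limit_rels I rel M \<phi>))"
  by (simp add: direct_limit_def limit_rels_def Let_def)

lemma limit_rels_subset:
  assumes S: "direct_system R I rel M \<phi>"
  shows "limit_rels I rel M \<phi> \<subseteq> carrier (direct_sum I M)"
proof
  note M = direct_systemD(5)[OF S]
  fix w assume "w \<in> limit_rels I rel M \<phi>"
  then obtain i j x where *: "i \<in> I" "j \<in> I" "rel i j" "x \<in> carrier (M i)"
    "w = sum_inj I M j (\<phi> i j x) \<ominus>\<^bsub>direct_sum I M\<^esub> sum_inj I M i x" unfolding limit_rels_def by blast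
  show "w \<in> carrier (direct_sum I M)" unfolding *(5)
    by (intro mod_diff_closed module_direct_sum[OF M] sum_inj_closed[where M=M, OF M]
        hom_closed[OF direct_systemD(6)[OF S]] *)
qed

lemma limit_span_submodule:
  assumes S: "direct_system R I rel M \<phi>"
  shows "submodule (module_span R (direct_sum I M) (limit_rels I rel M \<phi>)) R (direct_sum I M)"
  by (rule module_span_submodule[OF module_direct_sum[OF direct_systemD(5)[OF S]] limit_rels_subset[OF S]])

lemma module_direct_limit:
  assumes S: "direct_system R I rel M \<phi>"
  shows "module R (direct_limit R I rel M \<phi>)"
  unfolding direct_limit_eq
  by (rule module_quot[OF module_direct_sum[OF direct_systemD(5)[OF S]] limit_span_submodule[OF S]])

text \<open>The relations of the direct limit only contain families \<open>w\<close> whose components add up to zero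
  after they are moved to some common index.\<close>

lemma limit_span_sum_zero:
  assumes S: "direct_system R I rel M \<phi>"
    and w: "w \<in> module_span R (direct_sum I M) (limit_rels I rel M \<phi>)"
  shows "\<exists>T. \<exists>j\<in>I. finite T \<and> T \<subseteq> I \<and> (\<forall>i\<in>I. w i \<noteq> \<zero>\<^bsub>M i\<^esub> \<longrightarrow> i \<in> T) \<and> (\<forall>i\<in>T. rel i j) \<and>
    finsum (M j) (\<lambda>i. \<phi> i j (w i)) T = \<zero>\<^bsub>M j\<^esub>"
proof -
  note M = direct_systemD(5)[OF S]
  let ?D = "direct_sum I M"
  have D: "module R ?D" by (rule module_direct_sum[OF M])
  let ?P = "\<lambda>w T j. j \<in> I \<and> finite T \<and> T \<subseteq> I \<and> (\<forall>i\<in>I. w i \<noteq> \<zero>\<^bsub>M i\<^esub> \<longrightarrow> i \<in> T) \<and> (\<forall>i\<in>T. rel i j) \<and>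
    finsum (M j) (\<lambda>i. \<phi> i j (w i)) T = \<zero>\<^bsub>M j\<^esub>"
  let ?W = "{w \<in> carrier ?D. \<exists>T j. ?P w T j}"
  have wc: "\<phi> i j (w i) \<in> carrier (M j)" if "w \<in> carrier ?D" "i \<in> I" "j \<in> I" "rel i j" for w i j
    by (rule hom_closed[OF direct_systemD(6)[OF S that(2-4)] direct_sum_carrierD(1)[OF that(1,2)]])
  have "submodule ?W R ?D"
  proof (rule submoduleI'[OF D])
    obtain j where "j \<in> I" using direct_systemD(1)[OF S] by auto
    then have "?P \<zero>\<^bsub>?D\<^esub> {} j" using M by auto
    then show "\<zero>\<^bsub>?D\<^esub> \<in> ?W" using mod_zero_closed[OF D] by blast
  next
    fix r u assume r: "r \<in> carrier R" and "u \<in> ?W"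
    then obtain T j where u: "u \<in> carrier ?D" "?P u T j" by blast
    have "finsum (M j) (\<lambda>i. \<phi> i j ((r \<odot>\<^bsub>?D\<^esub> u) i)) T = finsum (M j) (\<lambda>i. r \<odot>\<^bsub>M j\<^esub> \<phi> i j (u i)) T"
    proof (rule mod_finsum_cong)
      fix i assume i: "i \<in> T"
      then have iI: "i \<in> I" "rel i j" "j \<in> I" using u by auto
      show "\<phi> i j ((r \<odot>\<^bsub>?D\<^esub> u) i) = r \<odot>\<^bsub>M j\<^esub> \<phi> i j (u i)"
        using hom_smult[OF direct_systemD(6)[OF S iI(1,3,2)] r direct_sum_carrierD(1)[OF u(1) iI(1)]] iI
        by simp
      show "r \<odot>\<^bsub>M j\<^esub> \<phi> i j (u i) \<in> carrier (M j)" using wc[OF u(1) iI(1,3,2)] M[OF iI(3)] r by simp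
    qed (use u M in auto)
    also have "\<dots> = r \<odot>\<^bsub>M j\<^esub> finsum (M j) (\<lambda>i. \<phi> i j (u i)) T"
      by (rule mod_finsum_smult[symmetric]) (use u M r wc in auto)
    finally have "finsum (M j) (\<lambda>i. \<phi> i j ((r \<odot>\<^bsub>?D\<^esub> u) i)) T = \<zero>\<^bsub>M j\<^esub>" using u M r by simp
    moreover have "i \<in> T" if "i \<in> I" "(r \<odot>\<^bsub>?D\<^esub> u) i \<noteq> \<zero>\<^bsub>M i\<^esub>" for i
      using that u M[OF that(1)] r by auto
    ultimately have "?P (r \<odot>\<^bsub>?D\<^esub> u) T j" using u(2) by (elim conjE) (intro conjI ballI impI; assumption?; blast)
    then show "r \<odot>\<^bsub>?D\<^esub> u \<in> ?W" using mod_smult_closed[OF D r u(1)] by blast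
  next
    fix u v assume "u \<in> ?W" "v \<in> ?W"
    then obtain T j T' j' where u: "u \<in> carrier ?D" "?P u T j" and v: "v \<in> carrier ?D" "?P v T' j'" by blast
    obtain k where k: "k \<in> I" "rel j k" "rel j' k" using direct_systemD(4)[OF S, of j j'] u v by blast
    \<comment> \<open>a vanishing sum may be moved to the later index \<open>k\<close> and extended to the larger support\<close>
    have move: "finsum (M k) (\<lambda>i. \<phi> i k (x i)) (T \<union> T') = \<zero>\<^bsub>M k\<^esub>"
      if x: "x \<in> carrier ?D" "?P x T0 j0" and j0: "rel j0 k" "T0 \<subseteq> T \<union> T'" for x T0 j0
    proof -
      have T0: "finite T0" "T0 \<subseteq> I" "j0 \<in> I" "\<And>i. i \<in> T0 \<Longrightarrow> rel i j0"
        "finsum (M j0) (\<lambda>i. \<phi> i j0 (x i)) T0 = \<zero>\<^bsub>M j0\<^esub>"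
        "\<And>i. \<lbrakk>i \<in> I; x i \<noteq> \<zero>\<^bsub>M i\<^esub>\<rbrakk> \<Longrightarrow> i \<in> T0" using x(2) by blast+
      have TI: "T \<union> T' \<subseteq> I" "finite (T \<union> T')" using u v by auto
      have relk: "rel i k" if "i \<in> T \<union> T'" for i
        using that u v k direct_systemD(3)[OF S, of i j k] direct_systemD(3)[OF S, of i j' k] by blast
      have xk: "\<phi> i k (x i) = \<phi> j0 k (\<phi> i j0 (x i))" if "i \<in> T0" for i
        using direct_systemD(8)[OF S _ T0(3) k(1) T0(4)[OF that] j0(1) direct_sum_carrierD(1)[OF x(1)]] that T0(2)
        by auto
      have "finsum (M k) (\<lambda>i. \<phi> i k (x i)) (T \<union> T') = finsum (M k) (\<lambda>i. \<phi> i k (x i)) T0"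
      proof (rule mod_finsum_mono[OF M[OF k(1)] TI(2) j0(2)])
        show "\<phi> i k (x i) \<in> carrier (M k)" if "i \<in> T0" for i
          using that j0(2) T0(2) by (intro wc[OF x(1) _ k(1) relk]) auto
        fix i assume i: "i \<in> T \<union> T' - T0"
        then have iI: "i \<in> I" using TI by auto
        then have "x i = \<zero>\<^bsub>M i\<^esub>" using T0(6) i by blast
        then show "\<phi> i k (x i) = \<zero>\<^bsub>M k\<^esub>"
          using hom_zero[OF direct_systemD(6)[OF S iI k(1) relk] M[OF iI] M[OF k(1)]] i by simp
      qed
      also have "\<dots> = finsum (M k) (\<lambda>i. \<phi> j0 k (\<phi> i j0 (x i))) T0"
      proof (rule mod_finsum_cong[OF M[OF k(1)] xk])
        fix i assume i: "i \<in> T0"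
        then have iI: "i \<in> I" using T0(2) by auto
        show "\<phi> j0 k (\<phi> i j0 (x i)) \<in> carrier (M k)"
          by (rule hom_closed[OF direct_systemD(6)[OF S T0(3) k(1) j0(1)] wc[OF x(1) iI T0(3) T0(4)[OF i]]])
      qed
      also have "\<dots> = \<phi> j0 k (finsum (M j0) (\<lambda>i. \<phi> i j0 (x i)) T0)"
      proof (rule hom_finsum[OF M[OF T0(3)] M[OF k(1)] direct_systemD(6)[OF S T0(3) k(1) j0(1)] T0(1), symmetric])
        fix i assume i: "i \<in> T0"
        then have iI: "i \<in> I" using T0(2) by auto
        show "\<phi> i j0 (x i) \<in> carrier (M j0)" by (rule wc[OF x(1) iI T0(3) T0(4)[OF i]])
      qed
      also have "\<dots> = \<zero>\<^bsub>M k\<^esub>" unfolding T0(5)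
        by (rule hom_zero[OF direct_systemD(6)[OF S T0(3) k(1) j0(1)] M[OF T0(3)] M[OF k(1)]])
      finally show ?thesis .
    qed
    have relk: "rel i k" if "i \<in> T \<union> T'" for i
      using that u v k direct_systemD(3)[OF S, of i j k] direct_systemD(3)[OF S, of i j' k] by blast
    have TI: "i \<in> I" if "i \<in> T \<union> T'" for i using that u v by blast
    have "finsum (M k) (\<lambda>i. \<phi> i k ((u \<oplus>\<^bsub>?D\<^esub> v) i)) (T \<union> T') =
        finsum (M k) (\<lambda>i. \<phi> i k (u i) \<oplus>\<^bsub>M k\<^esub> \<phi> i k (v i)) (T \<union> T')"
    proof (rule mod_finsum_cong[OF M[OF k(1)]])
      fix i assume i: "i \<in> T \<union> T'"
      note iI = TI[OF i] k(1) relk[OF i]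
      show "\<phi> i k ((u \<oplus>\<^bsub>?D\<^esub> v) i) = \<phi> i k (u i) \<oplus>\<^bsub>M k\<^esub> \<phi> i k (v i)"
        using hom_add[OF direct_systemD(6)[OF S iI] direct_sum_carrierD(1)[OF u(1) iI(1)]
            direct_sum_carrierD(1)[OF v(1) iI(1)]] iI(1) by simp
      show "\<phi> i k (u i) \<oplus>\<^bsub>M k\<^esub> \<phi> i k (v i) \<in> carrier (M k)"
        by (intro mod_add_closed M k wc u v iI)
    qed
    also have "\<dots> = finsum (M k) (\<lambda>i. \<phi> i k (u i)) (T \<union> T') \<oplus>\<^bsub>M k\<^esub> finsum (M k) (\<lambda>i. \<phi> i k (v i)) (T \<union> T')"
      by (rule mod_finsum_add[OF M[OF k(1)] wc[OF u(1) TI k(1) relk] wc[OF v(1) TI k(1) relk]])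
    also have "\<dots> = \<zero>\<^bsub>M k\<^esub>"
      using move[OF u k(2)] move[OF v k(3)] M[OF k(1)] by simp
    finally have sum0: "finsum (M k) (\<lambda>i. \<phi> i k ((u \<oplus>\<^bsub>?D\<^esub> v) i)) (T \<union> T') = \<zero>\<^bsub>M k\<^esub>" .
    have supp: "i \<in> T \<union> T'" if "i \<in> I" "(u \<oplus>\<^bsub>?D\<^esub> v) i \<noteq> \<zero>\<^bsub>M i\<^esub>" for i
    proof (rule ccontr)
      assume "i \<notin> T \<union> T'"
      then have "u i = \<zero>\<^bsub>M i\<^esub>" "v i = \<zero>\<^bsub>M i\<^esub>" using u v that(1) by blast+
      then show False using that M[OF that(1)] by simp
    qed
    have "finite (T \<union> T')" using u(2) v(2) by (elim conjE) simp
    then have "?P (u \<oplus>\<^bsub>?D\<^esub> v) (T \<union> T') k"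
      using k(1) relk subsetI[of "T \<union> T'" I, OF TI] sum0 supp by blast
    then show "u \<oplus>\<^bsub>?D\<^esub> v \<in> ?W" using mod_add_closed[OF D u(1) v(1)] by blast
  qed auto
  moreover have "limit_rels I rel M \<phi> \<subseteq> ?W"
  proof
    fix w assume w: "w \<in> limit_rels I rel M \<phi>"
    then obtain i j x where *: "i \<in> I" "j \<in> I" "rel i j" "x \<in> carrier (M i)"
      "w = sum_inj I M j (\<phi> i j x) \<ominus>\<^bsub>?D\<^esub> sum_inj I M i x" unfolding limit_rels_def by blast
    have px: "\<phi> i j x \<in> carrier (M j)" by (rule hom_closed[OF direct_systemD(6)[OF S *(1-3)] *(4)])
    have wD: "w \<in> carrier ?D" using w limit_rels_subset[OF S] by auto
    have wt: "w t = sum_inj I M j (\<phi> i j x) t \<ominus>\<^bsub>M t\<^esub> sum_inj I M i x t" if t: "t \<in> I" for t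
      using hom_diff[OF direct_sum_coord_hom[where M=M, OF M t] D M[OF t]
          sum_inj_closed[where M=M, OF M *(2) px] sum_inj_closed[where M=M, OF M *(1,4)]]
        sum_inj_closed[where M=M, OF M *(2) px] sum_inj_closed[where M=M, OF M *(1,4)] *(5) wD by simp
    have rel: "rel t j" if "t \<in> {i,j}" for t using that * direct_systemD(2)[OF S] by auto
    have sc: "sum_inj I M k y t \<in> carrier (M t)" if "t \<in> I" "y \<in> carrier (M k)" "k \<in> I" for k y t
      using that M by (simp add: sum_inj_def)
    have val: "finsum (M j) (\<lambda>t. \<phi> t j (sum_inj I M k y t)) {i,j} = \<phi> k j y"
      if k: "k \<in> {i,j}" "y \<in> carrier (M k)" for k y
    proof -
      have kI: "k \<in> I" using k * by auto
      have "finsum (M j) (\<lambda>t. \<phi> t j (sum_inj I M k y t)) {i,j} =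
          finsum (M j) (\<lambda>t. \<phi> t j (sum_inj I M k y t)) {k}"
      proof (rule mod_finsum_mono[OF M[OF *(2)]])
        fix t assume t: "t \<in> {i,j} - {k}"
        then have tI: "t \<in> I" "rel t j" using * rel by auto
        then show "\<phi> t j (sum_inj I M k y t) = \<zero>\<^bsub>M j\<^esub>"
          using t hom_zero[OF direct_systemD(6)[OF S tI(1) *(2) tI(2)] M[OF tI(1)] M[OF *(2)]]
          by (simp add: sum_inj_def)
      qed (use k * kI hom_closed[OF direct_systemD(6)[OF S kI *(2) rel[OF k(1)]] k(2)] in
          \<open>auto simp: sum_inj_def\<close>)
      also have "\<dots> = \<phi> k j y"
        using hom_closed[OF direct_systemD(6)[OF S kI *(2) rel[OF k(1)]] k(2)] kI M[OF *(2)]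
        by (subst mod_finsum_insert) (auto simp: sum_inj_def)
      finally show ?thesis .
    qed
    let ?a = "\<lambda>t. \<phi> t j (sum_inj I M j (\<phi> i j x) t)" and ?b = "\<lambda>t. \<phi> t j (sum_inj I M i x t)"
    have cl: "?a t \<in> carrier (M j)" "?b t \<in> carrier (M j)" if "t \<in> {i,j}" for t
      using that * px rel by (auto intro!: hom_closed[OF direct_systemD(6)[OF S]] sc)
    have "finsum (M j) (\<lambda>t. \<phi> t j (w t)) {i,j} \<oplus>\<^bsub>M j\<^esub> finsum (M j) ?b {i,j} = finsum (M j) ?a {i,j}"
    proof -
      have c: "\<phi> t j (w t) \<in> carrier (M j)" if "t \<in> {i,j}" for t
        using that * rel wc[OF wD _ *(2)] by auto
      have "\<phi> t j (w t) \<oplus>\<^bsub>M j\<^esub> ?b t = ?a t" if t: "t \<in> {i,j}" for t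
      proof -
        have tI: "t \<in> I" using t * by auto
        have st: "sum_inj I M j (\<phi> i j x) t \<in> carrier (M t)" "sum_inj I M i x t \<in> carrier (M t)"
          using sc tI px * by auto
        show ?thesis unfolding wt[OF tI]
          using hom_diff[OF direct_systemD(6)[OF S tI *(2) rel[OF t]] M[OF tI] M[OF *(2)] st] cl[OF t]
            M[OF *(2)] by simp
      qed
      then show ?thesis
        using c cl M[OF *(2)]
        by (subst mod_finsum_add[symmetric]) (auto intro!: mod_finsum_cong)
    qed
    then have "finsum (M j) (\<lambda>t. \<phi> t j (w t)) {i,j} \<oplus>\<^bsub>M j\<^esub> \<phi> i j x = \<phi> i j x"
      using val[of i x] val[of j "\<phi> i j x"] * px direct_systemD(7)[OF S *(2) px] by simp
    moreover have "finsum (M j) (\<lambda>t. \<phi> t j (w t)) {i,j} \<in> carrier (M j)"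
      by (rule mod_finsum_closed[OF M[OF *(2)]]) (use * rel wc[OF wD _ *(2)] in auto)
    ultimately have z0: "finsum (M j) (\<lambda>t. \<phi> t j (w t)) {i,j} = \<zero>\<^bsub>M j\<^esub>"
      using px M[OF *(2)] by (metis mod_add_diff_cancel(1) mod_diff_eq_zero)
    have sp: "t \<in> {i,j}" if "t \<in> I" "w t \<noteq> \<zero>\<^bsub>M t\<^esub>" for t
      using that wt[OF that(1)] M[OF that(1)]
      by (cases "t = i"; cases "t = j") (auto simp: sum_inj_def mod_diff)
    have "{i,j} \<subseteq> I" "finite {i,j}" "j \<in> I" using *(1,2) by auto
    have P: "?P w {i,j} j"
    proof (intro conjI ballI impI)
      show "t \<in> {i,j}" if "t \<in> I" "w t \<noteq> \<zero>\<^bsub>M t\<^esub>" for t by (rule sp[OF that])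
      show "rel t j" if "t \<in> {i,j}" for t by (rule rel[OF that])
    qed fact+
    show "w \<in> ?W" by (intro CollectI conjI[OF wD] exI[of _ "{i,j}"] exI[of _ j]) (rule P)
  qed
  ultimately have "module_span R ?D (limit_rels I rel M \<phi>) \<subseteq> ?W" by (rule module_span_min)
  from subsetD[OF this w] have "\<exists>T j. ?P w T j" unfolding mem_Collect_eq by (rule conjunct2)
  then obtain T j where P: "?P w T j" by (elim exE)
  show ?thesis by (rule exI[of _ T], rule bexI[of _ j]) (use P in simp_all)
qed

lemma direct_limit_cone:
  assumes S: "direct_system R I rel M \<phi>"
  shows "colim_cone R I rel M \<phi> (direct_limit R I rel M \<phi>) (limit_inj I rel M \<phi>)"
proof -
  note M = direct_systemD(5)[OF S]
  let ?D = "direct_sum I M" and ?L = "direct_limit R I rel M \<phi>" and ?\<psi> = "limit_inj I rel M \<phi>"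
  define W where "W = module_span R ?D (limit_rels I rel M \<phi>)"
  have D: "module R ?D" by (rule module_direct_sum[OF M])
  have W: "submodule W R ?D" unfolding W_def by (rule limit_span_submodule[OF S])
  have L: "module R ?L" by (rule module_direct_limit[OF S])
  have Leq: "?L = quot_module ?D W" by (simp add: direct_limit_eq W_def)
  have psi: "?\<psi> i x = W +>\<^bsub>?D\<^esub> sum_inj I M i x" if "x \<in> carrier (M i)" for i x
    using that by (simp add: limit_inj_def W_def)
  have sc: "sum_inj I M i x \<in> carrier ?D" if "i \<in> I" "x \<in> carrier (M i)" for i x
    by (rule sum_inj_closed[where M=M, OF M that])
  have hom: "?\<psi> i \<in> mod_hom R (M i) ?L" if i: "i \<in> I" for i
  proof -
    have "compose (carrier (M i)) (\<lambda>w\<in>carrier ?D. W +>\<^bsub>?D\<^esub> w) (restrict (sum_inj I M i) (carrier (M i)))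
        \<in> mod_hom R (M i) ?L"
      unfolding Leq by (rule hom_compose[OF M[OF i] sum_inj_hom[where M=M, OF M i] quot_proj_hom[OF D W]])
    also have "compose (carrier (M i)) (\<lambda>w\<in>carrier ?D. W +>\<^bsub>?D\<^esub> w) (restrict (sum_inj I M i) (carrier (M i)))
        = ?\<psi> i"
      unfolding compose_def limit_inj_def W_def[symmetric]
      by (rule restrict_ext) (use sc[OF i] in simp)
    finally show ?thesis .
  qed
  have comp: "?\<psi> j (\<phi> i j x) = ?\<psi> i x" if ij: "i \<in> I" "j \<in> I" "rel i j" "x \<in> carrier (M i)" for i j x
  proof -
    have px: "\<phi> i j x \<in> carrier (M j)" by (rule hom_closed[OF direct_systemD(6)[OF S ij(1-3)] ij(4)])
    have "sum_inj I M j (\<phi> i j x) \<ominus>\<^bsub>?D\<^esub> sum_inj I M i x \<in> limit_rels I rel M \<phi>"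
      unfolding limit_rels_def using ij by blast
    then have "sum_inj I M j (\<phi> i j x) \<ominus>\<^bsub>?D\<^esub> sum_inj I M i x \<in> W"
      unfolding W_def using module_span_superset by (rule subsetD[rotated])
    then show ?thesis unfolding psi[OF px] psi[OF ij(4)]
      using coset_eq_iff[OF D W sc[OF ij(2) px] sc[OF ij(1,4)]] by simp
  qed
  have im: "submodule {y \<in> carrier ?L. \<exists>i\<in>I. \<exists>x\<in>carrier (M i). ?\<psi> i x = y} R ?L"
  proof (rule submoduleI'[OF L])
    obtain i where i: "i \<in> I" using direct_systemD(1)[OF S] by auto
    have "?\<psi> i \<zero>\<^bsub>M i\<^esub> = \<zero>\<^bsub>?L\<^esub>" by (rule hom_zero[OF hom[OF i] M[OF i] L])
    then show "\<zero>\<^bsub>?L\<^esub> \<in> {y \<in> carrier ?L. \<exists>i\<in>I. \<exists>x\<in>carrier (M i). ?\<psi> i x = y}"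
      using i mod_zero_closed[OF M[OF i]] mod_zero_closed[OF L] by blast
  next
    fix u v assume u: "u \<in> {y \<in> carrier ?L. \<exists>i\<in>I. \<exists>x\<in>carrier (M i). ?\<psi> i x = y}"
      and v: "v \<in> {y \<in> carrier ?L. \<exists>i\<in>I. \<exists>x\<in>carrier (M i). ?\<psi> i x = y}"
    obtain i x j y where *: "i \<in> I" "x \<in> carrier (M i)" "?\<psi> i x = u" "j \<in> I" "y \<in> carrier (M j)" "?\<psi> j y = v"
      using u v by blast
    obtain k where k: "k \<in> I" "rel i k" "rel j k" using direct_systemD(4)[OF S *(1,4)] by blast
    have c: "\<phi> i k x \<in> carrier (M k)" "\<phi> j k y \<in> carrier (M k)"
      using hom_closed[OF direct_systemD(6)[OF S *(1) k(1,2)] *(2)]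
        hom_closed[OF direct_systemD(6)[OF S *(4) k(1,3)] *(5)] by auto
    have "?\<psi> k (\<phi> i k x \<oplus>\<^bsub>M k\<^esub> \<phi> j k y) = u \<oplus>\<^bsub>?L\<^esub> v"
      using hom_add[OF hom[OF k(1)] c] comp[OF *(1) k(1,2) *(2)] comp[OF *(4) k(1,3) *(5)] *(3,6) by simp
    then show "u \<oplus>\<^bsub>?L\<^esub> v \<in> {y \<in> carrier ?L. \<exists>i\<in>I. \<exists>x\<in>carrier (M i). ?\<psi> i x = y}"
      using mod_add_closed[OF M[OF k(1)] c] k(1) u v mod_add_closed[OF L, of u v] by blast
  next
    fix r u assume r: "r \<in> carrier R" and u: "u \<in> {y \<in> carrier ?L. \<exists>i\<in>I. \<exists>x\<in>carrier (M i). ?\<psi> i x = y}"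
    obtain i x where *: "i \<in> I" "x \<in> carrier (M i)" "?\<psi> i x = u" using u by blast
    have "?\<psi> i (r \<odot>\<^bsub>M i\<^esub> x) = r \<odot>\<^bsub>?L\<^esub> u" using hom_smult[OF hom[OF *(1)] r *(2)] *(3) by simp
    then show "r \<odot>\<^bsub>?L\<^esub> u \<in> {y \<in> carrier ?L. \<exists>i\<in>I. \<exists>x\<in>carrier (M i). ?\<psi> i x = y}"
      using mod_smult_closed[OF M[OF *(1)] r *(2)] *(1) u mod_smult_closed[OF L r, of u] by blast
  qed auto
  have surj: "\<exists>i\<in>I. \<exists>x\<in>carrier (M i). ?\<psi> i x = y" if y: "y \<in> carrier ?L" for y
  proof -
    obtain w where w: "w \<in> carrier ?D" "y = W +>\<^bsub>?D\<^esub> w" using y by (auto simp: Leq quot_carrier)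
    let ?T = "{i \<in> I. w i \<noteq> \<zero>\<^bsub>M i\<^esub>}"
    have T: "finite ?T" by (rule direct_sum_carrierD(3)[OF w(1)])
    have wi: "w i \<in> carrier (M i)" if "i \<in> I" for i by (rule direct_sum_carrierD(1)[OF w(1) that])
    let ?p = "\<lambda>w\<in>carrier ?D. W +>\<^bsub>?D\<^esub> w"
    have p: "?p \<in> mod_hom R ?D ?L" unfolding Leq by (rule quot_proj_hom[OF D W])
    have "y = ?p (finsum ?D (\<lambda>i. sum_inj I M i (w i)) ?T)"
      using w by (subst direct_sum_expand[where M=M, OF M w(1) T]) auto
    also have "\<dots> = finsum ?L (\<lambda>i. ?p (sum_inj I M i (w i))) ?T"
      by (rule hom_finsum[OF D L p T]) (use sc wi in auto)
    also have "\<dots> \<in> {y \<in> carrier ?L. \<exists>i\<in>I. \<exists>x\<in>carrier (M i). ?\<psi> i x = y}"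
    proof (rule finsum_submodule[OF L im T])
      fix i assume "i \<in> ?T"
      then have i: "i \<in> I" by auto
      have "?p (sum_inj I M i (w i)) = ?\<psi> i (w i)" using psi[OF wi[OF i]] sc[OF i wi[OF i]] by simp
      then show "?p (sum_inj I M i (w i)) \<in> {y \<in> carrier ?L. \<exists>i\<in>I. \<exists>x\<in>carrier (M i). ?\<psi> i x = y}"
        using i wi[OF i] hom_closed[OF hom[OF i] wi[OF i]] by auto
    qed
    finally show ?thesis by blast
  qed
  have ker: "\<exists>j\<in>I. rel i j \<and> \<phi> i j x = \<zero>\<^bsub>M j\<^esub>"
    if i: "i \<in> I" and x: "x \<in> carrier (M i)" and z: "?\<psi> i x = \<zero>\<^bsub>?L\<^esub>" for i x
  proof -
    have "sum_inj I M i x \<in> W"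
      using z coset_eq_zero_iff[OF D W sc[OF i x]] psi[OF x] by (simp add: Leq)
    then obtain T j where T: "j \<in> I" "finite T" "T \<subseteq> I" "\<forall>k\<in>I. sum_inj I M i x k \<noteq> \<zero>\<^bsub>M k\<^esub> \<longrightarrow> k \<in> T"
      "\<forall>k\<in>T. rel k j" "finsum (M j) (\<lambda>k. \<phi> k j (sum_inj I M i x k)) T = \<zero>\<^bsub>M j\<^esub>"
      using limit_span_sum_zero[OF S] unfolding W_def by blast
    show ?thesis
    proof (cases "i \<in> T")
      case True
      then have rij: "rel i j" using T by blast
      have pc: "\<phi> i j x \<in> carrier (M j)" by (rule hom_closed[OF direct_systemD(6)[OF S i T(1) rij] x])
      have "finsum (M j) (\<lambda>k. \<phi> k j (sum_inj I M i x k)) T = finsum (M j) (\<lambda>k. \<phi> k j (sum_inj I M i x k)) {i}"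
      proof (rule mod_finsum_mono[OF M[OF T(1)] T(2)])
        fix k assume k: "k \<in> T - {i}"
        then have kI: "k \<in> I" "rel k j" using T by auto
        then show "\<phi> k j (sum_inj I M i x k) = \<zero>\<^bsub>M j\<^esub>"
          using k hom_zero[OF direct_systemD(6)[OF S kI(1) T(1) kI(2)] M[OF kI(1)] M[OF T(1)]]
          by (simp add: sum_inj_def)
      qed (use True pc i in \<open>auto simp: sum_inj_def\<close>)
      also have "\<dots> = \<phi> i j x"
        using pc i M[OF T(1)] by (subst mod_finsum_insert) (auto simp: sum_inj_def)
      finally show ?thesis using T(1,6) rij by auto
    next
      case False
      then have "x = \<zero>\<^bsub>M i\<^esub>" using T(4) i by (auto simp: sum_inj_def)
      then show ?thesis using i x direct_systemD(2,7)[OF S i] by auto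
    qed
  qed
  show ?thesis unfolding colim_cone_def using hom comp surj ker by blast
qed

lemma direct_limit_lift:
  assumes S: "direct_system R I rel M \<phi>" and P: "module R P"
    and g: "\<And>i. i \<in> I \<Longrightarrow> g i \<in> mod_hom R (M i) P"
    and comp: "\<And>i j x. \<lbrakk>i \<in> I; j \<in> I; rel i j; x \<in> carrier (M i)\<rbrakk> \<Longrightarrow> g j (\<phi> i j x) = g i x"
  obtains h where "h \<in> mod_hom R (direct_limit R I rel M \<phi>) P"
    "\<And>i x. \<lbrakk>i \<in> I; x \<in> carrier (M i)\<rbrakk> \<Longrightarrow> h (limit_inj I rel M \<phi> i x) = g i x"
proof -
  note M = direct_systemD(5)[OF S]
  let ?D = "direct_sum I M"
  define W where "W = module_span R ?D (limit_rels I rel M \<phi>)"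
  have D: "module R ?D" by (rule module_direct_sum[OF M])
  have W: "submodule W R ?D" unfolding W_def by (rule limit_span_submodule[OF S])
  obtain h0 where h0: "h0 \<in> mod_hom R ?D P"
    "\<And>i x. \<lbrakk>i \<in> I; x \<in> carrier (M i)\<rbrakk> \<Longrightarrow> h0 (sum_inj I M i x) = g i x"
    using direct_sum_lift[where M=M and g=g, OF M P g] by metis
  have "limit_rels I rel M \<phi> \<subseteq> {w \<in> carrier ?D. h0 w = \<zero>\<^bsub>P\<^esub>}"
  proof
    fix w assume w: "w \<in> limit_rels I rel M \<phi>"
    then obtain i j x where *: "i \<in> I" "j \<in> I" "rel i j" "x \<in> carrier (M i)"
      "w = sum_inj I M j (\<phi> i j x) \<ominus>\<^bsub>?D\<^esub> sum_inj I M i x" unfolding limit_rels_def by blast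
    have px: "\<phi> i j x \<in> carrier (M j)" by (rule hom_closed[OF direct_systemD(6)[OF S *(1-3)] *(4)])
    have "h0 w = g j (\<phi> i j x) \<ominus>\<^bsub>P\<^esub> g i x"
      unfolding *(5)
      using hom_diff[OF h0(1) D P sum_inj_closed[where M=M, OF M *(2) px] sum_inj_closed[where M=M, OF M *(1,4)]]
        h0(2)[OF *(2) px] h0(2)[OF *(1,4)] by simp
    also have "\<dots> = \<zero>\<^bsub>P\<^esub>"
      using comp[OF *(1-4)] hom_closed[OF g[OF *(1)] *(4)] P by (simp add: mod_diff)
    finally show "w \<in> {w \<in> carrier ?D. h0 w = \<zero>\<^bsub>P\<^esub>}" using w limit_rels_subset[OF S] by blast
  qed
  then have "W \<subseteq> {w \<in> carrier ?D. h0 w = \<zero>\<^bsub>P\<^esub>}"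
    unfolding W_def by (rule module_span_min[OF kernel_submodule[OF D P h0(1)]])
  then have z: "\<And>w. w \<in> W \<Longrightarrow> h0 w = \<zero>\<^bsub>P\<^esub>" by blast
  from quot_factor[OF D W P h0(1) z] obtain h where h: "h \<in> mod_hom R (quot_module ?D W) P"
    "\<And>w. w \<in> carrier ?D \<Longrightarrow> h (W +>\<^bsub>?D\<^esub> w) = h0 w" by blast
  show ?thesis
  proof (rule that)
    show "h \<in> mod_hom R (direct_limit R I rel M \<phi>) P" using h(1) by (simp add: direct_limit_eq W_def)
    show "h (limit_inj I rel M \<phi> i x) = g i x" if i: "i \<in> I" and x: "x \<in> carrier (M i)" for i x
      using h(2)[OF sum_inj_closed[where M=M, OF M i x]] h0(2)[OF i x] x by (simp add: limit_inj_def W_def)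
  qed
qed

end

section \<open>Closure properties\<close>

context cring
begin

lemma tor_null_hom:
  assumes K: "K \<subseteq> carrier (free_module R UNIV)" and M: "module R M" and N: "module R N"
    and f: "f \<in> mod_hom R M N" and z: "tor_null K M z"
  shows "tor_null K N (\<lambda>k. f (z k))"
proof -
  obtain U n where U: "finite U" "U \<subseteq> K" "\<forall>\<kappa>\<in>U. n \<kappa> \<in> carrier M" "\<forall>k. lcomb M U (\<lambda>\<kappa>. \<kappa> k) n = z k"
    using z unfolding tor_null_def by blast
  have Kc: "\<kappa> k \<in> carrier R" if "\<kappa> \<in> U" for \<kappa> k
    using that U K by (intro free_carrierD(1)[of \<kappa> UNIV]) auto
  have "lcomb N U (\<lambda>\<kappa>. \<kappa> k) (\<lambda>\<kappa>. f (n \<kappa>)) = f (z k)" for k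
    using hom_lcomb[OF M N f U(1), of "\<lambda>\<kappa>. \<kappa> k" n] Kc U by simp
  then show ?thesis unfolding tor_null_def
    using U hom_closed[OF f] by (intro exI[of _ U] exI[of _ "\<lambda>\<kappa>. f (n \<kappa>)"]) auto
qed

lemma tor_null_add:
  assumes K: "K \<subseteq> carrier (free_module R UNIV)" and M: "module R M"
    and z: "tor_null K M z" "tor_null K M z'"
  shows "tor_null K M (\<lambda>k. z k \<oplus>\<^bsub>M\<^esub> z' k)"
proof -
  obtain U n where U: "finite U" "U \<subseteq> K" "\<forall>\<kappa>\<in>U. n \<kappa> \<in> carrier M" "\<forall>k. lcomb M U (\<lambda>\<kappa>. \<kappa> k) n = z k"
    using z(1) unfolding tor_null_def by blast
  obtain V p where V: "finite V" "V \<subseteq> K" "\<forall>\<kappa>\<in>V. p \<kappa> \<in> carrier M" "\<forall>k. lcomb M V (\<lambda>\<kappa>. \<kappa> k) p = z' k"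
    using z(2) unfolding tor_null_def by blast
  have Kc: "\<kappa> k \<in> carrier R" if "\<kappa> \<in> U \<union> V" for \<kappa> k
    using that U V K by (intro free_carrierD(1)[of \<kappa> UNIV]) auto
  let ?n = "\<lambda>\<kappa>. if \<kappa> \<in> U then n \<kappa> else \<zero>\<^bsub>M\<^esub>" and ?p = "\<lambda>\<kappa>. if \<kappa> \<in> V then p \<kappa> else \<zero>\<^bsub>M\<^esub>"
  have n: "?n \<kappa> \<in> carrier M" "?p \<kappa> \<in> carrier M" for \<kappa> using U V M by auto
  have "lcomb M (U \<union> V) (\<lambda>\<kappa>. \<kappa> k) (\<lambda>\<kappa>. ?n \<kappa> \<oplus>\<^bsub>M\<^esub> ?p \<kappa>) = z k \<oplus>\<^bsub>M\<^esub> z' k" for k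
  proof -
    have "lcomb M (U \<union> V) (\<lambda>\<kappa>. \<kappa> k) (\<lambda>\<kappa>. ?n \<kappa> \<oplus>\<^bsub>M\<^esub> ?p \<kappa>) =
        lcomb M (U \<union> V) (\<lambda>\<kappa>. \<kappa> k) ?n \<oplus>\<^bsub>M\<^esub> lcomb M (U \<union> V) (\<lambda>\<kappa>. \<kappa> k) ?p"
      by (rule lcomb_add[OF M Kc n])
    also have "lcomb M (U \<union> V) (\<lambda>\<kappa>. \<kappa> k) ?n = lcomb M U (\<lambda>\<kappa>. \<kappa> k) ?n"
      by (rule lcomb_mono[OF M _ _ Kc n(1)]) (use U V in auto)
    also have "\<dots> = lcomb M U (\<lambda>\<kappa>. \<kappa> k) n" by (rule lcomb_cong[OF M]) (use U Kc in auto)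
    also have "lcomb M (U \<union> V) (\<lambda>\<kappa>. \<kappa> k) ?p = lcomb M V (\<lambda>\<kappa>. \<kappa> k) ?p"
      by (rule lcomb_mono[OF M _ _ Kc n(2)]) (use U V in auto)
    also have "\<dots> = lcomb M V (\<lambda>\<kappa>. \<kappa> k) p" by (rule lcomb_cong[OF M]) (use V Kc in auto)
    finally show ?thesis using U V by simp
  qed
  then show ?thesis unfolding tor_null_def
    using U V n M by (intro exI[of _ "U \<union> V"] exI[of _ "\<lambda>\<kappa>. ?n \<kappa> \<oplus>\<^bsub>M\<^esub> ?p \<kappa>"]) auto
qed

lemma tor_null_zero: "module R M \<Longrightarrow> tor_null K M (\<lambda>k. \<zero>\<^bsub>M\<^esub>)"
  unfolding tor_null_def by (intro exI[of _ "{}"]) (auto simp: lcomb_def)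

lemma tor_null_finsum:
  assumes K: "K \<subseteq> carrier (free_module R UNIV)" and M: "module R M" and "finite S"
    "\<And>i k. i \<in> S \<Longrightarrow> z i k \<in> carrier M" "\<And>i. i \<in> S \<Longrightarrow> tor_null K M (z i)"
  shows "tor_null K M (\<lambda>k. finsum M (\<lambda>i. z i k) S)"
  using assms(3-5)
proof (induction S)
  case empty
  then show ?case using tor_null_zero[OF M] M by simp
next
  case (insert x S)
  have "tor_null K M (\<lambda>k. z x k \<oplus>\<^bsub>M\<^esub> finsum M (\<lambda>i. z i k) S)"
    by (rule tor_null_add[OF K M]) (use insert in auto)
  also have "(\<lambda>k. z x k \<oplus>\<^bsub>M\<^esub> finsum M (\<lambda>i. z i k) S) = (\<lambda>k. finsum M (\<lambda>i. z i k) (insert x S))"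
    using insert by (intro ext, subst mod_finsum_insert) (auto simp: M)
  finally show ?case .
qed

lemma tor_condD:
  assumes "tor_cond R K0 K1 M" "finite T" "T \<subseteq> K0" "\<And>k. k \<in> T \<Longrightarrow> m k \<in> carrier M"
    "\<And>s. lcomb M T (\<lambda>k. k s) m = \<zero>\<^bsub>M\<^esub>"
  shows "\<exists>J\<in>GV_ideals R. \<forall>r\<in>J. tor_null K1 M (\<lambda>k. if k \<in> T then r \<odot>\<^bsub>M\<^esub> m k else \<zero>\<^bsub>M\<^esub>)"
  using assms(1)[unfolded tor_cond_def, rule_format, of T m] assms(2-5) by blast

lemma tor_condI:
  assumes "\<And>T m. \<lbrakk>finite T; T \<subseteq> K0; \<And>k. k \<in> T \<Longrightarrow> m k \<in> carrier M;
      \<And>s. lcomb M T (\<lambda>k. k s) m = \<zero>\<^bsub>M\<^esub>\<rbrakk> \<Longrightarrow>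
    \<exists>J\<in>GV_ideals R. \<forall>r\<in>J. tor_null K1 M (\<lambda>k. if k \<in> T then r \<odot>\<^bsub>M\<^esub> m k else \<zero>\<^bsub>M\<^esub>)"
  shows "tor_cond R K0 K1 M"
  unfolding tor_cond_def by (intro allI impI, elim conjE, rule assms) auto

text \<open>To be a boundary is the solvability of a finite linear system; by purity a solution in \<open>M\<close> gives one
  in \<open>N\<close>.\<close>

lemma tor_cond_pure_sub:
  assumes M: "module R M" and pure: "sys_pure R N M"
    and K: "K0 \<subseteq> carrier (free_module R UNIV)" "K1 \<subseteq> carrier (free_module R UNIV)"
    and cond: "tor_cond R K0 K1 M"
  shows "tor_cond R K0 K1 (sub_module M N)"
proof (rule tor_condI)
  let ?N = "sub_module M N"
  note N = sys_pure_submodule[OF pure]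
  fix T m assume T: "finite T" "T \<subseteq> K0" and mN: "\<And>k. k \<in> T \<Longrightarrow> m k \<in> carrier ?N"
    and eq: "\<And>s. lcomb ?N T (\<lambda>k. k s) m = \<zero>\<^bsub>?N\<^esub>"
  have K0c: "k s \<in> carrier R" if "k \<in> T" for k s
    using that T K(1) by (intro free_carrierD(1)[of k UNIV]) auto
  have m: "m k \<in> N" if "k \<in> T" for k using mN[OF that] by simp
  have mM: "m k \<in> carrier M" if "k \<in> T" for k using submoduleD(3)[OF M N m[OF that]] .
  have "lcomb M T (\<lambda>k. k s) m = \<zero>\<^bsub>M\<^esub>" for s
    using eq[of s] lcomb_sub_module[OF M N T(1), of "\<lambda>k. k s" m] K0c m by simp
  then obtain J where J: "J \<in> GV_ideals R"
    "\<forall>r\<in>J. tor_null K1 M (\<lambda>k. if k \<in> T then r \<odot>\<^bsub>M\<^esub> m k else \<zero>\<^bsub>M\<^esub>)"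
    using tor_condD[where m=m, OF cond T mM] by blast
  have "tor_null K1 ?N (\<lambda>k. if k \<in> T then r \<odot>\<^bsub>?N\<^esub> m k else \<zero>\<^bsub>?N\<^esub>)" if r: "r \<in> J" for r
  proof -
    have rc: "r \<in> carrier R" using GV_idealD(2)[OF J(1)] r by auto
    obtain U n where U: "finite U" "U \<subseteq> K1" "\<forall>\<kappa>\<in>U. n \<kappa> \<in> carrier M"
      "\<forall>k. lcomb M U (\<lambda>\<kappa>. \<kappa> k) n = (if k \<in> T then r \<odot>\<^bsub>M\<^esub> m k else \<zero>\<^bsub>M\<^esub>)"
      using J(2)[rule_format, OF r, unfolded tor_null_def] by blast
    have Uf: "\<kappa> \<in> carrier (free_module R UNIV)" if "\<kappa> \<in> U" for \<kappa> using that U K by auto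
    have Kc: "\<kappa> k \<in> carrier R" if "\<kappa> \<in> U" for \<kappa> k by (rule free_carrierD(1)[OF Uf[OF that]])
    \<comment> \<open>only finitely many equations are not trivial\<close>
    define E where "E = T \<union> (\<Union>\<kappa>\<in>U. {k. \<kappa> k \<noteq> \<zero>})"
    have E: "finite E" unfolding E_def using T U free_carrierD(2)[OF Uf] by auto
    have "\<exists>n'. (\<forall>\<kappa>\<in>U. n' \<kappa> \<in> N) \<and>
        (\<forall>k\<in>E. lcomb M U (\<lambda>\<kappa>. \<kappa> k) n' = (if k \<in> T then r \<odot>\<^bsub>M\<^esub> m k else \<zero>\<^bsub>M\<^esub>))"
      by (rule sys_pure_finite[OF M pure E U(1), of "\<lambda>k \<kappa>. \<kappa> k"])
        (use Kc U m rc submoduleD(2,6)[OF M N] in auto)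
    then obtain n' where n': "\<forall>\<kappa>\<in>U. n' \<kappa> \<in> N"
      "\<forall>k\<in>E. lcomb M U (\<lambda>\<kappa>. \<kappa> k) n' = (if k \<in> T then r \<odot>\<^bsub>M\<^esub> m k else \<zero>\<^bsub>M\<^esub>)" by blast
    have n'M: "n' \<kappa> \<in> carrier M" if "\<kappa> \<in> U" for \<kappa> using n' that submoduleD(3)[OF M N] by blast
    have "lcomb ?N U (\<lambda>\<kappa>. \<kappa> k) n' = (if k \<in> T then r \<odot>\<^bsub>?N\<^esub> m k else \<zero>\<^bsub>?N\<^esub>)" for k
    proof (cases "k \<in> E")
      case True
      then show ?thesis using lcomb_sub_module[OF M N U(1), of "\<lambda>\<kappa>. \<kappa> k" n'] Kc n' by simp
    next
      case False
      then have "lcomb M U (\<lambda>\<kappa>. \<kappa> k) n' = \<zero>\<^bsub>M\<^esub>"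
        by (intro lcomb_zero[OF M Kc n'M]) (auto simp: E_def)
      moreover have "k \<notin> T" using False by (auto simp: E_def)
      ultimately show ?thesis using lcomb_sub_module[OF M N U(1), of "\<lambda>\<kappa>. \<kappa> k" n'] Kc n' by simp
    qed
    then show ?thesis unfolding tor_null_def using U n' by (intro exI[of _ U] exI[of _ n']) auto
  qed
  then show "\<exists>J\<in>GV_ideals R. \<forall>r\<in>J. tor_null K1 ?N (\<lambda>k. if k \<in> T then r \<odot>\<^bsub>?N\<^esub> m k else \<zero>\<^bsub>?N\<^esub>)"
    using J(1) by blast
qed

text \<open>A cycle in \<open>M/N\<close> lifts to a cycle in \<open>M\<close>: take any lift \<open>m\<close>.  Its boundary lies in \<open>N\<close>, so by purity
  some \<open>m'\<close> in \<open>N\<close> has the same boundary, and \<open>m - m'\<close> is a cycle.\<close>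

lemma tor_cond_pure_quot:
  assumes M: "module R M" and pure: "sys_pure R N M"
    and K: "K0 \<subseteq> carrier (free_module R UNIV)" "K1 \<subseteq> carrier (free_module R UNIV)"
    and cond: "tor_cond R K0 K1 M"
  shows "tor_cond R K0 K1 (quot_module M N)"
proof (rule tor_condI)
  let ?Q = "quot_module M N"
  note N = sys_pure_submodule[OF pure]
  note Q = module_quot[OF M N]
  let ?p = "\<lambda>x\<in>carrier M. N +>\<^bsub>M\<^esub> x"
  note p = quot_proj_hom[OF M N]
  fix T mq assume T: "finite T" "T \<subseteq> K0" and mq: "\<And>k. k \<in> T \<Longrightarrow> mq k \<in> carrier ?Q"
    and eq: "\<And>s. lcomb ?Q T (\<lambda>k. k s) mq = \<zero>\<^bsub>?Q\<^esub>"
  have Tf: "k \<in> carrier (free_module R UNIV)" if "k \<in> T" for k using that T K by auto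
  have K0c: "k s \<in> carrier R" if "k \<in> T" for k s by (rule free_carrierD(1)[OF Tf[OF that]])
  have "\<exists>x\<in>carrier M. ?p x = mq k" if k: "k \<in> T" for k
    using mq[OF k] unfolding quot_carrier by auto
  then obtain m where m: "\<And>k. k \<in> T \<Longrightarrow> m k \<in> carrier M" "\<And>k. k \<in> T \<Longrightarrow> ?p (m k) = mq k" by metis
  have lc: "lcomb M T (\<lambda>k. k s) m \<in> carrier M" for s by (rule lcomb_closed[OF M K0c m(1)])
  have "lcomb M T (\<lambda>k. k s) m \<in> N" for s
  proof -
    have "?p (lcomb M T (\<lambda>k. k s) m) = lcomb ?Q T (\<lambda>k. k s) (\<lambda>k. ?p (m k))"
      by (rule hom_lcomb[OF M Q p T(1) K0c m(1)])
    also have "\<dots> = lcomb ?Q T (\<lambda>k. k s) mq" by (rule lcomb_cong[OF Q]) (use m mq K0c in auto)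
    finally show ?thesis using eq[of s] coset_eq_zero_iff[OF M N lc] lc by simp
  qed
  moreover define E where "E = (\<Union>k\<in>T. {s. k s \<noteq> \<zero>})"
  have E: "finite E" unfolding E_def using T free_carrierD(2)[OF Tf] by auto
  ultimately have "\<exists>m'. (\<forall>k\<in>T. m' k \<in> N) \<and> (\<forall>s\<in>E. lcomb M T (\<lambda>k. k s) m' = lcomb M T (\<lambda>k. k s) m)"
    by (intro sys_pure_finite[OF M pure E T(1), of "\<lambda>s k. k s" _ m]) (use K0c m in auto)
  then obtain m' where m': "\<forall>k\<in>T. m' k \<in> N"
    "\<forall>s\<in>E. lcomb M T (\<lambda>k. k s) m' = lcomb M T (\<lambda>k. k s) m" by blast
  have m'M: "m' k \<in> carrier M" if "k \<in> T" for k using m' that submoduleD(3)[OF M N] by blast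
  let ?d = "\<lambda>k. m k \<ominus>\<^bsub>M\<^esub> m' k"
  have d: "?d k \<in> carrier M" if "k \<in> T" for k using m(1)[OF that] m'M[OF that] M by simp
  have "lcomb M T (\<lambda>k. k s) ?d = \<zero>\<^bsub>M\<^esub>" for s
  proof (cases "s \<in> E")
    case True
    then show ?thesis
      using lcomb_diff[OF M T(1), of "\<lambda>k. k s" m m'] K0c m(1) m'M m'(2) lc[of s] M by (simp add: mod_diff_eq_zero)
  next
    case False
    then show ?thesis by (intro lcomb_zero[OF M K0c d]) (auto simp: E_def)
  qed
  then obtain J where J: "J \<in> GV_ideals R"
    "\<forall>r\<in>J. tor_null K1 M (\<lambda>k. if k \<in> T then r \<odot>\<^bsub>M\<^esub> ?d k else \<zero>\<^bsub>M\<^esub>)"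
    using tor_condD[where m="?d", OF cond T d] by blast
  have pd: "?p (?d k) = mq k" if k: "k \<in> T" for k
  proof -
    have "?p (m' k) = \<zero>\<^bsub>?Q\<^esub>"
      using coset_eq_zero_iff[OF M N m'M[OF k]] m' k m'M[OF k] by simp
    then show ?thesis
      using hom_diff[OF p M Q m(1)[OF k] m'M[OF k]] m(2)[OF k] mq[OF k] Q by (simp add: mod_diff)
  qed
  have "tor_null K1 ?Q (\<lambda>k. if k \<in> T then r \<odot>\<^bsub>?Q\<^esub> mq k else \<zero>\<^bsub>?Q\<^esub>)" if r: "r \<in> J" for r
  proof -
    have rc: "r \<in> carrier R" using GV_idealD(2)[OF J(1)] r by auto
    have "tor_null K1 ?Q (\<lambda>k. ?p (if k \<in> T then r \<odot>\<^bsub>M\<^esub> ?d k else \<zero>\<^bsub>M\<^esub>))"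
      by (rule tor_null_hom[OF K(2) M Q p]) (use J r in blast)
    also have "(\<lambda>k. ?p (if k \<in> T then r \<odot>\<^bsub>M\<^esub> ?d k else \<zero>\<^bsub>M\<^esub>)) =
        (\<lambda>k. if k \<in> T then r \<odot>\<^bsub>?Q\<^esub> mq k else \<zero>\<^bsub>?Q\<^esub>)"
    proof
      fix k
      show "?p (if k \<in> T then r \<odot>\<^bsub>M\<^esub> ?d k else \<zero>\<^bsub>M\<^esub>) =
          (if k \<in> T then r \<odot>\<^bsub>?Q\<^esub> mq k else \<zero>\<^bsub>?Q\<^esub>)"
        by (cases "k \<in> T") (simp_all only: if_True if_False hom_smult[OF p rc d] pd hom_zero[OF p M Q])
    qed
    finally show ?thesis .
  qed
  then show "\<exists>J\<in>GV_ideals R. \<forall>r\<in>J. tor_null K1 ?Q (\<lambda>k. if k \<in> T then r \<odot>\<^bsub>?Q\<^esub> mq k else \<zero>\<^bsub>?Q\<^esub>)"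
    using J(1) by blast
qed

text \<open>A cycle in the limit comes from a finite family in some \<open>M i\<close>, and the finitely many equations that
  make it a cycle hold at some later index.\<close>

lemma tor_cond_colim:
  assumes S: "direct_system R I rel M \<phi>" and L: "module R L" and C: "colim_cone R I rel M \<phi> L \<psi>"
    and K: "K0 \<subseteq> carrier (free_module R UNIV)" "K1 \<subseteq> carrier (free_module R UNIV)"
    and cond: "\<And>i. i \<in> I \<Longrightarrow> tor_cond R K0 K1 (M i)"
  shows "tor_cond R K0 K1 L"
proof (rule tor_condI)
  note M = direct_systemD(5)[OF S]
  fix T m assume T: "finite T" "T \<subseteq> K0" and mL: "\<And>k. k \<in> T \<Longrightarrow> m k \<in> carrier L"
    and eq: "\<And>s. lcomb L T (\<lambda>k. k s) m = \<zero>\<^bsub>L\<^esub>"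
  have Tf: "k \<in> carrier (free_module R UNIV)" if "k \<in> T" for k using that T K by auto
  have K0c: "k s \<in> carrier R" if "k \<in> T" for k s by (rule free_carrierD(1)[OF Tf[OF that]])
  obtain i m' where i: "i \<in> I" and m'0: "\<forall>k\<in>T. m' k \<in> carrier (M i) \<and> \<psi> i (m' k) = m k"
    using colim_lift_finite[OF S C T(1), of m] mL by blast
  have m': "m' k \<in> carrier (M i)" "\<psi> i (m' k) = m k" if "k \<in> T" for k using m'0 that by auto
  define E where "E = (\<Union>k\<in>T. {s. k s \<noteq> \<zero>})"
  have E: "finite E" unfolding E_def using T free_carrierD(2)[OF Tf] by auto
  have psi: "\<psi> i \<in> mod_hom R (M i) L" by (rule colim_coneD(1)[OF C i])
  have lc: "lcomb (M i) T (\<lambda>k. k s) m' \<in> carrier (M i)" for s by (rule lcomb_closed[OF M[OF i] K0c m'(1)])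
  have "\<psi> i (lcomb (M i) T (\<lambda>k. k s) m') = \<zero>\<^bsub>L\<^esub>" for s
  proof -
    have "\<psi> i (lcomb (M i) T (\<lambda>k. k s) m') = lcomb L T (\<lambda>k. k s) (\<lambda>k. \<psi> i (m' k))"
      by (rule hom_lcomb[OF M[OF i] L psi T(1) K0c m'(1)])
    also have "\<dots> = lcomb L T (\<lambda>k. k s) m" by (rule lcomb_cong[OF L]) (use m' mL K0c in auto)
    finally show ?thesis using eq by simp
  qed
  then obtain j where j: "j \<in> I" "rel i j" "\<forall>s\<in>E. \<phi> i j (lcomb (M i) T (\<lambda>k. k s) m') = \<zero>\<^bsub>M j\<^esub>"
    using colim_kill_finite[OF S C i E, of "\<lambda>s. lcomb (M i) T (\<lambda>k. k s) m'"] lc by blast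
  have phi: "\<phi> i j \<in> mod_hom R (M i) (M j)" by (rule direct_systemD(6)[OF S i j(1,2)])
  let ?n = "\<lambda>k. \<phi> i j (m' k)"
  have n: "?n k \<in> carrier (M j)" if "k \<in> T" for k by (rule hom_closed[OF phi m'(1)[OF that]])
  have "lcomb (M j) T (\<lambda>k. k s) ?n = \<zero>\<^bsub>M j\<^esub>" for s
  proof (cases "s \<in> E")
    case True
    then show ?thesis using hom_lcomb[OF M[OF i] M[OF j(1)] phi T(1), of "\<lambda>k. k s" m'] K0c m'(1) j(3) by simp
  next
    case False
    then show ?thesis by (intro lcomb_zero[OF M[OF j(1)] K0c n]) (auto simp: E_def)
  qed
  then obtain J where J: "J \<in> GV_ideals R"
    "\<forall>r\<in>J. tor_null K1 (M j) (\<lambda>k. if k \<in> T then r \<odot>\<^bsub>M j\<^esub> ?n k else \<zero>\<^bsub>M j\<^esub>)"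
    using tor_condD[where m="?n", OF cond[OF j(1)] T n] by blast
  have psj: "\<psi> j \<in> mod_hom R (M j) L" by (rule colim_coneD(1)[OF C j(1)])
  have pn: "\<psi> j (?n k) = m k" if "k \<in> T" for k
    using colim_coneD(2)[OF C i j(1,2) m'(1)[OF that]] m'(2)[OF that] by simp
  have "tor_null K1 L (\<lambda>k. if k \<in> T then r \<odot>\<^bsub>L\<^esub> m k else \<zero>\<^bsub>L\<^esub>)" if r: "r \<in> J" for r
  proof -
    have rc: "r \<in> carrier R" using GV_idealD(2)[OF J(1)] r by auto
    have "tor_null K1 L (\<lambda>k. \<psi> j (if k \<in> T then r \<odot>\<^bsub>M j\<^esub> ?n k else \<zero>\<^bsub>M j\<^esub>))"
      by (rule tor_null_hom[OF K(2) M[OF j(1)] L psj]) (use J r in blast)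
    also have "(\<lambda>k. \<psi> j (if k \<in> T then r \<odot>\<^bsub>M j\<^esub> ?n k else \<zero>\<^bsub>M j\<^esub>)) =
        (\<lambda>k. if k \<in> T then r \<odot>\<^bsub>L\<^esub> m k else \<zero>\<^bsub>L\<^esub>)"
    proof
      fix k
      show "\<psi> j (if k \<in> T then r \<odot>\<^bsub>M j\<^esub> ?n k else \<zero>\<^bsub>M j\<^esub>) =
          (if k \<in> T then r \<odot>\<^bsub>L\<^esub> m k else \<zero>\<^bsub>L\<^esub>)"
        by (cases "k \<in> T")
          (simp_all only: if_True if_False hom_smult[OF psj rc n] pn hom_zero[OF psj M[OF j(1)] L])
    qed
    finally show ?thesis .
  qed
  then show "\<exists>J\<in>GV_ideals R. \<forall>r\<in>J. tor_null K1 L (\<lambda>k. if k \<in> T then r \<odot>\<^bsub>L\<^esub> m k else \<zero>\<^bsub>L\<^esub>)"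
    using J(1) by blast
qed

lemma GV_finite_intersection:
  assumes "finite S" "\<And>i. i \<in> S \<Longrightarrow> J i \<in> GV_ideals R"
  shows "\<exists>J0\<in>GV_ideals R. \<forall>i\<in>S. J0 \<subseteq> J i"
  using assms
proof (induction S)
  case empty
  then show ?case using GV_carrier by auto
next
  case (insert x S)
  then obtain J0 where J0: "J0 \<in> GV_ideals R" "\<forall>i\<in>S. J0 \<subseteq> J i" by auto
  obtain J1 where J1: "J1 \<in> GV_ideals R" "J1 \<subseteq> J0 \<inter> J x" using GV_product[OF J0(1), of "J x"] insert by auto
  then have "\<forall>i\<in>insert x S. J1 \<subseteq> J i" using J0(2) by auto
  then show ?case using J1(1) by blast
qed

text \<open>A cycle in a direct sum involves finitely many summands.  Each coordinate is a cycle, which a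
  GV-ideal multiplies into the boundaries; the finitely many GV-ideals contain a common one.\<close>

lemma tor_cond_direct_sum:
  assumes M: "\<And>i. i \<in> I \<Longrightarrow> module R (M i)"
    and K: "K0 \<subseteq> carrier (free_module R UNIV)" "K1 \<subseteq> carrier (free_module R UNIV)"
    and cond: "\<And>i. i \<in> I \<Longrightarrow> tor_cond R K0 K1 (M i)"
  shows "tor_cond R K0 K1 (direct_sum I M)"
proof (rule tor_condI)
  let ?D = "direct_sum I M"
  have D: "module R ?D" by (rule module_direct_sum[OF M])
  fix T m assume T: "finite T" "T \<subseteq> K0" and m: "\<And>k. k \<in> T \<Longrightarrow> m k \<in> carrier ?D"
    and eq: "\<And>s. lcomb ?D T (\<lambda>k. k s) m = \<zero>\<^bsub>?D\<^esub>"
  have K0c: "k s \<in> carrier R" if "k \<in> T" for k s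
    using that T K(1) by (intro free_carrierD(1)[of k UNIV]) auto
  have mc: "m k i \<in> carrier (M i)" if "k \<in> T" "i \<in> I" for k i
    by (rule direct_sum_carrierD(1)[OF m[OF that(1)] that(2)])
  define S where "S = (\<Union>k\<in>T. {i \<in> I. m k i \<noteq> \<zero>\<^bsub>M i\<^esub>})"
  have S: "finite S" "S \<subseteq> I" unfolding S_def using T direct_sum_carrierD(3)[OF m] by auto
  have "\<exists>J\<in>GV_ideals R. \<forall>r\<in>J. tor_null K1 (M i) (\<lambda>k. if k \<in> T then r \<odot>\<^bsub>M i\<^esub> m k i else \<zero>\<^bsub>M i\<^esub>)"
    if i: "i \<in> I" for i
  proof (rule tor_condD[OF cond[OF i] T, of "\<lambda>k. m k i"])
    show "m k i \<in> carrier (M i)" if "k \<in> T" for k by (rule mc[OF that i])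
    fix s
    let ?p = "\<lambda>x\<in>carrier ?D. x i"
    have "lcomb (M i) T (\<lambda>k. k s) (\<lambda>k. m k i) = lcomb (M i) T (\<lambda>k. k s) (\<lambda>k. ?p (m k))"
      by (rule lcomb_cong[OF M[OF i]]) (use m mc i K0c in auto)
    also have "\<dots> = ?p (lcomb ?D T (\<lambda>k. k s) m)"
      by (rule hom_lcomb[OF D M[OF i] direct_sum_coord_hom[where M=M, OF M i] T(1) K0c m, symmetric])
    also have "\<dots> = \<zero>\<^bsub>M i\<^esub>" unfolding eq using mod_zero_closed[OF D] i by simp
    finally show "lcomb (M i) T (\<lambda>k. k s) (\<lambda>k. m k i) = \<zero>\<^bsub>M i\<^esub>" .
  qed
  then have "\<forall>i\<in>I. \<exists>J. J \<in> GV_ideals R \<and>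
      (\<forall>r\<in>J. tor_null K1 (M i) (\<lambda>k. if k \<in> T then r \<odot>\<^bsub>M i\<^esub> m k i else \<zero>\<^bsub>M i\<^esub>))" by blast
  from bchoice[OF this] obtain J where Jall: "\<forall>i\<in>I. J i \<in> GV_ideals R \<and>
      (\<forall>r\<in>J i. tor_null K1 (M i) (\<lambda>k. if k \<in> T then r \<odot>\<^bsub>M i\<^esub> m k i else \<zero>\<^bsub>M i\<^esub>))" ..
  have J: "J i \<in> GV_ideals R"
    "r \<in> J i \<Longrightarrow> tor_null K1 (M i) (\<lambda>k. if k \<in> T then r \<odot>\<^bsub>M i\<^esub> m k i else \<zero>\<^bsub>M i\<^esub>)"
    if "i \<in> I" for i r
    using Jall that by blast+
  obtain J0 where J0: "J0 \<in> GV_ideals R" "\<forall>i\<in>S. J0 \<subseteq> J i"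
    using GV_finite_intersection[OF S(1), of J] J(1) S(2) by blast
  have "tor_null K1 ?D (\<lambda>k. if k \<in> T then r \<odot>\<^bsub>?D\<^esub> m k else \<zero>\<^bsub>?D\<^esub>)" if r: "r \<in> J0" for r
  proof -
    have rc: "r \<in> carrier R" using GV_idealD(2)[OF J0(1)] r by auto
    let ?z = "\<lambda>i k. if k \<in> T then r \<odot>\<^bsub>M i\<^esub> m k i else \<zero>\<^bsub>M i\<^esub>"
    have zc: "?z i k \<in> carrier (M i)" if "i \<in> I" for i k using that mc rc M by simp
    have "tor_null K1 ?D (\<lambda>k. restrict (sum_inj I M i) (carrier (M i)) (?z i k))" if i: "i \<in> S" for i
    proof (rule tor_null_hom[OF K(2) M D sum_inj_hom[where M=M, OF M]])
      show "tor_null K1 (M i) (?z i)" using i S J0(2) r J(2)[of i r] by blast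
    qed (use i S in auto)
    then have "tor_null K1 ?D (\<lambda>k. finsum ?D (\<lambda>i. restrict (sum_inj I M i) (carrier (M i)) (?z i k)) S)"
    proof (intro tor_null_finsum[OF K(2) D S(1)])
      fix i k assume "i \<in> S"
      then have i: "i \<in> I" using S by auto
      show "restrict (sum_inj I M i) (carrier (M i)) (?z i k) \<in> carrier ?D"
        by (rule hom_closed[OF sum_inj_hom[where M=M, OF M i] zc[OF i]])
    qed
    also have "(\<lambda>k. finsum ?D (\<lambda>i. restrict (sum_inj I M i) (carrier (M i)) (?z i k)) S) =
        (\<lambda>k. if k \<in> T then r \<odot>\<^bsub>?D\<^esub> m k else \<zero>\<^bsub>?D\<^esub>)"
    proof
      fix k
      let ?w = "if k \<in> T then r \<odot>\<^bsub>?D\<^esub> m k else \<zero>\<^bsub>?D\<^esub>"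
      have w: "?w \<in> carrier ?D" using m[of k] rc mod_smult_closed[OF D] mod_zero_closed[OF D] by auto
      have wi: "?w i = ?z i k" if "i \<in> I" for i using that by auto
      have "finsum ?D (\<lambda>i. restrict (sum_inj I M i) (carrier (M i)) (?z i k)) S =
          finsum ?D (\<lambda>i. sum_inj I M i (?w i)) S"
      proof (rule mod_finsum_cong[OF D])
        fix i assume "i \<in> S"
        then have i: "i \<in> I" using S by auto
        show "restrict (sum_inj I M i) (carrier (M i)) (?z i k) = sum_inj I M i (?w i)"
          using wi[OF i] zc[OF i, of k] by simp
        show "sum_inj I M i (?w i) \<in> carrier ?D"
          unfolding wi[OF i] by (rule sum_inj_closed[where M=M, OF M i zc[OF i]])
      qed
      also have "\<dots> = ?w"
      proof (rule direct_sum_expand[where M=M, OF M w S])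
        show "i \<in> S" if "i \<in> I" "?w i \<noteq> \<zero>\<^bsub>M i\<^esub>" for i
          using that M[OF that(1)] rc unfolding wi[OF that(1)] S_def
          by (cases "k \<in> T"; cases "m k i = \<zero>\<^bsub>M i\<^esub>") auto
      qed
      finally show "finsum ?D (\<lambda>i. restrict (sum_inj I M i) (carrier (M i)) (?z i k)) S = ?w" .
    qed
    finally show ?thesis .
  qed
  then show "\<exists>J\<in>GV_ideals R. \<forall>r\<in>J. tor_null K1 ?D (\<lambda>k. if k \<in> T then r \<odot>\<^bsub>?D\<^esub> m k else \<zero>\<^bsub>?D\<^esub>)"
    using J0(1) by blast
qed

lemma w_flat_module: "M \<in> semi_regular_w_flat R \<Longrightarrow> module R M"
  by (simp add: semi_regular_w_flat_iff)

lemma w_flat_tor_cond: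
  "\<lbrakk>M \<in> semi_regular_w_flat R; I \<in> fg_semi_regular_ideals R\<rbrakk> \<Longrightarrow>
    tor_cond R (tor_K0 R (quot_module (regular_module R) I)) (tor_K1 R (quot_module (regular_module R) I)) M"
  by (simp add: semi_regular_w_flat_iff)

lemma w_flat_pure_sub:
  assumes M: "M \<in> semi_regular_w_flat R" and N: "sys_pure R N M"
  shows "sub_module M N \<in> semi_regular_w_flat R"
  unfolding semi_regular_w_flat_iff
  using module_sub_module[OF w_flat_module[OF M] sys_pure_submodule[OF N]]
    tor_cond_pure_sub[OF w_flat_module[OF M] N tor_K0_subset tor_K1_subset w_flat_tor_cond[OF M]]
  by simp

lemma w_flat_pure_quot:
  assumes M: "M \<in> semi_regular_w_flat R" and N: "sys_pure R N M"
  shows "quot_module M N \<in> semi_regular_w_flat R"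
  unfolding semi_regular_w_flat_iff
  using module_quot[OF w_flat_module[OF M] sys_pure_submodule[OF N]]
    tor_cond_pure_quot[OF w_flat_module[OF M] N tor_K0_subset tor_K1_subset w_flat_tor_cond[OF M]]
  by simp

lemma w_flat_colim:
  assumes S: "direct_system R I rel M \<phi>" and M: "\<And>i. i \<in> I \<Longrightarrow> M i \<in> semi_regular_w_flat R"
    and L: "module R L" "colim_cone R I rel M \<phi> L \<psi>"
  shows "L \<in> semi_regular_w_flat R"
  unfolding semi_regular_w_flat_iff
  using tor_cond_colim[OF S L tor_K0_subset tor_K1_subset w_flat_tor_cond[OF M]] L(1) by simp

lemma w_flat_direct_sum:
  assumes M: "\<And>i. i \<in> I \<Longrightarrow> M i \<in> semi_regular_w_flat R"
  shows "direct_sum I M \<in> semi_regular_w_flat R"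
  unfolding semi_regular_w_flat_iff
  by (intro conjI ballI module_direct_sum tor_cond_direct_sum[OF _ tor_K0_subset tor_K1_subset]
      w_flat_module w_flat_tor_cond M)

end

section \<open>Cardinality bounds\<close>

subsection \<open>Injections into an infinite type and into its power set\<close>

text \<open>Cardinal bounds are expressed by injections.  An infinite type \<open>'l\<close> has room for products, options
  and lists over types that embed into it; \<open>'l set\<close> has room, moreover, for functions from such types.\<close>

lemma inj_nat_infinite:
  assumes "infinite (UNIV :: 'l set)"
  shows "\<exists>f :: nat \<Rightarrow> 'l. inj f"
  using infinite_countable_subset[OF assms] by auto

lemma inj_Times_infinite:
  fixes f :: "'x \<Rightarrow> 'l" and g :: "'y \<Rightarrow> 'l"
  assumes inf: "infinite (UNIV :: 'l set)" and f: "inj f" and g: "inj g"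
  shows "\<exists>h :: 'x \<times> 'y \<Rightarrow> 'l. inj h"
proof -
  have "(card_of (UNIV \<times> UNIV :: ('l \<times> 'l) set), card_of (UNIV :: 'l set)) \<in> ordLeq"
    using card_of_Times_same_infinite[OF inf] by (rule ordIso_imp_ordLeq)
  then obtain e :: "'l \<times> 'l \<Rightarrow> 'l" where e: "inj e"
    unfolding card_of_ordLeq[symmetric] by auto
  have "inj (\<lambda>p. e (f (fst p), g (snd p)))"
    by (rule injI) (auto dest!: injD[OF e] injD[OF f] injD[OF g] simp: prod_eq_iff)
  then show ?thesis by blast
qed

lemma inj_option_infinite:
  fixes f :: "'x \<Rightarrow> 'l"
  assumes inf: "infinite (UNIV :: 'l set)" and f: "inj f"
  shows "\<exists>h :: 'x option \<Rightarrow> 'l. inj h"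
proof -
  obtain n :: "nat \<Rightarrow> 'l" where n: "inj n" using inj_nat_infinite[OF inf] ..
  have idl: "inj (\<lambda>x. x :: 'l)" by (simp add: inj_on_def)
  obtain e :: "'l \<times> 'l \<Rightarrow> 'l" where e: "inj e" using inj_Times_infinite[OF inf idl idl] ..
  have "inj (\<lambda>x. case x of None \<Rightarrow> e (n 0, n 0) | Some y \<Rightarrow> e (n 1, f y))"
    by (rule injI) (auto dest!: injD[OF e] injD[OF f] injD[OF n] split: option.splits)
  then show ?thesis by blast
qed

lemma inj_list_infinite:
  fixes f :: "'x \<Rightarrow> 'l"
  assumes inf: "infinite (UNIV :: 'l set)" and f: "inj f"
  shows "\<exists>h :: 'x list \<Rightarrow> 'l. inj h"
proof -
  obtain n :: "nat \<Rightarrow> 'l" where n: "inj n" using inj_nat_infinite[OF inf] ..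
  have idl: "inj (\<lambda>x. x :: 'l)" by (simp add: inj_on_def)
  obtain e :: "'l \<times> 'l \<Rightarrow> 'l" where e: "inj e" using inj_Times_infinite[OF inf idl idl] ..
  define c where "c xs = foldr (\<lambda>x r. e (f x, r)) xs (n 0)" for xs
  have c: "c xs = c ys \<Longrightarrow> length xs = length ys \<Longrightarrow> xs = ys" for xs ys
  proof (induction xs arbitrary: ys)
    case (Cons x xs)
    then obtain y ys' where ys: "ys = y # ys'" by (cases ys) auto
    have "(f x, c xs) = (f y, c ys')" using Cons.prems(1) by (intro injD[OF e]) (simp add: c_def ys)
    then have "x = y" "c xs = c ys'" using injD[OF f] by auto
    then show ?case using Cons.IH[of ys'] Cons.prems(2) ys by simp
  qed simp
  have "inj (\<lambda>xs. e (n (length xs), c xs))"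
  proof (rule injI)
    fix xs ys assume "e (n (length xs), c xs) = e (n (length ys), c ys)"
    then have "(n (length xs), c xs) = (n (length ys), c ys)" by (rule injD[OF e])
    then have "length xs = length ys" "c xs = c ys" using injD[OF n] by auto
    then show "xs = ys" using c by blast
  qed
  then show ?thesis by blast
qed

lemma inj_on_comp_ex:
  assumes "\<exists>f :: 'x \<Rightarrow> 'y. inj_on f A" and h: "inj (h :: 'y \<Rightarrow> 'z)"
  shows "\<exists>c :: 'x \<Rightarrow> 'z. inj_on c A"
proof -
  obtain f :: "'x \<Rightarrow> 'y" where f: "inj_on f A" using assms(1) ..
  have "inj_on (h \<circ> f) A" by (rule comp_inj_on[OF f inj_on_subset[OF h]]) simp
  then show ?thesis by blast
qed

lemma inj_set_set: "inj (f :: 'x \<Rightarrow> 'l) \<Longrightarrow> \<exists>h :: 'x set \<Rightarrow> 'l set. inj h"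
  by (auto intro!: exI[of _ "image f"] simp: inj_on_def inj_image_eq_iff)

lemma inj_elem_set: "inj (f :: 'x \<Rightarrow> 'l) \<Longrightarrow> \<exists>h :: 'x \<Rightarrow> 'l set. inj h"
  by (auto intro!: exI[of _ "\<lambda>x. {f x}"] simp: inj_on_def)

lemma inj_fun_set:
  fixes f :: "'x \<Rightarrow> 'l" and g :: "'y \<Rightarrow> 'l set"
  assumes inf: "infinite (UNIV :: 'l set)" and f: "inj f" and g: "inj g"
  shows "\<exists>h :: ('x \<Rightarrow> 'y) \<Rightarrow> 'l set. inj h"
proof -
  have idl: "inj (\<lambda>x. x :: 'l)" by (simp add: inj_on_def)
  obtain e :: "'x \<times> 'l \<Rightarrow> 'l" where e: "inj e" using inj_Times_infinite[OF inf f idl] ..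
  have "inj (\<lambda>\<phi>. e ` {(x,y). y \<in> g (\<phi> x)})"
  proof (rule injI)
    fix \<phi> \<psi> assume "e ` {(x,y). y \<in> g (\<phi> x)} = e ` {(x,y). y \<in> g (\<psi> x)}"
    then have "{(x,y). y \<in> g (\<phi> x)} = {(x,y). y \<in> g (\<psi> x)}" using e by (simp add: inj_image_eq_iff)
    then have "g (\<phi> x) = g (\<psi> x)" for x by blast
    then have "\<phi> x = \<psi> x" for x by (rule injD[OF g])
    then show "\<phi> = \<psi>" by blast
  qed
  then show ?thesis by blast
qed

lemma inj_Times_set:
  fixes f :: "'x \<Rightarrow> 'l set" and g :: "'y \<Rightarrow> 'l set"
  assumes inf: "infinite (UNIV :: 'l set)" and f: "inj f" and g: "inj g"
  shows "\<exists>h :: 'x \<times> 'y \<Rightarrow> 'l set. inj h"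
proof -
  obtain n :: "nat \<Rightarrow> 'l" where n: "inj n" using inj_nat_infinite[OF inf] ..
  have idl: "inj (\<lambda>x. x :: 'l)" by (simp add: inj_on_def)
  obtain e :: "nat \<times> 'l \<Rightarrow> 'l" where e: "inj e" using inj_Times_infinite[OF inf n idl] ..
  have "inj (\<lambda>p. e ` ({0} \<times> f (fst p) \<union> {1} \<times> g (snd p)))"
  proof (rule injI)
    fix p q assume "e ` ({0} \<times> f (fst p) \<union> {1} \<times> g (snd p)) = e ` ({0} \<times> f (fst q) \<union> {1} \<times> g (snd q))"
    then have *: "{0} \<times> f (fst p) \<union> {1} \<times> g (snd p) = {0} \<times> f (fst q) \<union> {1::nat} \<times> g (snd q)"
      using e by (simp add: inj_image_eq_iff)
    have "y \<in> f (fst p) \<longleftrightarrow> (0,y) \<in> {0} \<times> f (fst p) \<union> {1::nat} \<times> g (snd p)"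
      "y \<in> f (fst q) \<longleftrightarrow> (0,y) \<in> {0} \<times> f (fst q) \<union> {1::nat} \<times> g (snd q)"
      "z \<in> g (snd p) \<longleftrightarrow> (1,z) \<in> {0} \<times> f (fst p) \<union> {1::nat} \<times> g (snd p)"
      "z \<in> g (snd q) \<longleftrightarrow> (1,z) \<in> {0} \<times> f (fst q) \<union> {1::nat} \<times> g (snd q)" for y z by auto
    then have "f (fst p) = f (fst q)" "g (snd p) = g (snd q)" using * by blast+
    then show "p = q" using f g by (auto dest: injD simp: prod_eq_iff)
  qed
  then show ?thesis by blast
qed


subsection \<open>Closure under finitary and under large operations\<close>

text \<open>Finitely many arguments from a set parametrized by \<open>'l\<close>, and an operation from \<open>'l\<close> many, are again
  parametrized by \<open>'l\<close>; so each of the \<open>\<omega>\<close> stages of the closure, and their union, is the range of a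
  function on \<open>'l\<close>.\<close>

lemma finitary_closure:
  fixes opr :: "'lab \<Rightarrow> 'g list \<Rightarrow> 'g" and c :: "'lab \<Rightarrow> 'l"
  assumes inf: "infinite (UNIV :: 'l set)" and c: "inj c" and xC: "x \<in> C"
    and opC: "\<And>lab as. set as \<subseteq> C \<Longrightarrow> opr lab as \<in> C"
  obtains v :: "'l \<Rightarrow> 'g" where "x \<in> range v" "range v \<subseteq> C"
    "\<And>lab as. set as \<subseteq> range v \<Longrightarrow> opr lab as \<in> range v"
proof -
  obtain n :: "nat \<Rightarrow> 'l" where n: "inj n" using inj_nat_infinite[OF inf] ..
  have idl: "inj (\<lambda>x. x :: 'l)" by (simp add: inj_on_def)
  obtain d0 :: "'lab option \<Rightarrow> 'l" where d0: "inj d0" using inj_option_infinite[OF inf c] ..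
  obtain d1 :: "'l list \<Rightarrow> 'l" where d1: "inj d1" using inj_list_infinite[OF inf idl] ..
  obtain d :: "'lab option \<times> 'l list \<Rightarrow> 'l" where d: "inj d" using inj_Times_infinite[OF inf d0 d1] ..
  obtain t :: "nat \<times> 'l \<Rightarrow> 'l" where t: "inj t" using inj_Times_infinite[OF inf n idl] ..
  define dec where "dec = inv_into UNIV d"
  have dec: "dec (d p) = p" for p using d by (simp add: dec_def)
  \<comment> \<open>the label \<open>None\<close> repeats an earlier element, so that the stages increase\<close>
  define stp where "stp e l = (case dec l of (None, ls) \<Rightarrow> e (hd ls) | (Some lab, ls) \<Rightarrow> opr lab (map e ls))"
    for e :: "'l \<Rightarrow> 'g" and l
  define e where "e k = (stp ^^ k) (\<lambda>_. x)" for k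
  have e0: "e 0 l = x" for l by (simp add: e_def)
  have eS: "e (Suc k) = stp (e k)" for k by (simp add: e_def)
  have mono1: "range (e k) \<subseteq> range (e (Suc k))" for k
  proof
    fix y assume "y \<in> range (e k)"
    then obtain l where "y = e k l" by auto
    then have "y = e (Suc k) (d (None, [l]))" by (simp add: eS stp_def dec)
    then show "y \<in> range (e (Suc k))" by auto
  qed
  have mono: "range (e i) \<subseteq> range (e j)" if "i \<le> j" for i j
    using that mono1 by (rule lift_Suc_mono_le[of "\<lambda>k. range (e k)", rotated])
  define v where "v l = e (fst (inv_into UNIV t l)) (snd (inv_into UNIV t l))" for l
  have vr: "range v = (\<Union>k. range (e k))"
  proof
    show "range v \<subseteq> (\<Union>k. range (e k))" by (auto simp: v_def)
    show "(\<Union>k. range (e k)) \<subseteq> range v"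
    proof clarify
      fix k l
      have "e k l = v (t (k,l))" using t by (simp add: v_def)
      then show "e k l \<in> range v" by auto
    qed
  qed
  have stage: "\<exists>k. set as \<subseteq> range (e k)" if "set as \<subseteq> range v" for as
    using that
  proof (induction as)
    case (Cons a as)
    then obtain k where k: "set as \<subseteq> range (e k)" by auto
    obtain j where j: "a \<in> range (e j)" using Cons.prems vr by auto
    have "set (a # as) \<subseteq> range (e (max k j))"
      using k j mono[of k "max k j"] mono[of j "max k j"] by auto
    then show ?case ..
  qed simp
  have eC: "range (e k) \<subseteq> C" for k
  proof (induction k)
    case 0
    then show ?case using xC by (auto simp: e0)
  next
    case (Suc k)
    have im: "e k ` A \<subseteq> C" "e k y \<in> C" for A y using Suc by auto
    have "stp (e k) l \<in> C" for l
      unfolding stp_def using opC[of "map (e k) (snd (dec l))"] Suc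
      by (auto split: prod.splits option.splits simp: im)
    then show ?case by (auto simp: eS)
  qed
  show ?thesis
  proof (rule that)
    show "x \<in> range v" unfolding vr using e0 by (metis UN_I UNIV_I rangeI)
    show "range v \<subseteq> C" unfolding vr using eC by blast
    fix lab as assume "set as \<subseteq> range v"
    then obtain k where k: "set as \<subseteq> range (e k)" using stage by blast
    define ls where "ls = map (inv_into UNIV (e k)) as"
    have "map (e k) ls = as" using k by (auto simp: ls_def f_inv_into_f intro!: map_idI)
    then have "opr lab as = e (Suc k) (d (Some lab, ls))" by (simp add: eS stp_def dec)
    then show "opr lab as \<in> range v" unfolding vr by blast
  qed
qed

text \<open>The operation \<open>V lab\<close> takes a family of arguments indexed by \<open>S lab\<close>, which may be infinite.  The family
  is restricted so that the value depends on nothing else.\<close>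

inductive_set large_hull :: "('lab \<Rightarrow> 'l set) \<Rightarrow> ('lab \<Rightarrow> ('l \<Rightarrow> 'g) \<Rightarrow> 'g) \<Rightarrow> 'g set"
  for S :: "'lab \<Rightarrow> 'l set" and V :: "'lab \<Rightarrow> ('l \<Rightarrow> 'g) \<Rightarrow> 'g" where
  step: "(\<And>l. l \<in> S lab \<Longrightarrow> w l \<in> large_hull S V) \<Longrightarrow> V lab (restrict w (S lab)) \<in> large_hull S V"

text \<open>A tree is given by the label \<open>t p\<close> at each path \<open>p\<close>; a node with label \<open>lab\<close> has the children \<open>S lab\<close>.  The
  trees with a value are the well-founded ones.\<close>

inductive tree_val :: "('lab \<Rightarrow> 'l set) \<Rightarrow> ('lab \<Rightarrow> ('l \<Rightarrow> 'g) \<Rightarrow> 'g) \<Rightarrow> ('l list \<Rightarrow> 'lab) \<Rightarrow> 'g \<Rightarrow> bool"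
  for S :: "'lab \<Rightarrow> 'l set" and V :: "'lab \<Rightarrow> ('l \<Rightarrow> 'g) \<Rightarrow> 'g" where
  "(\<And>l. l \<in> S (t []) \<Longrightarrow> tree_val S V (\<lambda>p. t (l # p)) (w l)) \<Longrightarrow>
    tree_val S V t (V (t []) (restrict w (S (t []))))"

lemma tree_val_unique: "tree_val S V t x \<Longrightarrow> tree_val S V t y \<Longrightarrow> x = y"
proof (induction arbitrary: y rule: tree_val.induct)
  case (1 t w)
  from 1(3) obtain w' where w': "y = V (t []) (restrict w' (S (t [])))"
    "\<And>l. l \<in> S (t []) \<Longrightarrow> tree_val S V (\<lambda>p. t (l # p)) (w' l)"
    by (cases rule: tree_val.cases) auto
  have "restrict w (S (t [])) = restrict w' (S (t []))"
    by (rule restrict_ext) (use 1(2) w'(2) in blast)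
  then show ?case using w'(1) by simp
qed

text \<open>An element that is generated by operations of large arity is coded by a well-founded tree.  A tree is
  determined by the labels of its nodes, and its nodes are finite paths; this bounds the number of
  generated elements without a transfinite iteration.\<close>

lemma large_hull_code:
  fixes S :: "'lab \<Rightarrow> 'l set" and V :: "'lab \<Rightarrow> ('l \<Rightarrow> 'g) \<Rightarrow> 'g"
  shows "\<exists>code :: 'g \<Rightarrow> 'l list \<Rightarrow> 'lab. inj_on code (large_hull S V)"
proof -
  have ex: "\<exists>t. tree_val S V t x" if "x \<in> large_hull S V" for x
    using that
  proof (induction rule: large_hull.induct)
    case (step lab w)
    then obtain t where t: "\<And>l. l \<in> S lab \<Longrightarrow> tree_val S V (t l) (w l)" by metis
    let ?t = "\<lambda>p. case p of [] \<Rightarrow> lab | l # q \<Rightarrow> t l q"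
    have "tree_val S V ?t (V (?t []) (restrict w (S (?t []))))"
      by (rule tree_val.intros) (use t in simp)
    then show ?case by auto
  qed
  then obtain code where code: "\<And>x. x \<in> large_hull S V \<Longrightarrow> tree_val S V (code x) x" by metis
  have "inj_on code (large_hull S V)"
    by (rule inj_onI) (metis code tree_val_unique)
  then show ?thesis by blast
qed


subsection \<open>Pure submodules in large modules\<close>

context cring
begin

text \<open>If \<open>G\<close> is large, the kernel of \<open>g\<close> contains a nonzero pure submodule.  Let \<open>L\<close> be an infinite set
  at least as large as the ring and \<open>M\<close>.  A problem prescribes, for a family indexed by \<open>L\<close>, some of
  its members, some sums and scalar multiples among them, and the values of \<open>g\<close> on them.  Let \<open>H\<close> be
  generated by chosen solutions: whenever the prescribed members lie in \<open>H\<close>, so do the members of the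
  chosen solution, if there is any.  There are \<open>2\<^sup>L\<close> problems, hence \<open>H\<close> has at most \<open>2\<^sup>L\<close> elements by
  \<open>large_hull_code\<close>.

  Suppose that \<open>x \<in> G\<close> is not in \<open>H\<close>.  Choose a submodule \<open>A\<close>, the range of a family \<open>v\<close> indexed by
  \<open>L\<close>, that contains \<open>x\<close> and is closed under solutions of finite systems \<open>\<Sum>\<^sub>j a\<^sub>i\<^sub>j y\<^sub>j = d\<^sub>i - h\<^sub>i\<close> for the
  unknowns \<open>y\<^sub>j\<close> in \<open>G\<close> and \<open>h\<^sub>i\<close> in \<open>H\<close>, with given \<open>d\<^sub>i\<close> in \<open>A\<close>.  The family \<open>v\<close> solves the problem given by its own
  members in \<open>H\<close>, its sums, multiples and values under \<open>g\<close>.  The chosen solution \<open>v'\<close> is in \<open>H\<close>, and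
  \<open>v \<mapsto> v'\<close> defines a homomorphism \<open>\<theta>\<close> on \<open>A\<close> that fixes the elements of \<open>A \<inter> H\<close> and respects \<open>g\<close>.
  The submodule \<open>D\<close> of all \<open>a - \<theta> a\<close> is contained in the kernel and contains \<open>x - \<theta> x \<noteq> 0\<close>.  It is pure: a
  system with right-hand sides \<open>d\<^sub>i - \<theta> d\<^sub>i\<close> that is solvable in \<open>G\<close> has, by the choice of \<open>A\<close>, elements
  \<open>y\<^sub>j\<close> of \<open>A\<close> and \<open>h\<^sub>i\<close> of \<open>A \<inter> H\<close> that solve it with right-hand sides \<open>d\<^sub>i - h\<^sub>i\<close>, and then the elements
  \<open>y\<^sub>j - \<theta> y\<^sub>j\<close> of \<open>D\<close> solve it with \<open>d\<^sub>i - \<theta> d\<^sub>i\<close>, as \<open>\<theta> h\<^sub>i = h\<^sub>i\<close>.\<close>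

lemma small_if_no_pure_submodule_in_kernel:
  fixes G :: "('a,'g) module" and M :: "('a,'m) module"
  assumes inf: "infinite (UNIV :: 'l set)" and ia: "inj (ia :: 'a \<Rightarrow> 'l)" and im: "inj (im :: 'm \<Rightarrow> 'l)"
    and G: "module R G" and M: "module R M" and g: "g \<in> mod_hom R G M"
    and no_pure: "\<And>P. \<lbrakk>sys_pure R P G; P \<subseteq> {x \<in> carrier G. g x = \<zero>\<^bsub>M\<^esub>}\<rbrakk> \<Longrightarrow> P = {\<zero>\<^bsub>G\<^esub>}"
  shows "\<exists>c :: 'g \<Rightarrow> 'l set. inj_on c (carrier G)"
proof -
  \<comment> \<open>\<open>S\<close> and \<open>w\<close> prescribe members, \<open>A\<close> sums, \<open>B\<close> multiples, and \<open>p\<close> the values of \<open>g\<close>\<close>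
  define realize where
    "realize S A B p w v \<longleftrightarrow> (\<forall>l. v l \<in> carrier G) \<and> (\<forall>l\<in>S. v l = w l) \<and>
      (\<forall>(l,l',l'')\<in>A. v l \<oplus>\<^bsub>G\<^esub> v l' = v l'') \<and>
      (\<forall>(r,l,l')\<in>B. r \<odot>\<^bsub>G\<^esub> v l = v l') \<and> (\<forall>l. g (v l) = p l)"
    for S :: "'l set" and A :: "('l \<times> 'l \<times> 'l) set"
      and B :: "('a \<times> 'l \<times> 'l) set" and p :: "'l \<Rightarrow> 'm" and w v
  define Sl where "Sl = (\<lambda>(S :: 'l set,
    A :: ('l \<times> 'l \<times> 'l) set,
    B :: ('a \<times> 'l \<times> 'l) set,
    p :: 'l \<Rightarrow> 'm, l :: 'l). S)"
  define V where "V = (\<lambda>(S, A, B, p, l) w. (SOME v. realize S A B p w v) l)"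
  define H where "H = large_hull Sl V"
  have idl: "inj (\<lambda>x. x :: 'l)" by (simp add: inj_on_def)
  obtain n0 :: "nat \<Rightarrow> 'l" where n0: "inj n0" using inj_nat_infinite[OF inf] ..
  note injl = idl ia im n0
  note T = inj_Times_infinite[OF inf] and TS = inj_Times_set[OF inf]
  \<comment> \<open>a label consists of four prescriptions and an index into the chosen solution\<close>
  have codeH: "\<exists>c :: 'g \<Rightarrow> 'l set. inj_on c H"
  proof -
    obtain i2 :: "'l \<times> 'l \<Rightarrow> 'l" where i2: "inj i2"
      using T[OF injl(1) injl(1)] ..
    obtain i3 :: "'l \<times> 'l \<times> 'l \<Rightarrow> 'l" where i3: "inj i3"
      using T[OF injl(1) i2] ..
    obtain i4 :: "'a \<times> 'l \<times> 'l \<Rightarrow> 'l" where i4: "inj i4"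
      using T[OF injl(2) i2] ..
    obtain i5 :: "'l list \<Rightarrow> 'l" where i5: "inj i5"
      using inj_list_infinite[OF inf injl(1)] ..
    obtain s3 :: "('l \<times> 'l \<times> 'l) set \<Rightarrow> 'l set"
      where s3: "inj s3" using inj_set_set[OF i3] ..
    obtain s4 :: "('a \<times> 'l \<times> 'l) set \<Rightarrow> 'l set"
      where s4: "inj s4" using inj_set_set[OF i4] ..
    obtain m5 :: "'m \<Rightarrow> 'l set" where m5: "inj m5" using inj_elem_set[OF injl(3)] ..
    obtain s5 :: "('l \<Rightarrow> 'm) \<Rightarrow> 'l set" where s5: "inj s5"
      using inj_fun_set[OF inf injl(1) m5] ..
    obtain s6 :: "'l \<Rightarrow> 'l set" where s6: "inj s6" using inj_elem_set[OF injl(1)] ..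
    have s1: "inj (\<lambda>x. x :: 'l set)" by (simp add: inj_on_def)
    obtain t1 where t1: "inj (t1 :: ('l \<Rightarrow> 'm) \<times> 'l \<Rightarrow> 'l set)"
      using TS[OF s5 s6] ..
    obtain t2 where t2: "inj (t2 :: ('a \<times> 'l \<times> 'l) set \<times>
        ('l \<Rightarrow> 'm) \<times> 'l \<Rightarrow> 'l set)"
      using TS[OF s4 t1] ..
    obtain t3 where t3: "inj (t3 :: ('l \<times> 'l \<times> 'l) set \<times>
        ('a \<times> 'l \<times> 'l) set \<times>
        ('l \<Rightarrow> 'm) \<times> 'l \<Rightarrow> 'l set)"
      using TS[OF s3 t2] ..
    obtain t4 where t4: "inj (t4 :: 'l set \<times>
        ('l \<times> 'l \<times> 'l) set \<times>
        ('a \<times> 'l \<times> 'l) set \<times>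
        ('l \<Rightarrow> 'm) \<times> 'l \<Rightarrow> 'l set)"
      using TS[OF s1 t3] ..
    obtain h where h: "inj (h :: ('l list \<Rightarrow> 'l set \<times>
        ('l \<times> 'l \<times> 'l) set \<times>
        ('a \<times> 'l \<times> 'l) set \<times>
        ('l \<Rightarrow> 'm) \<times> 'l) \<Rightarrow> 'l set)"
      using inj_fun_set[OF inf i5 t4] ..
    show ?thesis unfolding H_def by (rule inj_on_comp_ex[OF large_hull_code h])
  qed
  have "carrier G \<subseteq> H"
  proof (rule ccontr)
    assume "\<not> carrier G \<subseteq> H"
    then obtain x where x: "x \<in> carrier G" "x \<notin> H" by blast
    \<comment> \<open>\<open>B\<close> lists the rows of the matrix and \<open>as\<close> the elements \<open>d\<^sub>i\<close>; a solution is a pair of families \<open>(y, h)\<close>\<close>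
    define issol where "issol B n m as yh \<longleftrightarrow> (\<forall>j<m. fst yh j \<in> carrier G) \<and>
      (\<forall>i<n. snd yh i \<in> H \<inter> carrier G \<and> lcomb G {..<m} (\<lambda>j. B ! i ! j) (fst yh) = as ! i \<ominus>\<^bsub>G\<^esub> snd yh i)"
      for B :: "'a list list" and n m :: nat and as and yh :: "(nat \<Rightarrow> 'g) \<times> (nat \<Rightarrow> 'g)"
    \<comment> \<open>the operations numbered by \<open>k\<close>: sum, multiple, and the members of \<open>y\<close> and of \<open>h\<close> in a chosen solution\<close>
    define raw where "raw k r B n m i as =
      (if k = 0 then as ! 0 \<oplus>\<^bsub>G\<^esub> as ! 1 else if k = 1 then r \<odot>\<^bsub>G\<^esub> (as ! 0)
       else if k = 2 then fst (SOME yh. issol B n m as yh) i else snd (SOME yh. issol B n m as yh) i)"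
      for k :: nat and r :: 'a and B n m i as
    \<comment> \<open>the default value \<open>x\<close> keeps the operations inside \<open>G\<close>\<close>
    define opr where "opr = (\<lambda>(k, r, B, n, m, i) as.
      if raw k r B n m i as \<in> carrier G then raw k r B n m i as else x)"
    obtain c1 :: "'a list \<Rightarrow> 'l" where c1: "inj c1" using inj_list_infinite[OF inf injl(2)] ..
    obtain c2 :: "'a list list \<Rightarrow> 'l" where c2: "inj c2" using inj_list_infinite[OF inf c1] ..
    obtain c3 :: "nat \<times> nat \<Rightarrow> 'l" where c3: "inj c3" using T[OF injl(4) injl(4)] ..
    obtain c4 :: "nat \<times> nat \<times> nat \<Rightarrow> 'l" where c4: "inj c4" using T[OF injl(4) c3] ..
    obtain c5 :: "'a list list \<times> nat \<times> nat \<times> nat \<Rightarrow> 'l" where c5: "inj c5" using T[OF c2 c4] ..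
    obtain c6 :: "'a \<times> 'a list list \<times> nat \<times> nat \<times> nat \<Rightarrow> 'l" where c6: "inj c6"
      using T[OF injl(2) c5] ..
    obtain c7 :: "nat \<times> 'a \<times> 'a list list \<times> nat \<times> nat \<times> nat \<Rightarrow> 'l" where c7: "inj c7"
      using T[OF injl(4) c6] ..
    obtain v :: "'l \<Rightarrow> 'g" where v: "x \<in> range v" "range v \<subseteq> carrier G"
      "\<And>lab as. set as \<subseteq> range v \<Longrightarrow> opr lab as \<in> range v"
    proof (rule finitary_closure[OF inf c7 x(1), of opr], goal_cases)
      case (1 lab as)
      then show ?case using x(1) by (cases lab) (auto simp: opr_def)
    next
      case (2 v)
      show ?case by (rule 2(1)[OF 2(2-4)])
    qed
    let ?A = "range v"
    have vG: "v l \<in> carrier G" for l using v(2) by auto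
    have Aadd: "a \<oplus>\<^bsub>G\<^esub> b \<in> ?A" if "a \<in> ?A" "b \<in> ?A" for a b
    proof -
      have "a \<oplus>\<^bsub>G\<^esub> b \<in> carrier G" using subsetD[OF v(2)] that by (intro mod_add_closed[OF G])
      then have "opr (0, \<zero>, [], 0, 0, 0) [a,b] = a \<oplus>\<^bsub>G\<^esub> b" by (simp add: opr_def raw_def)
      then show ?thesis using v(3)[of "[a,b]" "(0, \<zero>, [], 0, 0, 0)"] that by simp
    qed
    have Asmult: "r \<odot>\<^bsub>G\<^esub> a \<in> ?A" if "r \<in> carrier R" "a \<in> ?A" for r a
    proof -
      have "r \<odot>\<^bsub>G\<^esub> a \<in> carrier G" using subsetD[OF v(2)] that by (intro mod_smult_closed[OF G])
      then have "opr (1, r, [], 0, 0, 0) [a] = r \<odot>\<^bsub>G\<^esub> a" by (simp add: opr_def raw_def)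
      then show ?thesis using v(3)[of "[a]" "(1, r, [], 0, 0, 0)"] that by simp
    qed
    have A0: "\<zero>\<^bsub>G\<^esub> \<in> ?A" using Asmult[OF zero_closed v(1)] x(1) G by simp
    have Asub: "submodule ?A R G" by (rule submoduleI'[OF G v(2) A0 Aadd Asmult])
    have Asol: "\<exists>y h. (\<forall>j<m. y j \<in> ?A) \<and> (\<forall>i<n. h i \<in> H \<inter> ?A \<and>
        lcomb G {..<m} (a i) y = d i \<ominus>\<^bsub>G\<^esub> h i)"
      if a: "\<And>i j. \<lbrakk>i < n; j < m\<rbrakk> \<Longrightarrow> a i j \<in> carrier R" and d: "\<And>i. i < n \<Longrightarrow> d i \<in> ?A"
        and y: "\<And>j. j < m \<Longrightarrow> y j \<in> carrier G" and h: "\<And>i. i < n \<Longrightarrow> h i \<in> H \<inter> carrier G"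
        and eq: "\<And>i. i < n \<Longrightarrow> lcomb G {..<m} (a i) y = d i \<ominus>\<^bsub>G\<^esub> h i"
      for n m :: nat and a d y h
    proof -
      define B where "B = map (\<lambda>i. map (a i) [0..<m]) [0..<n]"
      define as where "as = map d [0..<n]"
      have B: "B ! i ! j = a i j" if "i < n" "j < m" for i j using that by (simp add: B_def)
      have as: "as ! i = d i" if "i < n" for i using that by (simp add: as_def)
      have lcB: "lcomb G {..<m} (\<lambda>j. B ! i ! j) z = lcomb G {..<m} (a i) z"
        if "i < n" "\<And>j. j < m \<Longrightarrow> z j \<in> carrier G" for i z
        by (rule lcomb_cong[OF G]) (use B a that in auto)
      have "issol B n m as (y, h)" unfolding issol_def using y h eq as lcB[OF _ y] by simp
      then have sol: "issol B n m as (SOME yh. issol B n m as yh)" by (rule someI)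
      define yh where "yh = (SOME yh. issol B n m as yh)"
      have yh: "\<And>j. j < m \<Longrightarrow> fst yh j \<in> carrier G" "\<And>i. i < n \<Longrightarrow> snd yh i \<in> H \<inter> carrier G"
        "\<And>i. i < n \<Longrightarrow> lcomb G {..<m} (\<lambda>j. B ! i ! j) (fst yh) = as ! i \<ominus>\<^bsub>G\<^esub> snd yh i"
        using sol unfolding issol_def yh_def by blast+
      have asA: "set as \<subseteq> ?A" using d by (auto simp: as_def)
      have "fst yh j \<in> ?A" if "j < m" for j
        using v(3)[OF asA, of "(2, \<zero>, B, n, m, j)"] yh(1)[OF that]
        by (simp add: opr_def raw_def flip: yh_def)
      moreover have "snd yh i \<in> ?A" if "i < n" for i
        using v(3)[OF asA, of "(3, \<zero>, B, n, m, i)"] yh(2)[OF that]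
        by (simp add: opr_def raw_def flip: yh_def)
      moreover have "lcomb G {..<m} (a i) (fst yh) = d i \<ominus>\<^bsub>G\<^esub> snd yh i" if "i < n" for i
        using yh(3)[OF that] lcB[OF that yh(1)] as[OF that] by simp
      ultimately show ?thesis using yh(2) by (intro exI[of _ "fst yh"] exI[of _ "snd yh"]) auto
    qed
    \<comment> \<open>a copy \<open>v'\<close> of \<open>v\<close> inside \<open>H\<close>\<close>
    define S where "S = {l. v l \<in> H}"
    define Ra where "Ra = {(l,l',l''). v l \<oplus>\<^bsub>G\<^esub> v l' = v l''}"
    define Rs where "Rs = {(r,l,l'). r \<in> carrier R \<and> r \<odot>\<^bsub>G\<^esub> v l = v l'}"
    define v' where "v' = (SOME u. realize S Ra Rs (\<lambda>l. g (v l)) (restrict v S) u)"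
    have "realize S Ra Rs (\<lambda>l. g (v l)) (restrict v S) v"
      unfolding realize_def using vG by (auto simp: Ra_def Rs_def)
    then have v': "realize S Ra Rs (\<lambda>l. g (v l)) (restrict v S) v'"
      unfolding v'_def by (rule someI[of "realize S Ra Rs (\<lambda>l. g (v l)) (restrict v S)"])
    have v'H: "v' l \<in> H" for l
    proof -
      have "V (S, Ra, Rs, \<lambda>l. g (v l), l) (restrict v (Sl (S, Ra, Rs, \<lambda>l. g (v l), l))) \<in> H"
        unfolding H_def by (rule large_hull.step) (auto simp: Sl_def S_def H_def)
      then show ?thesis by (simp add: V_def Sl_def v'_def)
    qed
    have v'G: "v' l \<in> carrier G" for l using v' by (simp add: realize_def)
    have v'S: "v' l = v l" if "v l \<in> H" for l using v' that by (simp add: realize_def S_def)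
    have v'add: "v' l \<oplus>\<^bsub>G\<^esub> v' l' = v' l''" if "v l \<oplus>\<^bsub>G\<^esub> v l' = v l''" for l l' l''
      using v' that by (auto simp: realize_def Ra_def)
    have v'smult: "r \<odot>\<^bsub>G\<^esub> v' l = v' l'" if "r \<in> carrier R" "r \<odot>\<^bsub>G\<^esub> v l = v l'" for r l l'
      using v' that by (auto simp: realize_def Rs_def)
    have v'g: "g (v' l) = g (v l)" for l using v' by (simp add: realize_def)
    have v'eq: "v' l = v' l'" if "v l = v l'" for l l'
      using v'smult[of \<one> l l'] that vG v'G G by simp
    let ?A' = "sub_module G ?A"
    note A' = module_sub_module[OF G Asub]
    define th where "th a = v' (inv_into UNIV v a)" for a
    have th: "th (v l) = v' l" for l unfolding th_def by (rule v'eq) (simp add: f_inv_into_f)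
    have th_hom: "restrict th (carrier ?A') \<in> mod_hom R ?A' G"
    proof (rule mod_homI[OF A'])
      fix a assume "a \<in> carrier ?A'"
      then obtain l where l: "a = v l" by auto
      show "th a \<in> carrier G" using th v'G l by simp
      show "th (r \<odot>\<^bsub>?A'\<^esub> a) = r \<odot>\<^bsub>G\<^esub> th a" if r: "r \<in> carrier R" for r
      proof -
        obtain l' where l': "r \<odot>\<^bsub>G\<^esub> v l = v l'" using Asmult[OF r, of "v l"] by auto
        then show ?thesis using v'smult[OF r l'] th l by simp
      qed
      fix b assume "b \<in> carrier ?A'"
      then obtain k where k: "b = v k" by auto
      obtain l' where l': "v l \<oplus>\<^bsub>G\<^esub> v k = v l'" using Aadd[of "v l" "v k"] by auto
      then show "th (a \<oplus>\<^bsub>?A'\<^esub> b) = th a \<oplus>\<^bsub>G\<^esub> th b" using v'add[OF l'] th l k by simp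
    qed
    define D where "D = range (\<lambda>l. v l \<ominus>\<^bsub>G\<^esub> v' l)"
    have Dmem: "a \<ominus>\<^bsub>G\<^esub> th a \<in> D" if "a \<in> ?A" for a using that th by (auto simp: D_def)
    have Dsub: "submodule D R G"
    proof (rule submoduleI'[OF G])
      show "D \<subseteq> carrier G" using vG v'G G by (auto simp: D_def)
      obtain l where l: "v l = \<zero>\<^bsub>G\<^esub>" using A0 by (metis rangeE)
      have "v' l = \<zero>\<^bsub>G\<^esub>" using v'smult[of \<zero> l l] l v'G[of l] G by simp
      then have z: "v l \<ominus>\<^bsub>G\<^esub> v' l = \<zero>\<^bsub>G\<^esub>" using l G by (simp add: mod_diff)
      have "v l \<ominus>\<^bsub>G\<^esub> v' l \<in> D" unfolding D_def by (rule rangeI)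
      then show "\<zero>\<^bsub>G\<^esub> \<in> D" unfolding z .
      fix a assume "a \<in> D"
      then obtain l where a: "a = v l \<ominus>\<^bsub>G\<^esub> v' l" unfolding D_def by auto
      show "r \<odot>\<^bsub>G\<^esub> a \<in> D" if r: "r \<in> carrier R" for r
      proof -
        obtain l' where l': "r \<odot>\<^bsub>G\<^esub> v l = v l'" using Asmult[OF r, of "v l"] by auto
        then have "r \<odot>\<^bsub>G\<^esub> a = v l' \<ominus>\<^bsub>G\<^esub> v' l'"
          using v'smult[OF r l'] r vG v'G G a by (simp add: mod_smult_diff)
        then show ?thesis unfolding D_def by blast
      qed
      fix b assume "b \<in> D"
      then obtain k where b: "b = v k \<ominus>\<^bsub>G\<^esub> v' k" unfolding D_def by auto
      obtain l' where l': "v l \<oplus>\<^bsub>G\<^esub> v k = v l'" using Aadd[of "v l" "v k"] by auto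
      then have "a \<oplus>\<^bsub>G\<^esub> b = v l' \<ominus>\<^bsub>G\<^esub> v' l'"
        using v'add[OF l'] mod_diff_add[OF G vG v'G vG v'G, of l k l k] a b by simp
      then show "a \<oplus>\<^bsub>G\<^esub> b \<in> D" unfolding D_def by blast
    qed
    have "sys_pure R D G" unfolding sys_pure_def
    proof (intro conjI allI impI)
      fix n m :: nat and a b y
      assume a: "\<forall>i<n. \<forall>j<m. a i j \<in> carrier R" and b: "\<forall>i<n. b i \<in> D"
        and y: "\<forall>j<m. y j \<in> carrier G" and eq: "\<forall>i<n. lcomb G {..<m} (a i) y = b i"
      have "\<forall>i. \<exists>l. i < n \<longrightarrow> b i = v l \<ominus>\<^bsub>G\<^esub> v' l" using b by (auto simp: D_def)
      then obtain l where l: "\<And>i. i < n \<Longrightarrow> b i = v (l i) \<ominus>\<^bsub>G\<^esub> v' (l i)" by metis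
      have "\<exists>y h. (\<forall>j<m. y j \<in> ?A) \<and> (\<forall>i<n. h i \<in> H \<inter> ?A \<and>
          lcomb G {..<m} (a i) y = v (l i) \<ominus>\<^bsub>G\<^esub> h i)"
        by (rule Asol[of n m a "\<lambda>i. v (l i)" y "\<lambda>i. v' (l i)"]) (use a y eq l v'H v'G in auto)
      then obtain y' h' where y': "\<And>j. j < m \<Longrightarrow> y' j \<in> ?A" and h': "\<And>i. i < n \<Longrightarrow> h' i \<in> H \<inter> ?A"
        and eq': "\<And>i. i < n \<Longrightarrow> lcomb G {..<m} (a i) y' = v (l i) \<ominus>\<^bsub>G\<^esub> h' i" by blast
      have y'G: "y' j \<in> carrier G" if "j < m" for j using y'[OF that] v(2) by auto
      have thG: "th c \<in> carrier G" if "c \<in> ?A" for c using that th v'G by auto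
      show "\<exists>y'. (\<forall>j<m. y' j \<in> D) \<and> (\<forall>i<n. lcomb G {..<m} (a i) y' = b i)"
      proof (intro exI[of _ "\<lambda>j. y' j \<ominus>\<^bsub>G\<^esub> th (y' j)"] conjI allI impI)
        show "y' j \<ominus>\<^bsub>G\<^esub> th (y' j) \<in> D" if "j < m" for j by (rule Dmem[OF y'[OF that]])
        fix i assume i: "i < n"
        have h'G: "h' i \<in> carrier G" using h'[OF i] v(2) by auto
        obtain t where t: "h' i = v t" "v t \<in> H" using h'[OF i] by auto
        have thh: "th (h' i) = h' i" using t th v'S by simp
        have "lcomb G {..<m} (a i) (\<lambda>j. th (y' j)) = lcomb G {..<m} (a i) (\<lambda>j. restrict th (carrier ?A') (y' j))"
          by (rule lcomb_cong[OF G]) (use a i y' thG in auto)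
        also have "\<dots> = restrict th (carrier ?A') (lcomb ?A' {..<m} (a i) y')"
          by (rule hom_lcomb[OF A' G th_hom, symmetric]) (use a i y' in auto)
        also have "lcomb ?A' {..<m} (a i) y' = lcomb G {..<m} (a i) y'"
          by (rule lcomb_sub_module[OF G Asub]) (use a i y' in auto)
        also have "\<dots> = v (l i) \<ominus>\<^bsub>G\<^esub> h' i" by (rule eq'[OF i])
        also have "v (l i) \<ominus>\<^bsub>G\<^esub> h' i = v (l i) \<ominus>\<^bsub>?A'\<^esub> h' i"
        proof -
          have "x \<ominus>\<^bsub>?A'\<^esub> y = x \<ominus>\<^bsub>G\<^esub> y" if "x \<in> ?A" "y \<in> ?A" for x y
            using that mod_smult_neg_one[OF A', of y] mod_smult_neg_one[OF G, of y] v(2)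
            by (auto simp: mod_diff)
          then show ?thesis using h'[OF i] by auto
        qed
        also have "restrict th (carrier ?A') (v (l i) \<ominus>\<^bsub>?A'\<^esub> h' i) = v' (l i) \<ominus>\<^bsub>G\<^esub> h' i"
          using hom_diff[OF th_hom A' G, of "v (l i)" "h' i"] h'[OF i] th thh by simp
        finally have "lcomb G {..<m} (a i) (\<lambda>j. th (y' j)) = v' (l i) \<ominus>\<^bsub>G\<^esub> h' i" .
        moreover have "lcomb G {..<m} (a i) (\<lambda>j. y' j \<ominus>\<^bsub>G\<^esub> th (y' j)) =
            lcomb G {..<m} (a i) y' \<ominus>\<^bsub>G\<^esub> lcomb G {..<m} (a i) (\<lambda>j. th (y' j))"
          by (rule lcomb_diff[OF G]) (use a i y' y'G thG in auto)
        ultimately have "lcomb G {..<m} (a i) (\<lambda>j. y' j \<ominus>\<^bsub>G\<^esub> th (y' j)) =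
            (v (l i) \<ominus>\<^bsub>G\<^esub> h' i) \<ominus>\<^bsub>G\<^esub> (v' (l i) \<ominus>\<^bsub>G\<^esub> h' i)"
          using eq'[OF i] by simp
        also have "\<dots> = (v (l i) \<ominus>\<^bsub>G\<^esub> v' (l i)) \<ominus>\<^bsub>G\<^esub> (h' i \<ominus>\<^bsub>G\<^esub> h' i)"
          by (rule mod_diff_diff[OF G vG v'G h'G h'G])
        also have "\<dots> = b i" using l[OF i] vG v'G h'G G by (simp add: mod_diff)
        finally show "lcomb G {..<m} (a i) (\<lambda>j. y' j \<ominus>\<^bsub>G\<^esub> th (y' j)) = b i" .
      qed
    qed (rule Dsub)
    moreover have "g (v l \<ominus>\<^bsub>G\<^esub> v' l) = \<zero>\<^bsub>M\<^esub>" for l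
      using mod_diff_eq_zero[OF M hom_closed[OF g vG] hom_closed[OF g v'G], of l l]
      by (simp add: hom_diff[OF g G M vG v'G] v'g)
    then have "D \<subseteq> {x \<in> carrier G. g x = \<zero>\<^bsub>M\<^esub>}"
      using submoduleD(1)[OF G Dsub] by (auto simp: D_def)
    ultimately have D0: "D = {\<zero>\<^bsub>G\<^esub>}" by (rule no_pure)
    obtain l where l: "x = v l" using v(1) by auto
    have "v l \<ominus>\<^bsub>G\<^esub> v' l = \<zero>\<^bsub>G\<^esub>" using D0 unfolding D_def by blast
    then have "v l = v' l" using vG v'G G by (simp add: mod_diff_eq_zero)
    then show False using v'H[of l] x(2) l by simp
  qed
  then show ?thesis using codeH inj_on_subset by blast
qed

end

section \<open>Reduction to small modules\<close>

context cring
begin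

lemma sys_pure_chain_Union:
  assumes G: "module R G" and C: "C \<noteq> {}" "subset.chain {P. sys_pure R P G} C"
  shows "sys_pure R (\<Union>C) G"
proof -
  have Cp: "sys_pure R P G" if "P \<in> C" for P using C(2) that by (auto simp: subset.chain_def)
  have dir: "P \<subseteq> Q \<or> Q \<subseteq> P" if "P \<in> C" "Q \<in> C" for P Q using C(2) that by (auto simp: subset_chain_def)
  note sub = sys_pure_submodule[OF Cp]
  have fin: "\<exists>P\<in>C. B \<subseteq> P" if "finite B" "B \<subseteq> \<Union>C" for B
    using finite_subset_Union_chain[OF that C] by blast
  show ?thesis unfolding sys_pure_def
  proof (intro conjI allI impI)
    show "submodule (\<Union>C) R G"
    proof (rule submoduleI'[OF G])
      show "\<Union>C \<subseteq> carrier G" using submoduleD(1)[OF G sub] by blast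
      show "\<zero>\<^bsub>G\<^esub> \<in> \<Union>C" using C(1) submoduleD(2)[OF G sub] by blast
      show "x \<oplus>\<^bsub>G\<^esub> y \<in> \<Union>C" if xy: "x \<in> \<Union>C" "y \<in> \<Union>C" for x y
      proof -
        obtain P where "P \<in> C" "{x,y} \<subseteq> P" using fin[of "{x,y}"] xy by auto
        then show ?thesis using submoduleD(4)[OF G sub[of P], of x y] by auto
      qed
      show "r \<odot>\<^bsub>G\<^esub> x \<in> \<Union>C" if "r \<in> carrier R" "x \<in> \<Union>C" for r x
        using that submoduleD(6)[OF G sub] by blast
    qed
    fix n m :: nat and a b y
    assume a: "\<forall>i<n. \<forall>j<m. a i j \<in> carrier R" and b: "\<forall>i<n. b i \<in> \<Union>C"
      and y: "\<forall>j<m. y j \<in> carrier G" and eq: "\<forall>i<n. lcomb G {..<m} (a i) y = b i"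
    obtain P where P: "P \<in> C" "b ` {..<n} \<subseteq> P" using fin[of "b ` {..<n}"] b by auto
    have "\<exists>y'. (\<forall>j<m. y' j \<in> P) \<and> (\<forall>i<n. lcomb G {..<m} (a i) y' = b i)"
      by (rule sys_pure_solve[OF Cp[OF P(1)], where y=y]) (use a P(2) y eq in auto)
    then show "\<exists>y'. (\<forall>j<m. y' j \<in> \<Union>C) \<and> (\<forall>i<n. lcomb G {..<m} (a i) y' = b i)"
      using P(1) by blast
  qed
qed

text \<open>Purity is transitive: solve a given system in the quotient, lift the solution, and correct it by a
  solution in \<open>P\<close> of the system that describes the error.\<close>

lemma sys_pure_preimage:
  assumes G: "module R G" and P: "sys_pure R P G" and P': "sys_pure R P' (quot_module G P)"
  shows "sys_pure R {x \<in> carrier G. P +>\<^bsub>G\<^esub> x \<in> P'} G" (is "sys_pure R ?S G")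
proof -
  let ?Q = "quot_module G P"
  note Ps = sys_pure_submodule[OF P]
  note Q = module_quot[OF G Ps] and P's = sys_pure_submodule[OF P']
  let ?p = "\<lambda>x\<in>carrier G. P +>\<^bsub>G\<^esub> x"
  note p = quot_proj_hom[OF G Ps]
  have S: "submodule ?S R G"
  proof (rule submoduleI'[OF G])
    show "\<zero>\<^bsub>G\<^esub> \<in> ?S" using coset_zero[OF G Ps] submoduleD(2)[OF Q P's] G by simp
    show "x \<oplus>\<^bsub>G\<^esub> y \<in> ?S" if "x \<in> ?S" "y \<in> ?S" for x y
      using that quot_add[OF G Ps, of x y] submoduleD(4)[OF Q P's, of "P +>\<^bsub>G\<^esub> x" "P +>\<^bsub>G\<^esub> y"] G by simp
    show "r \<odot>\<^bsub>G\<^esub> x \<in> ?S" if "r \<in> carrier R" "x \<in> ?S" for r x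
      using that quot_smult[OF G Ps, of x r] submoduleD(6)[OF Q P's, of r "P +>\<^bsub>G\<^esub> x"] G by simp
  qed auto
  show ?thesis unfolding sys_pure_def
  proof (intro conjI allI impI)
    show "submodule ?S R G" by (rule S)
    fix n m :: nat and a b y
    assume a0: "\<forall>i<n. \<forall>j<m. a i j \<in> carrier R" and b0: "\<forall>i<n. b i \<in> ?S"
      and y0: "\<forall>j<m. y j \<in> carrier G" and eq0: "\<forall>i<n. lcomb G {..<m} (a i) y = b i"
    have a: "a i j \<in> carrier R" if "i < n" "j \<in> {..<m}" for i j using a0 that by auto
    have y: "y j \<in> carrier G" if "j \<in> {..<m}" for j using y0 that by auto
    have b: "b i \<in> carrier G" "P +>\<^bsub>G\<^esub> b i \<in> P'" if "i < n" for i using b0 that by auto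
    have eq: "lcomb G {..<m} (a i) y = b i" if "i < n" for i using eq0 that by simp
    have "\<exists>z. (\<forall>j<m. z j \<in> P') \<and> (\<forall>i<n. lcomb ?Q {..<m} (a i) z = P +>\<^bsub>G\<^esub> b i)"
    proof (rule sys_pure_solve[OF P', where y="\<lambda>j. ?p (y j)"])
      show "?p (y j) \<in> carrier ?Q" if "j < m" for j using hom_closed[OF p y] that by simp
      show "lcomb ?Q {..<m} (a i) (\<lambda>j. ?p (y j)) = P +>\<^bsub>G\<^esub> b i" if i: "i < n" for i
        using hom_lcomb[OF G Q p, of "{..<m}" "a i" y] a[OF i] y eq[OF i] b(1)[OF i] by simp
    qed (use a b in auto)
    then obtain z where z: "\<forall>j<m. z j \<in> P'" "\<forall>i<n. lcomb ?Q {..<m} (a i) z = P +>\<^bsub>G\<^esub> b i" by blast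
    have "\<exists>x. j < m \<longrightarrow> x \<in> carrier G \<and> ?p x = z j" for j
    proof (cases "j < m")
      case True
      then have "z j \<in> carrier ?Q" using z(1) submoduleD(3)[OF Q P's] by blast
      then show ?thesis by (auto simp: quot_carrier)
    qed simp
    then have "\<forall>j. \<exists>x. j < m \<longrightarrow> x \<in> carrier G \<and> ?p x = z j" by (rule allI)
    from choice[OF this] obtain w where w0: "\<forall>j. j < m \<longrightarrow> w j \<in> carrier G \<and> ?p (w j) = z j" ..
    have w: "w j \<in> carrier G" "?p (w j) = z j" if "j \<in> {..<m}" for j
    proof -
      have "j < m" using that by simp
      then have *: "w j \<in> carrier G \<and> ?p (w j) = z j" by (rule w0[THEN spec, THEN mp])
      show "w j \<in> carrier G" by (rule *[THEN conjunct1])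
      show "?p (w j) = z j" by (rule *[THEN conjunct2])
    qed
    have lw: "lcomb G {..<m} (a i) w \<in> carrier G" if "i < n" for i
      by (rule lcomb_closed[OF G a[OF that] w(1)])
    let ?d = "\<lambda>i. b i \<ominus>\<^bsub>G\<^esub> lcomb G {..<m} (a i) w"
    have d: "?d i \<in> P" if i: "i < n" for i
    proof -
      have "?p (lcomb G {..<m} (a i) w) = lcomb ?Q {..<m} (a i) (\<lambda>j. ?p (w j))"
        by (rule hom_lcomb[OF G Q p _ a[OF i] w(1)]) simp_all
      also have "\<dots> = lcomb ?Q {..<m} (a i) z"
        by (rule lcomb_cong[OF Q]) (use a i w z(1) submoduleD(3)[OF Q P's] in auto)
      also have "\<dots> = ?p (b i)" using z(2) i b(1)[OF i] by simp
      finally have "P +>\<^bsub>G\<^esub> b i = P +>\<^bsub>G\<^esub> lcomb G {..<m} (a i) w" using lw[OF i] b(1)[OF i] by simp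
      then show ?thesis using coset_eq_iff[OF G Ps b(1)[OF i] lw[OF i]] by simp
    qed
    have "\<exists>q. (\<forall>j<m. q j \<in> P) \<and> (\<forall>i<n. lcomb G {..<m} (a i) q = ?d i)"
    proof (rule sys_pure_solve[OF P, where y="\<lambda>j. y j \<ominus>\<^bsub>G\<^esub> w j"])
      show "lcomb G {..<m} (a i) (\<lambda>j. y j \<ominus>\<^bsub>G\<^esub> w j) = ?d i" if i: "i < n" for i
        using lcomb_diff[OF G, of "{..<m}" "a i" y w] a[OF i] y w(1) eq[OF i] by simp
    qed (use a d y w G in auto)
    then obtain q where q: "\<And>j. j < m \<Longrightarrow> q j \<in> P" "\<And>i. i < n \<Longrightarrow> lcomb G {..<m} (a i) q = ?d i" by blast
    have qG: "q j \<in> carrier G" if "j \<in> {..<m}" for j using q(1) that submoduleD(3)[OF G Ps] by simp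
    show "\<exists>y'. (\<forall>j<m. y' j \<in> ?S) \<and> (\<forall>i<n. lcomb G {..<m} (a i) y' = b i)"
    proof (intro exI[of _ "\<lambda>j. q j \<oplus>\<^bsub>G\<^esub> w j"] conjI allI impI)
      fix j assume j: "j < m"
      have "?p (q j) = \<zero>\<^bsub>?Q\<^esub>" using coset_eq_zero_iff[OF G Ps qG] q(1) j qG by simp
      then have "?p (q j \<oplus>\<^bsub>G\<^esub> w j) = z j"
        using hom_add[OF p qG w(1)] w(2) z(1) j submoduleD(3)[OF Q P's] Q by simp
      moreover have qw: "q j \<oplus>\<^bsub>G\<^esub> w j \<in> carrier G" using qG w(1) j G by simp
      ultimately have "P +>\<^bsub>G\<^esub> (q j \<oplus>\<^bsub>G\<^esub> w j) = z j" by simp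
      then show "q j \<oplus>\<^bsub>G\<^esub> w j \<in> ?S" using qw z(1) j by simp
    next
      fix i assume i: "i < n"
      show "lcomb G {..<m} (a i) (\<lambda>j. q j \<oplus>\<^bsub>G\<^esub> w j) = b i"
        using lcomb_add[OF G, of "{..<m}" "a i" q w] a[OF i] qG w(1) q(2)[OF i] b(1)[OF i] lw[OF i] G by simp
    qed
  qed
qed

text \<open>A module is the limit of an isomorphic one over a single index.\<close>

lemma w_flat_iso:
  assumes M: "M \<in> semi_regular_w_flat R" and L: "module R L" and f: "f \<in> mod_iso R M L"
  shows "L \<in> semi_regular_w_flat R"
proof -
  note Mm = w_flat_module[OF M]
  have f1: "f \<in> mod_hom R M L" "bij_betw f (carrier M) (carrier L)" using f by (auto simp: mod_iso_def)
  let ?id = "\<lambda>x\<in>carrier M. x"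
  have S: "direct_system R {()} (\<lambda>_ _. True) (\<lambda>_. M) (\<lambda>_ _. ?id)"
    unfolding direct_system_def using Mm hom_id[OF Mm] by simp
  have "colim_cone R {()} (\<lambda>_ _. True) (\<lambda>_. M) (\<lambda>_ _. ?id) L (\<lambda>_. f)"
    unfolding colim_cone_def
  proof (intro conjI ballI impI)
    show "\<exists>i\<in>{()}. \<exists>x\<in>carrier M. f x = y" if "y \<in> carrier L" for y
    proof -
      have "y \<in> f ` carrier M" using that f1(2) by (simp add: bij_betw_def)
      then show ?thesis by blast
    qed
    show "\<exists>j\<in>{()}. True \<and> ?id x = \<zero>\<^bsub>M\<^esub>" if "x \<in> carrier M" "f x = \<zero>\<^bsub>L\<^esub>" for x
      using that f1(2) hom_zero[OF f1(1) Mm L] Mm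
      by (auto simp: bij_betw_def dest: inj_onD[of f "carrier M" x "\<zero>\<^bsub>M\<^esub>"])
  qed (use f1 in auto)
  from w_flat_colim[OF S _ L this] show ?thesis using M by simp
qed

lemma module_transport:
  fixes Q :: "('a,'x) module" and c :: "'x \<Rightarrow> 'y"
  assumes Q: "module R Q" and c: "inj_on c (carrier Q)"
  obtains F :: "('a,'y) module" where "module R F" "restrict c (carrier Q) \<in> mod_iso R Q F"
proof -
  let ?i = "inv_into (carrier Q) c"
  define F :: "('a,'y) module" where "F = \<lparr> carrier = c ` carrier Q, mult = (\<lambda>_ _. undefined), one = undefined,
      zero = c \<zero>\<^bsub>Q\<^esub>, add = (\<lambda>x y. c (?i x \<oplus>\<^bsub>Q\<^esub> ?i y)), smult = (\<lambda>r x. c (r \<odot>\<^bsub>Q\<^esub> ?i x)) \<rparr>"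
  have i: "?i (c x) = x" if "x \<in> carrier Q" for x using that c by simp
  have F: "module R F" by (rule module_surj_image[OF Q, of c]) (auto simp: F_def i)
  have "restrict c (carrier Q) \<in> mod_hom R Q F" by (rule mod_homI[OF Q]) (auto simp: F_def i)
  then have "restrict c (carrier Q) \<in> mod_iso R Q F"
    unfolding mod_iso_def bij_betw_def using c by (auto simp: F_def)
  with F show ?thesis by (rule that)
qed

text \<open>Divide by a maximal pure submodule in the kernel of the given homomorphism.  The quotient is
  w-flat again.  By maximality, and since purity is transitive, the kernel of the induced
  homomorphism contains no nonzero pure submodule of the quotient, which bounds its size.\<close>

lemma w_flat_reduce:
  fixes G :: "('a,'g) module" and M :: "('a,'m) module"
  assumes Gf: "G \<in> semi_regular_w_flat R" and M: "module R M" and g: "g \<in> mod_hom R G M"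
  obtains F :: "('a, ('a,'m) cover_type) module" and f q where
    "F \<in> semi_regular_w_flat R" "f \<in> mod_hom R F M" "q \<in> mod_hom R G F"
    "\<And>x. x \<in> carrier G \<Longrightarrow> f (q x) = g x"
proof -
  note G = w_flat_module[OF Gf]
  let ?Z = "{x \<in> carrier G. g x = \<zero>\<^bsub>M\<^esub>}"
  have "\<exists>P\<in>{P. sys_pure R P G \<and> P \<subseteq> ?Z}. \<forall>X\<in>{P. sys_pure R P G \<and> P \<subseteq> ?Z}. P \<subseteq> X \<longrightarrow> X = P"
  proof (rule subset_Zorn_nonempty)
    show "{P. sys_pure R P G \<and> P \<subseteq> ?Z} \<noteq> {}"
    proof -
      have "{\<zero>\<^bsub>G\<^esub>} \<in> {P. sys_pure R P G \<and> P \<subseteq> ?Z}"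
        using sys_pure_zero[OF G] hom_zero[OF g G M] mod_zero_closed[OF G] by simp
      then show ?thesis by (metis empty_iff)
    qed
    fix C assume C: "C \<noteq> {}" "subset.chain {P. sys_pure R P G \<and> P \<subseteq> ?Z} C"
    then have "subset.chain {P. sys_pure R P G} C" by (auto simp: subset.chain_def)
    from sys_pure_chain_Union[OF G C(1) this] show "\<Union>C \<in> {P. sys_pure R P G \<and> P \<subseteq> ?Z}"
      using C(2) by (auto simp: subset.chain_def)
  qed
  then obtain P where P0: "P \<in> {P. sys_pure R P G \<and> P \<subseteq> ?Z}"
    "\<forall>X\<in>{P. sys_pure R P G \<and> P \<subseteq> ?Z}. P \<subseteq> X \<longrightarrow> X = P" by (rule bexE)
  have P: "sys_pure R P G" "P \<subseteq> ?Z" using P0(1) by simp_all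
  have Pmax: "X = P" if "sys_pure R X G" "X \<subseteq> ?Z" "P \<subseteq> X" for X
    using P0(2)[rule_format, of X] that by simp
  note Ps = sys_pure_submodule[OF P(1)]
  let ?Q = "quot_module G P"
  note Q = module_quot[OF G Ps]
  let ?p = "\<lambda>x\<in>carrier G. P +>\<^bsub>G\<^esub> x"
  have p: "?p \<in> mod_hom R G ?Q" by (rule quot_proj_hom[OF G Ps])
  have Qf: "?Q \<in> semi_regular_w_flat R" by (rule w_flat_pure_quot[OF Gf P(1)])
  have z: "\<And>x. x \<in> P \<Longrightarrow> g x = \<zero>\<^bsub>M\<^esub>" using P(2) by blast
  obtain h where h: "h \<in> mod_hom R ?Q M" "\<And>x. x \<in> carrier G \<Longrightarrow> h (P +>\<^bsub>G\<^esub> x) = g x"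
    using quot_factor[OF G Ps M g z] by blast
  have "\<exists>c :: 'g set \<Rightarrow> ('a,'m) cover_type. inj_on c (carrier ?Q)"
  proof (rule small_if_no_pure_submodule_in_kernel[OF _ _ _ Q M h(1)])
    show "infinite (UNIV :: ('a + 'm + nat) set)"
      by (simp add: finite_Plus_UNIV_iff flip: UNIV_Plus_UNIV)
    show "inj (Inl :: 'a \<Rightarrow> 'a + 'm + nat)" "inj (\<lambda>x :: 'm. Inr (Inl x) :: 'a + 'm + nat)"
      by (auto simp: inj_on_def)
    fix P' assume P': "sys_pure R P' ?Q" "P' \<subseteq> {x \<in> carrier ?Q. h x = \<zero>\<^bsub>M\<^esub>}"
    note P's = sys_pure_submodule[OF P'(1)]
    let ?S = "{x \<in> carrier G. P +>\<^bsub>G\<^esub> x \<in> P'}"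
    have "?S = P"
    proof (rule Pmax[OF sys_pure_preimage[OF G P(1) P'(1)]])
      show "?S \<subseteq> ?Z" using P'(2) h(2) by auto
      show "P \<subseteq> ?S"
      proof
        fix x assume x: "x \<in> P"
        then have xG: "x \<in> carrier G" by (rule submoduleD(3)[OF G Ps])
        then have "P +>\<^bsub>G\<^esub> x = \<zero>\<^bsub>?Q\<^esub>" using coset_eq_zero_iff[OF G Ps xG] x by simp
        then show "x \<in> ?S" using submoduleD(2)[OF Q P's] xG by simp
      qed
    qed
    have "x = \<zero>\<^bsub>?Q\<^esub>" if "x \<in> P'" for x
    proof -
      have "x \<in> carrier ?Q" using that submoduleD(3)[OF Q P's] by blast
      then obtain y where y: "y \<in> carrier G" "x = P +>\<^bsub>G\<^esub> y" by (auto simp: quot_carrier)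
      then have "y \<in> P" using that \<open>?S = P\<close> by blast
      then show ?thesis using coset_eq_zero_iff[OF G Ps y(1)] y(2) by simp
    qed
    then show "P' = {\<zero>\<^bsub>?Q\<^esub>}" using submoduleD(2)[OF Q P's] by blast
  qed
  then obtain c :: "'g set \<Rightarrow> ('a,'m) cover_type" where c: "inj_on c (carrier ?Q)" ..
  obtain F :: "('a, ('a,'m) cover_type) module" where F: "module R F" "restrict c (carrier ?Q) \<in> mod_iso R ?Q F"
    by (rule module_transport[OF Q c])
  let ?c = "restrict c (carrier ?Q)"
  have ch: "?c \<in> mod_hom R ?Q F" "bij_betw ?c (carrier ?Q) (carrier F)" using F(2) by (auto simp: mod_iso_def)
  obtain d where d: "d \<in> mod_hom R F ?Q" "\<And>x. x \<in> carrier ?Q \<Longrightarrow> d (?c x) = x"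
  proof (rule iso_inverse[OF Q F(1) ch], goal_cases)
    case (1 d)
    show ?case by (rule 1(1)[OF 1(2,3)])
  qed
  show ?thesis
  proof (rule that)
    show "F \<in> semi_regular_w_flat R" by (rule w_flat_iso[OF Qf F])
    show "compose (carrier F) h d \<in> mod_hom R F M" by (rule hom_compose[OF F(1) d(1) h(1)])
    show "compose (carrier G) ?c ?p \<in> mod_hom R G F" by (rule hom_compose[OF G p ch(1)])
    fix x assume x: "x \<in> carrier G"
    have px: "?p x \<in> carrier ?Q" by (rule hom_closed[OF p x])
    have "compose (carrier F) h d (compose (carrier G) ?c ?p x) = h (d (?c (?p x)))"
      using x hom_closed[OF ch(1) px] by (simp only: compose_eq)
    also have "\<dots> = h (?p x)" by (simp only: d(2)[OF px])
    also have "\<dots> = g x" using h(2)[OF x] x by simp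
    finally show "compose (carrier F) h d (compose (carrier G) ?c ?p x) = g x" .
  qed
qed

end

section \<open>Precovers\<close>

context cring
begin

lemma precover_w_flat_iff:
  "precover R C (semi_regular_w_flat R :: ('a,'n) module set) M F f \<longleftrightarrow> F \<in> C \<and> f \<in> mod_hom R F M \<and>
    (\<forall>F'\<in>(semi_regular_w_flat R :: ('a,'n) module set). \<forall>g\<in>mod_hom R F' M. \<exists>h\<in>mod_hom R F' F. \<forall>x\<in>carrier F'. f (h x) = g x)"
proof -
  have "((\<lambda>h. compose (carrier F') f h) ` mod_hom R F' F = mod_hom R F' M) \<longleftrightarrow>
      (\<forall>g\<in>mod_hom R F' M. \<exists>h\<in>mod_hom R F' F. \<forall>x\<in>carrier F'. f (h x) = g x)"
    if F': "module R F'" and f: "f \<in> mod_hom R F M" for F' :: "('a,'n) module"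
  proof
    assume l: "(\<lambda>h. compose (carrier F') f h) ` mod_hom R F' F = mod_hom R F' M"
    show "\<forall>g\<in>mod_hom R F' M. \<exists>h\<in>mod_hom R F' F. \<forall>x\<in>carrier F'. f (h x) = g x"
    proof
      fix g assume "g \<in> mod_hom R F' M"
      then obtain h where "h \<in> mod_hom R F' F" "g = compose (carrier F') f h" using l by blast
      then show "\<exists>h\<in>mod_hom R F' F. \<forall>x\<in>carrier F'. f (h x) = g x" by (auto simp: compose_eq)
    qed
  next
    assume rr: "\<forall>g\<in>mod_hom R F' M. \<exists>h\<in>mod_hom R F' F. \<forall>x\<in>carrier F'. f (h x) = g x"
    show "(\<lambda>h. compose (carrier F') f h) ` mod_hom R F' F = mod_hom R F' M"
    proof
      show "(\<lambda>h. compose (carrier F') f h) ` mod_hom R F' F \<subseteq> mod_hom R F' M"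
        using hom_compose[OF F' _ f] by blast
      show "mod_hom R F' M \<subseteq> (\<lambda>h. compose (carrier F') f h) ` mod_hom R F' F"
      proof
        fix g assume g: "g \<in> mod_hom R F' M"
        then obtain h where h: "h \<in> mod_hom R F' F" "\<forall>x\<in>carrier F'. f (h x) = g x" using rr by blast
        have "g = compose (carrier F') f h"
          by (rule hom_eqI[OF g hom_compose[OF F' h(1) f]]) (use h(2) in \<open>simp add: compose_eq\<close>)
        then show "g \<in> (\<lambda>h. compose (carrier F') f h) ` mod_hom R F' F" using h(1) by blast
      qed
    qed
  qed
  note key = this
  show ?thesis
  proof (cases "f \<in> mod_hom R F M")
    case True
    show ?thesis by (simp only: precover_def key[OF w_flat_module True] cong: ball_cong)
  next
    case False
    then show ?thesis by (simp add: precover_def)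
  qed
qed

text \<open>The test modules have their elements in the type on which covers of \<open>M\<close> are sought; the precover may
  live on any type.\<close>

abbreviation small_precover :: "('a,'m) module \<Rightarrow> ('a,'w) module \<Rightarrow> ('w \<Rightarrow> 'm) \<Rightarrow> bool" where
  "small_precover M \<equiv> precover R (semi_regular_w_flat R)
    (semi_regular_w_flat R :: ('a, ('a,'m) cover_type) module set) M"

lemma small_precoverD:
  fixes M :: "('a,'m) module" and F :: "('a, ('a,'m) cover_type) module"
  assumes "small_precover M W f"
  shows "W \<in> semi_regular_w_flat R" "module R W" "f \<in> mod_hom R W M"
    "\<lbrakk>F \<in> semi_regular_w_flat R; g \<in> mod_hom R F M\<rbrakk> \<Longrightarrow>
      \<exists>h\<in>mod_hom R F W. \<forall>x\<in>carrier F. f (h x) = g x"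
  using assms unfolding precover_w_flat_iff by (blast intro: w_flat_module)+

text \<open>The direct sum of the domains of all homomorphisms from test modules to \<open>M\<close> has the lifting
  property of a precover, and reducing it keeps this property.\<close>

lemma ex_small_precover:
  fixes M :: "('a,'m) module"
  assumes M: "module R M"
  shows "\<exists>(W :: ('a, ('a,'m) cover_type) module) f. small_precover M W f"
proof -
  define I :: "(('a, ('a,'m) cover_type) module \<times> (('a,'m) cover_type \<Rightarrow> 'm)) set"
    where "I = {(F,g). F \<in> semi_regular_w_flat R \<and> g \<in> mod_hom R F M}"
  let ?D = "direct_sum I fst"
  have If: "fst i \<in> semi_regular_w_flat R" "snd i \<in> mod_hom R (fst i) M" if "i \<in> I" for i
    using that by (auto simp: I_def)
  have D: "?D \<in> semi_regular_w_flat R" by (rule w_flat_direct_sum[OF If(1)])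
  note Im = w_flat_module[OF If(1)]
  obtain f0 where f0: "f0 \<in> mod_hom R ?D M"
    "\<And>i x. \<lbrakk>i \<in> I; x \<in> carrier (fst i)\<rbrakk> \<Longrightarrow> f0 (sum_inj I fst i x) = snd i x"
  proof (rule direct_sum_lift[where I=I and M=fst and g=snd and P=M], goal_cases)
    case (1 i)
    show ?case by (rule Im[OF 1(2)])
  next
    case 2
    show ?case by (rule M)
  next
    case (3 i)
    show ?case by (rule If(2)[OF 3(2)])
  next
    case (4 h)
    show ?case by (rule 4(1)[OF 4(2,3)])
  qed
  obtain W :: "('a, ('a,'m) cover_type) module" and f q where W: "W \<in> semi_regular_w_flat R"
    "f \<in> mod_hom R W M" "q \<in> mod_hom R ?D W" "\<And>x. x \<in> carrier ?D \<Longrightarrow> f (q x) = f0 x"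
  proof (rule w_flat_reduce[OF D M f0(1)], goal_cases)
    case (1 F f q)
    show ?case by (rule 1(1)[OF 1(2-5)])
  qed
  have "\<exists>h\<in>mod_hom R F W. \<forall>x\<in>carrier F. f (h x) = g x"
    if F: "F \<in> semi_regular_w_flat R" "g \<in> mod_hom R F M"
    for F :: "('a, ('a,'m) cover_type) module" and g
  proof -
    have i: "(F,g) \<in> I" using F by (simp add: I_def)
    let ?s = "restrict (sum_inj I fst (F,g)) (carrier (fst (F,g)))"
    have s: "?s \<in> mod_hom R F ?D" using sum_inj_hom[where M=fst, OF Im i] by simp
    show ?thesis
    proof (intro bexI[of _ "compose (carrier F) q ?s"] ballI)
      show "compose (carrier F) q ?s \<in> mod_hom R F W"
        by (rule hom_compose[OF w_flat_module[OF F(1)] s W(3)])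
      fix x assume x: "x \<in> carrier F"
      have "f (q (?s x)) = f0 (?s x)" by (rule W(4)[OF hom_closed[OF s x]])
      also have "\<dots> = g x" using f0(2)[OF i, of x] x by simp
      finally show "f (compose (carrier F) q ?s x) = g x" using x by (simp only: compose_eq)
    qed
  qed
  then have "small_precover M W f" unfolding precover_w_flat_iff using W(1,2) by blast
  then show ?thesis by blast
qed

text \<open>A homomorphism from a w-flat module of any size factors through a test module.\<close>

lemma small_precover_lift:
  fixes M :: "('a,'m) module" and G :: "('a,'g) module"
  assumes M: "module R M" and W: "small_precover M W f"
    and G: "G \<in> semi_regular_w_flat R" "g \<in> mod_hom R G M"
  shows "\<exists>h\<in>mod_hom R G W. \<forall>x\<in>carrier G. f (h x) = g x"
proof -
  obtain F :: "('a, ('a,'m) cover_type) module" and g' q where F: "F \<in> semi_regular_w_flat R"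
    "g' \<in> mod_hom R F M" "q \<in> mod_hom R G F" "\<And>x. x \<in> carrier G \<Longrightarrow> g' (q x) = g x"
  proof (rule w_flat_reduce[OF G(1) M G(2)], goal_cases)
    case (1 F f q)
    show ?case by (rule 1(1)[OF 1(2-5)])
  qed
  obtain h where h: "h \<in> mod_hom R F W" "\<forall>x\<in>carrier F. f (h x) = g' x" using small_precoverD(4)[OF W F(1,2)] by blast
  show ?thesis
  proof (intro bexI[of _ "compose (carrier G) h q"] ballI)
    show "compose (carrier G) h q \<in> mod_hom R G W" by (rule hom_compose[OF w_flat_module[OF G(1)] F(3) h(1)])
    show "f (compose (carrier G) h q x) = g x" if "x \<in> carrier G" for x
      using that h(2) hom_closed[OF F(3) that] F(4)[OF that] by (simp add: compose_eq)
  qed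
qed

end

section \<open>Covers\<close>

subsection \<open>Transfinite systems of endomorphisms\<close>

definition wo_less :: "'i rel \<Rightarrow> 'i \<Rightarrow> 'i \<Rightarrow> bool" where
  "wo_less r i j \<longleftrightarrow> (i, j) \<in> r \<and> i \<noteq> j"

text \<open>A direct system over the members of \<open>D\<close> whose modules are all the same, without the identities:
  the construction by transfinite recursion provides the maps from earlier to later indices.\<close>

definition strict_system ::
    "'i rel \<Rightarrow> 'i set \<Rightarrow> ('x \<Rightarrow> 'x) set \<Rightarrow> 'x set \<Rightarrow> ('i \<Rightarrow> 'i \<Rightarrow> 'x \<Rightarrow> 'x) \<Rightarrow> bool" where
  "strict_system r D E X \<phi> \<longleftrightarrow>
     (\<forall>i\<in>D. \<forall>j\<in>D. wo_less r i j \<longrightarrow> \<phi> i j \<in> E) \<and>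
     (\<forall>i\<in>D. \<forall>j\<in>D. \<forall>k\<in>D. wo_less r i j \<longrightarrow> wo_less r j k \<longrightarrow> (\<forall>x\<in>X. \<phi> j k (\<phi> i j x) = \<phi> i k x))"

definition strict_cocone ::
    "'i rel \<Rightarrow> 'i set \<Rightarrow> ('x \<Rightarrow> 'x) set \<Rightarrow> 'x set \<Rightarrow> ('i \<Rightarrow> 'i \<Rightarrow> 'x \<Rightarrow> 'x) \<Rightarrow> ('i \<Rightarrow> 'x \<Rightarrow> 'x) \<Rightarrow> bool"
  where
  "strict_cocone r D E X \<phi> c \<longleftrightarrow> (\<forall>i\<in>D. c i \<in> E) \<and>
     (\<forall>i\<in>D. \<forall>j\<in>D. wo_less r i j \<longrightarrow> (\<forall>x\<in>X. c j (\<phi> i j x) = c i x))"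

lemma strict_systemD:
  assumes "strict_system r D E X \<phi>"
  shows "\<lbrakk>i \<in> D; j \<in> D; wo_less r i j\<rbrakk> \<Longrightarrow> \<phi> i j \<in> E"
    "\<lbrakk>i \<in> D; j \<in> D; k \<in> D; wo_less r i j; wo_less r j k; x \<in> X\<rbrakk> \<Longrightarrow> \<phi> j k (\<phi> i j x) = \<phi> i k x"
  using assms unfolding strict_system_def by blast+

lemma strict_coconeD:
  assumes "strict_cocone r D E X \<phi> c"
  shows "i \<in> D \<Longrightarrow> c i \<in> E" "\<lbrakk>i \<in> D; j \<in> D; wo_less r i j; x \<in> X\<rbrakk> \<Longrightarrow> c j (\<phi> i j x) = c i x"
  using assms unfolding strict_cocone_def by blast+

lemma strict_system_subset:
  "\<lbrakk>strict_system r D E X \<phi>; D' \<subseteq> D\<rbrakk> \<Longrightarrow> strict_system r D' E X \<phi>"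
  unfolding strict_system_def by blast

lemma wo_less_facts:
  assumes "Well_order r"
  shows "\<not> wo_less r i i" "\<lbrakk>wo_less r i j; wo_less r j k\<rbrakk> \<Longrightarrow> wo_less r i k"
    "\<lbrakk>i \<in> Field r; j \<in> Field r; i \<noteq> j\<rbrakk> \<Longrightarrow> wo_less r i j \<or> wo_less r j i"
    "wo_less r i j \<Longrightarrow> i \<in> Field r" "wo_less r i j \<Longrightarrow> j \<in> Field r"
    "i \<in> underS r j \<longleftrightarrow> wo_less r i j" "wf (r - Id)" "(i,j) \<in> r - Id \<longleftrightarrow> wo_less r i j"
proof -
  have lin: "trans r" "antisym r" "total_on (Field r) r"
    using assms by (auto simp: well_order_on_def linear_order_on_def partial_order_on_def preorder_on_def)
  show "\<not> wo_less r i i" by (simp add: wo_less_def)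
  show "\<lbrakk>wo_less r i j; wo_less r j k\<rbrakk> \<Longrightarrow> wo_less r i k"
    using lin(1,2) unfolding wo_less_def by (metis antisymD transD)
  show "\<lbrakk>i \<in> Field r; j \<in> Field r; i \<noteq> j\<rbrakk> \<Longrightarrow> wo_less r i j \<or> wo_less r j i"
    using lin(3) unfolding wo_less_def total_on_def by blast
  show "wo_less r i j \<Longrightarrow> i \<in> Field r" "wo_less r i j \<Longrightarrow> j \<in> Field r"
    unfolding wo_less_def Field_def by auto
  show "i \<in> underS r j \<longleftrightarrow> wo_less r i j" by (auto simp: underS_def wo_less_def)
  show "wf (r - Id)" using assms by (simp add: well_order_on_def)
  show "(i,j) \<in> r - Id \<longleftrightarrow> wo_less r i j" by (auto simp: wo_less_def)
qed

text \<open>Systems of endomorphisms along a well-order exist as soon as systems along proper initial segments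
  have cocones.  The cocones may be chosen with an additional property \<open>Q\<close>.\<close>

lemma transfinite_system:
  assumes r: "Well_order r"
    and ex: "\<And>\<alpha> \<phi>. \<lbrakk>\<alpha> \<in> Field r; strict_system r (underS r \<alpha>) E X \<phi>\<rbrakk> \<Longrightarrow>
      \<exists>c. strict_cocone r (underS r \<alpha>) E X \<phi> c \<and> Q \<alpha> \<phi> c"
    and Q_cong: "\<And>\<alpha> \<phi> \<phi>' c. (\<And>i j. j \<in> underS r \<alpha> \<Longrightarrow> \<phi> i j = \<phi>' i j) \<Longrightarrow> Q \<alpha> \<phi> c = Q \<alpha> \<phi>' c"
  shows "\<exists>\<phi>. strict_system r (Field r) E X \<phi> \<and> (\<forall>\<alpha>\<in>Field r. Q \<alpha> \<phi> (\<lambda>\<beta>. \<phi> \<beta> \<alpha>))"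
proof -
  note lt = wo_less_facts[OF r]
  define P where "P F \<alpha> c \<longleftrightarrow> (\<alpha> \<in> Field r \<and> strict_system r (underS r \<alpha>) E X (\<lambda>i j. F j i) \<longrightarrow>
    strict_cocone r (underS r \<alpha>) E X (\<lambda>i j. F j i) c \<and> Q \<alpha> (\<lambda>i j. F j i) c)" for F \<alpha> c
  have "\<exists>F. \<forall>\<alpha>. P F \<alpha> (F \<alpha>)"
  proof (rule dependent_wf_choice[OF lt(7)])
    fix F G :: "'a \<Rightarrow> 'a \<Rightarrow> 'b \<Rightarrow> 'b" and \<alpha> c
    assume "\<And>z. (z, \<alpha>) \<in> r - Id \<Longrightarrow> F z = G z"
    then have FG: "F j = G j" if "j \<in> underS r \<alpha>" for j using that lt(6,8) by blast
    have 1: "strict_system r (underS r \<alpha>) E X (\<lambda>i j. F j i) = strict_system r (underS r \<alpha>) E X (\<lambda>i j. G j i)"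
      unfolding strict_system_def by (simp add: FG cong: ball_cong)
    have 2: "strict_cocone r (underS r \<alpha>) E X (\<lambda>i j. F j i) c = strict_cocone r (underS r \<alpha>) E X (\<lambda>i j. G j i) c"
      unfolding strict_cocone_def by (simp add: FG cong: ball_cong)
    have 3: "Q \<alpha> (\<lambda>i j. F j i) c = Q \<alpha> (\<lambda>i j. G j i) c" by (rule Q_cong) (simp add: FG)
    show "P F \<alpha> c = P G \<alpha> c" unfolding P_def 1 2 3 ..
  next
    fix \<alpha> F
    show "\<exists>c. P F \<alpha> c" unfolding P_def using ex[of \<alpha> "\<lambda>i j. F j i"] by blast
  qed
  then obtain F where F: "\<And>\<alpha>. P F \<alpha> (F \<alpha>)" by blast
  let ?\<phi> = "\<lambda>i j. F j i"
  have coc: "strict_cocone r (underS r \<alpha>) E X ?\<phi> (F \<alpha>) \<and> Q \<alpha> ?\<phi> (F \<alpha>)" if "\<alpha> \<in> Field r" for \<alpha>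
    using lt(7) that
  proof (induction \<alpha> rule: wf_induct_rule)
    case (less \<alpha>)
    have IH: "strict_cocone r (underS r \<beta>) E X ?\<phi> (F \<beta>)" if "\<beta> \<in> underS r \<alpha>" for \<beta>
      using less.IH[of \<beta>] that lt(4,6,8) by blast
    have "strict_system r (underS r \<alpha>) E X ?\<phi>"
      unfolding strict_system_def
    proof (intro conjI ballI impI)
      show "F j i \<in> E" if "i \<in> underS r \<alpha>" "j \<in> underS r \<alpha>" "wo_less r i j" for i j
        using strict_coconeD(1)[OF IH[OF that(2)]] that(3) lt(6) by blast
      show "F k j (F j i x) = F k i x" if "i \<in> underS r \<alpha>" "j \<in> underS r \<alpha>" "k \<in> underS r \<alpha>"
        "wo_less r i j" "wo_less r j k" "x \<in> X" for i j k x
        using strict_coconeD(2)[OF IH[OF that(3)], of i j x] that(4-6) lt(2)[OF that(4,5)] lt(6) by blast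
    qed
    then show ?case using F[of \<alpha>] less.prems unfolding P_def by blast
  qed
  have "strict_system r (Field r) E X ?\<phi>"
    unfolding strict_system_def
  proof (intro conjI ballI impI)
    show "F j i \<in> E" if "i \<in> Field r" "j \<in> Field r" "wo_less r i j" for i j
      using strict_coconeD(1)[OF conjunct1[OF coc[OF that(2)]]] that(3) lt(6) by blast
    show "F k j (F j i x) = F k i x" if "i \<in> Field r" "j \<in> Field r" "k \<in> Field r"
      "wo_less r i j" "wo_less r j k" "x \<in> X" for i j k x
      using strict_coconeD(2)[OF conjunct1[OF coc[OF that(3)]], of i j x] that(4-6) lt(2)[OF that(4,5)] lt(6)
      by blast
  qed
  then show ?thesis using coc by (intro exI[of _ ?\<phi>]) blast
qed

text \<open>The endomorphisms of \<open>W\<close> over the target of \<open>f\<close>; a precover \<open>f\<close> is a cover if all of them are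
  isomorphisms.\<close>

definition over_end :: "('a,'r) ring_scheme \<Rightarrow> ('a,'f) module \<Rightarrow> ('f \<Rightarrow> 'm) \<Rightarrow> ('f \<Rightarrow> 'f) set" where
  "over_end R W f = {h \<in> mod_hom R W W. \<forall>x\<in>carrier W. f (h x) = f x}"

context cring
begin

lemma over_endD:
  assumes "h \<in> over_end R W f"
  shows "h \<in> mod_hom R W W" "x \<in> carrier W \<Longrightarrow> f (h x) = f x" "x \<in> carrier W \<Longrightarrow> h x \<in> carrier W"
  using assms hom_closed[of h W W x] by (auto simp: over_end_def)

lemma over_end_compose:
  assumes W: "module R W" and "g \<in> over_end R W f" "h \<in> over_end R W f"
  shows "compose (carrier W) g h \<in> over_end R W f"
  unfolding over_end_def
  using hom_compose[OF W over_endD(1)[OF assms(3)] over_endD(1)[OF assms(2)]]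
    over_endD(2,3)[OF assms(3)] over_endD(2)[OF assms(2)] by (simp add: compose_eq)

lemma strict_direct_system:
  fixes W :: "('a,'f) module"
  assumes r: "Well_order r" and D: "D \<subseteq> Field r" "D \<noteq> {}" and W: "module R W"
    and S: "strict_system r D (over_end R W f) (carrier W) \<phi>"
  shows "direct_system R D (\<lambda>i j. i = j \<or> wo_less r i j) (\<lambda>_. W)
    (\<lambda>i j. if i = j then (\<lambda>x\<in>carrier W. x) else \<phi> i j)"
proof -
  note lt = wo_less_facts[OF r]
  let ?id = "\<lambda>x\<in>carrier W. x"
  note ph = over_endD[OF strict_systemD(1)[OF S]]
  show ?thesis unfolding direct_system_def
  proof (intro conjI ballI impI)
    show "(i = k \<or> wo_less r i k)" if "i = j \<or> wo_less r i j" "j = k \<or> wo_less r j k" for i j k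
      using that lt(2) by blast
    show "\<exists>k\<in>D. (i = k \<or> wo_less r i k) \<and> (j = k \<or> wo_less r j k)" if "i \<in> D" "j \<in> D" for i j
      using that lt(3)[of i j] D(1) by blast
    show "(if i = j then ?id else \<phi> i j) \<in> mod_hom R W W"
      if "i \<in> D" "j \<in> D" "i = j \<or> wo_less r i j" for i j
      using that ph(1)[of i j] hom_id[OF W] by auto
    fix i j k x assume ijk: "i \<in> D" "j \<in> D" "k \<in> D" "i = j \<or> wo_less r i j" "j = k \<or> wo_less r j k"
      "x \<in> carrier W"
    show "(if j = k then ?id else \<phi> j k) ((if i = j then ?id else \<phi> i j) x) =
        (if i = k then ?id else \<phi> i k) x"
    proof (cases "i = j \<or> j = k")
      case True
      then show ?thesis using ijk ph(3)[of i j x] by auto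
    next
      case False
      then have *: "wo_less r i j" "wo_less r j k" using ijk by auto
      then have "i \<noteq> k" using lt(1,2) by blast
      then show ?thesis using False strict_systemD(2)[OF S ijk(1-3) * ijk(6)] by simp
    qed
  qed (use W D in auto)
qed

text \<open>The direct limit of copies of \<open>W\<close> along endomorphisms over \<open>M\<close> is w-flat and has an induced
  homomorphism to \<open>M\<close>.  This homomorphism factors through the precover, and the factor composed with
  the canonical maps is a cocone of endomorphisms over \<open>M\<close>.\<close>

lemma over_end_cocone:
  fixes W :: "('a,'f) module" and M :: "('a,'m) module"
  assumes r: "Well_order r" and D: "D \<subseteq> Field r" and M: "module R M" and P: "small_precover M W f"
    and S: "strict_system r D (over_end R W f) (carrier W) \<phi>"
  shows "\<exists>c. strict_cocone r D (over_end R W f) (carrier W) \<phi> c"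
proof (cases "D = {}")
  case True
  then show ?thesis by (simp add: strict_cocone_def)
next
  case False
  note lt = wo_less_facts[OF r]
  note W = small_precoverD(1)[OF P] and Wm = small_precoverD(2)[OF P] and f = small_precoverD(3)[OF P]
  let ?rel = "\<lambda>i j. i = j \<or> wo_less r i j" and ?\<phi> = "\<lambda>i j. if i = j then (\<lambda>x\<in>carrier W. x) else \<phi> i j"
  have DS: "direct_system R D ?rel (\<lambda>_. W) ?\<phi>" by (rule strict_direct_system[OF r D False Wm S])
  let ?L = "direct_limit R D ?rel (\<lambda>_. W) ?\<phi>" and ?in = "limit_inj D ?rel (\<lambda>_. W) ?\<phi>"
  have C: "colim_cone R D ?rel (\<lambda>_. W) ?\<phi> ?L ?in" by (rule direct_limit_cone[OF DS])
  have L: "?L \<in> semi_regular_w_flat R" by (rule w_flat_colim[OF DS W module_direct_limit[OF DS] C])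
  obtain g where g: "g \<in> mod_hom R ?L M" "\<And>i x. \<lbrakk>i \<in> D; x \<in> carrier W\<rbrakk> \<Longrightarrow> g (?in i x) = f x"
  proof (rule direct_limit_lift[OF DS M, where g="\<lambda>_. f"], goal_cases)
    case (1 i)
    show ?case by (rule f)
  next
    case (2 i j x)
    then show ?case using over_endD(2)[OF strict_systemD(1)[OF S], of i j x] by auto
  next
    case (3 h)
    show ?case by (rule 3(1)[OF 3(2,3)])
  qed
  obtain h where h: "h \<in> mod_hom R ?L W" "\<forall>y\<in>carrier ?L. f (h y) = g y"
    using small_precover_lift[OF M P L g(1)] by blast
  have inh: "?in i \<in> mod_hom R W ?L" if "i \<in> D" for i by (rule colim_coneD(1)[OF C that])
  show ?thesis
  proof (intro exI[of _ "\<lambda>i. compose (carrier W) h (?in i)"], unfold strict_cocone_def, intro conjI ballI impI)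
    show "compose (carrier W) h (?in i) \<in> over_end R W f" if i: "i \<in> D" for i
      unfolding over_end_def
      using hom_compose[OF Wm inh[OF i] h(1)] h(2) hom_closed[OF inh[OF i]] g(2)[OF i]
      by (simp add: compose_eq)
    fix i j x assume ij: "i \<in> D" "j \<in> D" "wo_less r i j" and x: "x \<in> carrier W"
    have "\<phi> i j x \<in> carrier W" by (rule over_endD(3)[OF strict_systemD(1)[OF S ij] x])
    moreover have "?in j (\<phi> i j x) = ?in i x"
    proof -
      have "i \<noteq> j" using ij(3) lt(1) by blast
      then show ?thesis using colim_coneD(2)[OF C ij(1,2) disjI2[OF ij(3)] x] by simp
    qed
    ultimately show "compose (carrier W) h (?in j) (\<phi> i j x) = compose (carrier W) h (?in i) x"
      using x by (simp add: compose_eq)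
  qed
qed

subsection \<open>A precover without non-injective endomorphisms\<close>

text \<open>Some element is killed by the cocone but not by the system.\<close>

definition kills :: "'i rel \<Rightarrow> ('a,'f) module \<Rightarrow> 'i set \<Rightarrow> ('i \<Rightarrow> 'i \<Rightarrow> 'f \<Rightarrow> 'f) \<Rightarrow> ('i \<Rightarrow> 'f \<Rightarrow> 'f) \<Rightarrow> bool" where
  "kills r W D \<phi> c \<longleftrightarrow> (\<exists>i\<in>D. \<exists>x\<in>carrier W. c i x = \<zero>\<^bsub>W\<^esub> \<and> x \<noteq> \<zero>\<^bsub>W\<^esub> \<and>
     (\<forall>j\<in>D. wo_less r i j \<longrightarrow> \<phi> i j x \<noteq> \<zero>\<^bsub>W\<^esub>))"

text \<open>Index by the cardinal successor of the size of \<open>W\<close>, and choose at each stage a cocone that kills a new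
  element whenever there is one.  The kernels of the maps \<open>\<phi> i j\<close> grow with \<open>j\<close>, so they are stationary
  from some \<open>s i\<close> on.  Let \<open>\<delta>\<close> be the least strict upper bound of a sequence with \<open>b (n + 1) = s (b n)\<close>.
  The maps \<open>\<phi> i \<delta>\<close> kill nothing new: below \<open>\<delta>\<close> each index is at most some \<open>b n\<close>, and what is killed at \<open>\<delta>\<close>
  is killed at \<open>b (n + 1)\<close>.  By the choice at stage \<open>\<delta>\<close>, no cocone kills anything new.\<close>

lemma ex_stable_system:
  fixes W :: "('a,'f) module" and M :: "('a,'m) module"
  assumes inf: "infinite (UNIV :: 'f set)"
    and M: "module R M" and P: "small_precover M W f"
  obtains r :: "'f set rel" and D \<phi> c where "Well_order r" "D \<subseteq> Field r" "D \<noteq> {}"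
    "strict_system r D (over_end R W f) (carrier W) \<phi>" "strict_cocone r D (over_end R W f) (carrier W) \<phi> c"
    "\<And>c'. strict_cocone r D (over_end R W f) (carrier W) \<phi> c' \<Longrightarrow> \<not> kills r W D \<phi> c'"
proof -
  note Wm = small_precoverD(2)[OF P]
  let ?E = "over_end R W f" and ?X = "carrier W"
  define r where "r = cardSuc (card_of (UNIV :: 'f set))"
  have co: "Card_order (card_of (UNIV :: 'f set))" by (rule card_of_Card_order)
  have r: "Well_order r" unfolding r_def by (rule cardSuc_Well_order[OF co])
  note lt = wo_less_facts[OF r]
  have finf: "\<not> finite (Field (card_of (UNIV :: 'f set)))" using inf by (simp add: Field_card_of)
  have rinf: "\<not> finite (Field r)" unfolding r_def using cardSuc_finite[OF co] finf by simp
  have above: "\<exists>j. wo_less r i j" if "i \<in> Field r" for i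
    using infinite_Card_order_limit[OF cardSuc_Card_order[OF co] rinf[unfolded r_def] that[unfolded r_def]]
    unfolding wo_less_def r_def by blast
  define Q where "Q \<alpha> \<phi> c \<longleftrightarrow> ((\<exists>c'. strict_cocone r (underS r \<alpha>) ?E ?X \<phi> c' \<and> kills r W (underS r \<alpha>) \<phi> c') \<longrightarrow>
    kills r W (underS r \<alpha>) \<phi> c)" for \<alpha> \<phi> c
  have "\<exists>\<phi>. strict_system r (Field r) ?E ?X \<phi> \<and> (\<forall>\<alpha>\<in>Field r. Q \<alpha> \<phi> (\<lambda>\<beta>. \<phi> \<beta> \<alpha>))"
  proof (rule transfinite_system[OF r])
    fix \<alpha> \<phi> assume a: "\<alpha> \<in> Field r" "strict_system r (underS r \<alpha>) ?E ?X \<phi>"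
    have "underS r \<alpha> \<subseteq> Field r" using lt(4,6) by blast
    from over_end_cocone[OF r this M P a(2)] obtain c where c: "strict_cocone r (underS r \<alpha>) ?E ?X \<phi> c"
      by blast
    show "\<exists>c. strict_cocone r (underS r \<alpha>) ?E ?X \<phi> c \<and> Q \<alpha> \<phi> c"
      using c unfolding Q_def by blast
  next
    fix \<alpha> c and \<phi> \<phi>' :: "'f set \<Rightarrow> 'f set \<Rightarrow> 'f \<Rightarrow> 'f"
    assume eq: "\<And>i j. j \<in> underS r \<alpha> \<Longrightarrow> \<phi> i j = \<phi>' i j"
    have "kills r W (underS r \<alpha>) \<phi> c = kills r W (underS r \<alpha>) \<phi>' c" for c
      unfolding kills_def by (simp add: eq cong: ball_cong)
    moreover have "strict_cocone r (underS r \<alpha>) ?E ?X \<phi> c = strict_cocone r (underS r \<alpha>) ?E ?X \<phi>' c" for c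
      unfolding strict_cocone_def by (simp add: eq cong: ball_cong)
    ultimately show "Q \<alpha> \<phi> c = Q \<alpha> \<phi>' c" unfolding Q_def by simp
  qed
  then obtain \<phi> where S: "strict_system r (Field r) ?E ?X \<phi>"
    and Q: "\<And>\<alpha>. \<alpha> \<in> Field r \<Longrightarrow> Q \<alpha> \<phi> (\<lambda>\<beta>. \<phi> \<beta> \<alpha>)" by blast
  have ph: "\<phi> i j \<in> mod_hom R W W" "x \<in> ?X \<Longrightarrow> \<phi> i j x \<in> ?X" if "wo_less r i j" for i j x
    using over_endD(1,3)[OF strict_systemD(1)[OF S lt(4)[OF that] lt(5)[OF that] that]] by blast+
  have comp: "\<phi> j k (\<phi> i j x) = \<phi> i k x" if "wo_less r i j" "wo_less r j k" "x \<in> ?X" for i j k x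
    using strict_systemD(2)[OF S lt(4)[OF that(1)] lt(4)[OF that(2)] lt(5)[OF that(2)] that] .
  have ph0: "\<phi> i j \<zero>\<^bsub>W\<^esub> = \<zero>\<^bsub>W\<^esub>" if "wo_less r i j" for i j by (rule hom_zero[OF ph(1)[OF that] Wm Wm])
  \<comment> \<open>kernels become stationary since the index set is a successor cardinal\<close>
  have "\<exists>s. wo_less r i s \<and> (\<forall>j x. wo_less r i j \<longrightarrow> x \<in> ?X \<longrightarrow> \<phi> i j x = \<zero>\<^bsub>W\<^esub> \<longrightarrow> \<phi> i s x = \<zero>\<^bsub>W\<^esub>)"
    if i: "i \<in> Field r" for i
  proof -
    define K where "K j = {x \<in> ?X. wo_less r i j \<and> \<phi> i j x = \<zero>\<^bsub>W\<^esub>}" for j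
    have chain: "relChain r K" unfolding relChain_def
    proof (intro allI impI)
      fix j k assume "(j,k) \<in> r"
      then have "j = k \<or> wo_less r j k" by (auto simp: wo_less_def)
      then show "K j \<subseteq> K k"
      proof
        assume jk: "wo_less r j k"
        show "K j \<subseteq> K k"
        proof
          fix x assume "x \<in> K j"
          then have x: "x \<in> ?X" "wo_less r i j" "\<phi> i j x = \<zero>\<^bsub>W\<^esub>" by (auto simp: K_def)
          have "\<phi> i k x = \<phi> j k (\<phi> i j x)" using comp[OF x(2) jk x(1)] by simp
          then show "x \<in> K k" using x ph0[OF jk] lt(2)[OF x(2) jk] by (simp add: K_def)
        qed
      qed simp
    qed
    have "(card_of (\<Union>j\<in>Field r. K j), card_of (UNIV :: 'f set)) \<in> ordLeq" by (rule card_of_mono1) simp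
    then obtain s where s: "s \<in> Field r" "(\<Union>j\<in>Field r. K j) \<subseteq> K s"
      using cardSuc_UNION[OF co finf chain[unfolded r_def], of "\<Union>j\<in>Field r. K j"] unfolding r_def by blast
    show ?thesis
    proof (cases "wo_less r i s")
      case True
      have "\<phi> i s x = \<zero>\<^bsub>W\<^esub>" if "wo_less r i j" "x \<in> ?X" "\<phi> i j x = \<zero>\<^bsub>W\<^esub>" for j x
      proof -
        have "x \<in> K j" using that by (simp add: K_def)
        then have "x \<in> K s" using s(2) lt(5)[OF that(1)] by blast
        then show ?thesis by (simp add: K_def)
      qed
      then show ?thesis using True by blast
    next
      case False
      then have "K s = {}" by (auto simp: K_def)
      then have no: "\<phi> i j x \<noteq> \<zero>\<^bsub>W\<^esub>" if "wo_less r i j" "x \<in> ?X" for j x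
        using s(2) lt(5)[OF that(1)] that by (auto simp: K_def)
      obtain t where "wo_less r i t" using above[OF i] ..
      then show ?thesis using no by blast
    qed
  qed
  then have "\<forall>i. \<exists>s. i \<in> Field r \<longrightarrow> wo_less r i s \<and>
      (\<forall>j x. wo_less r i j \<longrightarrow> x \<in> ?X \<longrightarrow> \<phi> i j x = \<zero>\<^bsub>W\<^esub> \<longrightarrow> \<phi> i s x = \<zero>\<^bsub>W\<^esub>)" by blast
  from choice[OF this] obtain s where s0: "\<forall>i. i \<in> Field r \<longrightarrow> wo_less r i (s i) \<and>
      (\<forall>j x. wo_less r i j \<longrightarrow> x \<in> ?X \<longrightarrow> \<phi> i j x = \<zero>\<^bsub>W\<^esub> \<longrightarrow> \<phi> i (s i) x = \<zero>\<^bsub>W\<^esub>)" ..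
  have s: "wo_less r i (s i)"
    "\<lbrakk>wo_less r i j; x \<in> ?X; \<phi> i j x = \<zero>\<^bsub>W\<^esub>\<rbrakk> \<Longrightarrow> \<phi> i (s i) x = \<zero>\<^bsub>W\<^esub>" if "i \<in> Field r" for i j x
    using s0 that by blast+
  obtain b0 where b0: "b0 \<in> Field r" using rinf by fastforce
  define b where "b n = (s ^^ n) b0" for n
  have bF: "b n \<in> Field r" for n
    by (induction n) (use b0 lt(5) s(1) in \<open>auto simp: b_def\<close>)
  have bS: "b (Suc n) = s (b n)" for n by (simp add: b_def)
  have blt: "wo_less r (b n) (b (Suc n))" for n unfolding bS by (rule s(1)[OF bF])
  \<comment> \<open>the least strict upper bound of an increasing sequence along which the kernels are stationary\<close>
  have "\<exists>\<delta>. \<forall>n. wo_less r (b n) \<delta>"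
  proof -
    have chain: "relChain r (underS r)" unfolding relChain_def
    proof (intro allI impI subsetI)
      fix i j x assume "(i,j) \<in> r" "x \<in> underS r i"
      then show "x \<in> underS r j" using lt(2)[of x i j] lt(6) by (cases "i = j") (auto simp: wo_less_def)
    qed
    have "(card_of (range b), card_of (UNIV :: nat set)) \<in> ordLeq" by (rule card_of_image)
    moreover have "(card_of (UNIV :: nat set), card_of (UNIV :: 'f set)) \<in> ordLeq"
      using inf infinite_iff_card_of_nat by blast
    ultimately have "(card_of (range b), card_of (UNIV :: 'f set)) \<in> ordLeq" by (rule ordLeq_transitive)
    moreover have "range b \<subseteq> (\<Union>i\<in>Field r. underS r i)"
      using blt lt(5,6) by blast
    ultimately obtain \<delta> where "range b \<subseteq> underS r \<delta>"
      using cardSuc_UNION[OF co finf chain[unfolded r_def], of "range b"] unfolding r_def by blast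
    then show ?thesis using lt(6) by blast
  qed
  then obtain \<delta>0 where "\<delta>0 \<in> {\<delta>. \<forall>n. wo_less r (b n) \<delta>}" by blast
  then have mem: "\<delta>0 \<in> {\<delta>. \<forall>n. wo_less r (b n) \<delta>}" .
  obtain \<delta> where d0: "\<delta> \<in> {\<delta>. \<forall>n. wo_less r (b n) \<delta>}"
    "\<And>\<beta>. (\<beta>, \<delta>) \<in> r - Id \<Longrightarrow> \<beta> \<notin> {\<delta>. \<forall>n. wo_less r (b n) \<delta>}"
  proof (rule wfE_min[OF lt(7) mem], goal_cases)
    case (1 \<delta>)
    show ?case by (rule 1(1)[OF 1(2,3)])
  qed
  have d: "wo_less r (b n) \<delta>" "wo_less r \<beta> \<delta> \<Longrightarrow> \<exists>n. \<not> wo_less r (b n) \<beta>" for n \<beta>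
    using d0(1) d0(2)[unfolded lt(8), of \<beta>] by simp_all
  have dF: "\<delta> \<in> Field r" using d(1) lt(5) by blast
  let ?D = "underS r \<delta>"
  have DF: "?D \<subseteq> Field r" using lt(4,6) by blast
  have bD: "b n \<in> ?D" for n using d(1) lt(6) by blast
  have coc: "strict_cocone r ?D ?E ?X \<phi> (\<lambda>\<beta>. \<phi> \<beta> \<delta>)"
    unfolding strict_cocone_def
  proof (intro conjI ballI impI)
    show "\<phi> i \<delta> \<in> ?E" if "i \<in> ?D" for i using strict_systemD(1)[OF S, of i \<delta>] that DF dF lt(6) by blast
    show "\<phi> j \<delta> (\<phi> i j x) = \<phi> i \<delta> x" if "i \<in> ?D" "j \<in> ?D" "wo_less r i j" "x \<in> ?X" for i j x
      using comp[of i j \<delta> x] that lt(6) by blast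
  qed
  have "\<not> kills r W ?D \<phi> (\<lambda>\<beta>. \<phi> \<beta> \<delta>)"
    unfolding kills_def
  proof (intro notI, elim bexE conjE)
    fix i x assume i: "i \<in> ?D" and x: "x \<in> ?X" "\<phi> i \<delta> x = \<zero>\<^bsub>W\<^esub>"
      and no: "\<forall>j\<in>?D. wo_less r i j \<longrightarrow> \<phi> i j x \<noteq> \<zero>\<^bsub>W\<^esub>"
    have il: "wo_less r i \<delta>" using i lt(6) by blast
    obtain n where "\<not> wo_less r (b n) i" using d(2)[OF il] ..
    then have "i = b n \<or> wo_less r i (b n)" using lt(3)[of i "b n"] bF DF i by blast
    then have "wo_less r i (b (Suc n)) \<and> \<phi> i (b (Suc n)) x = \<zero>\<^bsub>W\<^esub>"
    proof
      assume "i = b n"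
      then show ?thesis using blt[of n] s(2)[OF bF d(1) x(1)] x(2) bS by metis
    next
      assume in': "wo_less r i (b n)"
      have "\<phi> (b n) \<delta> (\<phi> i (b n) x) = \<zero>\<^bsub>W\<^esub>" using comp[OF in' d(1) x(1)] x(2) by simp
      then have "\<phi> (b n) (b (Suc n)) (\<phi> i (b n) x) = \<zero>\<^bsub>W\<^esub>"
        unfolding bS by (rule s(2)[OF bF d(1) ph(2)[OF in' x(1)]])
      then show ?thesis using comp[OF in' blt x(1)] lt(2)[OF in' blt] by simp
    qed
    then show False using no bD by blast
  qed
  then have stable: "\<not> kills r W ?D \<phi> c'" if "strict_cocone r ?D ?E ?X \<phi> c'" for c'
    using Q[OF dF] that unfolding Q_def by blast
  show ?thesis
    by (rule that[OF r DF _ strict_system_subset[OF S DF] coc stable]) (use bD in auto)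
qed

text \<open>If no cocone of a system kills anything new, then the union of the images of a cocone is the direct
  limit of the system.  It is therefore w-flat, and it is a precover because \<open>W\<close> maps to it over \<open>M\<close>.
  An endomorphism of it over \<open>M\<close>, composed with the cocone, is a cocone, which kills nothing new;
  so the endomorphism is injective.\<close>

lemma ex_precover_injective_endomorphisms:
  fixes W :: "('a,'f) module" and M :: "('a,'m) module"
  assumes inf: "infinite (UNIV :: 'f set)"
    and M: "module R M" and P: "small_precover M W f"
  shows "\<exists>(G :: ('a,'f) module) f'. small_precover M G f' \<and>
    (\<forall>e\<in>over_end R G f'. inj_on e (carrier G))"
proof -
  note W = small_precoverD(1)[OF P] and Wm = small_precoverD(2)[OF P] and f = small_precoverD(3)[OF P]
  let ?E = "over_end R W f" and ?X = "carrier W"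
  obtain r :: "'f set rel" and D \<phi> c where r: "Well_order r" and D: "D \<subseteq> Field r" "D \<noteq> {}"
    and S: "strict_system r D ?E ?X \<phi>" and C: "strict_cocone r D ?E ?X \<phi> c"
    and stable: "\<And>c'. strict_cocone r D ?E ?X \<phi> c' \<Longrightarrow> \<not> kills r W D \<phi> c'"
  proof (rule ex_stable_system[OF inf M P], goal_cases)
    case (1 r D \<phi> c)
    show ?case by (rule 1(1)[OF 1(2-7)])
  qed
  note lt = wo_less_facts[OF r]
  let ?rel = "\<lambda>i j. i = j \<or> wo_less r i j" and ?\<phi> = "\<lambda>i j. if i = j then (\<lambda>x\<in>carrier W. x) else \<phi> i j"
  have DS: "direct_system R D ?rel (\<lambda>_. W) ?\<phi>" by (rule strict_direct_system[OF r D Wm S])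
  have cE: "c i \<in> ?E" if "i \<in> D" for i by (rule strict_coconeD(1)[OF C that])
  note ch = over_endD[OF cE]
  have cphi: "c j (\<phi> i j x) = c i x" if "i \<in> D" "j \<in> D" "wo_less r i j" "x \<in> ?X" for i j x
    by (rule strict_coconeD(2)[OF C that])
  have phc: "\<phi> i j x \<in> ?X" if "i \<in> D" "j \<in> D" "wo_less r i j" "x \<in> ?X" for i j x
    by (rule over_endD(3)[OF strict_systemD(1)[OF S that(1-3)] that(4)])
  define N where "N = (\<Union>i\<in>D. c i ` ?X)"
  have NI: "c i x \<in> N" if "i \<in> D" "x \<in> ?X" for i x using that unfolding N_def by blast
  have up: "\<exists>k\<in>D. \<exists>x'\<in>?X. \<exists>y'\<in>?X. c i x = c k x' \<and> c j y = c k y'"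
    if ij: "i \<in> D" "j \<in> D" "x \<in> ?X" "y \<in> ?X" for i j x y
  proof -
    consider "i = j" | "wo_less r i j" | "wo_less r j i" using lt(3)[of i j] ij D by blast
    then show ?thesis
    proof cases
      case 1
      then show ?thesis using ij by blast
    next
      case 2
      then show ?thesis using ij cphi[OF ij(1,2) 2 ij(3)] phc[OF ij(1,2) 2 ij(3)] by metis
    next
      case 3
      then show ?thesis using ij cphi[OF ij(2,1) 3 ij(4)] phc[OF ij(2,1) 3 ij(4)] by metis
    qed
  qed
  have N: "submodule N R W"
  proof (rule submoduleI'[OF Wm])
    show "N \<subseteq> carrier W" unfolding N_def using ch(3) by blast
    obtain i where i: "i \<in> D" using D by blast
    show "\<zero>\<^bsub>W\<^esub> \<in> N"
      using NI[OF i mod_zero_closed[OF Wm]] hom_zero[OF ch(1)[OF i] Wm Wm] by simp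
    show "u \<oplus>\<^bsub>W\<^esub> v \<in> N" if uv: "u \<in> N" "v \<in> N" for u v
    proof -
      obtain i x j y where *: "i \<in> D" "x \<in> ?X" "u = c i x" "j \<in> D" "y \<in> ?X" "v = c j y"
        using uv unfolding N_def by blast
      obtain k x' y' where k: "k \<in> D" "x' \<in> ?X" "y' \<in> ?X" "c i x = c k x'" "c j y = c k y'"
        using up[OF *(1,4,2,5)] by blast
      have "c k (x' \<oplus>\<^bsub>W\<^esub> y') \<in> N" by (rule NI[OF k(1) mod_add_closed[OF Wm k(2,3)]])
      then show ?thesis using hom_add[OF ch(1)[OF k(1)] k(2,3)] *(3,6) k(4,5) by simp
    qed
    show "a \<odot>\<^bsub>W\<^esub> u \<in> N" if a: "a \<in> carrier R" and u: "u \<in> N" for a u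
    proof -
      obtain i x where *: "i \<in> D" "x \<in> ?X" "u = c i x" using u unfolding N_def by blast
      have "c i (a \<odot>\<^bsub>W\<^esub> x) \<in> N" by (rule NI[OF *(1) mod_smult_closed[OF Wm a *(2)]])
      then show ?thesis using hom_smult[OF ch(1)[OF *(1)] a *(2)] *(3) by simp
    qed
  qed
  let ?G = "sub_module W N"
  have G: "module R ?G" by (rule module_sub_module[OF Wm N])
  have NX: "y \<in> ?X" if "y \<in> N" for y by (rule submoduleD(3)[OF Wm N that])
  have cG: "c i \<in> mod_hom R W ?G" if i: "i \<in> D" for i
    using ch(1)[OF i] NI[OF i] by (auto simp: mod_hom_def)
  have Ginc: "h \<in> mod_hom R P W" if "h \<in> mod_hom R P ?G" for h and P :: "('a,'f) module"
    using that NX by (auto simp: mod_hom_def)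
  have small: "x = \<zero>\<^bsub>W\<^esub> \<or> (\<exists>j\<in>D. wo_less r i j \<and> \<phi> i j x = \<zero>\<^bsub>W\<^esub>)"
    if "strict_cocone r D ?E ?X \<phi> c'" "i \<in> D" "x \<in> ?X" "c' i x = \<zero>\<^bsub>W\<^esub>" for c' i x
    using stable[OF that(1)] that(2-4) unfolding kills_def by blast
  have "colim_cone R D ?rel (\<lambda>_. W) ?\<phi> ?G c" unfolding colim_cone_def
  proof (intro conjI ballI impI)
    show "c i \<in> mod_hom R W ?G" if "i \<in> D" for i by (rule cG[OF that])
    show "c j (?\<phi> i j x) = c i x" if "i \<in> D" "j \<in> D" "i = j \<or> wo_less r i j" "x \<in> ?X" for i j x
      using that cphi[OF that(1,2) _ that(4)] by auto
    show "\<exists>i\<in>D. \<exists>x\<in>?X. c i x = y" if "y \<in> carrier ?G" for y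
    proof -
      have "y \<in> N" using that by simp
      then show ?thesis unfolding N_def by blast
    qed
    show "\<exists>j\<in>D. (i = j \<or> wo_less r i j) \<and> ?\<phi> i j x = \<zero>\<^bsub>W\<^esub>"
      if i: "i \<in> D" and x: "x \<in> ?X" and z: "c i x = \<zero>\<^bsub>?G\<^esub>" for i x
    proof -
      have "x = \<zero>\<^bsub>W\<^esub> \<or> (\<exists>j\<in>D. wo_less r i j \<and> \<phi> i j x = \<zero>\<^bsub>W\<^esub>)"
        using small[OF C i x] z by simp
      then show ?thesis
      proof
        assume "x = \<zero>\<^bsub>W\<^esub>"
        then show ?thesis using i x by (intro bexI[of _ i]) auto
      next
        assume "\<exists>j\<in>D. wo_less r i j \<and> \<phi> i j x = \<zero>\<^bsub>W\<^esub>"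
        then obtain j where "j \<in> D" "wo_less r i j" "\<phi> i j x = \<zero>\<^bsub>W\<^esub>" by blast
        then show ?thesis using lt(1) by (intro bexI[of _ j]) auto
      qed
    qed
  qed
  from w_flat_colim[OF DS W G this] have Gf: "?G \<in> semi_regular_w_flat R" by simp
  let ?f = "restrict f N"
  have fG: "?f \<in> mod_hom R ?G M" by (rule hom_restrict[OF Wm f N])
  have "\<exists>h\<in>mod_hom R F ?G. \<forall>x\<in>carrier F. ?f (h x) = g x"
    if F: "F \<in> semi_regular_w_flat R" "g \<in> mod_hom R F M"
    for F :: "('a, ('a,'m) cover_type) module" and g
  proof -
    obtain h where h: "h \<in> mod_hom R F W" "\<forall>x\<in>carrier F. f (h x) = g x"
      using small_precoverD(4)[OF P F] by blast
    obtain i where i: "i \<in> D" using D by blast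
    show ?thesis
    proof (intro bexI[of _ "compose (carrier F) (c i) h"] ballI)
      show "compose (carrier F) (c i) h \<in> mod_hom R F ?G"
        by (rule hom_compose[OF w_flat_module[OF F(1)] h(1) cG[OF i]])
      fix x assume x: "x \<in> carrier F"
      have hx: "h x \<in> ?X" by (rule hom_closed[OF h(1) x])
      show "?f (compose (carrier F) (c i) h x) = g x"
        using x NI[OF i hx] ch(2)[OF i hx] h(2) by (simp add: compose_eq)
    qed
  qed
  then have PG: "small_precover M ?G ?f" unfolding precover_w_flat_iff using Gf fG by blast
  have "inj_on e (carrier ?G)" if e: "e \<in> over_end R ?G ?f" for e
  proof -
    have eh: "e \<in> mod_hom R ?G ?G" by (rule over_endD(1)[OF e])
    have eN: "e y \<in> N" if "y \<in> N" for y using hom_closed[OF eh] that by simp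
    have ef: "f (e y) = f y" if "y \<in> N" for y using over_endD(2)[OF e, of y] eN[OF that] that by simp
    have "strict_cocone r D ?E ?X \<phi> (\<lambda>i. compose ?X e (c i))"
      unfolding strict_cocone_def
    proof (intro conjI ballI impI)
      fix i assume i: "i \<in> D"
      have "compose ?X e (c i) \<in> mod_hom R W W" by (rule Ginc[OF hom_compose[OF Wm cG[OF i] eh]])
      moreover have "f (compose ?X e (c i) x) = f x" if x: "x \<in> ?X" for x
        using x ef[OF NI[OF i x]] ch(2)[OF i x] by (simp add: compose_eq)
      ultimately show "compose ?X e (c i) \<in> ?E" by (simp add: over_end_def)
      fix j x assume j: "j \<in> D" "wo_less r i j" and x: "x \<in> ?X"
      show "compose ?X e (c j) (\<phi> i j x) = compose ?X e (c i) x"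
        using phc[OF i j x] cphi[OF i j x] x by (simp add: compose_eq)
    qed
    note ec = small[OF this]
    have z: "y = \<zero>\<^bsub>W\<^esub>" if y: "y \<in> N" "e y = \<zero>\<^bsub>W\<^esub>" for y
    proof -
      obtain i x where *: "i \<in> D" "x \<in> ?X" "y = c i x" using y(1) unfolding N_def by blast
      have c0: "c j \<zero>\<^bsub>W\<^esub> = \<zero>\<^bsub>W\<^esub>" if "j \<in> D" for j by (rule hom_zero[OF ch(1)[OF that] Wm Wm])
      have "compose ?X e (c i) x = \<zero>\<^bsub>W\<^esub>" using * y(2) by (simp add: compose_eq)
      from ec[OF *(1,2) this] show ?thesis
      proof
        assume "x = \<zero>\<^bsub>W\<^esub>"
        then show ?thesis using *(3) c0[OF *(1)] by simp
      next
        assume "\<exists>j\<in>D. wo_less r i j \<and> \<phi> i j x = \<zero>\<^bsub>W\<^esub>"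
        then obtain j where j: "j \<in> D" "wo_less r i j" "\<phi> i j x = \<zero>\<^bsub>W\<^esub>" by blast
        show ?thesis using cphi[OF *(1) j(1,2) *(2)] j(3) c0[OF j(1)] *(3) by simp
      qed
    qed
    show "inj_on e (carrier ?G)"
    proof (rule inj_onI)
      fix x y assume xy: "x \<in> carrier ?G" "y \<in> carrier ?G" "e x = e y"
      have d: "x \<ominus>\<^bsub>?G\<^esub> y \<in> carrier ?G" by (rule mod_diff_closed[OF G xy(1,2)])
      have "e (x \<ominus>\<^bsub>?G\<^esub> y) = \<zero>\<^bsub>?G\<^esub>"
        using hom_diff[OF eh G G xy(1,2)] xy(3) mod_diff_eq_zero[OF G hom_closed[OF eh xy(1)] hom_closed[OF eh xy(2)]]
        by simp
      then have "x \<ominus>\<^bsub>?G\<^esub> y = \<zero>\<^bsub>?G\<^esub>" using z[of "x \<ominus>\<^bsub>?G\<^esub> y"] d by simp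
      then show "x = y" using mod_diff_eq_zero[OF G xy(1,2)] by blast
    qed
  qed
  then show ?thesis using PG by blast
qed

subsection \<open>Injective endomorphisms over the module are surjective\<close>

text \<open>Let \<open>h\<close> be an endomorphism over \<open>M\<close> that misses an element.  Composing every chosen cocone with \<open>h\<close>
  gives a system, along the cardinal successor of the size of \<open>W\<close>, in which all maps to stage
  \<open>\<alpha>\<close> miss a common element \<open>z \<alpha>\<close>.  A cocone \<open>c\<close> of the whole system consists of injective maps, so the
  elements \<open>c \<alpha> (z \<alpha>)\<close> of \<open>W\<close> are distinct, and there are too many of them.\<close>

lemma over_end_surjective:
  fixes W :: "('a,'f) module" and M :: "('a,'m) module"
  assumes M: "module R M" and P: "small_precover M W f"
    and inj: "\<And>e. e \<in> over_end R W f \<Longrightarrow> inj_on e (carrier W)" and h: "h \<in> over_end R W f"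
  shows "h ` carrier W = carrier W"
proof (rule ccontr)
  note Wm = small_precoverD(2)[OF P]
  let ?E = "over_end R W f" and ?X = "carrier W"
  assume "h ` ?X \<noteq> ?X"
  then obtain z0 where z0: "z0 \<in> ?X" "z0 \<notin> h ` ?X" using over_endD(3)[OF h] by blast
  define r where "r = cardSuc (card_of (UNIV :: 'f set))"
  have co: "Card_order (card_of (UNIV :: 'f set))" by (rule card_of_Card_order)
  have r: "Well_order r" unfolding r_def by (rule cardSuc_Well_order[OF co])
  note lt = wo_less_facts[OF r]
  define Q where "Q \<alpha> (\<phi> :: 'f set \<Rightarrow> 'f set \<Rightarrow> 'f \<Rightarrow> 'f) c \<longleftrightarrow> (\<exists>z\<in>?X. \<forall>\<beta>\<in>underS r \<alpha>. z \<notin> c \<beta> ` ?X)" for \<alpha> \<phi> c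
  have "\<exists>\<phi>. strict_system r (Field r) ?E ?X \<phi> \<and> (\<forall>\<alpha>\<in>Field r. Q \<alpha> \<phi> (\<lambda>\<beta>. \<phi> \<beta> \<alpha>))"
  proof (rule transfinite_system[OF r])
    fix \<alpha> \<phi> assume a: "\<alpha> \<in> Field r" "strict_system r (underS r \<alpha>) ?E ?X \<phi>"
    have sub: "underS r \<alpha> \<subseteq> Field r" using lt(4,6) by blast
    from over_end_cocone[OF r sub M P a(2)] obtain c where c: "strict_cocone r (underS r \<alpha>) ?E ?X \<phi> c"
      by blast
    have "strict_cocone r (underS r \<alpha>) ?E ?X \<phi> (\<lambda>i. compose ?X h (c i))"
      unfolding strict_cocone_def
    proof (intro conjI ballI impI)
      show "compose ?X h (c i) \<in> ?E" if "i \<in> underS r \<alpha>" for i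
        by (rule over_end_compose[OF Wm h strict_coconeD(1)[OF c that]])
      show "compose ?X h (c j) (\<phi> i j x) = compose ?X h (c i) x"
        if "i \<in> underS r \<alpha>" "j \<in> underS r \<alpha>" "wo_less r i j" "x \<in> ?X" for i j x
        using strict_coconeD(2)[OF c that] over_endD(3)[OF strict_systemD(1)[OF a(2) that(1-3)] that(4)] that(4)
        by (simp add: compose_eq)
    qed
    moreover have "z0 \<notin> compose ?X h (c \<beta>) ` ?X" if "\<beta> \<in> underS r \<alpha>" for \<beta>
      using z0(2) over_endD(3)[OF strict_coconeD(1)[OF c that]] by (auto simp: compose_eq)
    ultimately show "\<exists>c. strict_cocone r (underS r \<alpha>) ?E ?X \<phi> c \<and> Q \<alpha> \<phi> c"
      using z0(1) unfolding Q_def by blast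
  qed (simp add: Q_def)
  then obtain \<phi> where S: "strict_system r (Field r) ?E ?X \<phi>"
    and Q: "\<And>\<alpha>. \<alpha> \<in> Field r \<Longrightarrow> Q \<alpha> \<phi> (\<lambda>\<beta>. \<phi> \<beta> \<alpha>)" by blast
  from over_end_cocone[OF r subset_refl M P S] obtain c where c: "strict_cocone r (Field r) ?E ?X \<phi> c"
    by blast
  have "\<forall>\<alpha>. \<exists>z. \<alpha> \<in> Field r \<longrightarrow> z \<in> ?X \<and> (\<forall>\<beta>. wo_less r \<beta> \<alpha> \<longrightarrow> z \<notin> \<phi> \<beta> \<alpha> ` ?X)"
    using Q unfolding Q_def lt(6)[symmetric] by blast
  from choice[OF this] obtain z where z0: "\<forall>\<alpha>. \<alpha> \<in> Field r \<longrightarrow> z \<alpha> \<in> ?X \<and>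
    (\<forall>\<beta>. wo_less r \<beta> \<alpha> \<longrightarrow> z \<alpha> \<notin> \<phi> \<beta> \<alpha> ` ?X)" ..
  have z: "z \<alpha> \<in> ?X" "wo_less r \<beta> \<alpha> \<Longrightarrow> z \<alpha> \<notin> \<phi> \<beta> \<alpha> ` ?X" if "\<alpha> \<in> Field r" for \<alpha> \<beta>
    using z0 that by blast+
  have ne: "c \<beta> (z \<beta>) \<noteq> c \<alpha> (z \<alpha>)" if ba: "wo_less r \<beta> \<alpha>" for \<alpha> \<beta>
  proof
    assume eq: "c \<beta> (z \<beta>) = c \<alpha> (z \<alpha>)"
    note F = lt(4)[OF ba] lt(5)[OF ba]
    have "c \<alpha> (\<phi> \<beta> \<alpha> (z \<beta>)) = c \<alpha> (z \<alpha>)"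
      using strict_coconeD(2)[OF c F ba z(1)[OF F(1)]] eq by simp
    then have "\<phi> \<beta> \<alpha> (z \<beta>) = z \<alpha>"
      using inj_onD[OF inj[OF strict_coconeD(1)[OF c F(2)]]]
        over_endD(3)[OF strict_systemD(1)[OF S F ba] z(1)[OF F(1)]] z(1)[OF F(2)] by blast
    then show False using z(2)[OF F(2) ba] imageI[OF z(1)[OF F(1)], of "\<phi> \<beta> \<alpha>"] by simp
  qed
  have "inj_on (\<lambda>\<alpha>. c \<alpha> (z \<alpha>)) (Field r)"
  proof (rule inj_onI)
    fix \<alpha> \<beta> assume ab: "\<alpha> \<in> Field r" "\<beta> \<in> Field r" "c \<alpha> (z \<alpha>) = c \<beta> (z \<beta>)"
    show "\<alpha> = \<beta>" using lt(3)[OF ab(1,2)] ne[of \<alpha> \<beta>] ne[of \<beta> \<alpha>] ab(3) by metis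
  qed
  then have "(card_of (Field r), card_of (UNIV :: 'f set)) \<in> ordLeq"
    using card_of_ordLeq[of "Field r" "UNIV :: 'f set"] by blast
  moreover have "(card_of (Field r), r) \<in> ordIso"
    unfolding r_def by (rule card_of_Field_ordIso[OF cardSuc_Card_order[OF co]])
  ultimately have "(r, card_of (UNIV :: 'f set)) \<in> ordLeq"
    using ordIso_symmetric ordIso_ordLeq_trans by blast
  moreover have "(card_of (UNIV :: 'f set), r) \<in> ordLess" unfolding r_def by (rule cardSuc_greater[OF co])
  ultimately show False using not_ordLess_ordLeq by blast
qed


subsection \<open>Existence of covers\<close>

lemma w_flat_ex_cover:
  fixes M :: "('a,'m) module"
  assumes M: "module R M"
  shows "\<exists>(F :: ('a, ('a,'m) cover_type) module) f.
    cover R (semi_regular_w_flat R) (semi_regular_w_flat R :: ('a, ('a,'m) cover_type) module set) M F f"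
proof -
  have inf: "infinite (UNIV :: ('a,'m) cover_type set)"
    by (simp add: Finite_Set.finite_set finite_Plus_UNIV_iff flip: UNIV_Plus_UNIV)
  obtain W :: "('a, ('a,'m) cover_type) module" and f where W: "small_precover M W f"
    using ex_small_precover[OF M] by blast
  obtain G :: "('a, ('a,'m) cover_type) module" and f' where G: "small_precover M G f'"
    and inj: "\<forall>e\<in>over_end R G f'. inj_on e (carrier G)"
    using ex_precover_injective_endomorphisms[OF inf M W] by blast
  have "h \<in> mod_iso R G G" if h: "h \<in> mod_hom R G G" "f' = compose (carrier G) f' h" for h
  proof -
    have "f' (h x) = f' x" if x: "x \<in> carrier G" for x
    proof -
      have "compose (carrier G) f' h x = f' x" by (simp only: h(2)[symmetric])
      then show ?thesis using x by (simp add: compose_eq)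
    qed
    then have e: "h \<in> over_end R G f'" using h(1) by (simp add: over_end_def)
    have "h ` carrier G = carrier G" by (rule over_end_surjective[OF M G _ e]) (use inj in blast)
    then show ?thesis using h(1) bspec[OF inj e] by (simp add: mod_iso_def bij_betw_def)
  qed
  then have "cover R (semi_regular_w_flat R) (semi_regular_w_flat R :: ('a, ('a,'m) cover_type) module set) M G f'"
    unfolding cover_def using G by blast
  then show ?thesis by blast
qed

lemma w_flat_cover_all:
  fixes M :: "('a,'m) module" and F :: "('a, 'w) module"
  assumes M: "module R M"
    and c: "cover R (semi_regular_w_flat R) (semi_regular_w_flat R :: ('a, ('a,'m) cover_type) module set) M F f"
  shows "cover R (semi_regular_w_flat R) (semi_regular_w_flat R :: ('a, 'n) module set) M F f"
proof -
  have P: "small_precover M F f" using c unfolding cover_def by blast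
  have "\<exists>h\<in>mod_hom R F' F. \<forall>x\<in>carrier F'. f (h x) = g x"
    if "F' \<in> semi_regular_w_flat R" "g \<in> mod_hom R F' M" for F' :: "('a,'n) module" and g
    by (rule small_precover_lift[OF M P that])
  then have "precover R (semi_regular_w_flat R) (semi_regular_w_flat R :: ('a,'n) module set) M F f"
    unfolding precover_w_flat_iff using small_precoverD(1,3)[OF P] by blast
  then show ?thesis using c unfolding cover_def by blast
qed

end

theorem proposition2p5:
  fixes R :: "('a,'r) ring_scheme"
  assumes "cring R"
  shows
    "(\<forall>(I :: 'i set) rel (M :: 'i \<Rightarrow> ('a,'b) module) \<phi> (L :: ('a,'c) module).
        direct_system R I rel M \<phi> \<longrightarrow> (\<forall>i\<in>I. M i \<in> semi_regular_w_flat R) \<longrightarrow>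
        module R L \<longrightarrow> mod_iso R (direct_limit R I rel M \<phi>) L \<noteq> {} \<longrightarrow>
        L \<in> semi_regular_w_flat R) \<and>
     (\<forall>(M :: ('a,'b) module) N.
        M \<in> semi_regular_w_flat R \<longrightarrow> pure_submodule R N M \<longrightarrow>
        sub_module M N \<in> semi_regular_w_flat R) \<and>
     (\<forall>(M :: ('a,'b) module) N.
        M \<in> semi_regular_w_flat R \<longrightarrow> pure_submodule R N M \<longrightarrow>
        quot_module M N \<in> semi_regular_w_flat R) \<and>
     (\<forall>M :: ('a,'m) module. module R M \<longrightarrow>
        (\<exists>(F :: ('a, ('a,'m) cover_type) module) f.
           cover R (semi_regular_w_flat R) (semi_regular_w_flat R :: ('a, ('a,'m) cover_type) module set) M F f) \<and>
        (\<forall>(F :: ('a, ('a,'m) cover_type) module) f.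
           cover R (semi_regular_w_flat R) (semi_regular_w_flat R :: ('a, ('a,'m) cover_type) module set) M F f \<longrightarrow>
           cover R (semi_regular_w_flat R) (semi_regular_w_flat R :: ('a,'n) module set) M F f))"
proof -
  interpret cring R by (rule assms)
  have direct_limits: "L \<in> semi_regular_w_flat R"
    if S: "direct_system R I rel M \<phi>" and M: "\<forall>i\<in>I. M i \<in> semi_regular_w_flat R"
      and L: "module R L" and iso: "mod_iso R (direct_limit R I rel M \<phi>) L \<noteq> {}"
    for I :: "'i set" and rel and M :: "'i \<Rightarrow> ('a,'b) module" and \<phi> and L :: "('a,'c) module"
  proof -
    obtain f where f: "f \<in> mod_iso R (direct_limit R I rel M \<phi>) L" using iso by blast
    have "direct_limit R I rel M \<phi> \<in> semi_regular_w_flat R"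
      using w_flat_colim[OF S _ module_direct_limit[OF S] direct_limit_cone[OF S]] M by blast
    then show ?thesis by (rule w_flat_iso[OF _ L f])
  qed
  have pure: "sub_module M N \<in> semi_regular_w_flat R" "quot_module M N \<in> semi_regular_w_flat R"
    if M: "M \<in> semi_regular_w_flat R" and N: "pure_submodule R N M"
    for M :: "('a,'b) module" and N
  proof -
    have "sys_pure R N M" by (rule pure_submodule_sys_pure[OF w_flat_module[OF M] N])
    then show "sub_module M N \<in> semi_regular_w_flat R" "quot_module M N \<in> semi_regular_w_flat R"
      using w_flat_pure_sub[OF M] w_flat_pure_quot[OF M] by blast+
  qed
  have ex: "\<exists>(F :: ('a, ('a,'m) cover_type) module) f.
      cover R (semi_regular_w_flat R) (semi_regular_w_flat R :: ('a, ('a,'m) cover_type) module set) M F f"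
    if "module R M" for M :: "('a,'m) module"
    by (rule w_flat_ex_cover[OF that])
  have all: "cover R (semi_regular_w_flat R) (semi_regular_w_flat R :: ('a,'n) module set) M F f"
    if "module R M"
      "cover R (semi_regular_w_flat R) (semi_regular_w_flat R :: ('a, ('a,'m) cover_type) module set) M F f"
    for M :: "('a,'m) module" and F :: "('a, ('a,'m) cover_type) module" and f
    by (rule w_flat_cover_all[OF that])
  show ?thesis
    by (intro conjI allI impI; (rule direct_limits pure ex all; assumption)?)
qed

end
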